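(* If $\mathfrak{M}$ is a matchbox manifold which is homogeneous as a topological space, then $\mathfrak{M}$ is equicontinuous.
   Context: Homogeneous: a topological space $X$ is homogeneous if for all $x,y\in X$ there is a homeomorphism $h\colon X\to X$ with $h(x)=y$. Foliated spaces: a continuum is a compact, connected, non-empty metrizable space. A continuum $\mathfrak{M}$ is a foliated space of dimension $n$ if there is a compact separable metric space $\mathfrak{X}$ and, for each $x\in\mathfrak{M}$, a compact subset $\mathfrak{T}_x\subset\mathfrak{X}$, an open set $U_x\subset\mathfrak{M}$ containing $x$, and a homeomorphism $\varphi_x\colon\overline{U}_x\to[-1,1]^n\times\mathfrak{T}_x$ with $\varphi_x(x)=(0,w_x)$, $w_x\in \mathrm{int}(\mathfrak{T}_x)$, and $U_x=\varphi_x^{-1}((-1,1)^n\times \mathrm{int}(\mathfrak{T}_x))$. Let $\pi_x\colon\overline{U}_x\to\mathfrak{T}_x$ be $\varphi_x$ followed by projection to the second factor. For $w\in\mathfrak{T}_x$ the plaque is $\mathcal{P}_x(w)=\pi_x^{-1}(w)$, with $\mathrm{int}(\mathcal{P}_x(w))=\varphi_x^{-1}((-1,1)^n\times\{w\})$, and for $z\in\overline{U}_x$ one writes $\mathcal{P}_x(z)=\mathcal{P}_x(\pi_x(z))$. It is required that for $z\in U_x\cap U_y$ the set $\mathrm{int}(\mathcal{P}_x(z))\cap \mathrm{int}(\mathcal{P}_y(z))$ is open in both $\mathcal{P}_x(z)$ and $\mathcal{P}_y(z)$. The sets $\varphi_x^{-1}(V\times\{w\})$, with $x\in\mathfrak{M}$,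 $w\in\mathfrak{T}_x$, $V\subset(-1,1)^n$ open, form a basis of the fine topology on $\mathfrak{M}$; the connected components in the fine topology are the leaves of the foliation $\mathcal{F}$. Smoothness: the foliated space is smooth if the charts can be chosen such that whenever $z\in U_x\cap U_y$ there is an open set $V_z$ with $z\in V_z\subset U_x\cap U_y$, with $\mathcal{P}_x(z)\cap V_z$ and $\mathcal{P}_y(z)\cap V_z$ connected open sets, such that $\varphi_y\circ\varphi_x^{-1}\colon\varphi_x(\mathcal{P}_x(z)\cap V_z)\to\varphi_y(\mathcal{P}_y(z)\cap V_z)$ is a smooth map (between subsets of copies of $\mathbb{R}^n$), depending continuously on $z$ in the $C^\infty$-topology on maps. A matchbox manifold is a continuum with the structure of a smooth foliated space such that every $\mathfrak{T}_x$ is totally disconnected. Regular coverings: fix metrics $d_{\mathfrak{M}}$ on $\mathfrak{M}$ and $d_{\mathfrak{X}}$ on $\mathfrak{X}$, and a leafwise Riemannian metric (smooth along leaves, continuous transversally in the $C^\infty$-topology in charts) for which every leaf is complete with bounded geometry. $B$ and $D$ denote open and closed balls. $d_{\mathcal{F}}$ is the leafwise path-length distance ($\infty$ for points on different leaves) and $D_{\mathcal{F}}(x,r)=\{y: d_{\mathcal{F}}(x,y)\le r\}$. A subset $C$ of a leaf $L$ is strongly convex if any two points of $C$ are joined by a unique shortest geodesic segment of $L$ and that segment lies in $C$. Fix $\lambda_{\mathcal{F}}>0$ such that $D_{\mathcal{F}}(x,\lambda_{\mathcal{F}})$ is strongly convex for all $x\in\mathfrak{M}$, and $\epsilon_{\mathcal{F}}>0$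 such that for every $x\in\mathfrak{M}$ there is a compact set $\overline{U}'\subset\mathfrak{M}$ with $D_{\mathfrak{M}}(x,3\epsilon_{\mathcal{F}})\subset \mathrm{int}(\overline{U}')$ and such that for each leaf $L$ every connected component of $L\cap\overline{U}'$ is strongly convex in $L$ (such constants exist). A regular covering is a finite family of foliation charts $\varphi_i\colon\overline{U}_i\to[-1,1]^n\times\mathfrak{T}_i$, $1\le i\le\nu$, with centers $x_i$, $\varphi_i(x_i)=(0,w_i)$, $\mathfrak{T}_i=D_{\mathfrak{X}}(w_i,\epsilon_i)$, such that the sets $U_i=\mathrm{int}(\overline{U}_i)=\varphi_i^{-1}((-1,1)^n\times B_{\mathfrak{X}}(w_i,\epsilon_i))$ cover $\mathfrak{M}$, $\overline{U}_i\subset B_{\mathfrak{M}}(x_i,\epsilon_{\mathcal{F}})$, and, for a common $0<\delta\le\lambda_{\mathcal{F}}/4$, the plaques of $\varphi_i$ are the strongly convex disks $D_{\mathcal{F}}(y,\delta)$, $y\in\varphi_i^{-1}(\{0\}\times\mathfrak{T}_i)$. Write $\pi_i\colon\overline{U}_i\to\mathfrak{T}_i$ for the transverse coordinate. Holonomy pseudogroup and equicontinuity: a pair $(i,j)$ is admissible if $U_i\cap U_j\ne\emptyset$. Then $\mathfrak{D}_{i,j}=\pi_i(U_i\cap U_j)$, and $h_{j,i}\colon\mathfrak{D}_{i,j}\to\mathfrak{D}_{j,i}$ is the homeomorphism with $h_{j,i}(\pi_i(z))=\pi_j(z)$ for $z\in U_i\cap U_j$. A sequence $\mathcal{I}=(i_0,\dots,i_\alpha)$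 is admissible if each $(i_{\ell-1},i_\ell)$ is admissible and $h_{\mathcal{I}}=h_{i_\alpha,i_{\alpha-1}}\circ\cdots\circ h_{i_1,i_0}$ has non-empty domain; $D(h_{\mathcal{I}})\subset\mathfrak{T}_{i_0}$ is the maximal open set on which the composition is defined. Let $\mathcal{G}_{\mathcal{F}}^*=\{h_{\mathcal{I}}|U : \mathcal{I}\text{ admissible},\ U\subset D(h_{\mathcal{I}})\text{ open}\}$, and write $D(g)$ for the domain of $g$. The holonomy pseudogroup is equicontinuous if for all $\epsilon>0$ there is $\delta>0$ such that for all $g\in\mathcal{G}_{\mathcal{F}}^*$ and $w,w'\in D(g)$ with $d_{\mathfrak{X}}(w,w')<\delta$ one has $d_{\mathfrak{X}}(g(w),g(w'))<\epsilon$. $\mathfrak{M}$ is equicontinuous if this holds for some regular covering of $\mathfrak{M}$. *)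

theory Defs
  imports "HOL-Analysis.Analysis"
begin

section \<open>Homogeneity, continua, total disconnectedness\<close>

text \<open>The ambient space and the transversal model space are types of class
  \<open>metric_space\<close>, so that \<open>dist\<close> plays the role of the fixed metrics on them;
  spaces of this class are non-empty.\<close>

definition homogeneous_space :: "'a::topological_space itself \<Rightarrow> bool" where
  "homogeneous_space _ \<longleftrightarrow>
     (\<forall>x y :: 'a. \<exists>h k. homeomorphism (UNIV :: 'a set) UNIV h k \<and> h x = y)"

definition continuum_space :: "'a::metric_space itself \<Rightarrow> bool" where
  "continuum_space _ \<longleftrightarrow> compact (UNIV :: 'a set) \<and> connected (UNIV :: 'a set)"

definition tot_disconnected :: "'a::topological_space set \<Rightarrow> bool" where
  "tot_disconnected S \<longleftrightarrow> (\<forall>x\<in>S. connected_component_set S x = {x})"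


section \<open>Smooth maps and the $C^\infty$-topology\<close>

text \<open>Iterated directional derivatives, i.e. all partial derivatives of all orders.\<close>

primrec iter_deriv ::
  "'a::real_normed_vector list \<Rightarrow> ('a \<Rightarrow> 'b::real_normed_vector) \<Rightarrow> 'a \<Rightarrow> 'b" where
  "iter_deriv [] f = f"
| "iter_deriv (u # us) f = (\<lambda>v. frechet_derivative (iter_deriv us f) (at v) u)"

definition smooth_on :: "'a::real_normed_vector set \<Rightarrow> ('a \<Rightarrow> 'b::real_normed_vector) \<Rightarrow> bool" where
  "smooth_on S f \<longleftrightarrow> open S \<and> (\<forall>us. iter_deriv us f differentiable_on S)"

text \<open>The slice of \<open>D\<close> over \<open>w\<close> is the domain of the map \<open>F w\<close>.  Each \<open>F w\<close> is smooth,
  and \<open>F w\<close> depends continuously on \<open>w\<close> in the (compact-open) $C^\infty$-topology: near every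
  \<open>w\<close>, all derivatives converge uniformly on every compact subset of the domain of \<open>F w\<close>.\<close>

definition smooth_family ::
  "('a::real_normed_vector \<times> 'c::topological_space) set \<Rightarrow> ('c \<Rightarrow> 'a \<Rightarrow> 'b::real_normed_vector) \<Rightarrow> bool"
where
  "smooth_family D F \<longleftrightarrow>
     (\<forall>w. smooth_on {v. (v, w) \<in> D} (F w)) \<and>
     (\<forall>w \<in> snd ` D. \<forall>K. compact K \<and> K \<subseteq> {v. (v, w) \<in> D} \<longrightarrow>
        (\<forall>\<^sub>F w' in at w within snd ` D. K \<subseteq> {v. (v, w') \<in> D}) \<and>
        (\<forall>us. uniform_limit K (\<lambda>w'. iter_deriv us (F w')) (iter_deriv us (F w))
                (at w within snd ` D)))"


section \<open>Foliated spaces and matchbox manifolds\<close>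

text \<open>A chart consists of the open set $U$, the compact set $\mathfrak{T}$ and the map $\varphi$,
  of which only the restriction to the closure of $U$ matters.\<close>

record ('m, 'n, 'x) fchart =
  udom :: "'m set"
  transv :: "'x set"
  coord :: "'m \<Rightarrow> (real, 'n::finite) vec \<times> 'x"

definition chart_inv :: "('m::metric_space, 'n::finite, 'x) fchart \<Rightarrow> (real^'n) \<times> 'x \<Rightarrow> 'm" where
  "chart_inv c = inv_into (closure (udom c)) (coord c)"

definition lcoord :: "('m, 'n::finite, 'x) fchart \<Rightarrow> 'm \<Rightarrow> real^'n" where
  "lcoord c z = fst (coord c z)"

definition tproj :: "('m, 'n::finite, 'x) fchart \<Rightarrow> 'm \<Rightarrow> 'x" where
  "tproj c z = snd (coord c z)"

text \<open>In \<^typ>\<open>real^'n\<close>, \<open>cbox (- 1) 1\<close> is $[-1,1]^n$ and \<open>box (- 1) 1\<close> is $(-1,1)^n$.\<close>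

definition is_chart :: "('m::metric_space, 'n::finite, 'x::metric_space) fchart \<Rightarrow> bool" where
  "is_chart c \<longleftrightarrow>
     open (udom c) \<and> compact (transv c) \<and>
     homeomorphism (closure (udom c)) (cbox (- 1) 1 \<times> transv c) (coord c) (chart_inv c) \<and>
     udom c = {z \<in> closure (udom c). coord c z \<in> box (- 1) 1 \<times> interior (transv c)}"

definition centered_at :: "('m, 'n::finite, 'x::metric_space) fchart \<Rightarrow> 'm \<Rightarrow> bool" where
  "centered_at c x \<longleftrightarrow> x \<in> udom c \<and> lcoord c x = 0 \<and> tproj c x \<in> interior (transv c)"

definition plaque :: "('m::metric_space, 'n::finite, 'x) fchart \<Rightarrow> 'x \<Rightarrow> 'm set" where
  "plaque c w = {z \<in> closure (udom c). tproj c z = w}"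

definition plaque_int :: "('m::metric_space, 'n::finite, 'x) fchart \<Rightarrow> 'x \<Rightarrow> 'm set" where
  "plaque_int c w = {z \<in> closure (udom c). coord c z \<in> box (- 1) 1 \<times> {w}}"

definition plaque_compatible ::
  "('m::metric_space, 'n::finite, 'x) fchart \<Rightarrow> ('m, 'n, 'x) fchart \<Rightarrow> bool" where
  "plaque_compatible c c' \<longleftrightarrow>
     (\<forall>z \<in> udom c \<inter> udom c'.
        let P = plaque c (tproj c z); P' = plaque c' (tproj c' z);
            I = plaque_int c (tproj c z) \<inter> plaque_int c' (tproj c' z)
        in openin (top_of_set P) I \<and> openin (top_of_set P') I)"

text \<open>\<open>A x\<close> is the chart $\varphi_x$ centered at \<open>x\<close>.  The model space \<open>'x\<close> is separable
  because it is compact.\<close>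

definition foliated_space ::
  "('m::metric_space \<Rightarrow> ('m, 'n::finite, 'x::metric_space) fchart) \<Rightarrow> bool" where
  "foliated_space A \<longleftrightarrow>
     continuum_space TYPE('m) \<and> compact (UNIV :: 'x set) \<and>
     (\<forall>x. is_chart (A x) \<and> centered_at (A x) x) \<and>
     (\<forall>x y. plaque_compatible (A x) (A y))"

definition fine_topology ::
  "('m::metric_space \<Rightarrow> ('m, 'n::finite, 'x::metric_space) fchart) \<Rightarrow> 'm topology" where
  "fine_topology A = topology_generated_by
     {{z \<in> closure (udom (A x)). coord (A x) z \<in> V \<times> {w}} | x V w.
        w \<in> transv (A x) \<and> open V \<and> V \<subseteq> box (- 1) 1}"

definition leaves ::
  "('m::metric_space \<Rightarrow> ('m, 'n::finite, 'x::metric_space) fchart) \<Rightarrow> 'm set set" where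
  "leaves A = connected_components_of (fine_topology A)"

text \<open>The transition map along the plaque of \<open>c\<close> over \<open>w\<close> is
  \<open>\<lambda>v. lcoord c' (chart_inv c (v, w))\<close>.\<close>

definition smoothly_related ::
  "('m::metric_space, 'n::finite, 'x::metric_space) fchart \<Rightarrow> ('m, 'n, 'x) fchart \<Rightarrow> bool" where
  "smoothly_related c c' \<longleftrightarrow>
     (\<forall>z \<in> udom c \<inter> udom c'. \<exists>V.
        let P = plaque c (tproj c z); P' = plaque c' (tproj c' z) in
        open V \<and> z \<in> V \<and> V \<subseteq> udom c \<inter> udom c' \<and>
        openin (top_of_set P) (P \<inter> V) \<and> connected (P \<inter> V) \<and>
        openin (top_of_set P') (P' \<inter> V) \<and> connected (P' \<inter> V) \<and>
        P \<inter> V \<subseteq> P' \<and>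
        smooth_family (coord c ` V) (\<lambda>w v. lcoord c' (chart_inv c (v, w))))"

definition smooth_foliated_space ::
  "('m::metric_space \<Rightarrow> ('m, 'n::finite, 'x::metric_space) fchart) \<Rightarrow> bool" where
  "smooth_foliated_space A \<longleftrightarrow> foliated_space A \<and> (\<forall>x y. smoothly_related (A x) (A y))"

definition matchbox_manifold ::
  "('m::metric_space \<Rightarrow> ('m, 'n::finite, 'x::metric_space) fchart) \<Rightarrow> bool" where
  "matchbox_manifold A \<longleftrightarrow>
     smooth_foliated_space A \<and> (\<forall>x. tot_disconnected (transv (A x)))"

text \<open>The charts of the smooth foliated structure determined by \<open>A\<close>, not necessarily
  among the \<open>A x\<close>.\<close>

definition foliation_chart ::
  "('m::metric_space \<Rightarrow> ('m, 'n::finite, 'x::metric_space) fchart) \<Rightarrow> ('m, 'n, 'x) fchart \<Rightarrow> bool" where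
  "foliation_chart A c \<longleftrightarrow> is_chart c \<and>
     (\<forall>x. plaque_compatible c (A x) \<and> smoothly_related c (A x) \<and> smoothly_related (A x) c)"


section \<open>Leafwise Riemannian metrics\<close>

text \<open>The tangent space of the leaf at \<open>z\<close> is identified with $\mathbb{R}^n$ by means of the
  chart \<open>A z\<close> centered at \<open>z\<close>, so that \<open>g z\<close> is an inner product on it.  The matrix of \<open>g\<close> with
  respect to the coordinates of another chart \<open>c\<close>, on the plaque over \<open>w\<close>, is obtained from the
  derivative of the transition map from \<open>c\<close> to \<open>A z\<close> at the point in question.\<close>

definition local_metric ::
  "('m::metric_space \<Rightarrow> ('m, 'n::finite, 'x::metric_space) fchart) \<Rightarrow> ('m \<Rightarrow> real^'n \<Rightarrow> real^'n \<Rightarrow> real)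
    \<Rightarrow> ('m, 'n, 'x) fchart \<Rightarrow> 'x \<Rightarrow> real^'n \<Rightarrow> real^'n^'n" where
  "local_metric A g c w v =
     (let z = chart_inv c (v, w);
          J = frechet_derivative (\<lambda>u. lcoord (A z) (chart_inv c (u, w))) (at v)
      in \<chi> i j. g z (J (axis i 1)) (J (axis j 1)))"

definition leafwise_riemannian ::
  "('m::metric_space \<Rightarrow> ('m, 'n::finite, 'x::metric_space) fchart) \<Rightarrow> ('m \<Rightarrow> real^'n \<Rightarrow> real^'n \<Rightarrow> real)
    \<Rightarrow> bool" where
  "leafwise_riemannian A g \<longleftrightarrow>
     (\<forall>z. bilinear (g z) \<and> (\<forall>a b. g z a b = g z b a) \<and> (\<forall>a. a \<noteq> 0 \<longrightarrow> g z a a > 0)) \<and>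
     (\<forall>x. smooth_family (box (- 1) 1 \<times> interior (transv (A x))) (local_metric A g (A x)))"


subsection \<open>Leafwise distance\<close>

definition velocity ::
  "('m::metric_space \<Rightarrow> ('m, 'n::finite, 'x::metric_space) fchart) \<Rightarrow> (real \<Rightarrow> 'm) \<Rightarrow> real \<Rightarrow> real^'n" where
  "velocity A \<gamma> t = vector_derivative (\<lambda>s. lcoord (A (\<gamma> t)) (\<gamma> s)) (at t within {0..1})"

definition leafwise_path ::
  "('m::metric_space \<Rightarrow> ('m, 'n::finite, 'x::metric_space) fchart) \<Rightarrow> (real \<Rightarrow> 'm) \<Rightarrow> bool" where
  "leafwise_path A \<gamma> \<longleftrightarrow>
     continuous_map (top_of_set {0..1}) (fine_topology A) \<gamma> \<and>
     (\<forall>x a b. 0 \<le> a \<and> a < b \<and> b \<le> 1 \<and> \<gamma> ` {a..b} \<subseteq> udom (A x) \<longrightarrow>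
        (\<lambda>t. lcoord (A x) (\<gamma> t)) piecewise_C1_differentiable_on {a..b})"

text \<open>The library notion of piecewise $C^1$ allows unbounded derivatives near the break points.
  The length is therefore a Lebesgue integral with values in \<^typ>\<open>ennreal\<close>, which is infinite
  for paths of infinite length.\<close>

definition path_len ::
  "('m::metric_space \<Rightarrow> ('m, 'n::finite, 'x::metric_space) fchart) \<Rightarrow> ('m \<Rightarrow> real^'n \<Rightarrow> real^'n \<Rightarrow> real)
    \<Rightarrow> (real \<Rightarrow> 'm) \<Rightarrow> ennreal" where
  "path_len A g \<gamma> =
     (\<integral>\<^sup>+ t \<in> {0..1}. ennreal (sqrt (g (\<gamma> t) (velocity A \<gamma> t) (velocity A \<gamma> t))) \<partial>lborel)"

text \<open>Leafwise paths stay in one leaf; between distinct leaves the infimum is over the empty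
  set and equals \<open>\<infinity>\<close>.\<close>

definition leaf_dist ::
  "('m::metric_space \<Rightarrow> ('m, 'n::finite, 'x::metric_space) fchart) \<Rightarrow> ('m \<Rightarrow> real^'n \<Rightarrow> real^'n \<Rightarrow> real)
    \<Rightarrow> 'm \<Rightarrow> 'm \<Rightarrow> ennreal" where
  "leaf_dist A g x y =
     (INF \<gamma> \<in> {\<gamma>. leafwise_path A \<gamma> \<and> \<gamma> 0 = x \<and> \<gamma> 1 = y}. path_len A g \<gamma>)"

definition leaf_cball ::
  "('m::metric_space \<Rightarrow> ('m, 'n::finite, 'x::metric_space) fchart) \<Rightarrow> ('m \<Rightarrow> real^'n \<Rightarrow> real^'n \<Rightarrow> real)
    \<Rightarrow> 'm \<Rightarrow> real \<Rightarrow> 'm set" where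
  "leaf_cball A g x r = {y. leaf_dist A g x y \<le> ennreal r}"

definition complete_leaf ::
  "('m::metric_space \<Rightarrow> ('m, 'n::finite, 'x::metric_space) fchart) \<Rightarrow> ('m \<Rightarrow> real^'n \<Rightarrow> real^'n \<Rightarrow> real)
    \<Rightarrow> 'm set \<Rightarrow> bool" where
  "complete_leaf A g L \<longleftrightarrow>
     (\<forall>s :: nat \<Rightarrow> 'm. range s \<subseteq> L \<and>
        (\<forall>e>0. \<exists>N. \<forall>m\<ge>N. \<forall>n\<ge>N. leaf_dist A g (s m) (s n) < ennreal e) \<longrightarrow>
        (\<exists>l\<in>L. \<forall>e>0. \<exists>N. \<forall>n\<ge>N. leaf_dist A g (s n) l < ennreal e))"


subsection \<open>Riemannian geometry in coordinates\<close>

text \<open>Here \<open>h\<close> is a field of symmetric positive definite matrices on an open subset of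
  $\mathbb{R}^n$, and a covariant tensor field of order \<open>m\<close> is given by its components,
  indexed by lists of length \<open>m\<close>.\<close>

definition pdiff :: "'n::finite \<Rightarrow> (real^'n \<Rightarrow> real) \<Rightarrow> real^'n \<Rightarrow> real" where
  "pdiff i f v = frechet_derivative f (at v) (axis i 1)"

text \<open>\<open>christoffel h k i j v\<close> is $\Gamma^k_{ij}(v)$.\<close>

definition christoffel ::
  "(real^'n \<Rightarrow> real^'n^'n) \<Rightarrow> 'n::finite \<Rightarrow> 'n \<Rightarrow> 'n \<Rightarrow> real^'n \<Rightarrow> real" where
  "christoffel h k i j v =
     (\<Sum>l\<in>UNIV. matrix_inv (h v) $ k $ l *
        (pdiff i (\<lambda>u. h u $ j $ l) v + pdiff j (\<lambda>u. h u $ i $ l) v - pdiff l (\<lambda>u. h u $ i $ j) v)) / 2"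

text \<open>\<open>curv h l k i j v\<close> is the component $R^l{}_{kij}$ in
  $R(\partial_i,\partial_j)\partial_k = \sum_l R^l{}_{kij}\,\partial_l$.\<close>

definition curv ::
  "(real^'n \<Rightarrow> real^'n^'n) \<Rightarrow> 'n::finite \<Rightarrow> 'n \<Rightarrow> 'n \<Rightarrow> 'n \<Rightarrow> real^'n \<Rightarrow> real" where
  "curv h l k i j v =
     pdiff i (christoffel h l j k) v - pdiff j (christoffel h l i k) v +
     (\<Sum>m\<in>UNIV. christoffel h l i m v * christoffel h m j k v -
                christoffel h l j m v * christoffel h m i k v)"

definition curv_tensor :: "(real^'n \<Rightarrow> real^'n^'n) \<Rightarrow> real^'n \<Rightarrow> 'n::finite list \<Rightarrow> real" where
  "curv_tensor h v a =
     (case a of [i, j, k, m] \<Rightarrow> \<Sum>l\<in>UNIV. h v $ m $ l * curv h l k i j v | _ \<Rightarrow> 0)"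

text \<open>$(\nabla T)_{i\,a_1\dots a_m} = \partial_i T_{a_1\dots a_m} -
  \sum_s\sum_k \Gamma^k_{i a_s} T_{a_1\dots k\dots a_m}$.\<close>

definition cov_deriv ::
  "(real^'n \<Rightarrow> real^'n^'n) \<Rightarrow> (real^'n \<Rightarrow> 'n::finite list \<Rightarrow> real) \<Rightarrow> real^'n \<Rightarrow> 'n list \<Rightarrow> real" where
  "cov_deriv h T v b =
     (case b of [] \<Rightarrow> 0
      | i # a \<Rightarrow> pdiff i (\<lambda>u. T u a) v -
          (\<Sum>s<length a. \<Sum>k\<in>UNIV. christoffel h k i (a ! s) v * T v (a[s := k])))"

definition tensor_norm2 :: "real^'n^'n \<Rightarrow> nat \<Rightarrow> ('n::finite list \<Rightarrow> real) \<Rightarrow> real" where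
  "tensor_norm2 H m T =
     (\<Sum>a \<in> {a. length a = m}. \<Sum>b \<in> {b. length b = m}.
        (\<Prod>s<m. matrix_inv H $ (a ! s) $ (b ! s)) * T a * T b)"

text \<open>Geodesics are parametrised affinely on $[0,1]$.\<close>

definition geodesic ::
  "('m::metric_space \<Rightarrow> ('m, 'n::finite, 'x::metric_space) fchart) \<Rightarrow> ('m \<Rightarrow> real^'n \<Rightarrow> real^'n \<Rightarrow> real)
    \<Rightarrow> (real \<Rightarrow> 'm) \<Rightarrow> bool" where
  "geodesic A g \<gamma> \<longleftrightarrow>
     continuous_map (top_of_set {0..1}) (fine_topology A) \<gamma> \<and>
     (\<forall>x a b. 0 \<le> a \<and> a < b \<and> b \<le> 1 \<and> \<gamma> ` {a..b} \<subseteq> udom (A x) \<longrightarrow>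
        (\<exists>q'. \<forall>t\<in>{a..b}.
           ((\<lambda>s. lcoord (A x) (\<gamma> s)) has_vector_derivative q' t) (at t within {a..b}) \<and>
           (q' has_vector_derivative
              (\<chi> k. - (\<Sum>i\<in>UNIV. \<Sum>j\<in>UNIV.
                 christoffel (local_metric A g (A x) (tproj (A x) (\<gamma> t))) k i j (lcoord (A x) (\<gamma> t))
                 * q' t $ i * q' t $ j))) (at t within {a..b})))"

definition exp_map ::
  "('m::metric_space \<Rightarrow> ('m, 'n::finite, 'x::metric_space) fchart) \<Rightarrow> ('m \<Rightarrow> real^'n \<Rightarrow> real^'n \<Rightarrow> real)
    \<Rightarrow> 'm \<Rightarrow> real^'n \<Rightarrow> 'm" where
  "exp_map A g y u =
     (THE z. \<exists>\<gamma>. geodesic A g \<gamma> \<and> \<gamma> 0 = y \<and> velocity A \<gamma> 0 = u \<and> \<gamma> 1 = z)"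

text \<open>On a complete leaf the exponential map is smooth, hence it is a diffeomorphism from the
  ball of radius \<open>r\<close> onto its image iff it is injective there with invertible derivative.\<close>

definition inj_radius_ge ::
  "('m::metric_space \<Rightarrow> ('m, 'n::finite, 'x::metric_space) fchart) \<Rightarrow> ('m \<Rightarrow> real^'n \<Rightarrow> real^'n \<Rightarrow> real)
    \<Rightarrow> 'm \<Rightarrow> real \<Rightarrow> bool" where
  "inj_radius_ge A g y r \<longleftrightarrow>
     inj_on (exp_map A g y) {u. g y u u < r\<^sup>2} \<and>
     (\<forall>u. g y u u < r\<^sup>2 \<longrightarrow>
        (\<exists>D. ((\<lambda>u'. lcoord (A (exp_map A g y u)) (exp_map A g y u')) has_derivative D) (at u) \<and> inj D))"

text \<open>Bounded geometry: injectivity radius bounded away from $0$, and the curvature tensor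
  together with each of its covariant derivatives bounded.\<close>

definition bounded_geometry_leaf ::
  "('m::metric_space \<Rightarrow> ('m, 'n::finite, 'x::metric_space) fchart) \<Rightarrow> ('m \<Rightarrow> real^'n \<Rightarrow> real^'n \<Rightarrow> real)
    \<Rightarrow> 'm set \<Rightarrow> bool" where
  "bounded_geometry_leaf A g L \<longleftrightarrow>
     (\<exists>r>0. \<forall>y\<in>L. inj_radius_ge A g y r) \<and>
     (\<forall>k. \<exists>C. \<forall>y\<in>L.
        let h = local_metric A g (A y) (tproj (A y) y); v = lcoord (A y) y
        in tensor_norm2 (h v) (4 + k) ((cov_deriv h ^^ k) (curv_tensor h) v) \<le> C)"


subsection \<open>Strong convexity\<close>

definition shortest_geodesic ::
  "('m::metric_space \<Rightarrow> ('m, 'n::finite, 'x::metric_space) fchart) \<Rightarrow> ('m \<Rightarrow> real^'n \<Rightarrow> real^'n \<Rightarrow> real)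
    \<Rightarrow> (real \<Rightarrow> 'm) \<Rightarrow> 'm \<Rightarrow> 'm \<Rightarrow> bool" where
  "shortest_geodesic A g \<gamma> x y \<longleftrightarrow>
     geodesic A g \<gamma> \<and> \<gamma> 0 = x \<and> \<gamma> 1 = y \<and> path_len A g \<gamma> = leaf_dist A g x y"

definition strongly_convex ::
  "('m::metric_space \<Rightarrow> ('m, 'n::finite, 'x::metric_space) fchart) \<Rightarrow> ('m \<Rightarrow> real^'n \<Rightarrow> real^'n \<Rightarrow> real)
    \<Rightarrow> 'm set \<Rightarrow> bool" where
  "strongly_convex A g C \<longleftrightarrow>
     (\<exists>L \<in> leaves A. C \<subseteq> L) \<and>
     (\<forall>x\<in>C. \<forall>y\<in>C. \<exists>\<gamma>. shortest_geodesic A g \<gamma> x y \<and> \<gamma> ` {0..1} \<subseteq> C \<and>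
        (\<forall>\<gamma>'. shortest_geodesic A g \<gamma>' x y \<longrightarrow> (\<forall>t\<in>{0..1}. \<gamma>' t = \<gamma> t)))"

definition convexity_radius ::
  "('m::metric_space \<Rightarrow> ('m, 'n::finite, 'x::metric_space) fchart) \<Rightarrow> ('m \<Rightarrow> real^'n \<Rightarrow> real^'n \<Rightarrow> real)
    \<Rightarrow> real \<Rightarrow> bool" where
  "convexity_radius A g lam \<longleftrightarrow> lam > 0 \<and> (\<forall>x. strongly_convex A g (leaf_cball A g x lam))"

text \<open>Connected components of $L \cap \overline{U}'$ are taken in the leaf topology.\<close>

definition convex_covering_constant ::
  "('m::metric_space \<Rightarrow> ('m, 'n::finite, 'x::metric_space) fchart) \<Rightarrow> ('m \<Rightarrow> real^'n \<Rightarrow> real^'n \<Rightarrow> real)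
    \<Rightarrow> real \<Rightarrow> bool" where
  "convex_covering_constant A g eps \<longleftrightarrow> eps > 0 \<and>
     (\<forall>x. \<exists>K. compact K \<and> cball x (3 * eps) \<subseteq> interior K \<and>
        (\<forall>L \<in> leaves A. \<forall>C \<in> connected_components_of (subtopology (fine_topology A) (L \<inter> K)).
           strongly_convex A g C))"


section \<open>Regular coverings\<close>

definition regular_covering ::
  "('m::metric_space \<Rightarrow> ('m, 'n::finite, 'x::metric_space) fchart) \<Rightarrow> ('m \<Rightarrow> real^'n \<Rightarrow> real^'n \<Rightarrow> real)
    \<Rightarrow> real \<Rightarrow> real \<Rightarrow> nat \<Rightarrow> (nat \<Rightarrow> ('m, 'n, 'x) fchart) \<Rightarrow> bool" where
  "regular_covering A g lam eps \<nu> c \<longleftrightarrow>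
     (\<Union>i\<in>{1..\<nu>}. udom (c i)) = UNIV \<and>
     (\<exists>ctr rad \<delta>. 0 < \<delta> \<and> \<delta> \<le> lam / 4 \<and>
        (\<forall>i\<in>{1..\<nu>}.
           foliation_chart A (c i) \<and> centered_at (c i) (ctr i) \<and> rad i > 0 \<and>
           transv (c i) = cball (tproj (c i) (ctr i)) (rad i) \<and>
           udom (c i) = interior (closure (udom (c i))) \<and>
           udom (c i) = {z \<in> closure (udom (c i)).
              coord (c i) z \<in> box (- 1) 1 \<times> ball (tproj (c i) (ctr i)) (rad i)} \<and>
           closure (udom (c i)) \<subseteq> ball (ctr i) eps \<and>
           (\<forall>y \<in> closure (udom (c i)). lcoord (c i) y = 0 \<longrightarrow>
              plaque (c i) (tproj (c i) y) = leaf_cball A g y \<delta> \<and>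
              strongly_convex A g (leaf_cball A g y \<delta>))))"


section \<open>Holonomy pseudogroup and equicontinuity\<close>

text \<open>Transformations of the pseudogroup are partial maps; \<open>hol c j i\<close> is $h_{j,i}$.\<close>

definition hol_dom :: "(nat \<Rightarrow> ('m, 'n::finite, 'x) fchart) \<Rightarrow> nat \<Rightarrow> nat \<Rightarrow> 'x set" where
  "hol_dom c i j = tproj (c i) ` (udom (c i) \<inter> udom (c j))"

definition hol :: "(nat \<Rightarrow> ('m, 'n::finite, 'x) fchart) \<Rightarrow> nat \<Rightarrow> nat \<Rightarrow> 'x \<rightharpoonup> 'x" where
  "hol c j i w =
     (if w \<in> hol_dom c i j
      then Some (THE w'. \<exists>z \<in> udom (c i) \<inter> udom (c j). tproj (c i) z = w \<and> tproj (c j) z = w')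
      else None)"

definition admissible_pair :: "nat \<Rightarrow> (nat \<Rightarrow> ('m, 'n::finite, 'x) fchart) \<Rightarrow> nat \<Rightarrow> nat \<Rightarrow> bool" where
  "admissible_pair \<nu> c i j \<longleftrightarrow>
     i \<in> {1..\<nu>} \<and> j \<in> {1..\<nu>} \<and> udom (c i) \<inter> udom (c j) \<noteq> {}"

text \<open>The maps $h_{j,i}$ are indeed well defined homeomorphisms.\<close>

definition hol_well_defined ::
  "nat \<Rightarrow> (nat \<Rightarrow> ('m, 'n::finite, 'x::metric_space) fchart) \<Rightarrow> bool" where
  "hol_well_defined \<nu> c \<longleftrightarrow>
     (\<forall>i j. admissible_pair \<nu> c i j \<longrightarrow>
        (\<forall>z \<in> udom (c i) \<inter> udom (c j). hol c j i (tproj (c i) z) = Some (tproj (c j) z)) \<and>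
        homeomorphism (hol_dom c i j) (hol_dom c j i) (the \<circ> hol c j i) (the \<circ> hol c i j))"

text \<open>\<open>hol_seq c [i\<^sub>0, \<dots>, i\<^sub>\<alpha>]\<close> is the composition $h_{\mathcal{I}}$ with its maximal domain.  For a
  sequence of length one it is the identity $h_{i,i}$ of $\pi_i(U_i)$; since $h_{j,i}$ takes values
  in $\pi_j(U_j)$, ending the recursion with $h_{j,j}$ does not change longer compositions.\<close>

fun hol_seq :: "(nat \<Rightarrow> ('m, 'n::finite, 'x) fchart) \<Rightarrow> nat list \<Rightarrow> 'x \<rightharpoonup> 'x" where
  "hol_seq c [] = Map.empty"
| "hol_seq c [i] = hol c i i"
| "hol_seq c (i # j # I) = hol_seq c (j # I) \<circ>\<^sub>m hol c j i"

definition admissible_seq :: "nat \<Rightarrow> (nat \<Rightarrow> ('m, 'n::finite, 'x) fchart) \<Rightarrow> nat list \<Rightarrow> bool" where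
  "admissible_seq \<nu> c I \<longleftrightarrow>
     I \<noteq> [] \<and> set I \<subseteq> {1..\<nu>} \<and> successively (admissible_pair \<nu> c) I \<and> dom (hol_seq c I) \<noteq> {}"

definition hol_pseudogroup ::
  "nat \<Rightarrow> (nat \<Rightarrow> ('m, 'n::finite, 'x::metric_space) fchart) \<Rightarrow> ('x \<rightharpoonup> 'x) set" where
  "hol_pseudogroup \<nu> c =
     {hol_seq c I |` U | I U. admissible_seq \<nu> c I \<and> open U \<and> U \<subseteq> dom (hol_seq c I)}"

definition equicontinuous_pseudogroup :: "('x::metric_space \<rightharpoonup> 'x) set \<Rightarrow> bool" where
  "equicontinuous_pseudogroup G \<longleftrightarrow>
     (\<forall>\<epsilon>>0. \<exists>\<delta>>0. \<forall>f\<in>G. \<forall>w\<in>dom f. \<forall>w'\<in>dom f.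
        dist w w' < \<delta> \<longrightarrow> dist (the (f w)) (the (f w')) < \<epsilon>)"

definition equicontinuous_matchbox ::
  "('m::metric_space \<Rightarrow> ('m, 'n::finite, 'x::metric_space) fchart) \<Rightarrow> ('m \<Rightarrow> real^'n \<Rightarrow> real^'n \<Rightarrow> real)
    \<Rightarrow> real \<Rightarrow> real \<Rightarrow> bool" where
  "equicontinuous_matchbox A g lam eps \<longleftrightarrow>
     (\<exists>\<nu> c. regular_covering A g lam eps \<nu> c \<and> hol_well_defined \<nu> c \<and>
            equicontinuous_pseudogroup (hol_pseudogroup \<nu> c))"

end

theory Submission
  imports Defs
begin

text \<open>By the Effros property, proved here by a back-and-forth argument on the homeomorphism group of
  the compact space, for any two sufficiently close points there is a homeomorphism \<open>h\<close> with \<open>h z = z'\<close>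
  that moves no point by more than a prescribed amount.  Transversals being totally disconnected, \<open>h\<close>
  maps plaques into slightly larger plaques, so it carries the chain of plaques that defines the
  holonomy along \<open>\<I>\<close> at \<open>z\<close> into the one at \<open>z'\<close>.  The two images under \<open>h\<^sub>\<I>\<close> are therefore
  as close as the end points of the chains, uniformly in \<open>\<I>\<close>.

  A regular covering is obtained without the exponential map.  In the coordinates of a chart, small
  leafwise balls are star-shaped about their centres, with a gauge that depends continuously on the
  plaque; such a family of star bodies is mapped onto a cube by diffeomorphisms of the interiors
  that extend continuously to the boundary.  Small balls inherit unique minimal geodesics from the
  balls of radius \<open>lam\<close>, and an energy estimate shows that these geodesics stay inside.\<close>

section \<open>Homeomorphisms close to the identity\<close>

text \<open>Holonomy maps are compositions of unbounded length, and no estimate for single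
  transition maps survives arbitrarily many compositions. One homeomorphism displaces a whole chain
  at once, so its displacement bound reaches the last plaque undiminished; this makes the modulus
  uniform. The Baire argument takes place in the space itself and only yields points in the closure
  of a small orbit; the back-and-forth removes the closure. The other obstacle is that a regular
  covering prescribes its plaques exactly: closed leafwise balls of one radius for all charts. Every
  construction of a chart therefore works for all sufficiently small radii, and the common radius is
  chosen after a finite subcover. The leafwise distance is handled through lengths of explicit
  comparison curves, which makes the gauge of a ball continuous but not smooth; hence coordinates on
  the cube that are smooth inside and merely continuous up to the boundary. Finally a closed
  transversal ball need not have the open ball as its interior, so radii are taken outside a
  countable set.\<close>

definition autohomeo :: "('a::topological_space \<Rightarrow> 'a) \<Rightarrow> bool" where
  "autohomeo h \<longleftrightarrow> bij h \<and> continuous_on UNIV h \<and> continuous_on UNIV (inv h)"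

definition small_homeos :: "real \<Rightarrow> ('a::metric_space \<Rightarrow> 'a) set" where
  "small_homeos e = {h. autohomeo h \<and> (\<forall>z. dist (h z) z < e)}"

lemma autohomeo_id: "autohomeo (\<lambda>x. x)"
  using bij_id inv_id by (simp add: autohomeo_def id_def)

lemma autohomeo_comp:
  assumes "autohomeo f" "autohomeo g" shows "autohomeo (\<lambda>x. f (g x))"
proof -
  have "bij f" "bij g" using assms by (auto simp: autohomeo_def)
  then have "inv (f \<circ> g) = inv g \<circ> inv f" by (rule o_inv_distrib)
  then have i: "inv (\<lambda>x. f (g x)) = (\<lambda>x. inv g (inv f x))" by (simp add: o_def)
  have "bij (\<lambda>x. f (g x))" using bij_comp[OF \<open>bij g\<close> \<open>bij f\<close>] by (simp add: o_def)
  moreover have "continuous_on UNIV (\<lambda>x. f (g x))"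
    by (rule continuous_on_compose2[of UNIV f]) (use assms in \<open>auto simp: autohomeo_def\<close>)
  moreover have "continuous_on UNIV (\<lambda>x. inv g (inv f x))"
    by (rule continuous_on_compose2[of UNIV "inv g"]) (use assms in \<open>auto simp: autohomeo_def\<close>)
  ultimately show ?thesis unfolding autohomeo_def i by blast
qed

lemma autohomeo_inv: "autohomeo f \<Longrightarrow> autohomeo (inv f)"
  unfolding autohomeo_def by (simp add: bij_imp_bij_inv inv_inv_eq)

lemma autohomeo_inv_f: "autohomeo f \<Longrightarrow> inv f (f x) = x"
  by (simp add: autohomeo_def bij_is_inj)

lemma autohomeo_f_inv: "autohomeo f \<Longrightarrow> f (inv f x) = x"
  by (meson autohomeo_def bij_inv_eq_iff)

lemma homogeneous_autohomeo:
  assumes "homogeneous_space TYPE('a::topological_space)"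
  shows "\<exists>h. autohomeo h \<and> h (x::'a) = y"
proof -
  obtain h k where hk: "homeomorphism (UNIV :: 'a set) UNIV h k" "h x = y"
    using assms unfolding homogeneous_space_def by blast
  have "bij h" using hk(1) unfolding homeomorphism_def by (metis bijI' UNIV_I)
  moreover have "inv h = k"
    using hk(1) unfolding homeomorphism_def by (metis UNIV_I ext inv_f_eq injI)
  ultimately have "autohomeo h" using hk(1) unfolding autohomeo_def homeomorphism_def by simp
  then show ?thesis using hk(2) by blast
qed

text \<open>Separability of the space of continuous self-maps in the uniform metric: up to
  \<open>e\<close>, a map is coded by a scale \<open>1 / Suc n\<close> on which it varies by less
  than \<open>e/4\<close> and by the points of a fixed finite net that lie near its values on a net
  of that scale. There are only countably many codes.\<close>

lemma continuous_maps_countable_decomposition: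
  fixes e :: real
  assumes comp: "compact (UNIV::'a::metric_space set)" and e: "e > 0"
  shows "\<exists>\<G>::nat \<Rightarrow> ('a \<Rightarrow> 'a) set. (\<forall>h. continuous_on UNIV h \<longrightarrow> (\<exists>n. h \<in> \<G> n)) \<and>
     (\<forall>n. \<forall>f\<in>\<G> n. \<forall>g\<in>\<G> n. \<forall>z. dist (f z) (g z) < e)"
proof -
  have net: "\<exists>xs::'a list. \<forall>z. \<exists>i<length xs. dist (xs ! i) z < r" if r: "r > 0" for r
  proof -
    obtain k where k: "finite k" "UNIV \<subseteq> (\<Union>x\<in>k. ball (x::'a) r)"
      using comp r unfolding compact_eq_totally_bounded by meson
    obtain xs where "set xs = k" using finite_list[OF k(1)] by blast
    then have "\<exists>x\<in>set xs. dist x z < r" for z using k(2) by (auto simp: subset_eq)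
    then show ?thesis by (intro exI[of _ xs]) (metis in_set_conv_nth)
  qed
  obtain xs where xs: "\<And>n z. \<exists>i<length (xs n). dist (xs n ! i) (z::'a) < 1 / Suc n"
  proof -
    have "\<forall>n. \<exists>xs::'a list. \<forall>z. \<exists>i<length xs. dist (xs ! i) z < 1 / Suc n" using net by simp
    from choice[OF this] show ?thesis using that by blast
  qed
  obtain ys where ys: "\<And>z. \<exists>i<length ys. dist (ys ! i) (z::'a) < e / 4"
    using net[of "e/4"] e by auto
  \<comment> \<open>Two maps with the same code differ at any point by four errors below
    \<open>e/4\<close>: two come from the modulus of continuity, two from the net of values.\<close>
  define C where "C = (\<lambda>(n, js). {h :: 'a \<Rightarrow> 'a. (\<forall>i<length (xs n). dist (ys ! (js ! i)) (h (xs n ! i)) < e/4) \<and>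
      (\<forall>a b. dist a b < 1 / Suc n \<longrightarrow> dist (h a) (h b) < e/4)})"
  define \<G> where "\<G> = (\<lambda>m. C (from_nat m :: nat \<times> nat list))"
  have 1: "\<exists>m. h \<in> \<G> m" if h: "continuous_on UNIV h" for h
  proof -
    have "uniformly_continuous_on UNIV h" by (rule compact_uniformly_continuous[OF h comp])
    then obtain d where d: "d > 0" "\<And>a b. dist a b < d \<Longrightarrow> dist (h a) (h b) < e/4"
      unfolding uniformly_continuous_on_def using e by (metis UNIV_I zero_less_divide_iff zero_less_numeral)
    obtain n where n: "1 / Suc n < d" using d(1) nat_approx_posE by metis
    obtain J where J: "\<And>z. J z < length ys \<and> dist (ys ! J z) z < e/4" using ys by metis
    have "h \<in> C (n, map (\<lambda>x. J (h x)) (xs n))"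
      unfolding C_def using J d(2) n by (auto dest: less_trans)
    then show ?thesis unfolding \<G>_def by (metis from_nat_to_nat)
  qed
  have 2: "dist (f z) (g z) < e" if fg: "f \<in> \<G> m" "g \<in> \<G> m" for m f g z
  proof -
    obtain n js where c: "f \<in> C (n, js)" "g \<in> C (n, js)" using fg unfolding \<G>_def by (metis surj_pair)
    obtain i where i: "i < length (xs n)" "dist (xs n ! i) z < 1 / Suc n" using xs by blast
    have a: "dist (f (xs n ! i)) (f z) < e/4" "dist (g (xs n ! i)) (g z) < e/4"
       "dist (ys ! (js ! i)) (f (xs n ! i)) < e/4" "dist (ys ! (js ! i)) (g (xs n ! i)) < e/4"
      using c i unfolding C_def by auto
    have "dist (f z) (g z) \<le> dist (f (xs n ! i)) (f z) + dist (ys ! (js ! i)) (f (xs n ! i)) +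
       dist (ys ! (js ! i)) (g (xs n ! i)) + dist (g (xs n ! i)) (g z)"
      by (smt (verit, best) dist_commute dist_triangle2)
    then show ?thesis using a by linarith
  qed
  show ?thesis using 1 2 by blast
qed

lemma autohomeo_image_open:
  assumes "autohomeo f" "open S" shows "open (f ` S)"
proof -
  have "f ` S = inv f -` S" using assms(1) by (metis autohomeo_def bij_vimage_eq_inv_image bij_imp_bij_inv inv_inv_eq)
  moreover have "open (inv f -` S)" using assms unfolding autohomeo_def
    by (auto intro: open_vimage)
  ultimately show ?thesis by simp
qed

lemma autohomeo_image_closure:
  assumes "autohomeo f" shows "f ` closure S \<subseteq> closure (f ` S)"
  using assms unfolding autohomeo_def
  by (meson closed_closure closure_subset continuous_on_subset image_closure_subset subset_UNIV)

text \<open>The Baire category half of the Effros property. By transitivity the sets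
  \<open>S n\<close> cover the space, so one of them is dense in some open set; a homeomorphism of
  the same piece moves this open set onto a neighbourhood of \<open>x\<close>, and the composition
  of the two maps involved is \<open>e\<close>-small because both lie in one piece of the
  decomposition.\<close>

lemma closure_orbit_contains_ball:
  fixes x :: "'a::metric_space"
  assumes comp: "compact (UNIV::'a set)" and hom: "homogeneous_space TYPE('a)" and e: "e > 0"
  shows "\<exists>d>0. ball x d \<subseteq> closure ((\<lambda>h. h x) ` small_homeos e)"
proof -
  obtain \<G> :: "nat \<Rightarrow> ('a \<Rightarrow> 'a) set" where
    G1: "\<And>h. continuous_on UNIV h \<Longrightarrow> \<exists>n. h \<in> \<G> n" and
    G2: "\<And>n f g z. f \<in> \<G> n \<Longrightarrow> g \<in> \<G> n \<Longrightarrow> dist (f z) (g z) < e"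
    using continuous_maps_countable_decomposition[OF comp e] by metis
  \<comment> \<open>The points are \<open>inv h x\<close> rather than \<open>h x\<close>: for
    \<open>f\<close> and \<open>h\<close> in one piece, \<open>f (inv h z)\<close> is then within
    \<open>e\<close> of \<open>h (inv h z) = z\<close>, without any control on the modulus of
    \<open>f\<close>.\<close>
  define S where "S n = {y. \<exists>h. autohomeo h \<and> h \<in> \<G> n \<and> y = inv h x}" for n
  have cover: "\<exists>n. y \<in> S n" for y
  proof -
    obtain h where h: "autohomeo h" "h y = x" using homogeneous_autohomeo[OF hom] by blast
    obtain n where "h \<in> \<G> n" using G1 h(1) unfolding autohomeo_def by blast
    moreover have "y = inv h x" using autohomeo_inv_f[OF h(1), of y] h(2) by simp
    ultimately show ?thesis unfolding S_def using h(1) by blast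
  qed
  have "\<exists>n. interior (closure (S n)) \<noteq> {}"
  proof (rule ccontr)
    assume "\<not> ?thesis"
    then have em: "\<And>n. interior (closure (S n)) = {}" by blast
    have "(euclidean :: 'a topology) interior_of \<Union>(range (\<lambda>n. closure (S n))) = {}"
    proof (rule Baire_category_alt)
      have "compact_space (euclidean :: 'a topology)" using comp by (simp add: compact_space_def)
      then show "completely_metrizable_space (euclidean :: 'a topology) \<or>
         locally_compact_space (euclidean :: 'a topology) \<and> regular_space (euclidean :: 'a topology)"
        by (simp add: compact_imp_locally_compact_space metrizable_imp_regular_space metrizable_space_euclidean)
    qed (use em in \<open>auto\<close>)
    moreover have "\<Union>(range (\<lambda>n. closure (S n))) = UNIV"
      using cover closure_subset by blast
    ultimately show False by simp
  qed
  then obtain n where n: "interior (closure (S n)) \<noteq> {}" by blast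
  have "interior (closure (S n)) \<inter> S n \<noteq> {}"
    using n by (metis open_Int_closure_eq_empty open_interior inf.absorb_iff1 interior_subset)
  then obtain f where f: "autohomeo f" "f \<in> \<G> n" "inv f x \<in> interior (closure (S n))"
    unfolding S_def by blast
  \<comment> \<open>The open set found by category contains \<open>inv f x\<close>, so its image
    under \<open>f\<close> is a neighbourhood of \<open>x\<close>.\<close>
  define Ob where "Ob = f ` interior (closure (S n))"
  have "open Ob" unfolding Ob_def using autohomeo_image_open[OF f(1)] by simp
  moreover have "x \<in> Ob" unfolding Ob_def using f(3) autohomeo_f_inv[OF f(1)] by (metis imageI)
  ultimately obtain d where d: "d > 0" "ball x d \<subseteq> Ob" using open_contains_ball by metis
  have "Ob \<subseteq> closure (f ` S n)"
    unfolding Ob_def using autohomeo_image_closure[OF f(1)] interior_subset by blast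
  also have "\<dots> \<subseteq> closure ((\<lambda>h. h x) ` small_homeos e)"
  proof (rule closure_mono, rule subsetI)
    fix y assume "y \<in> f ` S n"
    then obtain h where h: "autohomeo h" "h \<in> \<G> n" "y = f (inv h x)" unfolding S_def by blast
    have "(\<lambda>z. f (inv h z)) \<in> small_homeos e"
      unfolding small_homeos_def mem_Collect_eq
    proof (intro conjI allI)
      show "autohomeo (\<lambda>z. f (inv h z))" using autohomeo_comp[OF f(1) autohomeo_inv[OF h(1)]] .
      fix z show "dist (f (inv h z)) z < e" using G2[OF f(2) h(2), of "inv h z"] autohomeo_f_inv[OF h(1)] by simp
    qed
    then show "y \<in> (\<lambda>h. h x) ` small_homeos e" using h(3) by (intro image_eqI[of _ _ "\<lambda>z. f (inv h z)"])
  qed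
  finally show ?thesis using d by blast
qed

lemma pointwise_limit_geometric:
  fixes u :: "nat \<Rightarrow> 'b \<Rightarrow> 'a::metric_space"
  assumes comp: "compact (UNIV::'a set)"
    and step: "\<And>n z. dist (u (Suc n) z) (u n z) \<le> c / 2 ^ n"
  shows "\<exists>f. \<forall>n z. dist (u n z) (f z) \<le> 2 * c / 2 ^ n"
proof -
  have c: "c \<ge> 0" using step[of 0 undefined] by (simp add: order_trans[OF zero_le_dist])
  have tail: "dist (u (n + k) z) (u n z) \<le> 2 * c / 2 ^ n - 2 * c / 2 ^ (n + k)" for n k z
  proof (induction k)
    case (Suc k)
    have "dist (u (n + Suc k) z) (u n z) \<le> dist (u (Suc (n + k)) z) (u (n + k) z) + dist (u (n + k) z) (u n z)"
      by (simp add: dist_triangle)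
    also have "\<dots> \<le> c / 2 ^ (n + k) + (2 * c / 2 ^ n - 2 * c / 2 ^ (n + k))"
      by (rule add_mono[OF step Suc])
    also have "\<dots> = 2 * c / 2 ^ n - 2 * c / 2 ^ (n + Suc k)" by (simp add: field_simps)
    finally show ?case .
  qed simp
  have tail': "dist (u m z) (u n z) \<le> 2 * c / 2 ^ n" if "m \<ge> n" for m n z
  proof -
    have "0 \<le> 2 * c / 2 ^ (n + (m - n))" using c by simp
    then show ?thesis using tail[of n "m - n" z] that by simp
  qed
  have lim0: "(\<lambda>n. 2 * c / 2 ^ n) \<longlonglongrightarrow> 0" by (rule LIMSEQ_divide_realpow_zero) simp
  have "\<exists>l. (\<lambda>n. u n z) \<longlonglongrightarrow> l" for z
  proof -
    have "Cauchy (\<lambda>n. u n z)"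
    proof (rule metric_CauchyI)
      fix e :: real assume "e > 0"
      then obtain N where N: "\<And>n. n \<ge> N \<Longrightarrow> 2 * c / 2 ^ n < e / 2"
        using order_tendstoD(2)[OF lim0, of "e/2"] unfolding eventually_sequentially by auto
      show "\<exists>M. \<forall>m\<ge>M. \<forall>n\<ge>M. dist (u m z) (u n z) < e"
      proof (intro exI allI impI)
        fix m n assume "N \<le> m" "N \<le> n"
        then show "dist (u m z) (u n z) < e"
          using tail'[of N m z] tail'[of N n z] N[of N] dist_triangle2[of "u m z" "u n z" "u N z"] by linarith
      qed
    qed
    moreover have "complete (UNIV::'a set)" using compact_imp_complete[OF comp] .
    ultimately show ?thesis by (meson completeE UNIV_I)
  qed
  then obtain f where f: "\<And>z. (\<lambda>n. u n z) \<longlonglongrightarrow> f z" by metis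
  have "dist (u n z) (f z) \<le> 2 * c / 2 ^ n" for n z
  proof -
    have "(\<lambda>m. dist (u m z) (u n z)) \<longlonglongrightarrow> dist (f z) (u n z)" by (intro tendsto_intros f)
    then show ?thesis
      using tail'[of n] by (metis (no_types, lifting) Lim_bounded dist_commute)
  qed
  then show ?thesis by blast
qed

lemma tendsto_geometric:
  assumes "\<And>n. dist (a n) l \<le> c / 2 ^ n" shows "a \<longlonglongrightarrow> l"
proof (rule metric_tendsto_imp_tendsto)
  show "(\<lambda>n. c / 2 ^ n :: real) \<longlonglongrightarrow> 0" by (rule LIMSEQ_divide_realpow_zero) simp
  have "dist (a n) l \<le> dist (c / 2 ^ n) 0" for n
    using assms[of n] abs_ge_self[of "c / 2 ^ n"] by (simp add: dist_real_def)
  then show "\<forall>\<^sub>F n in sequentially. dist (a n) l \<le> dist (c / 2 ^ n) 0" by simp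
qed

lemma uniform_geometric_continuous:
  fixes u :: "nat \<Rightarrow> 'b::metric_space \<Rightarrow> 'a::metric_space"
  assumes "\<And>n z. dist (u n z) (f z) \<le> c / 2 ^ n" "\<And>n. continuous_on UNIV (u n)"
  shows "continuous_on UNIV f"
proof (rule uniform_limit_theorem[where F=sequentially and f=u])
  show "uniform_limit UNIV u f sequentially"
  proof (rule uniform_limitI)
    fix e :: real assume "e > 0"
    have "(\<lambda>n. c / 2 ^ n) \<longlonglongrightarrow> 0" by (rule LIMSEQ_divide_realpow_zero) simp
    then have "\<forall>\<^sub>F n in sequentially. c / 2 ^ n < e" using \<open>e > 0\<close> by (rule order_tendstoD(2))
    then show "\<forall>\<^sub>F n in sequentially. \<forall>x\<in>UNIV. dist (u n x) (f x) < e"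
      by eventually_elim (use assms(1) in \<open>auto intro: le_less_trans\<close>)
  qed
qed (use assms in auto)

text \<open>A uniform limit of homeomorphisms need not be injective. Demanding a geometric rate for
  the inverses as well produces a second limit, which inverts the first.\<close>

lemma autohomeo_limit:
  fixes u :: "nat \<Rightarrow> 'a::metric_space \<Rightarrow> 'a"
  assumes comp: "compact (UNIV::'a set)" and u: "\<And>n. autohomeo (u n)"
    and s1: "\<And>n z. dist (u (Suc n) z) (u n z) \<le> c / 2 ^ n"
    and s2: "\<And>n z. dist (inv (u (Suc n)) z) (inv (u n) z) \<le> C / 2 ^ n"
  shows "\<exists>f. autohomeo f \<and> (\<forall>n z. dist (u n z) (f z) \<le> 2 * c / 2 ^ n)"
proof -
  obtain f where f: "\<And>n z. dist (u n z) (f z) \<le> 2 * c / 2 ^ n"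
    using pointwise_limit_geometric[OF comp, of u c] s1 by metis
  obtain k where k: "\<And>n z. dist (inv (u n) z) (k z) \<le> 2 * C / 2 ^ n"
    using pointwise_limit_geometric[OF comp, of "\<lambda>n. inv (u n)" C] s2 by metis
  have cf: "continuous_on UNIV f" using f u by (intro uniform_geometric_continuous[of u f]) (auto simp: autohomeo_def)
  have ck: "continuous_on UNIV k" using k u
    by (intro uniform_geometric_continuous[of "\<lambda>n. inv (u n)" k]) (auto simp: autohomeo_def)
  have lf: "(\<lambda>n. u n z) \<longlonglongrightarrow> f z" for z
    by (rule tendsto_geometric[OF f])
  have lk: "(\<lambda>n. inv (u n) z) \<longlonglongrightarrow> k z" for z
    by (rule tendsto_geometric[OF k])
  have 1: "k (f z) = z" for z
  proof -
    have "(\<lambda>n. k (u n z)) \<longlonglongrightarrow> k (f z)"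
      by (rule continuous_on_tendsto_compose[OF ck lf]) auto
    moreover have "(\<lambda>n. k (u n z)) \<longlonglongrightarrow> z"
    proof (rule tendsto_geometric[of _ _ "2 * C"])
      fix n show "dist (k (u n z)) z \<le> 2 * C / 2 ^ n"
        using k[of n "u n z"] autohomeo_inv_f[OF u, of n z] by (simp add: dist_commute)
    qed
    ultimately show ?thesis using LIMSEQ_unique by blast
  qed
  have 2: "f (k z) = z" for z
  proof -
    have "(\<lambda>n. f (inv (u n) z)) \<longlonglongrightarrow> f (k z)"
      by (rule continuous_on_tendsto_compose[OF cf lk]) auto
    moreover have "(\<lambda>n. f (inv (u n) z)) \<longlonglongrightarrow> z"
    proof (rule tendsto_geometric[of _ _ "2 * c"])
      fix n show "dist (f (inv (u n) z)) z \<le> 2 * c / 2 ^ n"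
        using f[of n "inv (u n) z"] autohomeo_f_inv[OF u, of n z] by (simp add: dist_commute)
    qed
    ultimately show ?thesis using LIMSEQ_unique by blast
  qed
  have "bij f" using 1 2 by (metis bijI')
  moreover have "inv f = k" using 1 2 by (metis ext inv_f_eq injI)
  ultimately have "autohomeo f" using cf ck by (simp add: autohomeo_def)
  then show ?thesis using f by blast
qed

text \<open>Composing \<open>u\<close> on the left with \<open>g\<close> changes the inverse from
  \<open>inv u\<close> to \<open>inv u\<close> after \<open>inv g\<close>. Uniform continuity of
  \<open>inv u\<close> tells how small \<open>g\<close> must be for the inverses to stay close,
  which supplies the second rate in \<open>autohomeo_limit\<close>.\<close>

lemma small_homeos_inv_uniform:
  fixes u :: "'a::metric_space \<Rightarrow> 'a"
  assumes comp: "compact (UNIV::'a set)" and u: "autohomeo u" and "r > 0" 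
  shows "\<exists>e>0. e \<le> r \<and> (\<forall>g\<in>small_homeos e. \<forall>z. dist (inv u (inv g z)) (inv u z) \<le> r)"
proof -
  have "uniformly_continuous_on UNIV (inv u)"
    using u comp by (intro compact_uniformly_continuous) (auto simp: autohomeo_def)
  then obtain d where d: "d > 0" "\<And>a b. dist a b < d \<Longrightarrow> dist (inv u a) (inv u b) < r"
    unfolding uniformly_continuous_on_def using \<open>r > 0\<close> by blast
  show ?thesis
  proof (intro exI[of _ "min d r"] conjI ballI allI)
    fix g :: "'a \<Rightarrow> 'a" and z assume g: "g \<in> small_homeos (min d r)"
    then have "dist (g (inv g z)) (inv g z) < d" by (simp add: small_homeos_def)
    then have "dist (inv g z) z < d" using g by (simp add: small_homeos_def autohomeo_f_inv dist_commute)
    then show "dist (inv u (inv g z)) (inv u z) \<le> r" using d(2) less_imp_le by blast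
  qed (use d \<open>r > 0\<close> in auto)
qed

text \<open>Back-and-forth: homeomorphisms close to the identity move \<open>x\<close> and \<open>y\<close> in turn towards
  each other, each step being so small that the even and the odd compositions converge uniformly
  together with their inverses.\<close>

lemma homogeneous_small_homeo_local:
  fixes x :: "'a::metric_space"
  assumes comp: "compact (UNIV::'a set)" and hom: "homogeneous_space TYPE('a)" and eta: "\<eta> > 0"
  shows "\<exists>d>0. \<forall>y. dist x y < d \<longrightarrow> (\<exists>h\<in>small_homeos \<eta>. h x = y)"
proof -
  \<comment> \<open>Summing the geometric steps, each of the two limits moves points by at most
    \<open>2 * c\<close>, so the quotient of the limits moves them by at most \<open>4 * c\<close>,
    which is \<open>\<eta> / 2\<close>.\<close>
  define c where "c = \<eta> / 8"
  have c: "c > 0" using eta by (simp add: c_def)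
  \<comment> \<open>The effect of a step on the inverse depends on the composition reached so far,
    so the admissible size of the next step is a function of \<open>n\<close> and of that
    composition.\<close>
  define Eok where "Eok n u e \<longleftrightarrow> e > 0 \<and> e \<le> c / 2 ^ n \<and>
     (\<forall>g\<in>small_homeos e. \<forall>z. dist (inv u (inv g z)) (inv u z) \<le> c / 2 ^ n)" for n and u :: "'a \<Rightarrow> 'a" and e
  have Eex: "\<exists>e. Eok n u e" if "autohomeo u" for n u
    unfolding Eok_def using small_homeos_inv_uniform[OF comp that, of "c / 2 ^ n"] c by force
  define E where "E n u = (SOME e. Eok n u e)" for n u
  have E: "Eok n u (E n u)" if "autohomeo u" for n u
    unfolding E_def using someI_ex[OF Eex[OF that]] .
  define K where "K e a = closure ((\<lambda>h. h a) ` small_homeos e)" for e and a :: 'a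
  obtain d where d: "d > 0" "ball x d \<subseteq> K (E 0 (\<lambda>x. x)) x"
    using closure_orbit_contains_ball[OF comp hom] E[OF autohomeo_id, of 0] unfolding Eok_def K_def by blast
  have "\<exists>h\<in>small_homeos \<eta>. h x = y" if y: "dist x y < d" for y
  proof -
    define pt where "pt n = (if even n then x else y)" for n :: nat
    \<comment> \<open>The state consists of the last two compositions. The invariant says that the
      image of one point lies in the closure of the orbit of the image of the other under admissible
      small homeomorphisms, which is what permits the next move.\<close>
    define P where "P n s \<longleftrightarrow> autohomeo (fst s) \<and> autohomeo (snd s) \<and>
       snd s (pt (Suc n)) \<in> K (E n (fst s)) (fst s (pt n)) \<and> (n = 0 \<longrightarrow> s = (\<lambda>z. z, \<lambda>z. z))" for n and s :: "('a \<Rightarrow> 'a) \<times> ('a \<Rightarrow> 'a)"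
    define Q where "Q n s s' \<longleftrightarrow> fst s' = snd s \<and> (\<exists>g\<in>small_homeos (E n (fst s)). snd s' = (\<lambda>z. g (fst s z))) \<and>
       dist (snd s' (pt n)) (snd s (pt (Suc n))) < c / 2 ^ n" for n and s s' :: "('a \<Rightarrow> 'a) \<times> ('a \<Rightarrow> 'a)"
    have "\<exists>F. \<forall>n. P n (F n) \<and> Q n (F n) (F (Suc n))"
    proof (rule dependent_nat_choice)
      have "P 0 (\<lambda>z. z, \<lambda>z. z)" unfolding P_def pt_def using d y autohomeo_id by auto
      then show "\<exists>s. P 0 s" by blast
    next
      fix s n assume P: "P n s"
      obtain u v where s: "s = (u, v)" by (cases s)
      have u: "autohomeo u" and v: "autohomeo v" and vin: "v (pt (Suc n)) \<in> K (E n u) (u (pt n))"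
        using P unfolding P_def s by auto
      \<comment> \<open>Landing within \<open>r\<close> of the target restores the invariant with
        the roles of the two points exchanged.\<close>
      obtain r where r: "r > 0" "ball (v (pt (Suc n))) r \<subseteq> K (E (Suc n) v) (v (pt (Suc n)))"
        using closure_orbit_contains_ball[OF comp hom] E[OF v, of "Suc n"] unfolding Eok_def K_def by blast
      have "min r (c / 2 ^ n) > 0" using r c by simp
      then obtain g where g: "g \<in> small_homeos (E n u)" "dist (g (u (pt n))) (v (pt (Suc n))) < min r (c / 2 ^ n)"
        using vin unfolding K_def closure_approachable by blast
      have ag: "autohomeo (\<lambda>z. g (u z))" using g(1) u by (auto simp: small_homeos_def intro: autohomeo_comp)
      have "P (Suc n) (v, \<lambda>z. g (u z))"
        unfolding P_def using v ag r(2) g(2) by (auto simp: pt_def dist_commute split: if_splits)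
      moreover have "Q n s (v, \<lambda>z. g (u z))" unfolding Q_def s using g by auto
      ultimately show "\<exists>s'. P (Suc n) s' \<and> Q n s s'" by blast
    qed
    then obtain F where F: "\<And>n. P n (F n)" "\<And>n. Q n (F n) (F (Suc n))" by blast
    define u where "u n = fst (F n)" for n
    have snd: "snd (F n) = u (Suc n)" for n using F(2)[of n] by (simp add: Q_def u_def)
    have au: "autohomeo (u n)" for n using F(1)[of n] by (simp add: P_def u_def)
    have step: "\<exists>g\<in>small_homeos (E n (u n)). u (Suc (Suc n)) = (\<lambda>z. g (u n z))" for n
      using F(2)[of n] unfolding Q_def snd by (auto simp: u_def)
    have close: "dist (u (Suc (Suc n)) (pt n)) (u (Suc n) (pt (Suc n))) < c / 2 ^ n" for n
      using F(2)[of n] unfolding Q_def snd by auto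
    have s1: "dist (u (Suc (Suc n)) z) (u n z) \<le> c / 2 ^ n" for n z
    proof -
      obtain g where g: "g \<in> small_homeos (E n (u n))" "u (Suc (Suc n)) = (\<lambda>z. g (u n z))" using step by blast
      have "dist (g (u n z)) (u n z) < E n (u n)" using g(1) by (simp add: small_homeos_def)
      moreover have "E n (u n) \<le> c / 2 ^ n" using E[OF au] unfolding Eok_def by blast
      ultimately show ?thesis using g(2) by auto
    qed
    have s2: "dist (inv (u (Suc (Suc n))) z) (inv (u n) z) \<le> c / 2 ^ n" for n z
    proof -
      obtain g where g: "g \<in> small_homeos (E n (u n))" "u (Suc (Suc n)) = (\<lambda>z. g (u n z))" using step by blast
      have "autohomeo g" using g(1) by (simp add: small_homeos_def)
      then have "bij g" "bij (u n)" using au by (auto simp: autohomeo_def)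
      then have "inv (u (Suc (Suc n))) z = inv (u n) (inv g z)"
        unfolding g(2) using o_inv_distrib[of g "u n"] by (simp add: o_def)
      then show ?thesis using E[OF au, of n n] g(1) unfolding Eok_def by metis
    qed
    have w: "c / 2 ^ (2 * n + i) \<le> c / 2 ^ n" for n i
      using c by (intro divide_left_mono power_increasing) auto
    have lim: "\<exists>f. autohomeo f \<and> (\<forall>n z. dist (u (2 * n + i) z) (f z) \<le> 2 * c / 2 ^ n)" for i
    proof (rule autohomeo_limit[OF comp, where C = c])
      fix n z
      show "dist (u (2 * Suc n + i) z) (u (2 * n + i) z) \<le> c / 2 ^ n"
        using s1[of "2 * n + i" z] w[of n i] by simp
      show "dist (inv (u (2 * Suc n + i)) z) (inv (u (2 * n + i)) z) \<le> c / 2 ^ n"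
        using s2[of "2 * n + i" z] w[of n i] by simp
    qed (rule au)
    obtain f where f: "autohomeo f" "\<And>n z. dist (u (2 * n) z) (f z) \<le> 2 * c / 2 ^ n"
      using lim[of 0] by auto
    obtain k where k: "autohomeo k" "\<And>n z. dist (u (2 * n + 1) z) (k z) \<le> 2 * c / 2 ^ n"
      using lim[of 1] by blast
    have lim0: "(\<lambda>n. a / 2 ^ n) \<longlonglongrightarrow> 0" for a :: real by (rule LIMSEQ_divide_realpow_zero) simp
    have "dist (f x) (k y) \<le> 5 * c / 2 ^ n" for n
    proof -
      have "dist (u (2 * Suc n) x) (u (2 * n + 1) y) < c / 2 ^ (2 * n)"
        using close[of "2 * n"] by (simp add: pt_def)
      also have "\<dots> \<le> c / 2 ^ n" using w[of n 0] by simp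
      finally have a: "dist (u (2 * Suc n) x) (u (2 * n + 1) y) < c / 2 ^ n" .
      have "dist (u (2 * Suc n) x) (f x) \<le> 2 * c / 2 ^ Suc n" by (rule f(2))
      also have "\<dots> \<le> 2 * c / 2 ^ n" using c by (simp add: field_simps)
      finally have b: "dist (u (2 * Suc n) x) (f x) \<le> 2 * c / 2 ^ n" .
      have "dist (f x) (k y) \<le> dist (u (2 * Suc n) x) (f x) + dist (u (2 * Suc n) x) (u (2 * n + 1) y)
          + dist (u (2 * n + 1) y) (k y)"
        by (smt (verit, best) dist_commute dist_triangle2)
      also have "\<dots> \<le> 2 * c / 2 ^ n + c / 2 ^ n + 2 * c / 2 ^ n"
        using a b k(2)[of n y] by linarith
      also have "\<dots> = 5 * c / 2 ^ n" by (simp add: field_simps)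
      finally show ?thesis .
    qed
    then have "dist (f x) (k y) \<le> 0" using Lim_bounded2[OF lim0[of "5 * c"]] by blast
    then have fk: "f x = k y" by simp
    have "u 0 = (\<lambda>z. z)" "u 1 = (\<lambda>z. z)" using F(1)[of 0] snd[of 0] by (simp_all add: P_def u_def)
    then have f0: "dist z (f z) \<le> 2 * c" and k0: "dist z (k z) \<le> 2 * c" for z
      using f(2)[of 0 z] k(2)[of 0 z] by auto
    have "(\<lambda>z. inv k (f z)) \<in> small_homeos \<eta>"
      unfolding small_homeos_def mem_Collect_eq
    proof (intro conjI allI)
      show "autohomeo (\<lambda>z. inv k (f z))" using autohomeo_comp[OF autohomeo_inv[OF k(1)] f(1)] .
      fix z
      have "dist (inv k (f z)) (f z) \<le> 2 * c" using k0[of "inv k (f z)"] autohomeo_f_inv[OF k(1)] by simp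
      then have "dist (inv k (f z)) z \<le> 4 * c" using f0[of z] dist_triangle2[of "inv k (f z)" z "f z"] by linarith
      then show "dist (inv k (f z)) z < \<eta>" using eta by (simp add: c_def)
    qed
    moreover have "inv k (f x) = y" unfolding fk by (rule autohomeo_inv_f[OF k(1)])
    ultimately show ?thesis by (intro bexI[of _ "\<lambda>z. inv k (f z)"])
  qed
  then show ?thesis using d(1) by blast
qed

text \<open>A Lebesgue number makes the local radius uniform: two close points lie in a common ball
  about some \<open>a\<close>, both are images of \<open>a\<close> under homeomorphisms of size
  \<open>\<eta>/2\<close>, and the quotient of these two maps takes one point to the other.\<close>

theorem homogeneous_small_homeo:
  assumes comp: "compact (UNIV::'a::metric_space set)" and hom: "homogeneous_space TYPE('a)" and eta: "\<eta> > 0"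
  shows "\<exists>d>0. \<forall>x y :: 'a. dist x y < d \<longrightarrow> (\<exists>h\<in>small_homeos \<eta>. h x = y)"
proof -
  obtain D where D: "\<And>x::'a. D x > 0" "\<And>x y. dist x y < D x \<Longrightarrow> \<exists>h\<in>small_homeos (\<eta>/2). h x = y"
  proof -
    have "\<forall>x::'a. \<exists>d>0. \<forall>y. dist x y < d \<longrightarrow> (\<exists>h\<in>small_homeos (\<eta>/2). h x = y)"
      using homogeneous_small_homeo_local[OF comp hom, of "\<eta>/2"] eta by simp
    from choice[OF this] show ?thesis using that by blast
  qed
  obtain d where d: "d > 0" "\<And>x. x \<in> (UNIV::'a set) \<Longrightarrow> \<exists>G\<in>range (\<lambda>x. ball x (D x)). ball x d \<subseteq> G"
  proof (rule Heine_Borel_lemma[OF comp, of "range (\<lambda>x. ball x (D x))"])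
    have "x \<in> ball x (D x)" for x using D(1) by simp
    then show "UNIV \<subseteq> \<Union> (range (\<lambda>x. ball x (D x)))" by blast
    show "open G" if "G \<in> range (\<lambda>x. ball x (D x))" for G using that by blast
  qed (rule that)
  show ?thesis
  proof (intro exI[of _ d] conjI allI impI)
    fix x y :: 'a assume "dist x y < d"
    obtain a where a: "ball x d \<subseteq> ball a (D a)" using d(2) by blast
    have "x \<in> ball x d" "y \<in> ball x d" using \<open>dist x y < d\<close> d(1) by auto
    then have "x \<in> ball a (D a)" "y \<in> ball a (D a)" using a by blast+
    then have "dist a x < D a" "dist a y < D a" by simp_all
    from D(2)[OF this(1)] D(2)[OF this(2)]
    obtain h k where h: "h \<in> small_homeos (\<eta>/2)" "h a = x" and k: "k \<in> small_homeos (\<eta>/2)" "k a = y"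
      by blast
    have ah: "autohomeo h" "autohomeo k" using h k by (auto simp: small_homeos_def)
    have "(\<lambda>z. k (inv h z)) \<in> small_homeos \<eta>"
      unfolding small_homeos_def mem_Collect_eq
    proof (intro conjI allI)
      show "autohomeo (\<lambda>z. k (inv h z))" using autohomeo_comp[OF ah(2) autohomeo_inv[OF ah(1)]] .
      fix z
      have "dist (k (inv h z)) (inv h z) < \<eta>/2" using k(1) by (simp add: small_homeos_def)
      moreover have "dist (h (inv h z)) (inv h z) < \<eta>/2" using h(1) by (simp add: small_homeos_def)
      ultimately show "dist (k (inv h z)) z < \<eta>"
        using autohomeo_f_inv[OF ah(1), of z] dist_triangle2[of "k (inv h z)" z "inv h z"] by (simp add: dist_commute)
    qed
    moreover have "k (inv h x) = y" using h(2) k(2) autohomeo_inv_f[OF ah(1), of a] by simp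
    ultimately show "\<exists>h\<in>small_homeos \<eta>. h x = y" by (intro bexI[of _ "\<lambda>z. k (inv h z)"])
  qed (rule d(1))
qed

section \<open>Differentiable families of maps\<close>

definition dirder :: "'a::real_normed_vector \<Rightarrow> ('a \<times> 'c \<Rightarrow> 'b::real_normed_vector) \<Rightarrow> 'a \<times> 'c \<Rightarrow> 'b" where
  "dirder u F p = frechet_derivative (\<lambda>v. F (v, snd p)) (at (fst p)) u"

text \<open>The second component is a parameter: \<open>F\<close> is $C^k$ in the first component, with derivatives
  jointly continuous in both.\<close>

primrec ck :: "nat \<Rightarrow> ('a::euclidean_space \<times> 'c::t2_space) set \<Rightarrow>
    ('a \<times> 'c \<Rightarrow> 'b::real_normed_vector) \<Rightarrow> bool" where
  "ck 0 D F \<longleftrightarrow> continuous_on D F"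
| "ck (Suc k) D F \<longleftrightarrow> continuous_on D F \<and>
     (\<forall>p\<in>D. (\<lambda>v. F (v, snd p)) differentiable (at (fst p))) \<and> (\<forall>u. ck k D (dirder u F))"

lemma open_slice:
  fixes D :: "('a::topological_space \<times> 'c::t2_space) set"
  assumes "open D" shows "open {v. (v, w) \<in> D}"
proof -
  have "open ((\<lambda>v. (v, w)) -` D)" by (rule open_vimage[OF assms]) (intro continuous_intros)
  then show ?thesis by (simp add: vimage_def)
qed

lemma ck_imp_continuous: "ck k D F \<Longrightarrow> continuous_on D F"
  by (cases k) auto

lemma ck_has_derivative:
  assumes "ck (Suc k) D F" "p \<in> D"
  shows "((\<lambda>v. F (v, snd p)) has_derivative (\<lambda>u. dirder u F p)) (at (fst p))"
  using assms by (auto simp: dirder_def frechet_derivative_works[symmetric])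

lemma ck_dirder: "ck (Suc k) D F \<Longrightarrow> ck k D (dirder u F)"
  by simp

lemma dirder_eqI:
  assumes "((\<lambda>v. F (v, snd p)) has_derivative F') (at (fst p))"
  shows "dirder u F p = F' u"
  unfolding dirder_def using frechet_derivative_at[OF assms] by simp

lemma ck_Suc_imp: "ck (Suc k) D F \<Longrightarrow> ck k D F"
  by (induction k arbitrary: F) auto

lemma ck_subset: "ck k D F \<Longrightarrow> D' \<subseteq> D \<Longrightarrow> ck k D' F"
  by (induction k arbitrary: F) (auto intro: continuous_on_subset)

lemma ck_cong:
  assumes "open D" "\<And>p. p \<in> D \<Longrightarrow> F p = G p" "ck k D F"
  shows "ck k D G"
  using assms(2,3)
proof (induction k arbitrary: F G)
  case 0
  then show ?case using continuous_on_eq[of D F G] by simp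
next
  case (Suc k)
  have der: "((\<lambda>v. G (v, snd p)) has_derivative (\<lambda>u. dirder u F p)) (at (fst p))" if "p \<in> D" for p
  proof (rule has_derivative_transform_within_open[OF ck_has_derivative[OF Suc.prems(2) that]])
    show "open {v. (v, snd p) \<in> D}" by (rule open_slice[OF assms(1)])
  qed (use that Suc.prems(1) in auto)
  have "ck k D (dirder u G)" for u
  proof (rule Suc.IH)
    show "ck k D (dirder u F)" using Suc.prems(2) by simp
    show "dirder u F p = dirder u G p" if "p \<in> D" for p using dirder_eqI[OF der[OF that]] by simp
  qed
  moreover have "continuous_on D G"
    using Suc.prems continuous_on_eq[of D F G] by simp
  moreover have "(\<lambda>v. G (v, snd p)) differentiable (at (fst p))" if "p \<in> D" for p
    using der[OF that] differentiableI by blast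
  ultimately show ?case by simp
qed

lemma ck_SucI:
  assumes "open D" "continuous_on D F"
    and der: "\<And>p. p \<in> D \<Longrightarrow> ((\<lambda>v. F (v, snd p)) has_derivative F' p) (at (fst p))"
    and "\<And>u. ck k D (\<lambda>p. F' p u)"
  shows "ck (Suc k) D F"
proof -
  have "ck k D (dirder u F)" for u
    by (rule ck_cong[OF assms(1) _ assms(4)[of u]]) (simp add: dirder_eqI[OF der])
  moreover have "(\<lambda>v. F (v, snd p)) differentiable (at (fst p))" if "p \<in> D" for p
    using der[OF that] differentiableI by blast
  ultimately show ?thesis using assms(2) by simp
qed

lemma ck_local:
  assumes "\<And>p. p \<in> D \<Longrightarrow> \<exists>E. open E \<and> p \<in> E \<and> ck k E F"
  shows "ck k D F"
  using assms
proof (induction k arbitrary: F)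
  case 0
  have "isCont F p" if "p \<in> D" for p
    using 0[OF that] continuous_on_eq_continuous_at by auto
  then show ?case by (simp add: continuous_at_imp_continuous_on)
next
  case (Suc k)
  have "continuous_on D F"
  proof (rule continuous_at_imp_continuous_on, rule ballI)
    fix p assume "p \<in> D"
    then show "isCont F p"
      using Suc.prems[of p] ck_imp_continuous continuous_on_eq_continuous_at by metis
  qed
  moreover have "ck k D (dirder u F)" for u
    using Suc.prems by (intro Suc.IH) (meson ck_dirder)
  moreover have "(\<lambda>v. F (v, snd p)) differentiable (at (fst p))" if "p \<in> D" for p
    using Suc.prems[OF that] by auto
  ultimately show ?case by simp
qed

lemma ck_const: "open D \<Longrightarrow> ck k D (\<lambda>p. c)"
proof (induction k arbitrary: c)
  case (Suc k)
  show ?case by (rule ck_SucI[where F'="\<lambda>p u. 0"]) (use Suc in auto)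
qed simp

lemma ck_param:
  assumes "open D" "continuous_on D (\<lambda>p. f (snd p))"
  shows "ck k D (\<lambda>p. f (snd p))"
proof (cases k)
  case (Suc m)
  show ?thesis unfolding Suc by (rule ck_SucI[where F'="\<lambda>p u. 0"]) (use assms ck_const in auto)
qed (use assms in simp)

lemma ck_fst: "open D \<Longrightarrow> ck k D fst"
proof (cases k)
  case (Suc m)
  assume "open D"
  then show ?thesis unfolding Suc
    by (intro ck_SucI[where F'="\<lambda>p u. u"] continuous_intros ck_const) auto
qed (simp add: continuous_on_fst)

lemma ck_bounded_linear:
  assumes "open D" "bounded_linear L" "ck k D F"
  shows "ck k D (\<lambda>p. L (F p))"
  using assms(3)
proof (induction k arbitrary: F)
  case 0
  then show ?case using linear_continuous_on_compose assms(2) bounded_linear.linear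
    by (simp add: bounded_linear.continuous_on)
next
  case (Suc k)
  show ?case
  proof (rule ck_SucI[OF assms(1)])
    show "continuous_on D (\<lambda>p. L (F p))"
      using Suc.prems assms(2) by (simp add: bounded_linear.continuous_on)
    show "((\<lambda>v. L (F (v, snd p))) has_derivative (\<lambda>u. L (dirder u F p))) (at (fst p))" if "p \<in> D" for p
      by (rule bounded_linear.has_derivative[OF assms(2) ck_has_derivative[OF Suc.prems that]])
    show "ck k D (\<lambda>p. L (dirder u F p))" for u using Suc by simp
  qed
qed

lemma ck_add:
  assumes "open D" "ck k D F" "ck k D G"
  shows "ck k D (\<lambda>p. F p + G p)"
  using assms(2,3)
proof (induction k arbitrary: F G)
  case (Suc k)
  show ?case
  proof (rule ck_SucI[OF assms(1), where F'="\<lambda>p u. dirder u F p + dirder u G p"])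
    show "continuous_on D (\<lambda>p. F p + G p)" using Suc.prems by (auto intro: continuous_intros)
    show "((\<lambda>v. F (v, snd p) + G (v, snd p)) has_derivative (\<lambda>u. dirder u F p + dirder u G p)) (at (fst p))"
      if "p \<in> D" for p
      by (intro has_derivative_add ck_has_derivative[OF Suc.prems(1) that] ck_has_derivative[OF Suc.prems(2) that])
    show "ck k D (\<lambda>p. dirder u F p + dirder u G p)" for u using Suc by simp
  qed
qed (auto intro: continuous_intros)

lemma ck_bilinear:
  assumes "open D" "bounded_bilinear pr" "ck k D F" "ck k D G"
  shows "ck k D (\<lambda>p. pr (F p) (G p))"
  using assms(3,4)
proof (induction k arbitrary: F G)
  case 0
  then show ?case by (simp add: bounded_bilinear.continuous_on[OF assms(2)])
next
  case (Suc k)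
  show ?case
  proof (rule ck_SucI[OF assms(1), where F'="\<lambda>p u. pr (F p) (dirder u G p) + pr (dirder u F p) (G p)"])
    show "continuous_on D (\<lambda>p. pr (F p) (G p))"
      using Suc.prems by (simp add: bounded_bilinear.continuous_on[OF assms(2)])
    show "((\<lambda>v. pr (F (v, snd p)) (G (v, snd p))) has_derivative
        (\<lambda>u. pr (F p) (dirder u G p) + pr (dirder u F p) (G p))) (at (fst p))" if "p \<in> D" for p
      using bounded_bilinear.FDERIV[OF assms(2) ck_has_derivative[OF Suc.prems(1) that] ck_has_derivative[OF Suc.prems(2) that]]
      by simp
    show "ck k D (\<lambda>p. pr (F p) (dirder u G p) + pr (dirder u F p) (G p))" for u
      using Suc.prems ck_Suc_imp[OF Suc.prems(1)] ck_Suc_imp[OF Suc.prems(2)]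
      by (intro ck_add assms(1) Suc.IH) simp_all
  qed
qed

lemmas ck_mult = ck_bilinear[OF _ bounded_bilinear_mult]
lemmas ck_scaleR = ck_bilinear[OF _ bounded_bilinear_scaleR]
lemma ck_diff:
  assumes "open D" "ck k D F" "ck k D G"
  shows "ck k D (\<lambda>p. F p - G p)"
proof -
  have "ck k D (\<lambda>p. F p + - G p)"
    by (rule ck_add[OF assms(1,2) ck_bounded_linear[OF assms(1) bounded_linear_minus[OF bounded_linear_ident] assms(3)]])
  then show ?thesis by simp
qed

lemma ck_sum:
  assumes "open D" "\<And>i. i \<in> I \<Longrightarrow> ck k D (F i)"
  shows "ck k D (\<lambda>p. \<Sum>i\<in>I. F i p)"
  using assms(2)
proof (induction I rule: infinite_finite_induct)
  case (insert i I)
  then show ?case by (simp add: ck_add assms(1))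
qed (auto intro: ck_const assms(1))

lemma ck_prod:
  fixes F :: "'i \<Rightarrow> 'a::euclidean_space \<times> 'c::t2_space \<Rightarrow> real"
  assumes "open D" "\<And>i. i \<in> I \<Longrightarrow> ck k D (F i)"
  shows "ck k D (\<lambda>p. \<Prod>i\<in>I. F i p)"
  using assms(2)
proof (induction I rule: infinite_finite_induct)
  case (insert i I)
  then show ?case by (simp add: ck_mult assms(1))
qed (auto intro: ck_const assms(1))

text \<open>The transverse variable is reparametrised by a map \<open>\<kappa>\<close> that is only
  continuous, as transitions between transversals are. No derivative ever falls on it because
  differentiation is in the first variable alone.\<close>

lemma ck_compose:
  fixes G :: "'a::euclidean_space \<times> 'c::t2_space \<Rightarrow> 'e::euclidean_space"
    and F :: "'e \<times> 'd::t2_space \<Rightarrow> 'b::real_normed_vector"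
  assumes D: "open D" and E: "open E" and "ck k D G" "ck k E F"
    and \<kappa>: "continuous_on D (\<lambda>p. \<kappa> (snd p))" and sub: "\<And>p. p \<in> D \<Longrightarrow> (G p, \<kappa> (snd p)) \<in> E"
  shows "ck k D (\<lambda>p. F (G p, \<kappa> (snd p)))"
  using assms(3,4)
proof (induction k arbitrary: F)
  case 0
  then show ?case
    by (auto intro!: continuous_on_compose2[of E F] continuous_intros \<kappa> sub)
next
  case (Suc k)
  have G: "continuous_on D G" and F: "continuous_on E F"
    using Suc.prems ck_imp_continuous by blast+
  show ?case
  proof (rule ck_SucI[OF D, where F'="\<lambda>p u. dirder (dirder u G p) F (G p, \<kappa> (snd p))"])
    show "continuous_on D (\<lambda>p. F (G p, \<kappa> (snd p)))"
      by (auto intro!: continuous_on_compose2[OF F] continuous_intros \<kappa> sub G)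
    have F': "((\<lambda>v. F (v, \<kappa> (snd p))) has_derivative (\<lambda>u. dirder u F (G p, \<kappa> (snd p)))) (at (G p))" if "p \<in> D" for p
      using ck_has_derivative[OF Suc.prems(2) sub[OF that]] by simp
    show "((\<lambda>v. F (G (v, snd p), \<kappa> (snd (v, snd p)))) has_derivative
       (\<lambda>u. dirder (dirder u G p) F (G p, \<kappa> (snd p)))) (at (fst p))" if "p \<in> D" for p
      using has_derivative_compose[OF ck_has_derivative[OF Suc.prems(1) that], of "\<lambda>v. F (v, \<kappa> (snd p))"] F'[OF that]
      by simp
    fix u
    \<comment> \<open>The outer derivative is taken in a direction that varies with
      \<open>p\<close>. Expansion in a basis leaves fixed directions, to which the induction
      hypothesis applies.\<close>
    have "dirder (dirder u G p) F (G p, \<kappa> (snd p)) =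
       (\<Sum>b\<in>Basis. (dirder u G p \<bullet> b) *\<^sub>R dirder b F (G p, \<kappa> (snd p)))" if "p \<in> D" for p
    proof -
      have lin: "linear (\<lambda>u. dirder u F (G p, \<kappa> (snd p)))"
        using F'[OF that] has_derivative_linear by blast
      have "dirder (dirder u G p) F (G p, \<kappa> (snd p)) =
        dirder (\<Sum>b\<in>Basis. (dirder u G p \<bullet> b) *\<^sub>R b) F (G p, \<kappa> (snd p))"
        by (simp add: euclidean_representation)
      also have "\<dots> = (\<Sum>b\<in>Basis. (dirder u G p \<bullet> b) *\<^sub>R dirder b F (G p, \<kappa> (snd p)))"
        by (subst linear_sum[OF lin]) (simp add: linear_scale[OF lin])
      finally show ?thesis .
    qed
    moreover have "ck k D (\<lambda>p. (\<Sum>b\<in>Basis. (dirder u G p \<bullet> b) *\<^sub>R dirder b F (G p, \<kappa> (snd p))))"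
      using Suc.prems by (intro ck_sum ck_scaleR D ck_bounded_linear[OF D bounded_linear_inner_left] Suc.IH ck_Suc_imp[OF Suc.prems(1)]) simp_all
    ultimately show "ck k D (\<lambda>p. dirder (dirder u G p) F (G p, \<kappa> (snd p)))"
      using ck_cong[OF D] by (smt (verit, best))
  qed
qed

lemma ck_inverse:
  fixes F :: "'a::euclidean_space \<times> 'c::t2_space \<Rightarrow> real"
  assumes "open D" "ck k D F" and nz: "\<And>p. p \<in> D \<Longrightarrow> F p \<noteq> 0"
  shows "ck k D (\<lambda>p. inverse (F p))"
  using assms(2)
proof (induction k)
  case 0
  then show ?case using nz by (auto intro: continuous_intros)
next
  case (Suc k)
  show ?case
  proof (rule ck_SucI[OF assms(1), where F'="\<lambda>p u. - (inverse (F p) * dirder u F p * inverse (F p))"])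
    show "continuous_on D (\<lambda>p. inverse (F p))" using nz ck_imp_continuous[OF Suc.prems] by (intro continuous_intros) auto
    show "((\<lambda>v. inverse (F (v, snd p))) has_derivative
       (\<lambda>u. - (inverse (F p) * dirder u F p * inverse (F p)))) (at (fst p))" if "p \<in> D" for p
      using Deriv.has_derivative_inverse[OF _ ck_has_derivative[OF Suc.prems that]] nz[OF that] by simp
    fix u
    have "ck k D (\<lambda>p. inverse (F p) * dirder u F p * inverse (F p))"
      using Suc ck_Suc_imp[OF Suc.prems] by (intro ck_mult assms(1)) simp_all
    then show "ck k D (\<lambda>p. - (inverse (F p) * dirder u F p * inverse (F p)))"
      using ck_bounded_linear[OF assms(1) bounded_linear_minus[OF bounded_linear_ident]] by blast
  qed
qed

text \<open>Away from the origin the derivative of the norm is a linear function divided by the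
  norm, so the order rises by one at each step of the induction.\<close>

lemma ck_norm:
  assumes "open D" "\<And>p. p \<in> D \<Longrightarrow> fst p \<noteq> (0::'a::euclidean_space)"
  shows "ck k (D :: ('a \<times> 'c::t2_space) set) (\<lambda>p. norm (fst p))"
proof (induction k)
  case (Suc k)
  show ?case
  proof (rule ck_SucI[OF assms(1), where F'="\<lambda>p u. (fst p \<bullet> u) * inverse (norm (fst p))"])
    show "continuous_on D (\<lambda>p. norm (fst p))"
      by (rule continuous_on_norm[OF continuous_on_fst[OF continuous_on_id]])
    show "((\<lambda>v. norm (fst (v, snd p))) has_derivative (\<lambda>u. fst p \<bullet> u * inverse (norm (fst p)))) (at (fst p))"
      if "p \<in> D" for p
      using has_derivative_norm[OF assms(2)[OF that]] by (simp add: sgn_div_norm inner_commute mult.commute)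
    show "ck k D (\<lambda>p. (fst p \<bullet> u) * inverse (norm (fst p)))" for u
      by (intro ck_mult ck_inverse Suc assms(1) ck_bounded_linear[OF assms(1) bounded_linear_inner_left] ck_fst)
        (use assms in auto)
  qed
qed (simp add: continuous_on_norm[OF continuous_on_fst[OF continuous_on_id]])

lemma ck_vec:
  fixes F :: "'a::euclidean_space \<times> 'c::t2_space \<Rightarrow> real^'n"
  assumes "open D" "\<And>i. ck k D (\<lambda>p. F p $ i)"
  shows "ck k D F"
proof -
  have "ck k D (\<lambda>p. \<Sum>i\<in>UNIV. (F p $ i) *\<^sub>R axis i 1)"
    by (intro ck_sum ck_scaleR assms ck_const)
  moreover have "(\<lambda>p. \<Sum>i\<in>UNIV. (F p $ i) *\<^sub>R axis i 1) = F"
    by (simp add: fun_eq_iff vec_eq_iff axis_def if_distrib cong: if_cong)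
  ultimately show ?thesis using subst[of _ F "ck k D"] by blast
qed

lemma ck_component:
  fixes F :: "'a::euclidean_space \<times> 'c::t2_space \<Rightarrow> 'b::euclidean_space^'n"
  assumes "open D" "ck k D F" shows "ck k D (\<lambda>p. F p $ i)"
  by (rule ck_bounded_linear[OF assms(1) bounded_linear_vec_nth assms(2)])

lemma ck_det:
  fixes N :: "'a::euclidean_space \<times> 'c::t2_space \<Rightarrow> real^'n^'n"
  assumes "open D" "\<And>i j. ck k D (\<lambda>p. N p $ i $ j)"
  shows "ck k D (\<lambda>p. det (N p))"
  unfolding det_def by (intro ck_sum ck_mult ck_prod ck_const assms)

lemma matrix_inv_inverse:
  assumes "invertible M" shows "M ** matrix_inv M = mat 1" "matrix_inv M ** M = mat 1"
  using someI_ex[OF assms[unfolded invertible_def]] unfolding matrix_inv_def by auto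

text \<open>The derivative of the inverse is given by Cramer's rule, a rational function of the
  derivative of \<open>\<Phi>\<close> evaluated at \<open>\<Theta>\<close>; this makes the induction on the order work.\<close>

lemma ck_inverse_map:
  fixes \<Phi> :: "(real^'n) \<times> 'c::t2_space \<Rightarrow> real^'n"
  assumes D: "open D" and E: "open E" and \<Phi>: "\<And>k. ck k D \<Phi>" and \<Theta>: "continuous_on E \<Theta>"
    and inv: "\<And>p. p \<in> E \<Longrightarrow> (\<Theta> p, snd p) \<in> D \<and> \<Phi> (\<Theta> p, snd p) = fst p"
    and inj: "\<And>p. p \<in> D \<Longrightarrow> inj (\<lambda>u. dirder u \<Phi> p)"
  shows "ck k E \<Theta>"
proof (induction k)
  case 0
  then show ?case using \<Theta> by simp
next
  case (Suc k)
  define M where "M p = (\<chi> i j. dirder (axis j 1) \<Phi> (\<Theta> p, snd p) $ i)" for p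
  define R where "R p u = (\<chi> l. det (\<chi> i j. if j = l then u $ i else M p $ i $ j) * inverse (det (M p)))" for p and u :: "real^'n"
  have der: "((\<lambda>v. \<Phi> (v, snd p)) has_derivative (\<lambda>u. dirder u \<Phi> (\<Theta> p, snd p))) (at (\<Theta> p))" if "p \<in> E" for p
    using ck_has_derivative[OF \<Phi>[of "Suc 0"], of "(\<Theta> p, snd p)"] inv[OF that] by simp
  have Mv: "(\<lambda>u. dirder u \<Phi> (\<Theta> p, snd p)) = (*v) (M p)" if "p \<in> E" for p
  proof -
    have "M p = matrix (\<lambda>u. dirder u \<Phi> (\<Theta> p, snd p))" unfolding M_def matrix_def by simp
    then show ?thesis using matrix_vector_mul(2)[OF has_derivative_linear[OF der[OF that]]] by (simp add: fun_eq_iff)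
  qed
  have detM: "det (M p) \<noteq> 0" if "p \<in> E" for p
  proof -
    have "inj ((*v) (M p))" using inj[of "(\<Theta> p, snd p)"] inv[OF that] Mv[OF that] by simp
    then show ?thesis by (metis inj_matrix_vector_mult matrix_left_invertible_injective invertible_det_nz invertible_left_inverse)
  qed
  have R: "R p (M p *v x) = x" if "p \<in> E" for p x
    using cramer[OF detM[OF that], of x "M p *v x"] unfolding R_def divide_inverse by simp
  have R': "R p = (*v) (matrix_inv (M p))" if "p \<in> E" for p
  proof
    fix u
    have "M p ** matrix_inv (M p) = mat 1"
      using detM[OF that] matrix_inv_inverse[of "M p"] by (simp add: invertible_det_nz)
    then have "M p *v (matrix_inv (M p) *v u) = u" by (simp add: matrix_vector_mul_assoc)
    then show "R p u = matrix_inv (M p) *v u" using R[OF that, of "matrix_inv (M p) *v u"] by simp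
  qed
  have Mk: "ck k E (\<lambda>p. M p $ i $ j)" for i j
  proof -
    have "ck k E (\<lambda>p. dirder (axis j 1) \<Phi> (\<Theta> p, snd p))"
      using \<Phi>[of "Suc k"] inv by (intro ck_compose[OF E D Suc, where \<kappa>="\<lambda>w. w"]) (auto intro: continuous_intros)
    then show ?thesis unfolding M_def by (simp add: ck_component[OF E])
  qed
  show ?case
  proof (rule ck_SucI[OF E \<Theta>, where F'=R])
    show "((\<lambda>v. \<Theta> (v, snd p)) has_derivative R p) (at (fst p))" if "p \<in> E" for p
    proof (rule has_derivative_inverse_basic[where T="{v. (v, snd p) \<in> E}" and f="\<lambda>v. \<Phi> (v, snd p)"])
      show "((\<lambda>v. \<Phi> (v, snd p)) has_derivative (*v) (M p)) (at (\<Theta> (fst p, snd p)))"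
        using der[OF that] Mv[OF that] by simp
      show "bounded_linear (R p)" unfolding R'[OF that] by (rule matrix_vector_mul_bounded_linear)
      show "R p \<circ> (*v) (M p) = id" using R[OF that] by (auto simp: fun_eq_iff)
      have "isCont \<Theta> p" using \<Theta> E that continuous_on_eq_continuous_at by blast
      then show "isCont (\<lambda>v. \<Theta> (v, snd p)) (fst p)"
        by (intro continuous_at_compose[of _ "\<lambda>v. (v, snd p)" \<Theta>, unfolded o_def]) (auto intro: continuous_intros)
      show "open {v. (v, snd p) \<in> E}" by (rule open_slice[OF E])
    qed (use that inv in auto)
    show "ck k E (\<lambda>p. R p u)" for u
    proof (rule ck_vec[OF E])
      fix l
      have "ck k E (\<lambda>p. (if j = l then u $ i else M p $ i $ j))" for i j
        using Mk ck_const[OF E] by (cases "j = l") auto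
      then show "ck k E (\<lambda>p. R p u $ l)" unfolding R_def
        by (simp, intro ck_mult ck_inverse ck_det E Mk detM) (auto simp: ck_const[OF E])
    qed
  qed
qed

section \<open>Jointly continuous derivatives and the $C^\<infinity>$-topology\<close>

lemma ck_imp_smooth_on:
  fixes F :: "'c::t2_space \<Rightarrow> 'a::euclidean_space \<Rightarrow> 'b::real_normed_vector"
  assumes "\<And>k. ck k D (\<lambda>p. F (snd p) (fst p))"
  shows "ck k D (\<lambda>p. iter_deriv us (F (snd p)) (fst p))"
proof (induction us arbitrary: k)
  case (Cons u us)
  have "dirder u (\<lambda>p. iter_deriv us (F (snd p)) (fst p)) = (\<lambda>p. iter_deriv (u # us) (F (snd p)) (fst p))"
    by (simp add: dirder_def fun_eq_iff)
  then show ?case using ck_dirder[OF Cons[of "Suc k"], of u] by (simp only:)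
qed (use assms in simp)

text \<open>The tube lemma makes a compact part of one slice survive in the neighbouring slices, and
  joint continuity of each derivative is uniform over that compact part. This gives convergence in
  the compact-open topology.\<close>

lemma ck_imp_smooth_family:
  fixes F :: "'c::t2_space \<Rightarrow> 'a::euclidean_space \<Rightarrow> 'b::real_normed_vector"
  assumes D: "open D" and F: "\<And>k. ck k D (\<lambda>p. F (snd p) (fst p))"
  shows "smooth_family D F"
  unfolding smooth_family_def
proof (intro conjI ballI allI impI)
  note ck = ck_imp_smooth_on[OF F]
  fix w
  show "smooth_on {v. (v, w) \<in> D} (F w)"
    unfolding smooth_on_def
  proof (intro conjI allI open_slice[OF D])
    fix us
    show "iter_deriv us (F w) differentiable_on {v. (v, w) \<in> D}"
      unfolding differentiable_on_def
    proof safe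
      fix v assume "(v, w) \<in> D"
      then have "iter_deriv us (F w) differentiable (at v)"
        using ck[of "Suc 0" us] by auto
      then show "iter_deriv us (F w) differentiable (at v within {v. (v, w) \<in> D})"
        using differentiable_at_withinI by blast
    qed
  qed
next
  note ck = ck_imp_smooth_on[OF F]
  fix w K assume K: "compact K \<and> K \<subseteq> {v. (v, w) \<in> D}"
  have "open ((\<lambda>p. (snd p, fst p)) -` D)" by (intro open_vimage D continuous_intros)
  moreover have "{w} \<times> K \<subseteq> (\<lambda>p. (snd p, fst p)) -` D" using K by auto
  ultimately obtain X where X: "w \<in> X" "open X" "X \<times> K \<subseteq> (\<lambda>p. (snd p, fst p)) -` D"
    using Elementary_Topology.tube_lemma[of K "(\<lambda>p. (snd p, fst p)) -` D" w] K by blast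
  have XD: "(v, w') \<in> D" if "w' \<in> X" "v \<in> K" for v w' using X(3) that by auto
  show "\<forall>\<^sub>F w' in at w within snd ` D. K \<subseteq> {v. (v, w') \<in> D}"
    unfolding eventually_at_topological using X(1,2) XD by (intro exI[of _ X]) auto
  fix us
  show "uniform_limit K (\<lambda>w'. iter_deriv us (F w')) (iter_deriv us (F w)) (at w within snd ` D)"
  proof (rule uniform_limitI)
    fix e :: real assume "e > 0"
    have "continuous_on (X \<times> K) (\<lambda>q. (\<lambda>p. iter_deriv us (F (snd p)) (fst p)) (snd q, fst q))"
      by (rule continuous_on_compose2[OF ck_imp_continuous[OF ck[of 0]]])
        (use XD in \<open>auto intro!: continuous_intros\<close>)
    then have c: "continuous_on (X \<times> K) (\<lambda>(w, v). iter_deriv us (F w) v)" by (simp add: case_prod_beta')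
    obtain X0 where X0: "w \<in> X0" "open X0" "\<forall>w'\<in>X0 \<inter> X. \<forall>v\<in>K. dist (iter_deriv us (F w') v) (iter_deriv us (F w) v) \<le> e/2"
    proof (rule continuous_on_prod_compactE[OF c conjunct1[OF K] X(1), of "e/2"])
      fix X0 assume "w \<in> X0" "open X0" "\<forall>w'\<in>X0 \<inter> X. \<forall>v\<in>K.
        dist (case (w', v) of (w, v) \<Rightarrow> iter_deriv us (F w) v) (case (w, v) of (w, v) \<Rightarrow> iter_deriv us (F w) v) \<le> e/2"
      then show thesis by (intro that) auto
    qed (use \<open>e > 0\<close> in simp)
    show "\<forall>\<^sub>F w' in at w within snd ` D. \<forall>v\<in>K. dist (iter_deriv us (F w') v) (iter_deriv us (F w) v) < e"
      unfolding eventually_at_topological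
      using X0 X(1,2) \<open>e > 0\<close> by (intro exI[of _ "X0 \<inter> X"]) force
  qed
qed

text \<open>Joint continuity at a point splits into two errors: uniform convergence over a small
  closed ball compares the slice over \<open>w'\<close> with that over \<open>w\<close>, and
  continuity of the limiting derivative handles the move inside the slice over
  \<open>w\<close>.\<close>

lemma smooth_family_imp_ck:
  fixes F :: "'c::t2_space \<Rightarrow> 'a::euclidean_space \<Rightarrow> 'b::real_normed_vector"
  assumes D: "open D" and F: "smooth_family D F"
  shows "ck k D (\<lambda>p. F (snd p) (fst p))"
proof -
  have diff: "iter_deriv us (F w) differentiable (at v)" if "(v, w) \<in> D" for us v w
  proof -
    have "iter_deriv us (F w) differentiable (at v within {v. (v, w) \<in> D})"
      using F that unfolding smooth_family_def smooth_on_def differentiable_on_def by blast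
    then show ?thesis using at_within_open[of v "{v. (v, w) \<in> D}"] open_slice[OF D] that by simp
  qed
  have cont: "continuous_on D (\<lambda>p. iter_deriv us (F (snd p)) (fst p))" for us
    unfolding continuous_on_def
  proof safe
    fix v w assume vw: "(v, w) \<in> D"
    obtain r where r: "r > 0" "cball v r \<subseteq> {v. (v, w) \<in> D}"
      using open_contains_cball open_slice[OF D] vw by (metis mem_Collect_eq)
    have ul: "uniform_limit (cball v r) (\<lambda>w'. iter_deriv us (F w')) (iter_deriv us (F w)) (at w within snd ` D)"
      using F vw r(2) unfolding smooth_family_def by (metis compact_cball image_eqI snd_conv)
    have "isCont (iter_deriv us (F w)) v"
      using differentiable_imp_continuous_within[OF diff[OF vw]] .
    show "((\<lambda>p. iter_deriv us (F (snd p)) (fst p)) \<longlongrightarrow> iter_deriv us (F (snd (v, w))) (fst (v, w))) (at (v, w) within D)"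
    proof (rule tendstoI)
      fix e :: real assume "e > 0"
      obtain s where s: "s > 0" "\<And>v'. dist v' v < s \<Longrightarrow> dist (iter_deriv us (F w) v') (iter_deriv us (F w) v) < e/2"
        using \<open>isCont (iter_deriv us (F w)) v\<close> \<open>e > 0\<close> unfolding continuous_at_eps_delta by (metis half_gt_zero)
      obtain W where W: "open W" "w \<in> W" "\<And>w' v'. w' \<in> W \<Longrightarrow> w' \<noteq> w \<Longrightarrow> w' \<in> snd ` D \<Longrightarrow> v' \<in> cball v r \<Longrightarrow>
          dist (iter_deriv us (F w') v') (iter_deriv us (F w) v') < e/2"
        using uniform_limitD[OF ul, of "e/2"] \<open>e > 0\<close> unfolding eventually_at_topological by (metis half_gt_zero)
      have *: "dist (iter_deriv us (F w') v') (iter_deriv us (F w) v) < e"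
        if "v' \<in> ball v (min r s)" "w' \<in> W" "(v', w') \<in> D" for v' w'
      proof -
        have "dist (iter_deriv us (F w') v') (iter_deriv us (F w) v') < e/2"
        \<comment> \<open>The uniform limit is taken along \<open>at w\<close>, which says nothing
          about the parameter \<open>w\<close> itself.\<close>
        proof (cases "w' = w")
          case False
          have "w' \<in> snd ` D" using that(3) by force
          then show ?thesis using W(3)[of w' v'] that False by auto
        qed (use \<open>e > 0\<close> in auto)
        moreover have "dist (iter_deriv us (F w) v') (iter_deriv us (F w) v) < e/2"
          using s(2) that(1) by (auto simp: dist_commute)
        ultimately show ?thesis
          by (metis dist_triangle_half_r dist_commute)
      qed
      show "\<forall>\<^sub>F x in at (v, w) within D. dist (iter_deriv us (F (snd x)) (fst x)) (iter_deriv us (F (snd (v, w))) (fst (v, w))) < e"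
        unfolding eventually_at_topological
        by (intro exI[of _ "ball v (min r s) \<times> W"]) (use * W r s in \<open>auto intro: open_Times\<close>)
    qed
  qed
  have "ck k D (\<lambda>p. iter_deriv us (F (snd p)) (fst p))" for us
  proof (induction k arbitrary: us)
    case (Suc k)
    have "dirder u (\<lambda>p. iter_deriv us (F (snd p)) (fst p)) = (\<lambda>p. iter_deriv (u # us) (F (snd p)) (fst p))" for u
      by (simp add: dirder_def fun_eq_iff)
    then have "ck k D (dirder u (\<lambda>p. iter_deriv us (F (snd p)) (fst p)))" for u
      using Suc[of "u # us"] by (simp only:)
    then show ?case using cont diff by auto
  qed (use cont in simp)
  from this[of "[]"] show ?thesis by simp
qed

section \<open>Flat functions and smooth steps\<close>

definition flat_exp :: "nat \<Rightarrow> real \<Rightarrow> real" where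
  "flat_exp j x = (if x > 0 then exp (- inverse x) * inverse x ^ j else 0)"

lemma power_le_fact_exp: "(x::real) \<ge> 0 \<Longrightarrow> x ^ n \<le> fact n * exp x"
proof -
  assume x: "x \<ge> 0"
  have "(\<Sum>i\<in>{n}. x ^ i /\<^sub>R fact i) \<le> (\<Sum>i. x ^ i /\<^sub>R fact i)"
    using exp_converges[of x] x by (intro sum_le_suminf) (auto simp: sums_iff)
  also have "\<dots> = exp x" using exp_converges[of x] by (simp add: sums_iff)
  finally show ?thesis by (simp add: field_simps)
qed

text \<open>The term of order \<open>j + 2\<close> in the exponential series at
  \<open>inverse x\<close> beats the pole of order \<open>j\<close> with a factor \<open>x^2\<close>
  to spare, so that the difference quotient at the origin tends to zero.\<close>

lemma flat_exp_le:
  assumes "x > 0" shows "flat_exp j x \<le> fact (j + 2) * x\<^sup>2"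
proof -
  have e: "exp (- inverse x) = inverse (exp (inverse x))" by (rule exp_minus)
  have "inverse x ^ (j + 2) \<le> fact (j + 2) * exp (inverse x)"
    using assms by (intro power_le_fact_exp) auto
  then have "exp (- inverse x) * inverse x ^ (j + 2) \<le> exp (- inverse x) * (fact (j + 2) * exp (inverse x))"
    by (rule mult_left_mono) simp
  also have "\<dots> = fact (j + 2)" unfolding e by simp
  finally have "exp (- inverse x) * inverse x ^ (j + 2) \<le> fact (j + 2)" .
  then have "exp (- inverse x) * inverse x ^ (j + 2) * x\<^sup>2 \<le> fact (j + 2) * x\<^sup>2"
    by (rule mult_right_mono) simp
  moreover have "inverse x ^ (j + 2) * x\<^sup>2 = inverse x ^ j" using assms by (simp add: power_add field_simps power2_eq_square)
  then have "exp (- inverse x) * inverse x ^ (j + 2) * x\<^sup>2 = exp (- inverse x) * inverse x ^ j"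
    by (simp only: mult.assoc)
  ultimately have "exp (- inverse x) * inverse x ^ j \<le> fact (j + 2) * x\<^sup>2" by linarith
  then show ?thesis using assms by (simp only: flat_exp_def if_True)
qed

text \<open>The family is closed under differentiation up to linear combinations, with index raised
  by one or two. Smoothness of every member then follows by one induction over all indices.\<close>

lemma flat_exp_has_derivative:
  "(flat_exp j has_real_derivative (flat_exp (j + 2) x - j * flat_exp (j + 1) x)) (at x)"
proof -
  consider "x < 0" | "x = 0" | "x > 0" by linarith
  then show ?thesis
  proof cases
    case 1
    have "((\<lambda>x. 0) has_real_derivative 0) (at x)" by simp
    then have "(flat_exp j has_real_derivative 0) (at x)"
      by (rule has_field_derivative_transform_within_open[where S="{..<0}"]) (use 1 in \<open>auto simp: flat_exp_def\<close>)
    then show ?thesis using 1 by (simp add: flat_exp_def)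
  next
    case 2
    have "((\<lambda>h. (flat_exp j (0 + h) - flat_exp j 0) / h) \<longlongrightarrow> 0) (at 0)"
    proof (rule Lim_null_comparison)
      show "\<forall>\<^sub>F h in at 0. norm ((flat_exp j (0 + h) - flat_exp j 0) / h) \<le> fact (j + 2) * \<bar>h\<bar>"
      proof (rule always_eventually, rule allI)
        fix h :: real
        show "norm ((flat_exp j (0 + h) - flat_exp j 0) / h) \<le> fact (j + 2) * \<bar>h\<bar>"
        proof (cases "h > 0")
          case True
          have "flat_exp j h / h \<le> fact (j + 2) * h\<^sup>2 / h"
            using flat_exp_le[OF True] True by (intro divide_right_mono) auto
          moreover have "flat_exp j h \<ge> 0" using True by (simp add: flat_exp_def)
          ultimately show ?thesis using True by (simp add: flat_exp_def[of j 0] power2_eq_square)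
        next
          case False
          then have "flat_exp j h = 0" by (simp add: flat_exp_def)
          then show ?thesis by (simp add: flat_exp_def[of j 0])
        qed
      qed
      show "((\<lambda>h::real. fact (j + 2) * \<bar>h\<bar>) \<longlongrightarrow> 0) (at 0)"
        by (rule tendsto_eq_intros refl)+ auto
    qed
    then have "(flat_exp j has_real_derivative 0) (at 0)" unfolding DERIV_def .
    then show ?thesis using 2 by (simp add: flat_exp_def)
  next
    case 3
    have "((\<lambda>x. exp (- inverse x) * inverse x ^ j) has_real_derivative
       (exp (- inverse x) * (inverse x * inverse x)) * inverse x ^ j +
       (real j * (inverse x ^ (j - 1) * - (inverse x * inverse x))) * exp (- inverse x)) (at x)"
      using 3 by (auto intro!: derivative_eq_intros simp: power2_eq_square)
    moreover have "(exp (- y) * (y * y)) * y ^ j + (real j * (y ^ (j - 1) * - (y * y))) * exp (- y)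
       = exp (- y) * y ^ (j + 2) - real j * (exp (- y) * y ^ (j + 1))" for y :: real
      by (cases j) (simp_all add: algebra_simps)
    ultimately have "((\<lambda>x. exp (- inverse x) * inverse x ^ j) has_real_derivative
       (exp (- inverse x) * inverse x ^ (j + 2) - real j * (exp (- inverse x) * inverse x ^ (j + 1)))) (at x)"
      by (simp only:)
    then have "((\<lambda>x. exp (- inverse x) * inverse x ^ j) has_real_derivative
       (flat_exp (j + 2) x - j * flat_exp (j + 1) x)) (at x)"
      using 3 by (simp only: flat_exp_def if_True)
    then show ?thesis
      by (rule has_field_derivative_transform_within_open[where S="{0<..}"]) (use 3 in \<open>auto simp: flat_exp_def\<close>)
  qed
qed

lemma ck_flat_exp:
  "ck k (UNIV :: (real \<times> 'c::t2_space) set) (\<lambda>p. flat_exp j (fst p))"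
proof -
  have c: "continuous_on UNIV (\<lambda>p::real \<times> 'c. flat_exp j (fst p))" for j
  proof -
    have "continuous_on UNIV (flat_exp j)"
      using DERIV_isCont[OF flat_exp_has_derivative] by (simp add: continuous_at_imp_continuous_on)
    then show ?thesis by (rule continuous_on_compose2) (auto intro: continuous_intros)
  qed
  show ?thesis
  proof (induction k arbitrary: j)
    case (Suc k)
    show ?case
    proof (rule ck_SucI[where F'="\<lambda>p u. (flat_exp (j + 2) (fst p) - real j * flat_exp (j + 1) (fst p)) * u"])
      show "((\<lambda>v. flat_exp j (fst (v, snd p))) has_derivative
         (*) (flat_exp (j + 2) (fst p) - real j * flat_exp (j + 1) (fst p))) (at (fst p))" for p :: "real \<times> 'c"
        using flat_exp_has_derivative[of j "fst p"] by (simp add: has_field_derivative_def)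
      show "ck k UNIV (\<lambda>p::real \<times> 'c. (flat_exp (j + 2) (fst p) - real j * flat_exp (j + 1) (fst p)) * u)" for u
        by (intro ck_mult ck_diff ck_const Suc) auto
    qed (use c in auto)
  qed (use c in simp)
qed

text \<open>The usual smooth transition from the value 0 on \<open>x \<le> 0\<close> to the value 1
  on \<open>x \<ge> 1\<close>.\<close>

definition smooth_step :: "real \<Rightarrow> real" where
  "smooth_step x = flat_exp 0 x * inverse (flat_exp 0 x + flat_exp 0 (1 - x))"

lemma flat_exp_0: "flat_exp 0 x = (if x > 0 then exp (- inverse x) else 0)"
  by (simp add: flat_exp_def)

lemma flat_exp_sum_pos: "flat_exp 0 x + flat_exp 0 (1 - x) > 0"
  by (auto simp: flat_exp_0 intro: add_pos_pos)

lemma ck_smooth_step: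
  fixes G :: "'a::euclidean_space \<times> 'c::t2_space \<Rightarrow> real"
  assumes "open D" "ck k D G" shows "ck k D (\<lambda>p. smooth_step (G p))"
proof -
  have *: "ck k D (\<lambda>p. flat_exp 0 (H p))" if "ck k D H" for H :: "'a \<times> 'c \<Rightarrow> real"
    using ck_compose[OF assms(1) open_UNIV that ck_flat_exp[of k 0], of "\<lambda>w. w"]
    by (simp add: continuous_on_snd[OF continuous_on_id])
  show ?thesis unfolding smooth_step_def
    by (intro ck_mult ck_inverse ck_add * ck_diff ck_const assms) (use flat_exp_sum_pos in \<open>metis less_irrefl\<close>)
qed

lemma smooth_step_0: "x \<le> 0 \<Longrightarrow> smooth_step x = 0"
  by (simp add: smooth_step_def flat_exp_0)

lemma smooth_step_1: "x \<ge> 1 \<Longrightarrow> smooth_step x = 1"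
  by (simp add: smooth_step_def flat_exp_0)

lemma smooth_step_mono: assumes "x \<le> y" shows "smooth_step x \<le> smooth_step y"
proof -
  define a b c d where "a = flat_exp 0 x" "b = flat_exp 0 (1 - x)" "c = flat_exp 0 y" "d = flat_exp 0 (1 - y)"
  have m: "flat_exp 0 s \<le> flat_exp 0 t" if "s \<le> t" for s t
    using that by (auto simp: flat_exp_0 le_imp_inverse_le)
  have "a \<le> c" "d \<le> b" "a \<ge> 0" "d \<ge> 0" "a + b > 0" "c + d > 0"
    using m assms flat_exp_sum_pos by (auto simp: a_b_c_d_def flat_exp_0)
  then have "a * d \<le> c * b" by (intro mult_mono) auto
  then have "a / (a + b) \<le> c / (c + d)"
    using \<open>a + b > 0\<close> \<open>c + d > 0\<close> by (simp add: field_simps)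
  then show ?thesis by (simp add: smooth_step_def a_b_c_d_def divide_inverse)
qed

lemma smooth_step_bounds: "0 \<le> smooth_step x" "smooth_step x \<le> 1"
  using smooth_step_mono[of "min x 0" x] smooth_step_0[of "min x 0"]
    smooth_step_mono[of x "max x 1"] smooth_step_1[of "max x 1"] by auto

section \<open>Smooth star bodies and cubes\<close>

text \<open>Stone-Weierstrass for the algebra of functions that are smooth in \<open>v\<close> and
  jointly continuous: linear functionals separate different \<open>v\<close>, distance functions
  separate different \<open>w\<close>. The shift by \<open>d\<close> allows approximants that lie
  strictly below the gauge.\<close>

lemma star_body_approximation:
  fixes p :: "real^'n \<Rightarrow> 'c::metric_space \<Rightarrow> real" and T :: "'c set"
  assumes T: "compact T" and cont: "continuous_on (UNIV \<times> T) (\<lambda>q. p (fst q) (snd q))" and e: "e > 0"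
  shows "\<exists>b :: (real^'n) \<times> 'c \<Rightarrow> real. (\<forall>k. ck k UNIV b) \<and>
     (\<forall>v w. norm v = 1 \<longrightarrow> w \<in> T \<longrightarrow> \<bar>p v w - d - b (v, w)\<bar> < e)"
proof -
  interpret function_ring_on "{F :: (real^'n) \<times> 'c \<Rightarrow> real. \<forall>k. ck k UNIV F}" "sphere 0 1 \<times> T"
  proof
    show "compact (sphere (0::real^'n) 1 \<times> T)" by (intro compact_Times compact_sphere T)
    show "continuous_on (sphere 0 1 \<times> T) f" if "f \<in> {F :: (real^'n) \<times> 'c \<Rightarrow> real. \<forall>k. ck k UNIV F}" for f
      using that by (intro continuous_on_subset[OF ck_imp_continuous[of 0 UNIV f]]) auto
    fix x y :: "(real^'n) \<times> 'c" assume "x \<noteq> y"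
    show "\<exists>f\<in>{F. \<forall>k. ck k UNIV F}. f x \<noteq> (f y :: real)"
    proof (cases "fst x = fst y")
      case True
      then have "snd x \<noteq> snd y" using \<open>x \<noteq> y\<close> by (simp add: prod_eq_iff)
      moreover have "\<forall>k. ck k UNIV (\<lambda>q::(real^'n) \<times> 'c. dist (snd q) (snd x))"
        by (intro allI ck_param continuous_on_dist continuous_on_snd continuous_on_id continuous_on_const) simp
      ultimately show ?thesis by (intro bexI[of _ "\<lambda>q. dist (snd q) (snd x)"]) auto
    next
      case False
      have "fst x \<bullet> (fst x - fst y) \<noteq> fst y \<bullet> (fst x - fst y)"
      proof
        assume "fst x \<bullet> (fst x - fst y) = fst y \<bullet> (fst x - fst y)"
        then have "(fst x - fst y) \<bullet> (fst x - fst y) = 0" by (simp add: inner_diff_left)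
        then show False using False by simp
      qed
      moreover have "\<forall>k. ck k UNIV (\<lambda>q::(real^'n) \<times> 'c. fst q \<bullet> (fst x - fst y))"
        by (intro allI ck_bounded_linear[OF open_UNIV bounded_linear_inner_left] ck_fst) simp
      ultimately show ?thesis by (intro bexI[of _ "\<lambda>q. fst q \<bullet> (fst x - fst y)"]) auto
    qed
  qed (auto intro: ck_add ck_mult ck_const)
  have "continuous_on (sphere 0 1 \<times> T) (\<lambda>q. p (fst q) (snd q) - d)"
    by (intro continuous_intros continuous_on_subset[OF cont]) auto
  from Stone_Weierstrass_basic[OF this e] show ?thesis by auto
qed

text \<open>A negative derivative in the direction \<open>v\<close> would make the function drop
  immediately after \<open>v\<close> on the ray. The conclusion keeps the radial derivative of
  \<open>m(v) v\<close> positive.\<close>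

lemma has_derivative_monotone_ray:
  fixes m :: "'a::real_normed_vector \<Rightarrow> real"
  assumes der: "(m has_derivative m') (at v)" and mono: "\<And>t. t \<ge> 0 \<Longrightarrow> m v \<le> m (v + t *\<^sub>R v)"
  shows "m' v \<ge> 0"
proof (rule ccontr)
  assume "\<not> ?thesis"
  then have neg: "m' v < 0" by simp
  have "((\<lambda>t. v + t *\<^sub>R v) has_derivative (\<lambda>t. t *\<^sub>R v)) (at (0::real))"
    by (auto intro!: derivative_eq_intros)
  then have "((\<lambda>t. m (v + t *\<^sub>R v)) has_derivative (\<lambda>t. m' (t *\<^sub>R v))) (at 0)"
    by (rule has_derivative_compose) (use der in simp)
  moreover have "(\<lambda>t. m' (t *\<^sub>R v)) = (*) (m' v)"
    using linear_scale[OF has_derivative_linear[OF der]] by (auto simp: mult.commute)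
  ultimately have "((\<lambda>t. m (v + t *\<^sub>R v)) has_real_derivative m' v) (at 0)"
    by (simp add: has_field_derivative_def)
  from DERIV_neg_dec_right[OF this neg] obtain d where "d > 0" "\<And>h. h > 0 \<Longrightarrow> h < d \<Longrightarrow> m (v + h *\<^sub>R v) < m v"
    by auto
  from this(2)[of "d/2"] mono[of "d/2"] this(1) show False by auto
qed

text \<open>The diffeomorphism is the radial map \<open>v \<mapsto> m(v) v\<close>.  Approximations \<open>b\<^sub>k\<close> of the gauge on
  the unit sphere, smooth in \<open>v\<close> and increasing in \<open>k\<close>, are switched on one after the other near
  the boundary by \<open>smooth_step\<close>, in a way that is locally finite in the interior, so that
  \<open>m(v)\<close> tends to \<open>1 / norm v\<close> at the boundary.  Since \<open>m\<close> is nondecreasing on rays, the radial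
  derivative of \<open>m(v) v\<close> is positive.\<close>

lemma star_body_multiplier:
  fixes p :: "real^'n \<Rightarrow> 'c::metric_space \<Rightarrow> real" and T :: "'c set"
  assumes T: "compact T" "T \<noteq> {}" and cont: "continuous_on (UNIV \<times> T) (\<lambda>q. p (fst q) (snd q))"
    and hom: "\<And>v w s. w \<in> T \<Longrightarrow> s \<ge> 0 \<Longrightarrow> p (s *\<^sub>R v) w = s * p v w"
    and pos: "\<And>v w. w \<in> T \<Longrightarrow> v \<noteq> 0 \<Longrightarrow> p v w > 0"
  obtains m :: "(real^'n) \<times> 'c \<Rightarrow> real" where
    "continuous_on (UNIV \<times> T) m"
    "\<And>v w. w \<in> T \<Longrightarrow> m (v, w) > 0"
    "\<And>v w s. w \<in> T \<Longrightarrow> 0 \<le> s \<Longrightarrow> s \<le> 1 \<Longrightarrow> m (s *\<^sub>R v, w) \<le> m (v, w)"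
    "\<And>v w. w \<in> T \<Longrightarrow> p v w = 1 \<Longrightarrow> norm v * m (v, w) = 1"
    "\<And>k. ck k {q. snd q \<in> interior T \<and> p (fst q) (snd q) < 1} m"
proof -
  let ?S = "sphere (0::real^'n) 1 \<times> T"
  have cS: "compact ?S" by (intro compact_Times compact_sphere T)
  have neS: "?S \<noteq> {}" using T(2) by (auto simp: sphere_def intro!: exI[of _ "axis undefined 1"] norm_axis_1)
  have contS: "continuous_on ?S (\<lambda>q. p (fst q) (snd q))" by (rule continuous_on_subset[OF cont]) auto
  obtain pmin where pmin: "pmin > 0" "\<And>v w. norm v = 1 \<Longrightarrow> w \<in> T \<Longrightarrow> pmin \<le> p v w"
  proof -
    obtain x where x: "x \<in> ?S" "\<And>y. y \<in> ?S \<Longrightarrow> p (fst x) (snd x) \<le> p (fst y) (snd y)"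
      using continuous_attains_inf[OF cS neS contS] by blast
    have "p (fst x) (snd x) > 0" using x(1) by (intro pos) auto
    then show ?thesis using that[of "p (fst x) (snd x)"] x(2) by auto
  qed
  obtain pmax where pmax: "pmax > 0" "\<And>v w. norm v = 1 \<Longrightarrow> w \<in> T \<Longrightarrow> p v w \<le> pmax"
  proof -
    obtain x where x: "x \<in> ?S" "\<And>y. y \<in> ?S \<Longrightarrow> p (fst y) (snd y) \<le> p (fst x) (snd x)"
      using continuous_attains_sup[OF cS neS contS] by blast
    have "p (fst x) (snd x) > 0" using x(1) by (intro pos) auto
    then show ?thesis using that[of "p (fst x) (snd x)"] x(2) by auto
  qed
  define \<theta> where "\<theta> v = inverse (norm v) *\<^sub>R v" for v :: "real^'n"
  have n\<theta>: "norm (\<theta> v) = 1" if "v \<noteq> 0" for v using that by (simp add: \<theta>_def)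
  have p\<theta>: "p v w = norm v * p (\<theta> v) w" if "w \<in> T" for v w
    using hom[OF that, of "norm v" "\<theta> v"] hom[OF that, of 0 v] by (cases "v = 0") (auto simp: \<theta>_def)
  \<comment> \<open>The approximant number \<open>k\<close> lies between
    \<open>p - 9/8 * c / 4^k\<close> and \<open>p - 7/8 * c / 4^k\<close> on the sphere. The ratio 4
    makes these bands disjoint, so the approximants increase, and \<open>c = pmin / 8\<close> keeps
    even the first one above \<open>\<alpha> = pmin / 2\<close>.\<close>
  define c where "c = pmin / 8"
  define \<alpha> where "\<alpha> = pmin / 2"
  have c: "c > 0" using pmin by (simp add: c_def)
  have "\<forall>k. \<exists>b :: (real^'n) \<times> 'c \<Rightarrow> real. (\<forall>j. ck j UNIV b) \<and>
     (\<forall>v w. norm v = 1 \<longrightarrow> w \<in> T \<longrightarrow> \<bar>p v w - c / 4 ^ k - b (v, w)\<bar> < c / 4 ^ k / 8)"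
    using star_body_approximation[OF T(1) cont] c by simp
  from choice[OF this] obtain b where b: "\<And>k j. ck j UNIV (b k :: (real^'n) \<times> 'c \<Rightarrow> real)"
    and ba: "\<And>k v w. norm v = 1 \<Longrightarrow> w \<in> T \<Longrightarrow> \<bar>p v w - c / 4 ^ k - b k (v, w)\<bar> < c / 4 ^ k / 8"
    by blast
  \<comment> \<open>Term \<open>k\<close> is switched on while \<open>norm v * B k\<close> runs from
    \<open>1 - 2 * \<epsilon> k\<close> to \<open>1 - \<epsilon> k\<close>. Where
    \<open>p = 1\<close> this product is at least \<open>1 - 9/64 / 4^k\<close>, hence beyond the
    switch, so that every term is fully on at the boundary.\<close>
  define \<epsilon> :: "nat \<Rightarrow> real" where "\<epsilon> k = 1 / (4 * 4 ^ k)" for k :: nat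
  have \<epsilon>: "\<epsilon> k > 0" "\<epsilon> k \<le> 1/4" for k
    using one_le_power[of "4::real" k] by (auto simp: \<epsilon>_def field_simps)
  define B where "B k q = b k (\<theta> (fst q), snd q)" for k q
  \<comment> \<open>The increments telescope: the first \<open>n + 1\<close> of them add up to
    \<open>B n - \<alpha>\<close>, which tends to the gauge of the unit vector minus
    \<open>\<alpha>\<close>.\<close>
  define d where "d k q = B k q - (case k of 0 \<Rightarrow> \<alpha> | Suc j \<Rightarrow> B j q)" for k q
  define t where "t k q = (if fst q = 0 then 0 else
     d k q * smooth_step ((norm (fst q) * B k q - (1 - 2 * \<epsilon> k)) * inverse (\<epsilon> k)))" for k q
  define m where "m q = \<alpha> + (\<Sum>k. t k q)" for q
  have B: "B k (v, w) > p (\<theta> v) w - 9/8 * c / 4 ^ k" "B k (v, w) < p (\<theta> v) w - 7/8 * c / 4 ^ k"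
    if "w \<in> T" "v \<noteq> 0" for k v w
  proof -
    have e: "9/8 * c / 4 ^ k = c / 4 ^ k + c / 4 ^ k / 8" "7/8 * c / 4 ^ k = c / 4 ^ k - c / 4 ^ k / 8"
      by (simp_all add: field_simps)
    show "B k (v, w) > p (\<theta> v) w - 9/8 * c / 4 ^ k" "B k (v, w) < p (\<theta> v) w - 7/8 * c / 4 ^ k"
      using ba[OF n\<theta>[OF that(2)] that(1), of k] unfolding B_def e abs_less_iff by simp_all
  qed
  have Bpos: "B k (v, w) > \<alpha>" if "w \<in> T" "v \<noteq> 0" for k v w
  proof -
    have "9/8 * c / 4 ^ k \<le> 9/8 * c" using c one_le_power[of "4::real" k] by (simp add: divide_le_eq)
    then show ?thesis using B(1)[OF that, of k] pmin(2)[OF n\<theta>[OF that(2)] that(1)] pmin(1)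
      unfolding c_def \<alpha>_def by linarith
  qed
  have Bmono: "B k (v, w) < B (Suc k) (v, w)" if "w \<in> T" "v \<noteq> 0" for k v w
  proof -
    have "9/8 * c / 4 ^ Suc k \<le> 7/8 * c / 4 ^ k" using c by (simp add: field_simps)
    then show ?thesis using B(2)[OF that, of k] B(1)[OF that, of "Suc k"] by linarith
  qed
  have dpos: "d k (v, w) > 0" if "w \<in> T" "v \<noteq> 0" for k v w
    using Bpos[OF that, of 0] Bmono[OF that] by (cases k) (auto simp: d_def)
  define M where "M = pmax + 8 * c"
  have dle: "d k (v, w) \<le> M / 4 ^ k" if "w \<in> T" "v \<noteq> 0" for k v w
  proof (cases k)
    case 0
    then show ?thesis using B(2)[OF that, of 0] pmax(2)[OF n\<theta>[OF that(2)] that(1)] c pmin(1)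
      by (simp add: d_def M_def \<alpha>_def)
  next
    case (Suc j)
    have "d k (v, w) \<le> 9/8 * c / 4 ^ j"
    proof -
      have "0 \<le> 7/8 * c / 4 ^ k" using c by simp
      then have "B k (v, w) \<le> p (\<theta> v) w" using B(2)[OF that, of k] by linarith
      then show ?thesis using B(1)[OF that, of j] by (simp add: d_def Suc)
    qed
    also have "\<dots> \<le> 8 * c / 4 ^ k" using c by (simp add: Suc field_simps)
    also have "\<dots> \<le> M / 4 ^ k" using pmax(1) by (intro divide_right_mono) (auto simp: M_def)
    finally show ?thesis .
  qed
  have t0: "t k (v, w) \<ge> 0" if "w \<in> T" for k v w
    using dpos[OF that, of v k] smooth_step_bounds by (auto simp: t_def)
  have tle: "t k (v, w) \<le> M / 4 ^ k" if "w \<in> T" for k v w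
  proof (cases "v = 0")
    case False
    have "t k (v, w) \<le> d k (v, w)"
      using False dpos[OF that False, of k] smooth_step_bounds by (auto simp: t_def intro: mult_left_le)
    then show ?thesis using dle[OF that False, of k] by linarith
  qed (use pmax c in \<open>simp add: t_def M_def\<close>)
  have sumM: "summable (\<lambda>k. M / 4 ^ k)"
    using summable_mult[OF summable_geometric[of "1/4::real"], of M] by (simp add: power_divide)
  have sumt: "summable (\<lambda>k. t k (v, w))" if "w \<in> T" for v w
    by (rule summable_comparison_test'[OF sumM]) (use t0[OF that] tle[OF that] in auto)
  have tzero: "t k (v, w) = 0" if "w \<in> T" "p v w \<le> 1 - 2 * \<epsilon> k" for k v w
  proof (cases "v = 0")
    case False
    have "0 \<le> 7/8 * c / 4 ^ k" using c by simp
    then have "B k (v, w) \<le> p (\<theta> v) w" using B(2)[OF that(1) False, of k] by linarith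
    then have "norm v * B k (v, w) \<le> p v w" unfolding p\<theta>[OF that(1), of v] by (rule mult_left_mono) simp
    then have "(norm v * B k (v, w) - (1 - 2 * \<epsilon> k)) * inverse (\<epsilon> k) \<le> 0"
      using that(2) \<epsilon>(1)[of k] by (intro mult_nonpos_nonneg) auto
    then show ?thesis by (simp add: t_def smooth_step_0)
  qed (simp add: t_def)
  \<comment> \<open>The direction \<open>\<theta>\<close> is singular at the origin. For
    \<open>norm v < \<rho>\<close> the gauge is at most \<open>1/2\<close>, below every switching
    threshold \<open>1 - 2 * \<epsilon> k\<close>, so all terms vanish there and the singularity
    does no harm.\<close>
  define \<rho> where "\<rho> = 1 / (2 * pmax)"
  have \<rho>: "\<rho> > 0" using pmax by (simp add: \<rho>_def)
  have psmall: "p v w \<le> 1/2" if "w \<in> T" "norm v < \<rho>" for v w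
  proof (cases "v = 0")
    case True
    then show ?thesis using hom[OF that(1), of 0 v] by simp
  next
    case False
    have "p v w \<le> norm v * pmax" unfolding p\<theta>[OF that(1), of v]
      using pmax(2)[OF n\<theta>[OF False] that(1)] by (intro mult_left_mono) auto
    also have "\<dots> \<le> \<rho> * pmax" using that(2) pmax(1) by (intro mult_right_mono) auto
    finally show ?thesis using pmax(1) by (simp add: \<rho>_def)
  qed
  have tsmall: "t k (v, w) = 0" if "w \<in> T" "norm v < \<rho>" for k v w
    using psmall[OF that] \<epsilon>(2)[of k] by (intro tzero that) auto
  let ?E = "{q :: (real^'n) \<times> 'c. fst q \<noteq> 0}"
  have oE: "open ?E" by (intro open_Collect_neq continuous_on_fst continuous_on_id continuous_on_const)
  have tckE: "ck j ?E (t k)" for j k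
  proof -
    have 1: "ck j ?E (\<lambda>q. \<theta> (fst q))" unfolding \<theta>_def
      by (intro ck_scaleR oE ck_inverse ck_norm ck_fst) auto
    have 2: "ck j ?E (B k)" for k unfolding B_def
      by (rule ck_compose[OF oE open_UNIV 1 b, where \<kappa>="\<lambda>w. w"]) (auto intro: continuous_intros)
    have 3: "ck j ?E (d k)" for k unfolding d_def
      by (cases k) (auto intro!: ck_diff oE ck_const 2)
    have 4: "ck j ?E (\<lambda>q. norm (fst q))" by (rule ck_norm[OF oE]) simp
    have "ck j ?E (\<lambda>q. d k q * smooth_step ((norm (fst q) * B k q - (1 - 2 * \<epsilon> k)) * inverse (\<epsilon> k)))"
      by (rule ck_mult[OF oE 3 ck_smooth_step[OF oE ck_mult[OF oE ck_diff[OF oE ck_mult[OF oE 4 2] ck_const[OF oE]] ck_const[OF oE]]]])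
    then show ?thesis by (rule ck_cong[OF oE, rotated]) (simp add: t_def)
  qed
  have oB: "open {q :: (real^'n) \<times> 'c. norm (fst q) < \<rho>}"
    by (intro open_Collect_less continuous_on_norm continuous_on_fst continuous_on_id continuous_on_const)
  have tcont: "continuous_on (UNIV \<times> T) (t k)" for k
  proof -
    have U: "UNIV \<times> T = (UNIV \<times> T \<inter> ?E) \<union> (UNIV \<times> T \<inter> {q. norm (fst q) < \<rho>})" (is "_ = ?X \<union> ?Y")
      using \<rho> by auto
    have "continuous_on ?X (t k)"
      by (rule continuous_on_subset[OF ck_imp_continuous[OF tckE[of 0]]]) auto
    moreover have "continuous_on ?Y (t k)"
      by (rule continuous_on_eq[of _ "\<lambda>q. 0"]) (use tsmall in auto)
    ultimately show ?thesis
      using U oE oB by (metis (no_types, lifting) continuous_on_Un_local_open openin_open_Int)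
  qed
  have ot: "open (UNIV \<times> interior T)" by (intro open_Times) auto
  have tck: "ck j (UNIV \<times> interior T) (t k)" for j k
  proof (rule ck_local)
    fix q :: "(real^'n) \<times> 'c" assume q: "q \<in> UNIV \<times> interior T"
    show "\<exists>E. open E \<and> q \<in> E \<and> ck j E (t k)"
    proof (cases "fst q = 0")
      case False
      then show ?thesis using oE tckE by blast
    next
      case True
      let ?Y = "UNIV \<times> interior T \<inter> {q :: (real^'n) \<times> 'c. norm (fst q) < \<rho>}"
      have oY: "open ?Y" by (intro open_Int ot oB)
      have "t k q = 0" if "q \<in> ?Y" for q using that interior_subset[of T] tsmall[of "snd q" "fst q"] by auto
      then have "ck j ?Y (t k)" by (intro ck_cong[OF oY _ ck_const[OF oY, of _ 0]]) auto
      then show ?thesis using oY True q \<rho> by (intro exI[of _ ?Y]) auto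
    qed
  qed
  have oP: "open {q \<in> UNIV \<times> interior T. p (fst q) (snd q) < r}" for r
  proof -
    have "continuous_on (UNIV \<times> interior T) (\<lambda>q. p (fst q) (snd q))"
      using interior_subset by (intro continuous_on_subset[OF cont]) auto
    from continuous_open_preimage[OF this ot open_lessThan[of r]]
    have "open (UNIV \<times> interior T \<inter> (\<lambda>q. p (fst q) (snd q)) -` {..<r})" .
    also have "UNIV \<times> interior T \<inter> (\<lambda>q. p (fst q) (snd q)) -` {..<r} = {q \<in> UNIV \<times> interior T. p (fst q) (snd q) < r}"
      by auto
    finally show ?thesis .
  qed
  show ?thesis
  proof (rule that[of m])
    show "continuous_on (UNIV \<times> T) m"
    proof -
      have "uniform_limit (UNIV \<times> T) (\<lambda>n q. \<Sum>k<n. t k q) (\<lambda>q. \<Sum>k. t k q) sequentially"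
        using t0 tle by (intro Weierstrass_m_test[OF _ sumM]) auto
      then have "continuous_on (UNIV \<times> T) (\<lambda>q. \<Sum>k. t k q)"
        by (rule uniform_limit_theorem[rotated]) (auto intro!: always_eventually continuous_intros tcont)
      then show ?thesis unfolding m_def by (intro continuous_intros)
    qed
    show "m (v, w) > 0" if "w \<in> T" for v w
    proof -
      have "(\<Sum>k. t k (v, w)) \<ge> 0" using t0[OF that] sumt[OF that] by (intro suminf_nonneg) auto
      then show ?thesis using pmin(1) by (simp add: m_def \<alpha>_def)
    qed
    show "m (s *\<^sub>R v, w) \<le> m (v, w)" if "w \<in> T" "0 \<le> s" "s \<le> 1" for v w s
    proof -
      have "t k (s *\<^sub>R v, w) \<le> t k (v, w)" for k
      proof (cases "s *\<^sub>R v = 0")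
        case True
        then show ?thesis using t0[OF that(1)] by (simp add: t_def)
      next
        case False
        then have v: "v \<noteq> 0" and "s > 0" using that(2) by auto
        then have \<theta>s: "\<theta> (s *\<^sub>R v) = \<theta> v" by (simp add: \<theta>_def)
        have Bs: "B k (s *\<^sub>R v, w) = B k (v, w)" for k by (simp add: B_def \<theta>s)
        have ds: "d k (s *\<^sub>R v, w) = d k (v, w)" by (cases k) (simp_all add: d_def Bs)
        have "s * norm v \<le> 1 * norm v" using that(3) by (intro mult_right_mono) auto
        then have "s * norm v * B k (v, w) \<le> norm v * B k (v, w)"
          using Bpos[OF that(1) v, of k] pmin(1) by (intro mult_right_mono) (auto simp: \<alpha>_def)
        then have "(s * norm v * B k (v, w) - (1 - 2 * \<epsilon> k)) * inverse (\<epsilon> k) \<le> (norm v * B k (v, w) - (1 - 2 * \<epsilon> k)) * inverse (\<epsilon> k)"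
          using \<epsilon>(1)[of k] by (intro mult_right_mono) auto
        then show ?thesis
          using False v dpos[OF that(1) v, of k] \<open>s > 0\<close> by (auto simp: t_def Bs ds intro!: mult_left_mono smooth_step_mono)
      qed
      then show ?thesis unfolding m_def using sumt[OF that(1)] by (intro add_left_mono suminf_le)
    qed
    show "norm v * m (v, w) = 1" if w: "w \<in> T" and p1: "p v w = 1" for v w
    proof -
      have v: "v \<noteq> 0" using hom[OF w, of 0 v] p1 by auto
      have pp: "norm v * p (\<theta> v) w = 1" using p\<theta>[OF w, of v] p1 by simp
      have np: "norm v * pmin \<le> 1" unfolding pp[symmetric]
        using pmin(2)[OF n\<theta>[OF v] w] by (intro mult_left_mono) auto
      have "t k (v, w) = d k (v, w)" for k
      proof -
        have "norm v * B k (v, w) \<ge> norm v * (p (\<theta> v) w - 9/8 * c / 4 ^ k)"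
          using B(1)[OF w v, of k] by (intro mult_left_mono) auto
        moreover have "norm v * (p (\<theta> v) w - 9/8 * c / 4 ^ k) = 1 - (norm v * pmin) * (9/64 / 4 ^ k)"
          using pp by (simp add: c_def right_diff_distrib)
        moreover have "(norm v * pmin) * (9/64 / 4 ^ k) \<le> 1 * (9/64 / 4 ^ k)"
          using np by (intro mult_right_mono) auto
        moreover have "9/64 / 4 ^ k \<le> \<epsilon> k" by (simp add: \<epsilon>_def field_simps)
        ultimately have "norm v * B k (v, w) \<ge> 1 - \<epsilon> k" by linarith
        then have "(norm v * B k (v, w) - (1 - 2 * \<epsilon> k)) * inverse (\<epsilon> k) \<ge> \<epsilon> k * inverse (\<epsilon> k)"
          using \<epsilon>(1)[of k] by (intro mult_right_mono) auto
        then have "(norm v * B k (v, w) - (1 - 2 * \<epsilon> k)) * inverse (\<epsilon> k) \<ge> 1"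
          using \<epsilon>(1)[of k] by simp
        then show ?thesis using v by (simp add: t_def smooth_step_1)
      qed
      moreover have "(\<lambda>k. d k (v, w)) sums (p (\<theta> v) w - \<alpha>)"
      proof -
        have part: "(\<Sum>k<Suc n. d k (v, w)) = B n (v, w) - \<alpha>" for n
          by (induction n) (simp_all add: d_def)
        have l0: "(\<lambda>n. a / 4 ^ n :: real) \<longlonglongrightarrow> 0" for a by (rule LIMSEQ_divide_realpow_zero) simp
        have "(\<lambda>n. B n (v, w)) \<longlonglongrightarrow> p (\<theta> v) w"
        proof (rule tendsto_sandwich)
          show "(\<lambda>n. p (\<theta> v) w - 9/8 * c / 4 ^ n) \<longlonglongrightarrow> p (\<theta> v) w"
            using tendsto_diff[OF tendsto_const l0, of "p (\<theta> v) w" "9/8 * c"] by simp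
          show "(\<lambda>n. p (\<theta> v) w - 7/8 * c / 4 ^ n) \<longlonglongrightarrow> p (\<theta> v) w"
            using tendsto_diff[OF tendsto_const l0, of "p (\<theta> v) w" "7/8 * c"] by simp
        qed (use B[OF w v] in \<open>auto intro!: always_eventually less_imp_le\<close>)
        then have "(\<lambda>n. \<Sum>k<Suc n. d k (v, w)) \<longlonglongrightarrow> p (\<theta> v) w - \<alpha>"
          unfolding part by (intro tendsto_intros)
        then show ?thesis unfolding sums_def by (rule LIMSEQ_imp_Suc)
      qed
      ultimately have "m (v, w) = p (\<theta> v) w" by (simp add: m_def sums_iff)
      then show ?thesis using pp by simp
    qed
    show "ck k {q. snd q \<in> interior T \<and> p (fst q) (snd q) < 1} m" for k
    proof (rule ck_local)
      fix q :: "(real^'n) \<times> 'c" assume q: "q \<in> {q. snd q \<in> interior T \<and> p (fst q) (snd q) < 1}"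
      \<comment> \<open>On the open set where \<open>p < r\<close>, with \<open>r < 1\<close>, only
        the finitely many terms with \<open>2 * \<epsilon> k \<ge> 1 - r\<close> can be
        non-zero.\<close>
      define r where "r = (1 + p (fst q) (snd q)) / 2"
      have r: "p (fst q) (snd q) < r" "r < 1" using q by (auto simp: r_def)
      define Y where "Y = {q \<in> UNIV \<times> interior T. p (fst q) (snd q) < r}"
      have oY: "open Y" unfolding Y_def by (rule oP)
      have "(\<lambda>k. 1/2 / 4 ^ k :: real) \<longlonglongrightarrow> 0" by (rule LIMSEQ_divide_realpow_zero) simp
      then obtain N where N: "\<And>k. k \<ge> N \<Longrightarrow> 1/2 / 4 ^ k < 1 - r"
      proof -
        have "\<forall>\<^sub>F k in sequentially. 1/2 / 4 ^ k < 1 - r"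
          by (rule order_tendstoD(2)[OF \<open>(\<lambda>k. 1/2 / 4 ^ k :: real) \<longlonglongrightarrow> 0\<close>]) (use r(2) in simp)
        then show thesis using that unfolding eventually_sequentially by blast
      qed
      have mN: "m q' = \<alpha> + (\<Sum>k<N. t k q')" if "q' \<in> Y" for q'
      proof -
        have "t k (fst q', snd q') = 0" if "k \<ge> N" for k
          using N[OF that] \<open>q' \<in> Y\<close> interior_subset[of T] by (intro tzero) (auto simp: Y_def \<epsilon>_def)
        then have "(\<Sum>k. t k q') = (\<Sum>k<N. t k q')" by (intro suminf_finite) auto
        then show ?thesis by (simp add: m_def)
      qed
      moreover have "ck k Y (\<lambda>q'. \<alpha> + (\<Sum>k<N. t k q'))"
        by (intro ck_add ck_sum ck_const oY ck_subset[OF tck]) (auto simp: Y_def)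
      ultimately have "ck k Y m" using ck_cong[OF oY, of "\<lambda>q'. \<alpha> + (\<Sum>k<N. t k q')" m] mN by simp
      then show "\<exists>E. open E \<and> q \<in> E \<and> ck k E m" using oY q r by (intro exI[of _ Y]) (auto simp: Y_def mem_Times_iff)
    qed
  qed
qed

text \<open>On each ray the norm of \<open>m(v) v\<close> increases strictly because the multiplier
  does not decrease, and it equals 1 exactly where the gauge does; this yields a radial bijection
  onto the unit ball. Its derivative sends \<open>u\<close> to \<open>m u + (D_u m) v\<close>, whose
  kernel could only lie along \<open>v\<close>, where the factor \<open>m + D_v m\<close> is
  positive.\<close>

lemma star_body_ball:
  fixes p :: "real^'n \<Rightarrow> 'c::metric_space \<Rightarrow> real" and T :: "'c set"
  assumes T: "compact T" "T \<noteq> {}" and cont: "continuous_on (UNIV \<times> T) (\<lambda>q. p (fst q) (snd q))"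
    and hom: "\<And>v w s. w \<in> T \<Longrightarrow> s \<ge> 0 \<Longrightarrow> p (s *\<^sub>R v) w = s * p v w"
    and pos: "\<And>v w. w \<in> T \<Longrightarrow> v \<noteq> 0 \<Longrightarrow> p v w > 0"
  obtains X Y :: "(real^'n) \<times> 'c \<Rightarrow> real^'n" where
    "continuous_on {q. snd q \<in> T \<and> p (fst q) (snd q) \<le> 1} X"
    "continuous_on (cball 0 1 \<times> T) Y"
    "\<And>v w. w \<in> T \<Longrightarrow> p v w \<le> 1 \<Longrightarrow> norm (X (v, w)) \<le> 1 \<and> Y (X (v, w), w) = v"
    "\<And>v w. w \<in> T \<Longrightarrow> p v w \<le> 1 \<Longrightarrow> norm (X (v, w)) < 1 \<longleftrightarrow> p v w < 1"
    "\<And>y w. w \<in> T \<Longrightarrow> norm y \<le> 1 \<Longrightarrow> p (Y (y, w)) w \<le> 1 \<and> X (Y (y, w), w) = y"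
    "\<And>w. X (0, w) = 0"
    "\<And>k. ck k {q. snd q \<in> interior T \<and> p (fst q) (snd q) < 1} X"
    "\<And>k. ck k (ball 0 1 \<times> interior T) Y"
proof -
  obtain m where mcont: "continuous_on (UNIV \<times> T) m"
    and mpos: "\<And>v w. w \<in> T \<Longrightarrow> m (v, w) > 0"
    and mmono: "\<And>v w s. w \<in> T \<Longrightarrow> 0 \<le> s \<Longrightarrow> s \<le> 1 \<Longrightarrow> m (s *\<^sub>R v, w) \<le> m (v, w)"
    and m1: "\<And>v w. w \<in> T \<Longrightarrow> p v w = 1 \<Longrightarrow> norm v * m (v, w) = 1"
    and mck: "\<And>k. ck k {q. snd q \<in> interior T \<and> p (fst q) (snd q) < 1} m"
    using star_body_multiplier[of T p] assms by blast
  define X where "X q = m q *\<^sub>R fst q" for q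
  have X: "X (v, w) = m (v, w) *\<^sub>R v" for v w by (simp add: X_def)
  have p0: "p 0 w = 0" if "w \<in> T" for w using hom[OF that, of 0 0] by simp
  have pnn: "p v w \<ge> 0" if "w \<in> T" for v w using pos[OF that, of v] p0[OF that] by (cases "v = 0") auto
  have nX: "norm (X (v, w)) = norm v * m (v, w)" if "w \<in> T" for v w
    using mpos[OF that, of v] by (simp add: X)
  have ray: "norm (X (s *\<^sub>R v, w)) < norm (X (v, w))" if "w \<in> T" "v \<noteq> 0" "0 \<le> s" "s < 1" for s v w
  proof -
    have "norm (X (s *\<^sub>R v, w)) = s * norm v * m (s *\<^sub>R v, w)" using nX[OF that(1)] that(3) by simp
    also have "\<dots> \<le> s * norm v * m (v, w)" using mmono[of w s v] that by (intro mult_left_mono) auto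
    also have "\<dots> < 1 * norm v * m (v, w)" using that mpos[OF that(1), of v] by (intro mult_strict_right_mono) auto
    finally show ?thesis using nX[OF that(1)] by simp
  qed
  have Xlt: "norm (X (v, w)) < 1" if "w \<in> T" "p v w < 1" for v w
  proof (cases "v = 0")
    case False
    define s where "s = p v w"
    have s: "s > 0" "s < 1" using pos[OF that(1) False] that(2) by (auto simp: s_def)
    define v' where "v' = inverse s *\<^sub>R v"
    have v': "v = s *\<^sub>R v'" "v' \<noteq> 0" using s False by (auto simp: v'_def)
    have "p v' w = 1" using hom[OF that(1), of "inverse s" v] s by (simp add: v'_def s_def)
    then have "norm (X (v', w)) = 1" using m1[OF that(1)] nX[OF that(1)] by simp
    then show ?thesis using ray[OF that(1) v'(2), of s] s v'(1) by simp
  qed (simp add: X)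
  have Xeq: "norm (X (v, w)) = 1" if "w \<in> T" "p v w = 1" for v w
    using m1[OF that] nX[OF that(1)] by simp
  have inj: "v = v'" if w: "w \<in> T" and eq: "X (v, w) = X (v', w)" for v v' w
  proof (cases "v = 0 \<or> v' = 0")
    case True
    then show ?thesis using eq mpos[OF w, of v] mpos[OF w, of v'] by (auto simp: X)
  next
    case False
    have pp: "m (v, w) > 0" "m (v', w) > 0" using mpos[OF w] by auto
    define s where "s = m (v, w) / m (v', w)"
    have "inverse (m (v', w)) *\<^sub>R (m (v', w) *\<^sub>R v') = inverse (m (v', w)) *\<^sub>R (m (v, w) *\<^sub>R v)" using eq by (simp add: X)
    then have v': "v' = s *\<^sub>R v" using pp by (simp add: s_def field_simps)
    have s: "s > 0" using pp by (simp add: s_def)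
    then have v: "v = inverse s *\<^sub>R v'" using v' by simp
    have "\<not> s < 1" using ray[OF w, of v s] v' s eq False by auto
    moreover have "\<not> inverse s < 1" using ray[OF w, of v' "inverse s"] v s eq False by (auto simp del: inverse_less_1_iff)
    ultimately have "s = 1" using s by (auto simp: inverse_less_1_iff)
    then show ?thesis using v' by simp
  qed
  let ?D = "{q. snd q \<in> T \<and> p (fst q) (snd q) \<le> 1}"
  have Xcont: "continuous_on (UNIV \<times> T) X" unfolding X_def
    by (intro continuous_on_scaleR mcont continuous_on_fst continuous_on_id)
  have surj: "\<exists>v. p v w \<le> 1 \<and> X (v, w) = y" if w: "w \<in> T" and y: "norm y \<le> 1" for y w
  proof (cases "y = 0")
    case True
    then show ?thesis using p0[OF w] by (intro exI[of _ 0]) (simp add: X)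
  next
    case False
    define a where "a = p y w"
    have a: "a > 0" using pos[OF w False] by (simp add: a_def)
    \<comment> \<open>\<open>v1\<close> is the point where the ray through \<open>y\<close> meets
      the boundary of the body. The intermediate value theorem on the segment from the origin to
      \<open>v1\<close> finds the preimage of \<open>y\<close>.\<close>
    define v1 where "v1 = inverse a *\<^sub>R y"
    have p1: "p v1 w = 1" using hom[OF w, of "inverse a" y] a by (simp add: v1_def a_def)
    have "continuous_on {0..1} (\<lambda>s. norm (X (s *\<^sub>R v1, w)))"
      using w by (intro continuous_on_norm continuous_on_compose2[OF Xcont] continuous_intros) auto
    then obtain s where s: "0 \<le> s" "s \<le> 1" "norm (X (s *\<^sub>R v1, w)) = norm y"
      using IVT'[of "\<lambda>s. norm (X (s *\<^sub>R v1, w))" 0 "norm y" 1] y Xeq[OF w p1] by (auto simp: X)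
    define r where "r = m (s *\<^sub>R v1, w) * s * inverse a"
    have r: "r \<ge> 0" using s a mpos[OF w, of "s *\<^sub>R v1"] by (simp add: r_def)
    have "X (s *\<^sub>R v1, w) = r *\<^sub>R y" by (simp add: X r_def v1_def)
    moreover from this s(3) have "r * norm y = norm y" using r by simp
    then have "r = 1" using False by simp
    ultimately have "X (s *\<^sub>R v1, w) = y" by simp
    moreover have "p (s *\<^sub>R v1) w \<le> 1" using hom[OF w s(1)] p1 s by simp
    ultimately show ?thesis by blast
  qed
  define Y where "Y q = (SOME v. p v (snd q) \<le> 1 \<and> X (v, snd q) = fst q)" for q
  have Y: "p (Y (y, w)) w \<le> 1 \<and> X (Y (y, w), w) = y" if "w \<in> T" "norm y \<le> 1" for y w
    unfolding Y_def using someI_ex[OF surj[OF that]] by simp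
  have Xle: "norm (X (v, w)) \<le> 1" if "w \<in> T" "p v w \<le> 1" for v w
    using Xlt[OF that(1), of v] Xeq[OF that(1), of v] that(2) by (cases "p v w < 1") auto
  have YX: "Y (X (v, w), w) = v" if "w \<in> T" "p v w \<le> 1" for v w
    using inj[OF that(1)] Y[OF that(1) Xle[OF that]] by blast
  have contD: "continuous_on ?D X" by (rule continuous_on_subset[OF Xcont]) auto
  have cD: "compact ?D"
  proof -
    have cS: "compact (sphere (0::real^'n) 1 \<times> T)" by (intro compact_Times compact_sphere T)
    have neS: "sphere (0::real^'n) 1 \<times> T \<noteq> {}" using T(2) by (auto simp: sphere_def intro!: exI[of _ "axis undefined 1"] norm_axis_1)
    have contS: "continuous_on (sphere (0::real^'n) 1 \<times> T) (\<lambda>q. p (fst q) (snd q))" by (rule continuous_on_subset[OF cont]) auto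
    obtain x where x: "x \<in> sphere (0::real^'n) 1 \<times> T" "\<And>y. y \<in> sphere (0::real^'n) 1 \<times> T \<Longrightarrow> p (fst x) (snd x) \<le> p (fst y) (snd y)"
      using continuous_attains_inf[OF cS neS contS] by blast
    define a where "a = p (fst x) (snd x)"
    have a: "a > 0" using x(1) unfolding a_def by (intro pos) auto
    have bd: "norm v \<le> 1 / a" if "w \<in> T" "p v w \<le> 1" for v w
    proof (cases "v = 0")
      case False
      have "a \<le> p (inverse (norm v) *\<^sub>R v) w" using x(2)[of "(inverse (norm v) *\<^sub>R v, w)"] that False by (auto simp: a_def)
      also have "\<dots> = inverse (norm v) * p v w" using hom[OF that(1)] by simp
      also have "\<dots> \<le> inverse (norm v) * 1" using that(2) by (intro mult_left_mono) auto
      finally show ?thesis using a False by (simp add: field_simps)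
    qed (use a in simp)
    have c: "compact (cball (0::real^'n) (1/a) \<times> T)" by (intro compact_Times compact_cball T)
    have "closed {q \<in> cball (0::real^'n) (1/a) \<times> T. p (fst q) (snd q) \<le> 1}"
      by (rule continuous_on_closed_Collect_le[OF continuous_on_subset[OF cont] continuous_on_const compact_imp_closed[OF c]]) auto
    moreover have "{q \<in> cball (0::real^'n) (1/a) \<times> T. p (fst q) (snd q) \<le> 1} = ?D" using bd by (auto simp: mem_Times_iff)
    ultimately have "compact (cball (0::real^'n) (1/a) \<times> T \<inter> ?D)" using compact_Int_closed[OF c, of ?D] by simp
    moreover have "cball (0::real^'n) (1/a) \<times> T \<inter> ?D = ?D" using bd by auto
    ultimately show ?thesis by simp
  qed
  have Ycont: "continuous_on (cball 0 1 \<times> T) Y"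
  proof -
    \<comment> \<open>Carrying \<open>w\<close> along turns the family of maps into a single
      injective continuous map on a compact set, whose inverse is automatically continuous.\<close>
    have c: "continuous_on ?D (\<lambda>q. (X q, snd q))" by (intro continuous_on_Pair contD continuous_on_snd continuous_on_id)
    have "continuous_on ((\<lambda>q. (X q, snd q)) ` ?D) (\<lambda>q. (Y q, snd q))"
      by (rule continuous_on_inv[OF c cD]) (auto simp: YX)
    moreover have "cball 0 1 \<times> T \<subseteq> (\<lambda>q. (X q, snd q)) ` ?D"
    proof
      fix q :: "(real^'n) \<times> 'c" assume q: "q \<in> cball 0 1 \<times> T"
      then show "q \<in> (\<lambda>q. (X q, snd q)) ` ?D"
        using Y[of "snd q" "fst q"] by (intro image_eqI[of _ _ "(Y q, snd q)"]) (auto simp: mem_Times_iff)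
    qed
    ultimately have "continuous_on (cball 0 1 \<times> T) (\<lambda>q. (Y q, snd q))" using continuous_on_subset by blast
    from continuous_on_fst[OF this] show ?thesis by simp
  qed
  let ?D0 = "{q. snd q \<in> interior T \<and> p (fst q) (snd q) < 1}"
  have oD0: "open ?D0"
  proof -
    have o: "open (UNIV \<times> interior T)" by (intro open_Times) auto
    have "continuous_on (UNIV \<times> interior T) (\<lambda>q. p (fst q) (snd q))"
      using interior_subset by (intro continuous_on_subset[OF cont]) auto
    from continuous_open_preimage[OF this o open_lessThan[of 1]]
    have "open (UNIV \<times> interior T \<inter> (\<lambda>q. p (fst q) (snd q)) -` {..<1})" .
    also have "UNIV \<times> interior T \<inter> (\<lambda>q. p (fst q) (snd q)) -` {..<1} = ?D0" by (auto simp: mem_Times_iff)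
    finally show ?thesis .
  qed
  have Xck: "ck k ?D0 X" for k unfolding X_def by (intro ck_scaleR oD0 mck ck_fst)
  have inT: "w \<in> T" if "w \<in> interior T" for w using that interior_subset by blast
  have Yck: "ck k (ball 0 1 \<times> interior T) Y" for k
  proof (rule ck_inverse_map[OF oD0 _ Xck])
    show "open (ball (0::real^'n) 1 \<times> interior T)" by (intro open_Times) auto
    show "continuous_on (ball 0 1 \<times> interior T) Y"
      by (rule continuous_on_subset[OF Ycont]) (use inT in auto)
    fix q :: "(real^'n) \<times> 'c" assume q: "q \<in> ball 0 1 \<times> interior T"
    obtain y w where yw: "q = (y, w)" by (cases q)
    have y: "norm y < 1" "w \<in> interior T" using q yw by auto
    have "p (Y (y, w)) w \<noteq> 1" using Xeq[OF inT[OF y(2)], of "Y (y, w)"] Y[OF inT[OF y(2)], of y] y(1) by auto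
    then have "p (Y (y, w)) w < 1" using Y[OF inT[OF y(2)], of y] y(1) by auto
    then show "(Y q, snd q) \<in> ?D0 \<and> X (Y q, snd q) = fst q"
      using Y[OF inT[OF y(2)], of y] y yw by auto
  next
    fix q :: "(real^'n) \<times> 'c" assume q: "q \<in> ?D0"
    obtain v w where vw: "q = (v, w)" by (cases q)
    have w: "w \<in> T" using q vw inT by auto
    have der: "((\<lambda>v. m (v, w)) has_derivative (\<lambda>u. dirder u m q)) (at v)"
      using ck_has_derivative[OF mck[of "Suc 0"] q] vw by simp
    have derX: "((\<lambda>v. X (v, w)) has_derivative (\<lambda>u. m q *\<^sub>R u + dirder u m q *\<^sub>R v)) (at v)"
      unfolding X_def using has_derivative_scaleR[OF der has_derivative_ident] by (simp add: vw)
    have eq: "dirder u X q = m q *\<^sub>R u + dirder u m q *\<^sub>R v" for u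
      by (rule dirder_eqI[of X q "\<lambda>u. m q *\<^sub>R u + dirder u m q *\<^sub>R v"]) (use derX vw in simp)
    have nonneg: "dirder v m q \<ge> 0"
    proof (rule has_derivative_monotone_ray[OF der])
      fix t :: real assume "t \<ge> 0"
      have v: "v = inverse (1 + t) *\<^sub>R (v + t *\<^sub>R v)"
      proof -
        have "v + t *\<^sub>R v = (1 + t) *\<^sub>R v" by (simp add: scaleR_add_left)
        then show ?thesis using \<open>t \<ge> 0\<close> by simp
      qed
      show "m (v, w) \<le> m (v + t *\<^sub>R v, w)"
        using mmono[OF w, of "inverse (1 + t)" "v + t *\<^sub>R v"] \<open>t \<ge> 0\<close> v by (simp add: inverse_le_1_iff)
    qed
    have mq: "m q > 0" using mpos[OF w] vw by simp
    have "linear (\<lambda>u. dirder u X q)" unfolding eq using has_derivative_linear[OF derX] .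
    moreover have "u = 0" if "dirder u X q = 0" for u
    proof -
      \<comment> \<open>A kernel vector satisfies \<open>m u = - (D_u m) v\<close> and is thus a
        multiple \<open>c v\<close>; substituting it back gives \<open>c * (m + D_v m) = 0\<close>
        with a positive second factor.\<close>
      define c where "c = - dirder u m q / m q"
      have e: "m q *\<^sub>R u = - (dirder u m q *\<^sub>R v)" using that by (simp add: eq add_eq_0_iff2)
      have "u = inverse (m q) *\<^sub>R (m q *\<^sub>R u)" using mq by simp
      also have "\<dots> = c *\<^sub>R v" unfolding e using mq by (simp add: c_def divide_inverse mult.commute)
      finally have u: "u = c *\<^sub>R v" .
      have "dirder u m q = c * dirder v m q"
        using linear_scale[OF has_derivative_linear[OF der], of c v] by (simp add: u)
      then have "c * (m q + dirder v m q) = 0" using mq by (simp add: c_def field_simps)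
      then have "c = 0" using mq nonneg by auto
      then show ?thesis using u by simp
    qed
    ultimately show "inj (\<lambda>u. dirder u X q)" using linear_injective_0[of "\<lambda>u. dirder u X q"] by blast
  qed
  show ?thesis
  proof (rule that[of X Y])
    show "X (0, w) = 0" for w by (simp add: X)
    show "norm (X (v, w)) < 1 \<longleftrightarrow> p v w < 1" if "w \<in> T" "p v w \<le> 1" for v w
      using Xlt[OF that(1)] Xeq[OF that(1)] that(2) by (metis less_le order_less_irrefl)
  qed (use contD Ycont Xck Yck Y YX Xle in auto)
qed

lemma infnorm_less_1_iff: "infnorm v < 1 \<longleftrightarrow> v \<in> box (- 1) (1 :: real^'n)"
  and infnorm_le_1_iff: "infnorm v \<le> 1 \<longleftrightarrow> v \<in> cbox (- 1) (1 :: real^'n)"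
proof -
  have e: "infnorm v = Max ((\<lambda>i. \<bar>v $ i\<bar>) ` UNIV)"
  proof -
    have "{\<bar>v $ i\<bar> |i. i \<in> UNIV} = (\<lambda>i. \<bar>v $ i\<bar>) ` UNIV" by auto
    then show ?thesis unfolding infnorm_cart by (simp add: cSup_eq_Max)
  qed
  have "infnorm v < 1 \<longleftrightarrow> (\<forall>i. \<bar>v $ i\<bar> < 1)" "infnorm v \<le> 1 \<longleftrightarrow> (\<forall>i. \<bar>v $ i\<bar> \<le> 1)"
    unfolding e by (subst Max_less_iff Max_le_iff; simp)+
  then show "infnorm v < 1 \<longleftrightarrow> v \<in> box (- 1) (1 :: real^'n)" "infnorm v \<le> 1 \<longleftrightarrow> v \<in> cbox (- 1) (1 :: real^'n)"
    by (auto simp: mem_box_cart abs_less_iff abs_le_iff minus_less_iff minus_le_iff)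
qed

text \<open>The cube is itself a star body, with gauge \<open>infnorm\<close>. The map to the cube
  passes through the unit ball: forward by the coordinates of the given body, back by those of the
  cube.\<close>

lemma star_body_cube:
  fixes p :: "real^'n \<Rightarrow> 'c::metric_space \<Rightarrow> real" and T :: "'c set"
  assumes T: "compact T" "T \<noteq> {}" and cont: "continuous_on (UNIV \<times> T) (\<lambda>q. p (fst q) (snd q))"
    and hom: "\<And>v w s. w \<in> T \<Longrightarrow> s \<ge> 0 \<Longrightarrow> p (s *\<^sub>R v) w = s * p v w"
    and pos: "\<And>v w. w \<in> T \<Longrightarrow> v \<noteq> 0 \<Longrightarrow> p v w > 0"
  obtains X Y :: "(real^'n) \<times> 'c \<Rightarrow> real^'n" where
    "continuous_on {q. snd q \<in> T \<and> p (fst q) (snd q) \<le> 1} X"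
    "continuous_on (cbox (- 1) 1 \<times> T) Y"
    "\<And>v w. w \<in> T \<Longrightarrow> p v w \<le> 1 \<Longrightarrow> X (v, w) \<in> cbox (- 1) 1 \<and> Y (X (v, w), w) = v"
    "\<And>v w. w \<in> T \<Longrightarrow> p v w \<le> 1 \<Longrightarrow> X (v, w) \<in> box (- 1) 1 \<longleftrightarrow> p v w < 1"
    "\<And>y w. w \<in> T \<Longrightarrow> y \<in> cbox (- 1) 1 \<Longrightarrow> p (Y (y, w)) w \<le> 1 \<and> X (Y (y, w), w) = y"
    "\<And>w. w \<in> T \<Longrightarrow> X (0, w) = 0"
    "\<And>k. ck k {q. snd q \<in> interior T \<and> p (fst q) (snd q) < 1} X"
    "\<And>k. ck k (box (- 1) 1 \<times> interior T) Y"
proof -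
  obtain X1 Y1 :: "(real^'n) \<times> 'c \<Rightarrow> real^'n" where
    1: "continuous_on {q. snd q \<in> T \<and> p (fst q) (snd q) \<le> 1} X1"
    "continuous_on (cball 0 1 \<times> T) Y1"
    "\<And>v w. w \<in> T \<Longrightarrow> p v w \<le> 1 \<Longrightarrow> norm (X1 (v, w)) \<le> 1 \<and> Y1 (X1 (v, w), w) = v"
    "\<And>v w. w \<in> T \<Longrightarrow> p v w \<le> 1 \<Longrightarrow> norm (X1 (v, w)) < 1 \<longleftrightarrow> p v w < 1"
    "\<And>y w. w \<in> T \<Longrightarrow> norm y \<le> 1 \<Longrightarrow> p (Y1 (y, w)) w \<le> 1 \<and> X1 (Y1 (y, w), w) = y"
    "\<And>w. X1 (0, w) = 0"
    "\<And>k. ck k {q. snd q \<in> interior T \<and> p (fst q) (snd q) < 1} X1"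
    "\<And>k. ck k (ball 0 1 \<times> interior T) Y1"
    using star_body_ball[of T p] assms by blast
  have ci: "continuous_on S (\<lambda>q. infnorm (fst q))" for S :: "((real^'n) \<times> 'c) set"
    by (rule continuous_on_infnorm) (intro continuous_on_fst continuous_on_id)
  obtain X2 Y2 :: "(real^'n) \<times> 'c \<Rightarrow> real^'n" where
    2: "continuous_on {q. snd q \<in> T \<and> infnorm (fst q) \<le> 1} X2"
    "continuous_on (cball 0 1 \<times> T) Y2"
    "\<And>v w. w \<in> T \<Longrightarrow> infnorm v \<le> 1 \<Longrightarrow> norm (X2 (v, w)) \<le> 1 \<and> Y2 (X2 (v, w), w) = v"
    "\<And>v w. w \<in> T \<Longrightarrow> infnorm v \<le> 1 \<Longrightarrow> norm (X2 (v, w)) < 1 \<longleftrightarrow> infnorm v < 1"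
    "\<And>y w. w \<in> T \<Longrightarrow> norm y \<le> 1 \<Longrightarrow> infnorm (Y2 (y, w)) \<le> 1 \<and> X2 (Y2 (y, w), w) = y"
    "\<And>w. X2 (0, w) = 0"
    "\<And>k. ck k {q. snd q \<in> interior T \<and> infnorm (fst q) < 1} X2"
    "\<And>k. ck k (ball 0 1 \<times> interior T) Y2"
    by (rule star_body_ball[of T "\<lambda>v w. infnorm v"]) (use T ci in \<open>auto simp: infnorm_mul infnorm_pos_lt\<close>)
  define X where "X q = Y2 (X1 q, snd q)" for q
  define Y where "Y q = Y1 (X2 q, snd q)" for q
  have inT: "w \<in> T" if "w \<in> interior T" for w using that interior_subset by blast
  have oball: "open (ball (0::real^'n) 1 \<times> interior T)" by (intro open_Times) auto
  have oD0: "open {q :: (real^'n) \<times> 'c. snd q \<in> interior T \<and> p (fst q) (snd q) < 1}"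
  proof -
    have o: "open (UNIV \<times> interior T)" by (intro open_Times) auto
    have "continuous_on (UNIV \<times> interior T) (\<lambda>q. p (fst q) (snd q))"
      using interior_subset by (intro continuous_on_subset[OF cont]) auto
    from continuous_open_preimage[OF this o open_lessThan[of 1]]
    have "open (UNIV \<times> interior T \<inter> (\<lambda>q. p (fst q) (snd q)) -` {..<1})" .
    also have "UNIV \<times> interior T \<inter> (\<lambda>q. p (fst q) (snd q)) -` {..<1} = {q. snd q \<in> interior T \<and> p (fst q) (snd q) < 1}"
      by (auto simp: mem_Times_iff)
    finally show ?thesis .
  qed
  have ckbox: "{q. snd q \<in> interior T \<and> infnorm (fst q) < 1} = box (- 1) (1::real^'n) \<times> interior T"
    by (auto simp: infnorm_less_1_iff mem_Times_iff)
  have obox: "open (box (- 1) (1::real^'n) \<times> interior T)" by (intro open_Times) (auto simp: open_box)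
  show ?thesis
  proof (rule that[of X Y])
    show "continuous_on {q. snd q \<in> T \<and> p (fst q) (snd q) \<le> 1} X" unfolding X_def
      using 1(3) by (intro continuous_on_compose2[OF 2(2)] continuous_on_Pair 1(1) continuous_on_snd continuous_on_id) auto
    have "continuous_on (cbox (- 1) 1 \<times> T) X2"
      by (rule continuous_on_subset[OF 2(1)]) (auto simp: infnorm_le_1_iff)
    then show "continuous_on (cbox (- 1) 1 \<times> T) Y" unfolding Y_def
      using 2(3) by (intro continuous_on_compose2[OF 1(2)] continuous_on_Pair continuous_on_snd continuous_on_id) (auto simp: infnorm_le_1_iff)
    show "X (v, w) \<in> cbox (- 1) 1 \<and> Y (X (v, w), w) = v" if "w \<in> T" "p v w \<le> 1" for v w
      using 1(3)[OF that] 2(5)[OF that(1), of "X1 (v, w)"] by (simp add: X_def Y_def infnorm_le_1_iff)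
    show "X (v, w) \<in> box (- 1) 1 \<longleftrightarrow> p v w < 1" if "w \<in> T" "p v w \<le> 1" for v w
      using 1(3)[OF that] 1(4)[OF that] 2(5)[OF that(1), of "X1 (v, w)"] 2(4)[OF that(1), of "Y2 (X1 (v, w), w)"]
      by (simp add: X_def infnorm_less_1_iff)
    show "p (Y (y, w)) w \<le> 1 \<and> X (Y (y, w), w) = y" if "w \<in> T" "y \<in> cbox (- 1) 1" for y w
      using 2(3)[OF that(1), of y] 1(5)[OF that(1), of "X2 (y, w)"] that(2) by (simp add: X_def Y_def infnorm_le_1_iff)
    show "X (0, w) = 0" if "w \<in> T" for w
      using 2(3)[OF that, of 0] 2(6)[of w] 1(6)[of w] by (simp add: X_def infnorm_0)
    show "ck k {q. snd q \<in> interior T \<and> p (fst q) (snd q) < 1} X" for k unfolding X_def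
      using 1(4) inT by (intro ck_compose[OF oD0 oball 1(7) 2(8), where \<kappa>="\<lambda>w. w"] continuous_on_snd continuous_on_id) (auto simp: less_imp_le)
    show "ck k (box (- 1) 1 \<times> interior T) Y" for k unfolding Y_def
      using 2(4) inT
      by (intro ck_compose[OF obox oball 2(7)[unfolded ckbox] 1(8), where \<kappa>="\<lambda>w. w"] continuous_on_snd continuous_on_id)
        (auto simp: less_imp_le infnorm_less_1_iff[symmetric])
  qed
qed

section \<open>Holonomy of coverings by matching charts\<close>

text \<open>\<open>\<tau> i\<close> extends the transverse coordinate of the chart \<open>c i\<close> to a larger chart domain \<open>B i\<close>;
  \<open>M i\<close> is an intermediate domain, small enough to lie in \<open>B j\<close> whenever it meets \<open>M j\<close>.\<close>

locale holonomy_cover =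
  fixes \<nu> :: nat and c :: "nat \<Rightarrow> ('m::metric_space, 'n::finite, 'x::metric_space) fchart"
    and M B :: "nat \<Rightarrow> 'm set" and \<tau> :: "nat \<Rightarrow> 'm \<Rightarrow> 'x" and sec :: "nat \<Rightarrow> 'x \<Rightarrow> 'm"
  assumes cpt: "compact (UNIV :: 'm set)"
    and opU: "\<And>i. i \<in> {1..\<nu>} \<Longrightarrow> open (udom (c i))"
    and tp: "\<And>i z. i \<in> {1..\<nu>} \<Longrightarrow> z \<in> udom (c i) \<Longrightarrow> tproj (c i) z = \<tau> i z"
    and fibU: "\<And>i w. i \<in> {1..\<nu>} \<Longrightarrow> connected {z \<in> udom (c i). \<tau> i z = w}"
    and opM: "\<And>i. i \<in> {1..\<nu>} \<Longrightarrow> open (M i)"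
    and fibM: "\<And>i w. i \<in> {1..\<nu>} \<Longrightarrow> connected {z \<in> M i. \<tau> i z = w}"
    and clU: "\<And>i. i \<in> {1..\<nu>} \<Longrightarrow> closure (udom (c i)) \<subseteq> M i"
    and MB: "\<And>i. i \<in> {1..\<nu>} \<Longrightarrow> M i \<subseteq> B i"
    and MMB: "\<And>i j. i \<in> {1..\<nu>} \<Longrightarrow> j \<in> {1..\<nu>} \<Longrightarrow> M i \<inter> M j \<noteq> {} \<Longrightarrow> M i \<subseteq> B j"
    and cont: "\<And>i. i \<in> {1..\<nu>} \<Longrightarrow> continuous_on (B i) (\<tau> i)"
    and const: "\<And>i C x y. i \<in> {1..\<nu>} \<Longrightarrow> connected C \<Longrightarrow> C \<subseteq> B i \<Longrightarrow> x \<in> C \<Longrightarrow> y \<in> C \<Longrightarrow> \<tau> i x = \<tau> i y"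
    and opent: "\<And>i V. i \<in> {1..\<nu>} \<Longrightarrow> open V \<Longrightarrow> V \<subseteq> udom (c i) \<Longrightarrow> open (\<tau> i ` V)"
    and sec: "\<And>i w. i \<in> {1..\<nu>} \<Longrightarrow> w \<in> \<tau> i ` udom (c i) \<Longrightarrow> sec i w \<in> udom (c i) \<and> \<tau> i (sec i w) = w"
    and usec: "\<And>i. i \<in> {1..\<nu>} \<Longrightarrow> uniformly_continuous_on (\<tau> i ` udom (c i)) (sec i)"
begin

lemma UM: "i \<in> {1..\<nu>} \<Longrightarrow> udom (c i) \<subseteq> M i"
  using clU closure_subset by blast

text \<open>A fibre of \<open>\<tau> i\<close> in the domain of the chart number \<open>i\<close> is
  connected and lies in the large domain \<open>B j\<close>, on whose connected subsets
  \<open>\<tau> j\<close> is constant.\<close>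

lemma transverse_welldef:
  assumes ij: "i \<in> {1..\<nu>}" "j \<in> {1..\<nu>}" and z: "z \<in> udom (c i) \<inter> udom (c j)" "z' \<in> udom (c i) \<inter> udom (c j)"
    and eq: "\<tau> i z = \<tau> i z'"
  shows "\<tau> j z = \<tau> j z'"
proof (rule const[OF ij(2) fibU[OF ij(1), of "\<tau> i z"]])
  have "M i \<inter> M j \<noteq> {}" using z(1) UM[OF ij(1)] UM[OF ij(2)] by blast
  then show "{x \<in> udom (c i). \<tau> i x = \<tau> i z} \<subseteq> B j" using UM[OF ij(1)] MMB[OF ij] by blast
qed (use z eq in auto)

lemma hol_dom_eq:
  assumes "i \<in> {1..\<nu>}" shows "hol_dom c i j = \<tau> i ` (udom (c i) \<inter> udom (c j))"
  unfolding hol_dom_def using tp[OF assms] by (intro image_cong) auto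

lemma hol_eq:
  assumes ij: "i \<in> {1..\<nu>}" "j \<in> {1..\<nu>}" and z: "z \<in> udom (c i) \<inter> udom (c j)"
  shows "hol c j i (\<tau> i z) = Some (\<tau> j z)"
proof -
  have "\<tau> i z \<in> hol_dom c i j" using z by (auto simp: hol_dom_eq[OF ij(1)])
  moreover have "(THE w'. \<exists>y \<in> udom (c i) \<inter> udom (c j). tproj (c i) y = \<tau> i z \<and> tproj (c j) y = w') = \<tau> j z"
  proof (rule the_equality)
    show "\<exists>y \<in> udom (c i) \<inter> udom (c j). tproj (c i) y = \<tau> i z \<and> tproj (c j) y = \<tau> j z"
      using z tp[OF ij(1)] tp[OF ij(2)] by blast
    fix w' assume "\<exists>y \<in> udom (c i) \<inter> udom (c j). tproj (c i) y = \<tau> i z \<and> tproj (c j) y = w'"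
    then obtain y where "y \<in> udom (c i) \<inter> udom (c j)" "\<tau> i y = \<tau> i z" "\<tau> j y = w'"
      using tp[OF ij(1)] tp[OF ij(2)] by auto
    then show "w' = \<tau> j z" using transverse_welldef[OF ij _ z] by metis
  qed
  ultimately show ?thesis by (simp add: hol_def)
qed

lemma hol_SomeD:
  assumes ij: "i \<in> {1..\<nu>}" "j \<in> {1..\<nu>}" and h: "hol c j i w = Some u"
  shows "\<exists>z \<in> udom (c i) \<inter> udom (c j). \<tau> i z = w \<and> \<tau> j z = u"
proof -
  have "w \<in> hol_dom c i j" using h by (auto simp: hol_def split: if_splits)
  then obtain z where z: "z \<in> udom (c i) \<inter> udom (c j)" "w = \<tau> i z" by (auto simp: hol_dom_eq[OF ij(1)])
  then show ?thesis using hol_eq[OF ij z(1)] h by auto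
qed

lemma hol_continuous:
  assumes ij: "i \<in> {1..\<nu>}" "j \<in> {1..\<nu>}"
  shows "continuous_on (hol_dom c i j) (the \<circ> hol c j i)"
proof -
  have o: "open (hol_dom c i j)"
    unfolding hol_dom_eq[OF ij(1)] by (intro opent ij open_Int opU) auto
  show ?thesis
    unfolding continuous_on_open_vimage[OF o]
  proof (intro allI impI)
    fix V :: "'x set" assume V: "open V"
    have "(the \<circ> hol c j i) -` V \<inter> hol_dom c i j = \<tau> i ` (udom (c i) \<inter> (udom (c j) \<inter> \<tau> j -` V))"
    proof (intro equalityI subsetI)
      fix w assume w: "w \<in> (the \<circ> hol c j i) -` V \<inter> hol_dom c i j"
      then obtain z where "z \<in> udom (c i) \<inter> udom (c j)" "w = \<tau> i z" by (auto simp: hol_dom_eq[OF ij(1)])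
      then show "w \<in> \<tau> i ` (udom (c i) \<inter> (udom (c j) \<inter> \<tau> j -` V))" using w hol_eq[OF ij] by auto
    next
      fix w assume "w \<in> \<tau> i ` (udom (c i) \<inter> (udom (c j) \<inter> \<tau> j -` V))"
      then obtain z where "z \<in> udom (c i) \<inter> udom (c j)" "\<tau> j z \<in> V" "w = \<tau> i z" by auto
      then show "w \<in> (the \<circ> hol c j i) -` V \<inter> hol_dom c i j" using hol_eq[OF ij] by (auto simp: hol_dom_eq[OF ij(1)])
    qed
    moreover have "open (udom (c j) \<inter> \<tau> j -` V)"
      using continuous_open_preimage[OF continuous_on_subset[OF cont[OF ij(2)]] opU[OF ij(2)] V] UM[OF ij(2)] MB[OF ij(2)]
      by blast
    ultimately show "open ((the \<circ> hol c j i) -` V \<inter> hol_dom c i j)"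
      using opent[OF ij(1) open_Int[OF opU[OF ij(1)]]] by auto
  qed
qed

lemma hol_well_defined: "hol_well_defined \<nu> c"
  unfolding hol_well_defined_def
proof (intro allI impI conjI)
  fix i j assume "admissible_pair \<nu> c i j"
  then have ij: "i \<in> {1..\<nu>}" "j \<in> {1..\<nu>}" by (auto simp: admissible_pair_def)
  show "\<forall>z \<in> udom (c i) \<inter> udom (c j). hol c j i (tproj (c i) z) = Some (tproj (c j) z)"
    using hol_eq[OF ij] tp ij by auto
  have inv: "(the \<circ> hol c i j) ((the \<circ> hol c j i) w) = w \<and> (the \<circ> hol c j i) w \<in> hol_dom c j i"
    if ij: "i \<in> {1..\<nu>}" "j \<in> {1..\<nu>}" and w: "w \<in> hol_dom c i j" for i j w
  proof -
    obtain z where z: "z \<in> udom (c i) \<inter> udom (c j)" "w = \<tau> i z" using w by (auto simp: hol_dom_eq[OF ij(1)])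
    then have z': "z \<in> udom (c j) \<inter> udom (c i)" by auto
    show ?thesis using hol_eq[OF ij z(1)] hol_eq[OF ij(2,1) z'] z by (auto simp: hol_dom_eq[OF ij(2)])
  qed
  show "homeomorphism (hol_dom c i j) (hol_dom c j i) (the \<circ> hol c j i) (the \<circ> hol c i j)"
  proof (rule homeomorphismI)
    show "(the \<circ> hol c j i) ` hol_dom c i j \<subseteq> hol_dom c j i" using inv[OF ij] by blast
    show "(the \<circ> hol c i j) ` hol_dom c j i \<subseteq> hol_dom c i j" using inv[OF ij(2,1)] by blast
    show "(the \<circ> hol c i j) ((the \<circ> hol c j i) w) = w" if "w \<in> hol_dom c i j" for w using inv[OF ij that] by blast
    show "(the \<circ> hol c j i) ((the \<circ> hol c i j) w) = w" if "w \<in> hol_dom c j i" for w using inv[OF ij(2,1) that] by blast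
  qed (rule hol_continuous[OF ij] hol_continuous[OF ij(2,1)])+
qed

text \<open>The homeomorphism is not assumed to respect charts or leaves. The image of a plaque is
  connected and stays in the enlarged domain, which already forces it into one fibre of
  \<open>\<tau> i\<close>.\<close>

lemma connected_image_transverse:
  assumes i: "i \<in> {1..\<nu>}" and h: "continuous_on UNIV h" and hM: "\<And>z. z \<in> udom (c i) \<Longrightarrow> h z \<in> M i"
    and z: "z \<in> udom (c i)" "z' \<in> udom (c i)" "\<tau> i z = \<tau> i z'"
  shows "\<tau> i (h z) = \<tau> i (h z')"
proof (rule const[OF i])
  show "connected (h ` {x \<in> udom (c i). \<tau> i x = \<tau> i z})"
    by (rule connected_continuous_image[OF continuous_on_subset[OF h] fibU[OF i]]) simp
  show "h ` {x \<in> udom (c i). \<tau> i x = \<tau> i z} \<subseteq> B i" using hM MB[OF i] by blast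
qed (use z in auto)

text \<open>A homeomorphism close to the identity carries the chain of plaques through \<open>z\<close> into the
  chain of plaques through \<open>h z\<close>, since connected sets cannot leave a plaque.\<close>

lemma hol_seq_follows:
  assumes h: "continuous_on UNIV h" and hM: "\<And>i z. i \<in> {1..\<nu>} \<Longrightarrow> z \<in> udom (c i) \<Longrightarrow> h z \<in> M i"
    and I: "I \<noteq> []" "set I \<subseteq> {1..\<nu>}"
    and z: "z \<in> udom (c (hd I))" and u: "hol_seq c I (\<tau> (hd I) z) = Some u"
    and u': "hol_seq c I (\<tau> (hd I) (h z)) = Some u'"
  shows "\<exists>y \<in> udom (c (last I)). \<tau> (last I) y = u \<and> \<tau> (last I) (h y) = u'"
  using I z u u'
proof (induction I arbitrary: z rule: induct_list012)
  case (2 i)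
  then have i: "i \<in> {1..\<nu>}" and z: "z \<in> udom (c i)" by auto
  have "u = \<tau> i z" using 2 hol_eq[OF i i, of z] z by simp
  moreover have "u' = \<tau> i (h z)" using 2 hol_SomeD[OF i i, of "\<tau> i (h z)" u'] by auto
  ultimately show ?case using z by auto
next
  case (3 i j I)
  then have ij: "i \<in> {1..\<nu>}" "j \<in> {1..\<nu>}" and z: "z \<in> udom (c i)" by auto
  obtain w1 where w1: "hol c j i (\<tau> i z) = Some w1" "hol_seq c (j # I) w1 = Some u"
    using 3 by (auto simp: map_comp_Some_iff)
  obtain w2 where w2: "hol c j i (\<tau> i (h z)) = Some w2" "hol_seq c (j # I) w2 = Some u'"
    using 3 by (auto simp: map_comp_Some_iff)
  obtain z1 where z1: "z1 \<in> udom (c i) \<inter> udom (c j)" "\<tau> i z1 = \<tau> i z" "\<tau> j z1 = w1"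
    using hol_SomeD[OF ij w1(1)] by blast
  obtain z2 where z2: "z2 \<in> udom (c i) \<inter> udom (c j)" "\<tau> i z2 = \<tau> i (h z)" "\<tau> j z2 = w2"
    using hol_SomeD[OF ij w2(1)] by blast
  have hz: "\<tau> i (h z1) = \<tau> i (h z)"
    using connected_image_transverse[OF ij(1) h hM[OF ij(1)], of z1 z] z z1 by auto
  have m: "h z1 \<in> M i" "h z1 \<in> M j" "z2 \<in> M i"
    using hM[OF ij(1)] hM[OF ij(2)] z1 z2 UM[OF ij(1)] by auto
  \<comment> \<open>The witness \<open>z2\<close> for the second chain need not be
    \<open>h z1\<close>. Both lie in one fibre of \<open>\<tau> i\<close> in \<open>M i\<close>,
    which is connected and contained in \<open>B j\<close> because \<open>M i\<close> meets
    \<open>M j\<close> at \<open>h z1\<close>; hence they determine the same plaque of the next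
    chart.\<close>
  have "\<tau> j (h z1) = \<tau> j z2"
  proof (rule const[OF ij(2) fibM[OF ij(1), of "\<tau> i (h z)"]])
    show "{x \<in> M i. \<tau> i x = \<tau> i (h z)} \<subseteq> B j" using MMB[OF ij] m by blast
  qed (use m hz z2 in auto)
  then have "hol_seq c (j # I) (\<tau> (hd (j # I)) (h z1)) = Some u'" using w2 z2 by simp
  moreover have "hol_seq c (j # I) (\<tau> (hd (j # I)) z1) = Some u" using w1 z1 by simp
  moreover have "set (j # I) \<subseteq> {1..\<nu>}" using 3 by auto
  moreover have "z1 \<in> udom (c (hd (j # I)))" using z1 by simp
  ultimately show ?case using "3.IH"(2)[of z1] by simp
qed simp

text \<open>The closure of the chart domain is compact and contained in the open set
  \<open>M i\<close>, so a Lebesgue number gives a uniform margin for leaving \<open>M i\<close> and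
  for the variation of \<open>\<tau> i\<close>.\<close>

lemma transverse_uniform:
  assumes i: "i \<in> {1..\<nu>}" and e: "e > 0"
  shows "\<exists>\<eta>>0. \<forall>z\<in>udom (c i). \<forall>z'. dist z' z < \<eta> \<longrightarrow> z' \<in> M i \<and> dist (\<tau> i z) (\<tau> i z') < e"
proof -
  define K where "K = closure (udom (c i))"
  have K: "compact K" unfolding K_def using cpt by (metis closed_closure compact_Int_closed Int_UNIV_left)
  have KM: "K \<subseteq> M i" unfolding K_def by (rule clU[OF i])
  have "\<exists>d>0. ball x (2 * d) \<subseteq> M i \<and> (\<forall>y\<in>ball x (2 * d). dist (\<tau> i x) (\<tau> i y) < e/2)" if "x \<in> K" for x
  proof -
    have x: "x \<in> M i" using KM that by blast
    then obtain d1 where d1: "d1 > 0" "ball x d1 \<subseteq> M i" using opM[OF i] open_contains_ball by blast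
    have "isCont (\<tau> i) x"
      using continuous_on_subset[OF cont[OF i] MB[OF i]] opM[OF i] x continuous_on_eq_continuous_at by blast
    then obtain d2 where d2: "d2 > 0" "\<And>y. dist y x < d2 \<Longrightarrow> dist (\<tau> i y) (\<tau> i x) < e/2"
      using e unfolding continuous_at_eps_delta by (metis half_gt_zero)
    show ?thesis
      using d1 d2 by (intro exI[of _ "min d1 d2 / 2"]) (auto simp: dist_commute subset_eq)
  qed
  then obtain D where D: "\<And>x. x \<in> K \<Longrightarrow> D x > 0 \<and> ball x (2 * D x) \<subseteq> M i \<and> (\<forall>y\<in>ball x (2 * D x). dist (\<tau> i x) (\<tau> i y) < e/2)"
    by metis
  obtain \<eta> where \<eta>: "\<eta> > 0" "\<And>x. x \<in> K \<Longrightarrow> \<exists>G\<in>(\<lambda>x. ball x (D x)) ` K. ball x \<eta> \<subseteq> G"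
  proof (rule Heine_Borel_lemma[OF K, of "(\<lambda>x. ball x (D x)) ` K"])
    have "x \<in> ball x (D x)" if "x \<in> K" for x using D[OF that] by simp
    then show "K \<subseteq> \<Union> ((\<lambda>x. ball x (D x)) ` K)" by blast
    show "open G" if "G \<in> (\<lambda>x. ball x (D x)) ` K" for G using that by blast
  qed (rule that)
  show ?thesis
  proof (intro exI[of _ \<eta>] conjI ballI allI impI)
    fix z z' assume z: "z \<in> udom (c i)" "dist z' z < \<eta>"
    have "z \<in> K" using z(1) closure_subset unfolding K_def by blast
    then obtain x where x: "x \<in> K" "ball z \<eta> \<subseteq> ball x (D x)" using \<eta>(2) by blast
    have "z \<in> ball z \<eta>" "z' \<in> ball z \<eta>" using z \<eta>(1) by (auto simp: dist_commute)
    moreover have "D x > 0" using D[OF x(1)] by blast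
    ultimately have "z \<in> ball x (2 * D x)" "z' \<in> ball x (2 * D x)" using subsetD[OF x(2)] by fastforce+
    then show "z' \<in> M i" "dist (\<tau> i z) (\<tau> i z') < e"
      using D[OF x(1)] dist_triangle_half_r[of "\<tau> i x" "\<tau> i z" e "\<tau> i z'"] by auto
  qed (rule \<eta>)
qed

text \<open>The constants are chosen backwards: \<open>e\<close> fixes a displacement
  \<open>\<eta>\<close> that changes the transverse coordinates by less than \<open>e\<close>, the
  Effros property turns \<open>\<eta>\<close> into a distance \<open>d\<close> of points, and the
  modulus of the sections turns \<open>d\<close> into \<open>\<delta>\<close>. Nothing in this
  choice refers to the length of the sequence \<open>I\<close>, since only the last chart of the
  chain enters the final estimate.\<close>

lemma equicontinuous_holonomy:
  assumes hom: "homogeneous_space TYPE('m)"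
  shows "equicontinuous_pseudogroup (hol_pseudogroup \<nu> c)"
  unfolding equicontinuous_pseudogroup_def
proof (intro allI impI)
  fix e :: real assume e: "e > 0"
  obtain H where H: "\<And>i. i \<in> {1..\<nu>} \<Longrightarrow> H i > 0 \<and>
      (\<forall>z\<in>udom (c i). \<forall>z'. dist z' z < H i \<longrightarrow> z' \<in> M i \<and> dist (\<tau> i z) (\<tau> i z') < e)"
    using transverse_uniform[OF _ e] by metis
  define \<eta> where "\<eta> = Min (insert 1 (H ` {1..\<nu>}))"
  have \<eta>: "\<eta> > 0" unfolding \<eta>_def using H by (subst Min_gr_iff) auto
  have \<eta>H: "\<eta> \<le> H i" if "i \<in> {1..\<nu>}" for i unfolding \<eta>_def using that by (intro Min_le) auto
  obtain d where d: "d > 0" "\<And>x y :: 'm. dist x y < d \<Longrightarrow> \<exists>h\<in>small_homeos \<eta>. h x = y"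
    using homogeneous_small_homeo[OF cpt hom \<eta>] by blast
  have "\<exists>r>0. \<forall>w\<in>\<tau> i ` udom (c i). \<forall>w'\<in>\<tau> i ` udom (c i). dist w w' < r \<longrightarrow> dist (sec i w) (sec i w') < d"
    if "i \<in> {1..\<nu>}" for i
    using usec[OF that] d(1) unfolding uniformly_continuous_on_def by (metis dist_commute)
  then obtain R where R: "\<And>i. i \<in> {1..\<nu>} \<Longrightarrow> R i > 0 \<and>
     (\<forall>w\<in>\<tau> i ` udom (c i). \<forall>w'\<in>\<tau> i ` udom (c i). dist w w' < R i \<longrightarrow> dist (sec i w) (sec i w') < d)"
    by metis
  define \<delta> where "\<delta> = Min (insert 1 (R ` {1..\<nu>}))"
  have \<delta>: "\<delta> > 0" unfolding \<delta>_def using R by (subst Min_gr_iff) auto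
  have \<delta>R: "\<delta> \<le> R i" if "i \<in> {1..\<nu>}" for i unfolding \<delta>_def using that by (intro Min_le) auto
  show "\<exists>\<delta>>0. \<forall>f\<in>hol_pseudogroup \<nu> c. \<forall>w\<in>dom f. \<forall>w'\<in>dom f. dist w w' < \<delta> \<longrightarrow> dist (the (f w)) (the (f w')) < e"
  proof (intro exI[of _ \<delta>] conjI ballI impI \<delta>)
    fix f w w' assume f: "f \<in> hol_pseudogroup \<nu> c" and w: "w \<in> dom f" "w' \<in> dom f" "dist w w' < \<delta>"
    obtain I U where I: "f = hol_seq c I |` U" "admissible_seq \<nu> c I" using f unfolding hol_pseudogroup_def by blast
    have I': "I \<noteq> []" "set I \<subseteq> {1..\<nu>}" using I(2) by (auto simp: admissible_seq_def)
    have wU: "w \<in> U" "w' \<in> U" using w I(1) by (auto simp: restrict_map_def split: if_splits)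
    obtain u u' where u: "hol_seq c I w = Some u" "hol_seq c I w' = Some u'"
      using w wU I(1) by (auto simp: restrict_map_def)
    have i: "hd I \<in> {1..\<nu>}" and il: "last I \<in> {1..\<nu>}" using I' hd_in_set last_in_set by blast+
    have dom: "v \<in> \<tau> (hd I) ` udom (c (hd I))" if "hol_seq c I v = Some y" for v y
    proof (cases "tl I")
      case Nil
      then have "I = [hd I]" using I'(1) by (metis list.collapse)
      then have "hol c (hd I) (hd I) v = Some y" using that by (metis hol_seq.simps(2))
      then show ?thesis using hol_SomeD[OF i i] by blast
    next
      case (Cons j J)
      then have Ieq: "I = hd I # j # J" using I'(1) by (metis list.collapse)
      then have j: "j \<in> {1..\<nu>}" using I'(2) by (metis list.set_intros subsetD)
      have "(hol_seq c (j # J) \<circ>\<^sub>m hol c j (hd I)) v = Some y" using that Ieq by (metis hol_seq.simps(3))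
      then obtain x where "hol c j (hd I) v = Some x" by (auto simp: map_comp_Some_iff)
      then show ?thesis using hol_SomeD[OF i j] by blast
    qed
    have s: "sec (hd I) w \<in> udom (c (hd I))" "\<tau> (hd I) (sec (hd I) w) = w" "\<tau> (hd I) (sec (hd I) w') = w'"
      using sec[OF i] dom[OF u(1)] dom[OF u(2)] by auto
    have "dist (sec (hd I) w) (sec (hd I) w') < d"
      using R[OF i] dom[OF u(1)] dom[OF u(2)] w(3) \<delta>R[OF i] by auto
    then obtain h where h: "h \<in> small_homeos \<eta>" "h (sec (hd I) w) = sec (hd I) w'" using d(2) by blast
    have near: "dist (h z) z < H j" if "j \<in> {1..\<nu>}" for j z
      using h(1) \<eta>H[OF that] unfolding small_homeos_def by (auto intro: less_le_trans)
    have hM: "h z \<in> M j" if "j \<in> {1..\<nu>}" "z \<in> udom (c j)" for j z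
      using H[OF that(1)] that(2) near[OF that(1)] by blast
    have hc: "continuous_on UNIV h" using h(1) by (simp add: small_homeos_def autohomeo_def)
    obtain y where y: "y \<in> udom (c (last I))" "\<tau> (last I) y = u" "\<tau> (last I) (h y) = u'"
      using hol_seq_follows[OF hc hM I' s(1)] u s h(2) by auto
    have "dist u u' < e" using H[OF il] y near[OF il] by blast
    then show "dist (the (f w)) (the (f w')) < e" using u wU I(1) by simp
  qed
qed

end

section \<open>Charts and the leafwise metric in coordinates\<close>

context
  fixes c :: "('m::metric_space, 'n::finite, 'x::metric_space) fchart"
  assumes c: "is_chart c"
begin

lemma chart_homeo: "homeomorphism (closure (udom c)) (cbox (- 1) 1 \<times> transv c) (coord c) (chart_inv c)"
  using c by (simp add: is_chart_def)

lemma chart_open: "open (udom c)"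
  using c by (simp add: is_chart_def)

lemma chart_udom_closure: "z \<in> udom c \<Longrightarrow> z \<in> closure (udom c)"
  using closure_subset by blast

lemma chart_udom_iff: "z \<in> udom c \<longleftrightarrow> z \<in> closure (udom c) \<and> coord c z \<in> box (- 1) 1 \<times> interior (transv c)"
proof -
  have "udom c = {z \<in> closure (udom c). coord c z \<in> box (- 1) 1 \<times> interior (transv c)}"
    using c by (simp add: is_chart_def)
  then have "z \<in> udom c \<longleftrightarrow> z \<in> {z \<in> closure (udom c). coord c z \<in> box (- 1) 1 \<times> interior (transv c)}"
    by (rule arg_cong)
  then show ?thesis unfolding mem_Collect_eq .
qed

lemma chart_inv_coord: "z \<in> closure (udom c) \<Longrightarrow> chart_inv c (coord c z) = z"
  using chart_homeo by (simp add: homeomorphism_def)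

lemma chart_coord_mem: "z \<in> closure (udom c) \<Longrightarrow> coord c z \<in> cbox (- 1) 1 \<times> transv c"
  using chart_homeo unfolding homeomorphism_def by blast

lemma chart_coord_inv: "q \<in> cbox (- 1) 1 \<times> transv c \<Longrightarrow> coord c (chart_inv c q) = q"
  using chart_homeo unfolding homeomorphism_def by blast

lemma chart_inv_mem: "q \<in> cbox (- 1) 1 \<times> transv c \<Longrightarrow> chart_inv c q \<in> closure (udom c)"
  using chart_homeo unfolding homeomorphism_def by blast

lemma chart_box_sub: "box (- 1) 1 \<times> interior (transv c) \<subseteq> cbox (- 1) 1 \<times> transv c"
  using interior_subset[of "transv c"] box_subset_cbox by blast

lemma chart_inv_udom: "q \<in> box (- 1) 1 \<times> interior (transv c) \<Longrightarrow> chart_inv c q \<in> udom c"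
  using chart_box_sub chart_coord_inv chart_inv_mem by (auto simp: chart_udom_iff)

lemma chart_coord_udom: "z \<in> udom c \<Longrightarrow> coord c z \<in> box (- 1) 1 \<times> interior (transv c)"
  using chart_udom_iff by blast

lemma chart_cont_coord: "continuous_on (closure (udom c)) (coord c)"
  and chart_cont_inv: "continuous_on (cbox (- 1) 1 \<times> transv c) (chart_inv c)"
  using chart_homeo by (simp_all add: homeomorphism_def)

lemma chart_box_open: "open (box (- 1) (1::real^'n) \<times> interior (transv c))"
  by (intro open_Times open_box open_interior)

lemma chart_inv_image_open:
  assumes "open V" "V \<subseteq> box (- 1) 1 \<times> interior (transv c)"
  shows "open (chart_inv c ` V)"
proof -
  have "chart_inv c ` V = udom c \<inter> coord c -` V"
  proof (intro equalityI subsetI)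
    fix z assume "z \<in> chart_inv c ` V"
    then obtain q where q: "q \<in> V" "z = chart_inv c q" by blast
    then have "q \<in> cbox (- 1) 1 \<times> transv c" "q \<in> box (- 1) 1 \<times> interior (transv c)" using assms(2) chart_box_sub by blast+
    then show "z \<in> udom c \<inter> coord c -` V" using q chart_inv_udom chart_coord_inv by auto
  next
    fix z assume "z \<in> udom c \<inter> coord c -` V"
    then show "z \<in> chart_inv c ` V" using chart_inv_coord[OF chart_udom_closure, of z] by (auto intro!: image_eqI[of _ _ "coord c z"])
  qed
  moreover have "open (udom c \<inter> coord c -` V)"
    by (rule continuous_open_preimage[OF continuous_on_subset[OF chart_cont_coord closure_subset] chart_open assms(1)])
  ultimately show ?thesis by simp
qed

lemma chart_coord_image:
  assumes "W \<subseteq> udom c"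
  shows "coord c ` W = box (- 1) 1 \<times> interior (transv c) \<inter> chart_inv c -` W"
proof (intro equalityI subsetI)
  fix q assume "q \<in> coord c ` W"
  then show "q \<in> box (- 1) 1 \<times> interior (transv c) \<inter> chart_inv c -` W"
    using assms chart_coord_udom chart_inv_coord[OF chart_udom_closure] by auto
next
  fix q assume q: "q \<in> box (- 1) 1 \<times> interior (transv c) \<inter> chart_inv c -` W"
  then have "coord c (chart_inv c q) = q" using chart_coord_inv chart_box_sub by blast
  then show "q \<in> coord c ` W" using q by (intro image_eqI[of _ _ "chart_inv c q"]) auto
qed

lemma chart_coord_image_open:
  assumes "open W" "W \<subseteq> udom c"
  shows "open (coord c ` W)"
  unfolding chart_coord_image[OF assms(2)]
  by (rule continuous_open_preimage[OF continuous_on_subset[OF chart_cont_inv chart_box_sub] chart_box_open assms(1)])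

lemma chart_cont_lcoord: "continuous_on (closure (udom c)) (lcoord c)"
  and chart_cont_tproj: "continuous_on (closure (udom c)) (tproj c)"
  unfolding lcoord_def[abs_def] tproj_def[abs_def]
  by (intro continuous_on_fst continuous_on_snd chart_cont_coord)+

lemma chart_lcoord_inv: "(v, w) \<in> cbox (- 1) 1 \<times> transv c \<Longrightarrow> lcoord c (chart_inv c (v, w)) = v"
  and chart_tproj_inv: "(v, w) \<in> cbox (- 1) 1 \<times> transv c \<Longrightarrow> tproj c (chart_inv c (v, w)) = w"
  using chart_coord_inv by (simp_all add: lcoord_def tproj_def)

lemma chart_coord_eq: "coord c z = (lcoord c z, tproj c z)"
  by (simp add: lcoord_def tproj_def)

lemma chart_inv_lcoord_tproj: "z \<in> closure (udom c) \<Longrightarrow> chart_inv c (lcoord c z, tproj c z) = z"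
  using chart_inv_coord by (simp add: lcoord_def tproj_def)

lemma chart_lcoord_mem: "z \<in> udom c \<Longrightarrow> lcoord c z \<in> box (- 1) 1"
  and chart_tproj_mem: "z \<in> udom c \<Longrightarrow> tproj c z \<in> interior (transv c)"
  using chart_coord_udom by (auto simp: lcoord_def tproj_def mem_Times_iff)

text \<open>The form in which total disconnectedness of transversals is put to use: a connected
  subset of a chart cannot cross from one plaque to another.\<close>

lemma chart_tproj_const:
  assumes td: "tot_disconnected (transv c)" and C: "connected C" "C \<subseteq> closure (udom c)" and xy: "x \<in> C" "y \<in> C"
  shows "tproj c x = tproj c y"
proof -
  have con: "connected (tproj c ` C)"
    by (rule connected_continuous_image[OF continuous_on_subset[OF chart_cont_tproj C(2)] C(1)])
  have sub: "tproj c ` C \<subseteq> transv c"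
    using C(2) chart_coord_mem by (auto simp: tproj_def mem_Times_iff)
  have "tproj c ` C \<subseteq> connected_component_set (transv c) (tproj c x)"
    using connected_component_maximal[OF _ con sub] xy by blast
  moreover have "connected_component_set (transv c) (tproj c x) = {tproj c x}"
    using td sub xy(1) unfolding tot_disconnected_def by blast
  ultimately show ?thesis using xy by auto
qed

lemma chart_transition_ck:
  assumes "smoothly_related c c'"
  shows "ck k (coord c ` (udom c \<inter> udom c')) (\<lambda>q. lcoord c' (chart_inv c q))"
proof (rule ck_local)
  fix p assume "p \<in> coord c ` (udom c \<inter> udom c')"
  then obtain z where z: "z \<in> udom c \<inter> udom c'" "p = coord c z" by blast
  obtain V where V: "open V" "z \<in> V" "V \<subseteq> udom c \<inter> udom c'"
    "smooth_family (coord c ` V) (\<lambda>w v. lcoord c' (chart_inv c (v, w)))"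
    using assms z(1) unfolding smoothly_related_def Let_def by metis
  have o: "open (coord c ` V)" using chart_coord_image_open V by blast
  have "ck k (coord c ` V) (\<lambda>q. lcoord c' (chart_inv c q))"
    using smooth_family_imp_ck[OF o V(4), of k] by simp
  then show "\<exists>E. open E \<and> p \<in> E \<and> ck k E (\<lambda>q. lcoord c' (chart_inv c q))"
    using o V(2) z(2) by blast
qed

end

section \<open>The leafwise metric in the coordinates of the given charts\<close>

locale riemannian_matchbox =
  fixes A :: "'m::metric_space \<Rightarrow> ('m, 'n::finite, 'x::metric_space) fchart"
    and g :: "'m \<Rightarrow> real^'n \<Rightarrow> real^'n \<Rightarrow> real"
  assumes mm: "matchbox_manifold A" and lr: "leafwise_riemannian A g"
begin

lemma A_chart: "is_chart (A x)"
  using mm by (simp add: matchbox_manifold_def smooth_foliated_space_def foliated_space_def)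

lemma A_center: "x \<in> udom (A x)" "lcoord (A x) x = 0" "tproj (A x) x \<in> interior (transv (A x))"
  using mm by (auto simp: matchbox_manifold_def smooth_foliated_space_def foliated_space_def centered_at_def)

lemma A_td: "tot_disconnected (transv (A x))"
  using mm by (simp add: matchbox_manifold_def)

lemma A_smooth: "smoothly_related (A x) (A y)"
  using mm by (simp add: matchbox_manifold_def smooth_foliated_space_def)

lemma compact_M: "compact (UNIV :: 'm set)" and compact_X: "compact (UNIV :: 'x set)"
  using mm by (auto simp: matchbox_manifold_def smooth_foliated_space_def foliated_space_def continuum_space_def)

abbreviation "dom_box x \<equiv> box (- 1) (1::real^'n) \<times> interior (transv (A x))"

lemmas A_inv_udom = chart_inv_udom[OF A_chart]
lemmas A_coord_inv = chart_coord_inv[OF A_chart]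

lemma A_lcoord_inv: "(v, w) \<in> dom_box x \<Longrightarrow> lcoord (A x) (chart_inv (A x) (v, w)) = v"
  using chart_lcoord_inv[OF A_chart, of v w x] chart_box_sub[OF A_chart, of x] by blast

lemma A_tproj_inv: "(v, w) \<in> dom_box x \<Longrightarrow> tproj (A x) (chart_inv (A x) (v, w)) = w"
  using chart_tproj_inv[OF A_chart, of v w x] chart_box_sub[OF A_chart, of x] by blast

lemma A_cont_inv: "continuous_on (dom_box x) (chart_inv (A x))"
  by (rule continuous_on_subset[OF chart_cont_inv[OF A_chart] chart_box_sub[OF A_chart]])

definition tr :: "'m \<Rightarrow> 'm \<Rightarrow> (real^'n) \<times> 'x \<Rightarrow> real^'n" where
  "tr x y q = lcoord (A y) (chart_inv (A x) q)"

definition tr_dom :: "'m \<Rightarrow> 'm \<Rightarrow> ((real^'n) \<times> 'x) set" where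
  "tr_dom x y = coord (A x) ` (udom (A x) \<inter> udom (A y))"

lemma tr_ck: "ck k (tr_dom x y) (tr x y)"
  using chart_transition_ck[OF A_chart A_smooth] unfolding tr_def[abs_def] tr_dom_def .

lemma tr_dom_open: "open (tr_dom x y)"
  unfolding tr_dom_def using chart_coord_image_open[OF A_chart] chart_open[OF A_chart] by (metis inf_le1 open_Int)

lemma tr_dom_iff: "q \<in> tr_dom x y \<longleftrightarrow> q \<in> dom_box x \<and> chart_inv (A x) q \<in> udom (A y)"
  unfolding tr_dom_def using chart_coord_image[OF A_chart, of "udom (A x) \<inter> udom (A y)" x] A_inv_udom by auto

text \<open>The metric matrix is written as a function of the pair \<open>(v, w)\<close> so that the
  calculus of \<open>ck\<close>, with \<open>w\<close> as parameter, applies to it.\<close>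

definition hm :: "'m \<Rightarrow> (real^'n) \<times> 'x \<Rightarrow> real^'n^'n" where
  "hm x q = local_metric A g (A x) (snd q) (fst q)"

lemma hm_ck: "ck k (dom_box x) (hm x)"
  using smooth_family_imp_ck[OF chart_box_open[OF A_chart], where F="local_metric A g (A x)"] lr
  unfolding leafwise_riemannian_def hm_def[abs_def] by blast

lemma slice_derivative:
  assumes "(v, w) \<in> tr_dom x y"
  shows "((\<lambda>u. tr x y (u, w)) has_derivative (\<lambda>u. dirder u (tr x y) (v, w))) (at v)"
  using ck_has_derivative[OF tr_ck[of "Suc 0"] assms] by simp

text \<open>\<open>g z\<close> lives in the chart centred at \<open>z\<close>, and the entries of
  the matrix are its values on the images of the basis vectors under the derivative of the
  transition map. Linearity of that derivative and bilinearity of \<open>g z\<close> extend the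
  formula to all vectors.\<close>

lemma hm_inner:
  assumes q: "(v, w) \<in> dom_box x"
  defines "z \<equiv> chart_inv (A x) (v, w)"
  shows "a \<bullet> (hm x (v, w) *v b) = g z (dirder a (tr x z) (v, w)) (dirder b (tr x z) (v, w))"
proof -
  have dom: "(v, w) \<in> tr_dom x z" using q A_center(1)[of z] by (simp add: tr_dom_iff z_def)
  define J where "J u = dirder u (tr x z) (v, w)" for u
  have lin: "linear J" unfolding J_def using has_derivative_linear[OF slice_derivative[OF dom]] .
  have J: "frechet_derivative (\<lambda>u. lcoord (A z) (chart_inv (A x) (u, w))) (at v) = J"
    using frechet_derivative_at[OF slice_derivative[OF dom]] unfolding J_def tr_def by simp
  have bil: "bilinear (g z)" using lr unfolding leafwise_riemannian_def by blast
  have h: "hm x (v, w) $ i $ j = g z (J (axis i 1)) (J (axis j 1))" for i j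
    unfolding hm_def local_metric_def Let_def fst_conv snd_conv z_def[symmetric] J by simp
  have JJ: "J u = (\<Sum>i\<in>UNIV. u $ i *\<^sub>R J (axis i 1))" for u
  proof -
    have "u = (\<Sum>i\<in>UNIV. u $ i *\<^sub>R axis i 1)" by (simp add: vec_eq_iff axis_def if_distrib cong: if_cong)
    then have "J u = J (\<Sum>i\<in>UNIV. u $ i *\<^sub>R axis i 1)" by simp
    then show ?thesis by (simp only: linear_sum[OF lin] linear_scale[OF lin])
  qed
  have "g z (J a) (J b) = (\<Sum>i\<in>UNIV. \<Sum>j\<in>UNIV. a $ i * (b $ j * g z (J (axis i 1)) (J (axis j 1))))"
  proof -
    have l1: "linear (\<lambda>y. g z x y)" and l2: "linear (\<lambda>x. g z x y)" for x y
      using bil by (auto simp: bilinear_def)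
    have "g z (J a) (J b) = g z (\<Sum>i\<in>UNIV. a $ i *\<^sub>R J (axis i 1)) (\<Sum>j\<in>UNIV. b $ j *\<^sub>R J (axis j 1))"
      using JJ[of a] JJ[of b] by simp
    also have "\<dots> = (\<Sum>i\<in>UNIV. a $ i *\<^sub>R g z (J (axis i 1)) (\<Sum>j\<in>UNIV. b $ j *\<^sub>R J (axis j 1)))"
      by (simp only: linear_sum[OF l2] linear_scale[OF l2])
    also have "\<dots> = (\<Sum>i\<in>UNIV. a $ i *\<^sub>R (\<Sum>j\<in>UNIV. b $ j *\<^sub>R g z (J (axis i 1)) (J (axis j 1))))"
      by (simp only: linear_sum[OF l1] linear_scale[OF l1])
    finally show ?thesis by (simp add: sum_distrib_left)
  qed
  also have "\<dots> = a \<bullet> (hm x (v, w) *v b)"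
    by (simp add: inner_vec_def matrix_vector_mult_def h sum_distrib_left mult_ac)
  finally show ?thesis by (simp add: J_def)
qed

lemma hm_symmetric:
  assumes "q \<in> dom_box x" shows "a \<bullet> (hm x q *v b) = b \<bullet> (hm x q *v a)"
  using hm_inner[of "fst q" "snd q" x] assms lr unfolding leafwise_riemannian_def by (metis prod.collapse)

lemma connected_plaque_ball:
  assumes "\<And>u. u \<in> ball v r \<Longrightarrow> (u, w) \<in> dom_box x"
  shows "connected ((\<lambda>u. chart_inv (A x) (u, w)) ` ball v r)"
proof (rule connected_continuous_image)
  show "continuous_on (ball v r) (\<lambda>u. chart_inv (A x) (u, w))"
    by (rule continuous_on_compose2[OF A_cont_inv[of x]])
      (use assms in \<open>auto intro!: continuous_on_Pair continuous_on_id continuous_on_const\<close>)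
qed (intro convex_connected convex_ball)

text \<open>A small ball in a plaque of one chart is connected, so it stays over a single transverse
  coordinate of the other chart. With that coordinate frozen, the two transition maps are inverse to
  each other.\<close>

lemma tr_inverse_near:
  assumes q: "(v, w) \<in> tr_dom x y"
  shows "\<exists>r>0. \<forall>u\<in>ball v r. (u, w) \<in> tr_dom x y \<and>
     tproj (A y) (chart_inv (A x) (u, w)) = tproj (A y) (chart_inv (A x) (v, w)) \<and>
     (tr x y (u, w), tproj (A y) (chart_inv (A x) (v, w))) \<in> tr_dom y x \<and>
     tr y x (tr x y (u, w), tproj (A y) (chart_inv (A x) (v, w))) = u \<and>
     chart_inv (A y) (tr x y (u, w), tproj (A y) (chart_inv (A x) (v, w))) = chart_inv (A x) (u, w)"
proof -
  have "open {u. (u, w) \<in> tr_dom x y}" by (rule open_slice[OF tr_dom_open])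
  then obtain r where r: "r > 0" "ball v r \<subseteq> {u. (u, w) \<in> tr_dom x y}"
    using q open_contains_ball by (metis mem_Collect_eq)
  have dom: "(u, w) \<in> dom_box x" "chart_inv (A x) (u, w) \<in> udom (A y)" if "u \<in> ball v r" for u
    using r(2) that tr_dom_iff by blast+
  have tpc: "tproj (A y) (chart_inv (A x) (u, w)) = tproj (A y) (chart_inv (A x) (v, w))" if "u \<in> ball v r" for u
  proof (rule chart_tproj_const[OF A_chart A_td connected_plaque_ball[of v r w x]])
    show "(u, w) \<in> dom_box x" if "u \<in> ball v r" for u using dom that by blast
    show "(\<lambda>u. chart_inv (A x) (u, w)) ` ball v r \<subseteq> closure (udom (A y))"
      using dom closure_subset by blast
  qed (use that r(1) in auto)
  show ?thesis
  proof (intro exI[of _ r] conjI ballI r(1))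
    fix u assume u: "u \<in> ball v r"
    let ?w = "tproj (A y) (chart_inv (A x) (v, w))"
    have inv: "chart_inv (A y) (tr x y (u, w), ?w) = chart_inv (A x) (u, w)"
      using chart_inv_lcoord_tproj[OF A_chart chart_udom_closure[OF A_chart dom(2)[OF u]]] tpc[OF u] by (simp add: tr_def)
    show "chart_inv (A y) (tr x y (u, w), ?w) = chart_inv (A x) (u, w)" by (rule inv)
    show "(u, w) \<in> tr_dom x y" using u r(2) by blast
    show "tproj (A y) (chart_inv (A x) (u, w)) = ?w" by (rule tpc[OF u])
    have "(tr x y (u, w), ?w) \<in> dom_box y"
      using chart_lcoord_mem[OF A_chart dom(2)[OF u]] chart_tproj_mem[OF A_chart dom(2)[OF u]] tpc[OF u] by (simp add: tr_def)
    then show "(tr x y (u, w), ?w) \<in> tr_dom y x"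
      unfolding tr_dom_iff inv using A_inv_udom[OF dom(1)[OF u]] by simp
    show "tr y x (tr x y (u, w), ?w) = u" unfolding tr_def[of y x] inv using A_lcoord_inv[OF dom(1)[OF u]] .
  qed
qed

text \<open>By the chain rule the derivative of the opposite transition is a left inverse. This is
  what carries positive definiteness of \<open>g\<close> over to the matrices
  \<open>hm\<close>.\<close>

lemma dirder_tr_inj:
  assumes q: "(v, w) \<in> tr_dom x y" and z: "dirder a (tr x y) (v, w) = 0"
  shows "a = 0"
proof -
  let ?w = "tproj (A y) (chart_inv (A x) (v, w))"
  obtain r where r: "r > 0" "\<And>u. u \<in> ball v r \<Longrightarrow> (tr x y (u, w), ?w) \<in> tr_dom y x \<and> tr y x (tr x y (u, w), ?w) = u"
    using tr_inverse_near[OF q] by blast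
  have "((\<lambda>u. tr y x (u, ?w)) has_derivative (\<lambda>u. dirder u (tr y x) (tr x y (v, w), ?w))) (at (tr x y (v, w)))"
    by (rule slice_derivative) (use r in auto)
  from has_derivative_compose[OF slice_derivative[OF q] this]
  have "((\<lambda>u. tr y x (tr x y (u, w), ?w)) has_derivative (\<lambda>u. dirder (dirder u (tr x y) (v, w)) (tr y x) (tr x y (v, w), ?w))) (at v)" .
  then have d: "((\<lambda>u. u) has_derivative (\<lambda>u. dirder (dirder u (tr x y) (v, w)) (tr y x) (tr x y (v, w), ?w))) (at v)"
    by (rule has_derivative_transform_within_open[where s="ball v r"]) (use r in auto)
  have "dirder (dirder a (tr x y) (v, w)) (tr y x) (tr x y (v, w), ?w) = a"
    using has_derivative_unique[OF d has_derivative_ident] by metis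
  moreover have "linear (\<lambda>u. dirder u (tr y x) (tr x y (v, w), ?w))"
    using has_derivative_linear[OF slice_derivative[of "tr x y (v, w)" ?w y x]] r by auto
  ultimately show ?thesis using z linear_0 by metis
qed

lemma hm_pos:
  assumes q: "q \<in> dom_box x" and a: "a \<noteq> 0"
  shows "a \<bullet> (hm x q *v a) > 0"
proof -
  obtain v w where vw: "q = (v, w)" by (cases q)
  let ?z = "chart_inv (A x) (v, w)"
  have "(v, w) \<in> tr_dom x ?z" using q A_center(1)[of ?z] by (simp add: tr_dom_iff vw)
  then have "dirder a (tr x ?z) (v, w) \<noteq> 0" using dirder_tr_inj a by blast
  then show ?thesis using hm_inner[of v w x a a] q lr unfolding leafwise_riemannian_def vw by simp
qed

lemma openin_fine_plaque:
  assumes "w \<in> transv (A x)" "open V" "V \<subseteq> box (- 1) 1"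
  shows "openin (fine_topology A) {z \<in> closure (udom (A x)). coord (A x) z \<in> V \<times> {w}}"
  unfolding fine_topology_def by (rule topology_generated_by_Basis) (use assms in blast)

text \<open>Around each of its points \<open>z\<close>, an open set contains its own slice along the
  plaque of the centred chart \<open>A z\<close>, and this slice is a basic fine open set.\<close>

lemma open_imp_openin_fine:
  assumes "open W" shows "openin (fine_topology A) W"
proof (subst openin_subopen, intro ballI)
  fix z assume z: "z \<in> W"
  define w where "w = tproj (A z) z"
  have w: "w \<in> interior (transv (A z))" using A_center(3) by (simp add: w_def)
  have dom: "(0, w) \<in> dom_box z" using w by (simp add: mem_box_cart)
  have inv0: "chart_inv (A z) (0, w) = z"
    using chart_inv_lcoord_tproj[OF A_chart chart_udom_closure[OF A_chart A_center(1)], of z] by (simp add: A_center w_def)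
  have "open (dom_box z \<inter> chart_inv (A z) -` W)"
    by (rule continuous_open_preimage[OF A_cont_inv chart_box_open[OF A_chart] assms])
  then have o: "open {v. (v, w) \<in> dom_box z \<inter> chart_inv (A z) -` W}" by (rule open_slice)
  define V where "V = {v. (v, w) \<in> dom_box z \<inter> chart_inv (A z) -` W}"
  define E where "E = {y \<in> closure (udom (A z)). coord (A z) y \<in> V \<times> {w}}"
  have "openin (fine_topology A) E"
    unfolding E_def using w interior_subset[of "transv (A z)"] o by (intro openin_fine_plaque) (auto simp: V_def)
  moreover have "z \<in> E"
    using z dom inv0 A_center[of z] chart_udom_closure[OF A_chart A_center(1), of z]
    by (auto simp: E_def V_def w_def chart_coord_eq[OF A_chart])
  moreover have "E \<subseteq> W"
  proof
    fix y assume "y \<in> E"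
    then have y: "y \<in> closure (udom (A z))" "coord (A z) y \<in> V \<times> {w}" by (auto simp: E_def)
    then have "chart_inv (A z) (coord (A z) y) \<in> W" by (auto simp: V_def)
    then show "y \<in> W" using chart_inv_coord[OF A_chart y(1)] by simp
  qed
  ultimately show "\<exists>T. openin (fine_topology A) T \<and> z \<in> T \<and> T \<subseteq> W" by blast
qed

lemma topspace_fine: "topspace (fine_topology A) = UNIV"
  using open_imp_openin_fine[OF open_UNIV] openin_subset by blast

lemma fine_continuous_imp_continuous:
  assumes "continuous_map (top_of_set S) (fine_topology A) f"
  shows "continuous_on S f"
proof -
  have "continuous_map (top_of_set S) euclidean f"
    unfolding continuous_map_def
  proof (intro conjI allI impI)
    fix W :: "'m set" assume "openin euclidean W"
    then have "openin (fine_topology A) W" using open_imp_openin_fine by simp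
    then show "openin (top_of_set S) {x \<in> topspace (top_of_set S). f x \<in> W}"
      using assms unfolding continuous_map_def by blast
  qed simp
  then show ?thesis by simp
qed

text \<open>A plaque of another chart need not lie in the interior of the domain of that chart; invariance
  of domain shows that it is nevertheless open in the leaf.\<close>

lemma plaque_fine_continuous:
  assumes w: "w \<in> interior (transv (A x))"
  shows "continuous_map (top_of_set (box (- 1) 1)) (fine_topology A) (\<lambda>v. chart_inv (A x) (v, w))"
  unfolding fine_topology_def
proof (rule continuous_on_generated_topo)
  let ?f = "\<lambda>v. chart_inv (A x) (v, w)"
  fix U assume "U \<in> {{z \<in> closure (udom (A x)). coord (A x) z \<in> V \<times> {w}} |x V w. w \<in> transv (A x) \<and> open V \<and> V \<subseteq> box (- 1) 1}"
  then obtain y V u where U: "U = {z \<in> closure (udom (A y)). coord (A y) z \<in> V \<times> {u}}"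
    and y: "u \<in> transv (A y)" "open V" "V \<subseteq> box (- 1) 1" by blast
  have "\<exists>T. open T \<and> v \<in> T \<and> T \<subseteq> ?f -` U \<inter> box (- 1) 1" if v: "v \<in> ?f -` U \<inter> box (- 1) 1" for v
  proof -
    define z where "z = ?f v"
    have z: "z \<in> closure (udom (A y))" "coord (A y) z \<in> V \<times> {u}" using v U by (auto simp: z_def)
    define v' where "v' = lcoord (A y) z"
    have v': "v' \<in> V" "chart_inv (A y) (v', u) = z"
      using z chart_inv_coord[OF A_chart z(1)] by (auto simp: v'_def lcoord_def)
    have zU: "z \<in> udom (A x)" using v w A_inv_udom[of "(v, w)" x] by (auto simp: z_def)
    have sub: "V \<times> {u} \<subseteq> cbox (- 1) 1 \<times> transv (A y)" using y box_subset_cbox by blast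
    have cV: "continuous_on V (\<lambda>v. chart_inv (A y) (v, u))"
      by (rule continuous_on_compose2[OF chart_cont_inv[OF A_chart[of y]]])
        (use sub in \<open>auto intro!: continuous_on_Pair continuous_on_id continuous_on_const\<close>)
    have "open (V \<inter> (\<lambda>v. chart_inv (A y) (v, u)) -` udom (A x))"
      by (rule continuous_open_preimage[OF cV y(2) chart_open[OF A_chart]])
    moreover have "v' \<in> V \<inter> (\<lambda>v. chart_inv (A y) (v, u)) -` udom (A x)" using v' zU by auto
    ultimately obtain r where r: "r > 0" "ball v' r \<subseteq> V \<inter> (\<lambda>v. chart_inv (A y) (v, u)) -` udom (A x)"
      using open_contains_ball by blast
    have bV: "ball v' r \<subseteq> V" and bU: "\<And>a. a \<in> ball v' r \<Longrightarrow> chart_inv (A y) (a, u) \<in> udom (A x)" using r(2) by auto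
    have bsub: "(a, u) \<in> cbox (- 1) 1 \<times> transv (A y)" if "a \<in> ball v' r" for a
      using that bV sub by blast
    have con: "connected ((\<lambda>v. chart_inv (A y) (v, u)) ` ball v' r)"
      by (intro connected_continuous_image[OF continuous_on_subset[OF cV bV]] convex_connected convex_ball)
    have tpw: "tproj (A x) (chart_inv (A y) (a, u)) = w" if "a \<in> ball v' r" for a
    proof -
      have "tproj (A x) (chart_inv (A y) (a, u)) = tproj (A x) (chart_inv (A y) (v', u))"
      proof (rule chart_tproj_const[OF A_chart A_td con])
        show "(\<lambda>v. chart_inv (A y) (v, u)) ` ball v' r \<subseteq> closure (udom (A x))"
          using bU closure_subset by blast
      qed (use that r(1) in auto)
      also have "\<dots> = w" using v'(2) v w A_tproj_inv[of v w x] by (simp add: z_def)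
      finally show ?thesis .
    qed
    define f where "f a = lcoord (A x) (chart_inv (A y) (a, u))" for a
    have fa: "?f (f a) = chart_inv (A y) (a, u)" if "a \<in> ball v' r" for a
      using chart_inv_lcoord_tproj[OF A_chart chart_udom_closure[OF A_chart bU[OF that]]] tpw[OF that] by (simp add: f_def)
    \<comment> \<open>The coordinate \<open>u\<close> may be a boundary point of its transversal,
      where the smoothness condition on transitions says nothing; continuity and injectivity of the
      transition are enough.\<close>
    have "open (f ` ball v' r)"
    proof (rule invariance_of_domain)
      show "continuous_on (ball v' r) f" unfolding f_def
        by (rule continuous_on_compose2[OF chart_cont_lcoord[OF A_chart] continuous_on_subset[OF cV bV]])
          (use bU closure_subset in blast)
      show "inj_on f (ball v' r)"
      proof (rule inj_onI)
        fix a b assume ab: "a \<in> ball v' r" "b \<in> ball v' r" "f a = f b"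
        then have "chart_inv (A y) (a, u) = chart_inv (A y) (b, u)" using fa by metis
        moreover have "(a, u) \<in> cbox (- 1) 1 \<times> transv (A y)" "(b, u) \<in> cbox (- 1) 1 \<times> transv (A y)"
          using bsub[OF ab(1)] bsub[OF ab(2)] .
        ultimately show "a = b" using A_coord_inv by (metis prod.inject)
      qed
    qed simp
    moreover have "v \<in> f ` ball v' r"
    proof (rule image_eqI)
      show "v = f v'" using v'(2) v w A_lcoord_inv[of v w x] by (simp add: f_def z_def)
    qed (use r in simp)
    moreover have "f ` ball v' r \<subseteq> ?f -` U \<inter> box (- 1) 1"
    proof
      fix b assume "b \<in> f ` ball v' r"
      then obtain a where a: "a \<in> ball v' r" "b = f a" by blast
      have q: "(a, u) \<in> cbox (- 1) 1 \<times> transv (A y)" using bsub[OF a(1)] .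
      have "b \<in> box (- 1) 1" using chart_lcoord_mem[OF A_chart bU[OF a(1)]] a by (simp add: f_def)
      moreover have "?f b \<in> U" using fa[OF a(1)] a chart_inv_mem[OF A_chart q] A_coord_inv[OF q] subsetD[OF bV a(1)] unfolding U by simp
      ultimately show "b \<in> ?f -` U \<inter> box (- 1) 1" by simp
    qed
    ultimately show ?thesis by blast
  qed
  then have "open (?f -` U \<inter> box (- 1) 1)" by (meson open_subopen)
  then show "openin (top_of_set (box (- 1) 1)) (?f -` U \<inter> topspace (top_of_set (box (- 1) 1)))"
    by (simp add: openin_open_eq open_box)
next
  show "(\<lambda>v. chart_inv (A x) (v, w)) ` topspace (top_of_set (box (- 1) 1)) \<subseteq>
    \<Union> {{z \<in> closure (udom (A x)). coord (A x) z \<in> V \<times> {w}} |x V w. w \<in> transv (A x) \<and> open V \<and> V \<subseteq> box (- 1) 1}"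
    using topspace_fine unfolding fine_topology_def topology_generated_by_topspace by simp
qed

end

section \<open>Leafwise distance in coordinates\<close>

text \<open>The derivative is given outside a finite set and may be unbounded near it, in agreement
  with the piecewise $C^1$ condition on leafwise paths.\<close>

definition pw_curve :: "real set \<Rightarrow> (real \<Rightarrow> 'a::real_normed_vector) \<Rightarrow> (real \<Rightarrow> 'a) \<Rightarrow> real set \<Rightarrow> bool" where
  "pw_curve I q q' S \<longleftrightarrow> continuous_on I q \<and> finite S \<and>
     (\<forall>t\<in>I - S. (q has_vector_derivative q' t) (at t)) \<and> continuous_on (I - S) q'"

definition clen :: "(real^'n \<Rightarrow> real^'n^'n) \<Rightarrow> (real \<Rightarrow> real^'n) \<Rightarrow> (real \<Rightarrow> real^'n) \<Rightarrow> ennreal" where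
  "clen h q q' = (\<integral>\<^sup>+ t \<in> {0..1}. ennreal (sqrt (q' t \<bullet> (h (q t) *v q' t))) \<partial>lborel)"

lemma AE_finite_lborel: "finite (S :: real set) \<Longrightarrow> AE t in lborel. t \<notin> S"
  by (intro AE_not_in finite_imp_null_set_lborel)

text \<open>If the length is infinite there is nothing to prove. Otherwise the derivative is
  Lebesgue integrable, and its integral equals the increment of the curve by the fundamental theorem
  for the gauge integral, which tolerates finitely many exceptional points even when the derivative
  is unbounded.\<close>

lemma curve_displacement_le:
  fixes q :: "real \<Rightarrow> 'a::euclidean_space"
  assumes "a \<le> b" and q: "pw_curve {a..b} q q' S"
  shows "ennreal (norm (q b - q a)) \<le> (\<integral>\<^sup>+ t \<in> {a..b}. ennreal (norm (q' t)) \<partial>lborel)"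
proof -
  have S: "finite S" and cq: "continuous_on {a..b} q" and cq': "continuous_on ({a..b} - S) q'"
    and der: "\<And>t. t \<in> {a..b} - S \<Longrightarrow> (q has_vector_derivative q' t) (at t)"
    using q by (auto simp: pw_curve_def)
  define f where "f t = indicator ({a..b} - S) t *\<^sub>R q' t" for t
  have "{a..b} - S \<in> sets borel" using S by (intro sets.Diff) (auto intro: borel_closed finite_imp_closed)
  then have meas: "f \<in> borel_measurable borel"
    unfolding f_def[abs_def] using cq' by (rule borel_measurable_continuous_on_indicator)
  have eq: "(\<integral>\<^sup>+ t. ennreal (norm (f t)) \<partial>lborel) = (\<integral>\<^sup>+ t \<in> {a..b}. ennreal (norm (q' t)) \<partial>lborel)"
    using AE_finite_lborel[OF S] by (intro nn_integral_cong_AE) (auto simp: f_def indicator_def elim!: eventually_mono)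
  show ?thesis
  proof (cases "(\<integral>\<^sup>+ t. ennreal (norm (f t)) \<partial>lborel) = \<infinity>")
    case True
    then show ?thesis using eq by simp
  next
    case False
    then have int: "integrable lborel f"
      using meas by (intro integrableI_bounded) (auto simp: less_top)
    have "(f has_integral (integral\<^sup>L lborel f)) UNIV" by (rule has_integral_integral_lborel[OF int])
    moreover have "(f has_integral (q b - q a)) UNIV"
    proof -
      have "(q' has_integral (q b - q a)) {a..b}"
        by (rule fundamental_theorem_of_calculus_interior_strong[OF S assms(1) _ cq]) (use der in auto)
      then have "(f has_integral (q b - q a)) {a..b}"
        by (rule has_integral_spike_finite[OF S, rotated]) (auto simp: f_def)
      then show ?thesis
        by (rule has_integral_on_superset) (auto simp: f_def)
    qed
    ultimately have "integral\<^sup>L lborel f = q b - q a" by (rule has_integral_unique)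
    then show ?thesis using integral_norm_bound_ennreal[OF int] eq by simp
  qed
qed

lemma quad_speed_continuous:
  fixes q q' :: "real \<Rightarrow> real^'n"
  assumes "continuous_on I q" "continuous_on I q'" "continuous_on B h" "\<And>t. t \<in> I \<Longrightarrow> q t \<in> B"
  shows "continuous_on I (\<lambda>t. q' t \<bullet> (h (q t) *v q' t))"
proof -
  have "continuous_on I (\<lambda>t. h (q t))" using assms by (intro continuous_on_compose2[OF assms(3)]) auto
  then have "continuous_on I (\<lambda>t. \<Sum>i\<in>UNIV. \<Sum>j\<in>UNIV. q' t $ i * (h (q t) $ i $ j * q' t $ j))"
    using assms(2) by (intro continuous_on_sum continuous_on_mult continuous_on_component)
  then show ?thesis by (simp add: inner_vec_def matrix_vector_mult_def sum_distrib_left)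
qed

text \<open>A pointwise comparison of speeds passes to lengths, and only the speed of the reference
  curve \<open>q\<close> has to be measurable. The affine form \<open>\<alpha> * _ + \<beta>\<close>
  covers curves that are scaled as well as curves with an added drift.\<close>

lemma clen_transfer:
  fixes q q' p p' :: "real \<Rightarrow> real^'n"
  assumes q: "pw_curve {0..1} q q' S" and B: "continuous_on B h" "\<And>t. t \<in> {0..1} \<Longrightarrow> q t \<in> B"
    and \<alpha>: "\<alpha> \<ge> 0" "\<beta> \<ge> 0"
    and le: "\<And>t. t \<in> {0..1} - S \<Longrightarrow> sqrt (p' t \<bullet> (k (p t) *v p' t)) \<le> \<alpha> * sqrt (q' t \<bullet> (h (q t) *v q' t)) + \<beta>"
  shows "clen k p p' \<le> ennreal \<alpha> * clen h q q' + ennreal \<beta>"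
proof -
  have S: "finite S" and cq: "continuous_on {0..1} q" and cq': "continuous_on ({0..1} - S) q'"
    using q by (auto simp: pw_curve_def)
  define F where "F t = indicator ({0..1} - S) t *\<^sub>R sqrt (q' t \<bullet> (h (q t) *v q' t))" for t
  have "{0..1} - S \<in> sets borel" using S by (intro sets.Diff) (auto intro: borel_closed finite_imp_closed)
  moreover have "continuous_on ({0..1} - S) (\<lambda>t. sqrt (q' t \<bullet> (h (q t) *v q' t)))"
    by (intro continuous_on_real_sqrt quad_speed_continuous[OF continuous_on_subset[OF cq] cq' B(1)]) (use B in auto)
  ultimately have meas: "F \<in> borel_measurable borel"
    unfolding F_def[abs_def] by (rule borel_measurable_continuous_on_indicator)
  then have meas': "(\<lambda>t. ennreal (F t)) \<in> borel_measurable lborel" by simp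
  have F: "clen h q q' = (\<integral>\<^sup>+ t. ennreal (F t) \<partial>lborel)" unfolding clen_def
    using AE_finite_lborel[OF S] by (intro nn_integral_cong_AE) (auto simp: F_def indicator_def elim!: eventually_mono)
  have "clen k p p' \<le> (\<integral>\<^sup>+ t. ennreal \<alpha> * ennreal (F t) + ennreal \<beta> * indicator {0..1::real} t \<partial>lborel)"
    unfolding clen_def
  proof (rule nn_integral_mono_AE, rule AE_mp[OF AE_finite_lborel[OF S]], rule AE_I2, rule impI)
    fix t :: real assume "t \<notin> S"
    show "ennreal (sqrt (p' t \<bullet> (k (p t) *v p' t))) * indicator {0..1} t \<le> ennreal \<alpha> * ennreal (F t) + ennreal \<beta> * indicator {0..1} t"
    proof (cases "t \<in> {0..1}")
      case True
      define y where "y = sqrt (q' t \<bullet> (h (q t) *v q' t))"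
      have y: "F t = y" using True \<open>t \<notin> S\<close> by (simp add: F_def y_def)
      have l: "sqrt (p' t \<bullet> (k (p t) *v p' t)) \<le> \<alpha> * y + \<beta>" using le[of t] True \<open>t \<notin> S\<close> by (simp add: y_def)
      show ?thesis
      proof (cases "y \<ge> 0")
        case pos: True
        have "ennreal (sqrt (p' t \<bullet> (k (p t) *v p' t))) \<le> ennreal (\<alpha> * y + \<beta>)" by (rule ennreal_leI[OF l])
        also have "\<dots> = ennreal \<alpha> * ennreal y + ennreal \<beta>" using \<alpha> pos by (simp add: ennreal_plus ennreal_mult)
        finally show ?thesis using True y by simp
      next
        \<comment> \<open>The field \<open>h\<close> is not assumed positive here, and
          \<open>sqrt\<close> of a negative number is negative.\<close>
        case False
        then have "\<alpha> * y \<le> 0" using \<alpha> by (simp add: mult_nonneg_nonpos)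
        then have "sqrt (p' t \<bullet> (k (p t) *v p' t)) \<le> \<beta>" using l by linarith
        then have "ennreal (sqrt (p' t \<bullet> (k (p t) *v p' t))) \<le> ennreal \<beta>" by (rule ennreal_leI)
        then show ?thesis using True by (simp add: add_increasing)
      qed
    qed simp
  qed
  also have "\<dots> = ennreal \<alpha> * (\<integral>\<^sup>+ t. ennreal (F t) \<partial>lborel) + ennreal \<beta> * (\<integral>\<^sup>+ t. indicator {0..1::real} t \<partial>lborel)"
    using meas' by (subst nn_integral_add) (auto simp: nn_integral_cmult)
  also have "\<dots> = ennreal \<alpha> * clen h q q' + ennreal \<beta>" by (simp add: F)
  finally show ?thesis .
qed

context riemannian_matchbox
begin

text \<open>The velocity at time \<open>t\<close> is measured in the chart centred at
  \<open>\<gamma> t\<close>; the chain rule writes it as the image of \<open>q'\<close> under the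
  derivative of the transition map that also defines the metric matrix, so the two changes of
  coordinates cancel.\<close>

lemma speed_eq:
  assumes t: "t \<in> {0..1}" and w: "w \<in> interior (transv (A x))" and qt: "q t \<in> box (- 1) 1"
    and der: "(q has_vector_derivative q') (at t within {0..1})"
    and d: "d > 0" "\<And>s. s \<in> {0..1} \<Longrightarrow> dist s t < d \<Longrightarrow> \<gamma> s = chart_inv (A x) (q s, w)"
  shows "g (\<gamma> t) (velocity A \<gamma> t) (velocity A \<gamma> t) = q' \<bullet> (hm x (q t, w) *v q')"
proof -
  have dom: "(q t, w) \<in> dom_box x" using qt w by simp
  have \<gamma>t: "\<gamma> t = chart_inv (A x) (q t, w)" using d t by simp
  have trd: "(q t, w) \<in> tr_dom x (\<gamma> t)" using dom A_center(1)[of "\<gamma> t"] \<gamma>t by (simp add: tr_dom_iff)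
  have lin: "linear (\<lambda>u. dirder u (tr x (\<gamma> t)) (q t, w))" using has_derivative_linear[OF slice_derivative[OF trd]] .
  have "((\<lambda>s. tr x (\<gamma> t) (q s, w)) has_derivative (\<lambda>h. dirder (h *\<^sub>R q') (tr x (\<gamma> t)) (q t, w))) (at t within {0..1})"
    using has_derivative_compose[OF der[unfolded has_vector_derivative_def] slice_derivative[OF trd]] .
  then have "((\<lambda>s. tr x (\<gamma> t) (q s, w)) has_vector_derivative dirder q' (tr x (\<gamma> t)) (q t, w)) (at t within {0..1})"
    unfolding has_vector_derivative_def using linear_scale[OF lin] by simp
  then have "((\<lambda>s. lcoord (A (\<gamma> t)) (\<gamma> s)) has_vector_derivative dirder q' (tr x (\<gamma> t)) (q t, w)) (at t within {0..1})"
    by (rule has_vector_derivative_transform_within[OF _ d(1) t]) (simp add: d(2) tr_def)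
  then have "velocity A \<gamma> t = dirder q' (tr x (\<gamma> t)) (q t, w)"
    unfolding velocity_def using t by (intro vector_derivative_within_closed_interval) auto
  then show ?thesis using hm_inner[OF dom, of q' q'] \<gamma>t by simp
qed

lemma coord_path_leafwise:
  assumes q: "pw_curve {0..1} q q' S" and w: "w \<in> interior (transv (A x))" and qb: "\<And>t. t \<in> {0..1} \<Longrightarrow> q t \<in> box (- 1) 1"
  shows "leafwise_path A (\<lambda>t. chart_inv (A x) (q t, w))"
  unfolding leafwise_path_def
proof (intro conjI allI impI)
  have S: "finite S" and cq: "continuous_on {0..1} q" and cq': "continuous_on ({0..1} - S) q'"
    and der: "\<And>t. t \<in> {0..1} - S \<Longrightarrow> (q has_vector_derivative q' t) (at t)"
    using q by (auto simp: pw_curve_def)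
  have cm: "continuous_map (top_of_set {0..1}) (top_of_set (box (- 1) 1)) q"
    using cq qb by (auto simp: continuous_map_in_subtopology)
  show fc: "continuous_map (top_of_set {0..1}) (fine_topology A) (\<lambda>t. chart_inv (A x) (q t, w))"
    using continuous_map_compose[OF cm plaque_fine_continuous[OF w]] by (simp add: o_def)
  fix y a b assume ab: "0 \<le> a \<and> a < b \<and> b \<le> 1 \<and> (\<lambda>t. chart_inv (A x) (q t, w)) ` {a..b} \<subseteq> udom (A y)"
  have sub: "{a..b} \<subseteq> {0..1}" using ab by auto
  have trd: "(q t, w) \<in> tr_dom x y" if "t \<in> {a..b}" for t
    using that sub qb w ab by (auto simp: tr_dom_iff)
  have eq: "(\<lambda>t. lcoord (A y) (chart_inv (A x) (q t, w))) = (\<lambda>t. tr x y (q t, w))" by (simp add: tr_def)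
  have cqw: "continuous_on I (\<lambda>t. (q t, w))" if "continuous_on I q" for I
    by (intro continuous_on_Pair that continuous_on_const)
  show "(\<lambda>t. lcoord (A y) (chart_inv (A x) (q t, w))) piecewise_C1_differentiable_on {a..b}"
    unfolding eq piecewise_C1_differentiable_on_def
  proof (intro conjI exI[of _ S] S)
    show "continuous_on {a..b} (\<lambda>t. tr x y (q t, w))"
      by (rule continuous_on_compose2[OF ck_imp_continuous[OF tr_ck[of 0]] cqw[OF continuous_on_subset[OF cq sub]]])
        (use trd in auto)
    show "(\<lambda>t. tr x y (q t, w)) C1_differentiable_on {a..b} - S"
      unfolding C1_differentiable_on_def
    proof (intro exI[of _ "\<lambda>t. dirder (q' t) (tr x y) (q t, w)"] conjI ballI)
      fix t assume t: "t \<in> {a..b} - S"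
      have lin: "linear (\<lambda>u. dirder u (tr x y) (q t, w))" using has_derivative_linear[OF slice_derivative[OF trd]] t by blast
      have "((\<lambda>s. tr x y (q s, w)) has_derivative (\<lambda>h. dirder (h *\<^sub>R q' t) (tr x y) (q t, w))) (at t)"
        using has_derivative_compose[OF der[unfolded has_vector_derivative_def] slice_derivative[OF trd]] t sub by blast
      then show "((\<lambda>s. tr x y (q s, w)) has_vector_derivative dirder (q' t) (tr x y) (q t, w)) (at t)"
        unfolding has_vector_derivative_def using linear_scale[OF lin] by simp
    next
      have e: "dirder (q' t) (tr x y) (q t, w) = (\<Sum>b\<in>Basis. (q' t \<bullet> b) *\<^sub>R dirder b (tr x y) (q t, w))" if "t \<in> {a..b} - S" for t
      proof -
        have lin: "linear (\<lambda>u. dirder u (tr x y) (q t, w))" using has_derivative_linear[OF slice_derivative[OF trd]] that by blast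
        have "dirder (q' t) (tr x y) (q t, w) = dirder (\<Sum>b\<in>Basis. (q' t \<bullet> b) *\<^sub>R b) (tr x y) (q t, w)"
          by (simp add: euclidean_representation)
        then show ?thesis by (simp only: linear_sum[OF lin] linear_scale[OF lin])
      qed
      have sub': "{a..b} - S \<subseteq> {0..1} - S" using sub by auto
      have "continuous_on ({a..b} - S) (\<lambda>t. \<Sum>b\<in>Basis. (q' t \<bullet> b) *\<^sub>R dirder b (tr x y) (q t, w))"
      proof (intro continuous_on_sum continuous_on_scaleR continuous_on_inner continuous_on_const)
        show "continuous_on ({a..b} - S) q'" by (rule continuous_on_subset[OF cq' sub'])
        show "continuous_on ({a..b} - S) (\<lambda>t. dirder i (tr x y) (q t, w))" for i
          by (rule continuous_on_compose2[OF ck_imp_continuous[OF ck_dirder[OF tr_ck[of "Suc 0"]]] cqw[OF continuous_on_subset[OF cq]]])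
            (use trd sub in auto)
      qed
      then show "continuous_on ({a..b} - S) (\<lambda>t. dirder (q' t) (tr x y) (q t, w))"
        by (rule continuous_on_eq) (simp add: e)
    qed
  qed
qed

lemma coord_path_len:
  assumes q: "pw_curve {0..1} q q' S" and w: "w \<in> interior (transv (A x))" and qb: "\<And>t. t \<in> {0..1} \<Longrightarrow> q t \<in> box (- 1) 1"
  shows "path_len A g (\<lambda>t. chart_inv (A x) (q t, w)) = clen (\<lambda>v. hm x (v, w)) q q'"
  unfolding path_len_def clen_def
proof (rule nn_integral_cong_AE, rule AE_mp[OF AE_finite_lborel[of S]], goal_cases)
  case 1
  show ?case using q by (simp add: pw_curve_def)
next
  case 2
  show ?case
  proof (rule AE_I2, rule impI)
  fix t assume "t \<notin> S"
  show "ennreal (sqrt (g (chart_inv (A x) (q t, w)) (velocity A (\<lambda>t. chart_inv (A x) (q t, w)) t)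
       (velocity A (\<lambda>t. chart_inv (A x) (q t, w)) t))) * indicator {0..1} t =
     ennreal (sqrt (q' t \<bullet> (hm x (q t, w) *v q' t))) * indicator {0..1} t"
  proof (cases "t \<in> {0..1}")
    case True
    then have "(q has_vector_derivative q' t) (at t within {0..1})"
      using q \<open>t \<notin> S\<close> by (auto simp: pw_curve_def intro: has_vector_derivative_at_within)
    from speed_eq[OF True w qb[OF True] this zero_less_one, where \<gamma>="\<lambda>t. chart_inv (A x) (q t, w)"]
    show ?thesis by simp
  qed simp
  qed
qed

lemma leaf_dist_le_clen:
  assumes q: "pw_curve {0..1} q q' S" and w: "w \<in> interior (transv (A x))" and qb: "\<And>t. t \<in> {0..1} \<Longrightarrow> q t \<in> box (- 1) 1"
  shows "leaf_dist A g (chart_inv (A x) (q 0, w)) (chart_inv (A x) (q 1, w)) \<le> clen (\<lambda>v. hm x (v, w)) q q'"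
proof -
  have "leaf_dist A g (chart_inv (A x) (q 0, w)) (chart_inv (A x) (q 1, w))
     \<le> path_len A g (\<lambda>t. chart_inv (A x) (q t, w))"
    unfolding leaf_dist_def by (rule INF_lower) (use coord_path_leafwise[OF assms] in simp)
  then show ?thesis using coord_path_len[OF assms] by (simp only:)
qed

text \<open>While the path stays in one chart it stays in one plaque, by connectedness. The speed
  formula is restricted to the open interval because it needs the coordinate form of the path on a
  whole neighbourhood of \<open>t\<close>.\<close>

lemma leafwise_path_coords:
  assumes \<gamma>: "leafwise_path A \<gamma>" and ab: "0 \<le> a" "a < b" "b \<le> 1" and sub: "\<gamma> ` {a..b} \<subseteq> udom (A x)"
    and w: "\<gamma> a = chart_inv (A x) (v0, w)" "(v0, w) \<in> dom_box x"
  obtains q' S where "pw_curve {a..b} (\<lambda>t. lcoord (A x) (\<gamma> t)) q' S"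
    "\<And>t. t \<in> {a..b} \<Longrightarrow> lcoord (A x) (\<gamma> t) \<in> box (- 1) 1 \<and> \<gamma> t = chart_inv (A x) (lcoord (A x) (\<gamma> t), w)"
    "\<And>t. t \<in> {a<..<b} - S \<Longrightarrow>
       g (\<gamma> t) (velocity A \<gamma> t) (velocity A \<gamma> t) = q' t \<bullet> (hm x (lcoord (A x) (\<gamma> t), w) *v q' t)"
proof -
  have c\<gamma>: "continuous_on {0..1} \<gamma>" using \<gamma> fine_continuous_imp_continuous by (auto simp: leafwise_path_def)
  have sub01: "{a..b} \<subseteq> {0..1}" using ab by auto
  have con: "connected (\<gamma> ` {a..b})"
    by (rule connected_continuous_image[OF continuous_on_subset[OF c\<gamma> sub01]]) simp
  have w': "w \<in> interior (transv (A x))" using w by simp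
  have tp: "tproj (A x) (\<gamma> t) = w" if "t \<in> {a..b}" for t
  proof -
    have "tproj (A x) (\<gamma> t) = tproj (A x) (\<gamma> a)"
    proof (rule chart_tproj_const[OF A_chart A_td con])
      show "\<gamma> ` {a..b} \<subseteq> closure (udom (A x))" using sub closure_subset by blast
    qed (use that ab in auto)
    then show ?thesis using w A_tproj_inv by simp
  qed
  have c: "lcoord (A x) (\<gamma> t) \<in> box (- 1) 1 \<and> \<gamma> t = chart_inv (A x) (lcoord (A x) (\<gamma> t), w)" if "t \<in> {a..b}" for t
  proof -
    have u: "\<gamma> t \<in> udom (A x)" using sub that by blast
    show ?thesis using chart_lcoord_mem[OF A_chart u]
        chart_inv_lcoord_tproj[OF A_chart chart_udom_closure[OF A_chart u]] tp[OF that] by simp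
  qed
  have "(\<lambda>t. lcoord (A x) (\<gamma> t)) piecewise_C1_differentiable_on {a..b}"
    using \<gamma> ab sub unfolding leafwise_path_def by blast
  then obtain S q' where S: "finite S" "continuous_on {a..b} (\<lambda>t. lcoord (A x) (\<gamma> t))"
    and q': "\<And>t. t \<in> {a..b} - S \<Longrightarrow> ((\<lambda>t. lcoord (A x) (\<gamma> t)) has_vector_derivative q' t) (at t)" "continuous_on ({a..b} - S) q'"
    unfolding piecewise_C1_differentiable_on_def C1_differentiable_on_def by blast
  show ?thesis
  proof (rule that[of q' S])
    show "pw_curve {a..b} (\<lambda>t. lcoord (A x) (\<gamma> t)) q' S" using S q' by (simp add: pw_curve_def)
    fix t assume t: "t \<in> {a<..<b} - S"
    show "g (\<gamma> t) (velocity A \<gamma> t) (velocity A \<gamma> t) = q' t \<bullet> (hm x (lcoord (A x) (\<gamma> t), w) *v q' t)"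
    proof (rule speed_eq[OF _ w' _ _, of t "\<lambda>t. lcoord (A x) (\<gamma> t)" "q' t" "min (t - a) (b - t)" \<gamma>])
      show "((\<lambda>t. lcoord (A x) (\<gamma> t)) has_vector_derivative q' t) (at t within {0..1})"
        using q'(1)[of t] t by (auto intro: has_vector_derivative_at_within)
      show "\<gamma> s = chart_inv (A x) (lcoord (A x) (\<gamma> s), w)" if "s \<in> {0..1}" "dist s t < min (t - a) (b - t)" for s
        using c[of s] that by (auto simp: dist_real_def abs_less_iff)
    qed (use t ab c in auto)
  qed (use c in auto)
qed

text \<open>To leave a coordinate ball of radius \<open>r\<close>, a path must first travel a
  coordinate distance \<open>r\<close> inside the closed ball, which costs length at least
  \<open>l * r\<close>.\<close>

lemma leafwise_path_confined:
  assumes \<gamma>: "leafwise_path A \<gamma>" and \<gamma>0: "\<gamma> 0 = chart_inv (A x) (v1, w)" and w: "w \<in> interior (transv (A x))"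
    and r: "r > 0" "cball v1 r \<subseteq> box (- 1) 1" and l: "l > 0"
    and lower: "\<And>v a. v \<in> cball v1 r \<Longrightarrow> l * norm a \<le> sqrt (a \<bullet> (hm x (v, w) *v a))"
    and len: "path_len A g \<gamma> < ennreal (l * r)" and t: "t \<in> {0..1}"
  shows "\<gamma> t \<in> (\<lambda>v. chart_inv (A x) (v, w)) ` ball v1 r"
proof (rule ccontr)
  assume bad: "\<gamma> t \<notin> (\<lambda>v. chart_inv (A x) (v, w)) ` ball v1 r"
  let ?E = "(\<lambda>v. chart_inv (A x) (v, w)) ` ball v1 r"
  have bb: "ball v1 r \<subseteq> box (- 1) 1" using r(2) ball_subset_cball by blast
  have wT: "w \<in> transv (A x)" using w interior_subset by blast
  have dom: "(v, w) \<in> dom_box x" if "v \<in> cball v1 r" for v using that r(2) w by blast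
  have E: "?E = {z \<in> closure (udom (A x)). coord (A x) z \<in> ball v1 r \<times> {w}}"
  proof (intro equalityI subsetI)
    fix z assume "z \<in> ?E"
    then obtain v where v: "v \<in> ball v1 r" "z = chart_inv (A x) (v, w)" by blast
    have "(v, w) \<in> cbox (- 1) 1 \<times> transv (A x)" using dom[of v] v(1) chart_box_sub[OF A_chart, of x] by (auto simp: less_imp_le)
    then show "z \<in> {z \<in> closure (udom (A x)). coord (A x) z \<in> ball v1 r \<times> {w}}"
      using chart_inv_mem[OF A_chart] A_coord_inv v by auto
  next
    fix z assume z: "z \<in> {z \<in> closure (udom (A x)). coord (A x) z \<in> ball v1 r \<times> {w}}"
    then have "z = chart_inv (A x) (lcoord (A x) z, w)" "lcoord (A x) z \<in> ball v1 r"
      using chart_inv_coord[OF A_chart, of z x] by (auto simp: lcoord_def mem_Times_iff)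
    then show "z \<in> ?E" by blast
  qed
  have "openin (fine_topology A) ?E" unfolding E using openin_fine_plaque[OF wT open_ball bb] .
  then have "openin (top_of_set {0..1}) {s \<in> {0..1}. \<gamma> s \<in> ?E}"
    using \<gamma> unfolding leafwise_path_def continuous_map_def by auto
  from closedin_diff[OF closedin_topspace this]
  have cl: "closedin (top_of_set {0..1}) ({0..1} - {s \<in> {0..1}. \<gamma> s \<in> ?E})" by simp
  have "closed ({0..1} - {s \<in> {0..1}. \<gamma> s \<in> ?E})" by (rule closedin_closed_trans[OF cl closed_atLeastAtMost])
  moreover have Neq: "{0..1} - {s \<in> {0..1}. \<gamma> s \<in> ?E} = {s \<in> {0..1}. \<gamma> s \<notin> ?E}" by blast
  ultimately have cN: "compact {s \<in> {0..1}. \<gamma> s \<notin> ?E}"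
    using compact_Int_closed[OF compact_Icc[of 0 "1::real"], of "{s \<in> {0..1}. \<gamma> s \<notin> ?E}"] by (simp only: Neq Int_absorb1 Collect_restrict)
  \<comment> \<open>The slice over the open ball is open in the leaf, so the exit times form a
    compact set and there is a first one.\<close>
  obtain t1 where t1: "t1 \<in> {0..1}" "\<gamma> t1 \<notin> ?E" and min: "\<And>s. s \<in> {0..1} \<Longrightarrow> \<gamma> s \<notin> ?E \<Longrightarrow> t1 \<le> s"
  proof -
    have ne: "{s \<in> {0..1}. \<gamma> s \<notin> ?E} \<noteq> {}" using bad t by blast
    show ?thesis using compact_attains_inf[OF cN ne] that by blast
  qed
  have "\<gamma> 0 \<in> ?E" using \<gamma>0 r(1) by auto
  then have pos: "t1 > 0" using t1 by (cases "t1 = 0") auto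
  have before: "\<gamma> s \<in> ?E" if "0 \<le> s" "s < t1" for s using min[of s] that t1(1) by auto
  define K where "K = (\<lambda>v. chart_inv (A x) (v, w)) ` cball v1 r"
  have "compact K" unfolding K_def
  proof (rule compact_continuous_image[OF _ compact_cball])
    show "continuous_on (cball v1 r) (\<lambda>v. chart_inv (A x) (v, w))"
      by (rule continuous_on_compose2[OF A_cont_inv[of x]])
        (use dom in \<open>auto intro!: continuous_on_Pair continuous_on_id continuous_on_const\<close>)
  qed
  then have "closed K" by (rule compact_imp_closed)
  have c\<gamma>: "continuous_on {0..1} \<gamma>" using \<gamma> fine_continuous_imp_continuous by (auto simp: leafwise_path_def)
  have EK: "?E \<subseteq> K" unfolding K_def by (intro image_mono ball_subset_cball)
  \<comment> \<open>The slice over the closed ball is compact, hence closed, so the path is still in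
    it at the exit time and the coordinates remain available up to that moment.\<close>
  have subK: "\<gamma> ` {0..t1} \<subseteq> K"
  proof -
    have "continuous_on (closure {0..<t1}) \<gamma>" using pos t1(1) by (intro continuous_on_subset[OF c\<gamma>]) auto
    then have "\<gamma> ` closure {0..<t1} \<subseteq> K"
      using before EK by (intro image_closure_subset \<open>closed K\<close>) auto
    then show ?thesis using pos by simp
  qed
  have KU: "K \<subseteq> udom (A x)" unfolding K_def using dom A_inv_udom by blast
  have dom1: "(v1, w) \<in> dom_box x" using dom[of v1] r(1) by simp
  have sub: "\<gamma> ` {0..t1} \<subseteq> udom (A x)" using subK KU by blast
  have t1': "t1 \<le> 1" using t1 by simp
  obtain q' S where q: "pw_curve {0..t1} (\<lambda>t. lcoord (A x) (\<gamma> t)) q' S"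
    and sp: "\<And>t. t \<in> {0<..<t1} - S \<Longrightarrow>
       g (\<gamma> t) (velocity A \<gamma> t) (velocity A \<gamma> t) = q' t \<bullet> (hm x (lcoord (A x) (\<gamma> t), w) *v q' t)"
    using leafwise_path_coords[OF \<gamma> order_refl pos t1' sub \<gamma>0 dom1] by metis
  have qK: "lcoord (A x) (\<gamma> s) \<in> cball v1 r" if s: "s \<in> {0..t1}" for s
  proof -
    have "\<gamma> s \<in> K" using subK s by blast
    then obtain v where v: "v \<in> cball v1 r" "\<gamma> s = chart_inv (A x) (v, w)" unfolding K_def by blast
    then show ?thesis using A_lcoord_inv[OF dom[OF v(1)]] by simp
  qed
  have "norm (lcoord (A x) (\<gamma> t1) - lcoord (A x) (\<gamma> 0)) \<ge> r"
  proof (rule ccontr)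
    assume "\<not> ?thesis"
    then have n: "lcoord (A x) (\<gamma> t1) \<in> ball v1 r"
      using A_lcoord_inv[OF dom1] \<gamma>0 by (simp add: dist_norm norm_minus_commute)
    have "\<gamma> t1 \<in> K" using subK pos by auto
    then obtain v where v: "v \<in> cball v1 r" "\<gamma> t1 = chart_inv (A x) (v, w)" unfolding K_def by blast
    then have "v = lcoord (A x) (\<gamma> t1)" using A_lcoord_inv[OF dom[OF v(1)]] by simp
    then show False using n v(2) t1(2) by blast
  qed
  then have "ennreal (l * r) \<le> ennreal (norm (l *\<^sub>R lcoord (A x) (\<gamma> t1) - l *\<^sub>R lcoord (A x) (\<gamma> 0)))"
    using l by (intro ennreal_leI) (simp add: scaleR_diff_right[symmetric])
  also have "\<dots> \<le> (\<integral>\<^sup>+ t \<in> {0..t1}. ennreal (norm (l *\<^sub>R q' t)) \<partial>lborel)"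
  proof (rule curve_displacement_le)
    show "pw_curve {0..t1} (\<lambda>t. l *\<^sub>R lcoord (A x) (\<gamma> t)) (\<lambda>t. l *\<^sub>R q' t) S"
      using q unfolding pw_curve_def by (auto intro!: continuous_on_scaleR continuous_on_const bounded_linear.has_vector_derivative[OF bounded_linear_scaleR_right])
  qed (use pos in simp)
  also have "\<dots> \<le> path_len A g \<gamma>" unfolding path_len_def
  proof (rule nn_integral_mono_AE, rule AE_mp[OF AE_finite_lborel[of "S \<union> {0, t1}"]])
    show "finite (S \<union> {0, t1})" using q by (simp add: pw_curve_def)
    show "AE s in lborel. s \<notin> S \<union> {0, t1} \<longrightarrow> ennreal (norm (l *\<^sub>R q' s)) * indicator {0..t1} s
        \<le> ennreal (sqrt (g (\<gamma> s) (velocity A \<gamma> s) (velocity A \<gamma> s))) * indicator {0..1} s"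
    proof (rule AE_I2, rule impI)
      fix s assume s: "s \<notin> S \<union> {0, t1}"
      show "ennreal (norm (l *\<^sub>R q' s)) * indicator {0..t1} s
        \<le> ennreal (sqrt (g (\<gamma> s) (velocity A \<gamma> s) (velocity A \<gamma> s))) * indicator {0..1} s"
      proof (cases "s \<in> {0..t1}")
        case True
        then have "s \<in> {0<..<t1} - S" using s by auto
        then show ?thesis using sp[of s] lower[OF qK[OF True], of "q' s"] True t1' l by (auto intro!: ennreal_leI)
      qed simp
    qed
  qed
  finally show False using len by simp
qed

text \<open>For distances below the confinement threshold \<open>l * r\<close>, a nearly minimal
  path runs entirely in one coordinate ball of one plaque and can be treated as a curve in Euclidean
  space.\<close>

lemma leaf_dist_coords:
  assumes w: "w \<in> interior (transv (A x))"
    and r: "r > 0" "cball v1 r \<subseteq> box (- 1) 1" and l: "l > 0"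
    and lower: "\<And>v a. v \<in> cball v1 r \<Longrightarrow> l * norm a \<le> sqrt (a \<bullet> (hm x (v, w) *v a))"
    and d: "leaf_dist A g (chart_inv (A x) (v1, w)) z < ennreal L" and L: "L \<le> l * r"
  obtains q q' S where "pw_curve {0..1} q q' S" "q 0 = v1" "\<And>t. t \<in> {0..1} \<Longrightarrow> q t \<in> ball v1 r"
    "z = chart_inv (A x) (q 1, w)" "clen (\<lambda>v. hm x (v, w)) q q' < ennreal L"
proof -
  obtain \<gamma> where \<gamma>: "leafwise_path A \<gamma>" "\<gamma> 0 = chart_inv (A x) (v1, w)" "\<gamma> 1 = z" "path_len A g \<gamma> < ennreal L"
    using d unfolding leaf_dist_def INF_less_iff by blast
  have pl: "path_len A g \<gamma> < ennreal (l * r)" using less_le_trans[OF \<gamma>(4) ennreal_leI[OF L]] .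
  have conf: "\<gamma> t \<in> (\<lambda>v. chart_inv (A x) (v, w)) ` ball v1 r" if "t \<in> {0..1}" for t
    by (rule leafwise_path_confined[OF \<gamma>(1,2) w r l _ pl that]) (rule lower)
  have bb: "ball v1 r \<subseteq> box (- 1) 1" using r(2) ball_subset_cball by blast
  have dom: "(v, w) \<in> dom_box x" if "v \<in> ball v1 r" for v using that bb w by blast
  have sub: "\<gamma> ` {0..1} \<subseteq> udom (A x)"
  proof
    fix y assume "y \<in> \<gamma> ` {0..1}"
    then obtain t where "t \<in> {0..1}" "y = \<gamma> t" by blast
    then obtain v where "v \<in> ball v1 r" "y = chart_inv (A x) (v, w)" using conf[of t] by blast
    then show "y \<in> udom (A x)" using A_inv_udom[OF dom] by simp
  qed
  have dom1: "(v1, w) \<in> dom_box x" using dom[of v1] r(1) by simp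
  obtain q' S where q: "pw_curve {0..1} (\<lambda>t. lcoord (A x) (\<gamma> t)) q' S"
    and inv: "\<And>t. t \<in> {0..1} \<Longrightarrow> \<gamma> t = chart_inv (A x) (lcoord (A x) (\<gamma> t), w)"
    and sp: "\<And>t. t \<in> {0<..<1} - S \<Longrightarrow>
       g (\<gamma> t) (velocity A \<gamma> t) (velocity A \<gamma> t) = q' t \<bullet> (hm x (lcoord (A x) (\<gamma> t), w) *v q' t)"
    using leafwise_path_coords[OF \<gamma>(1) order_refl zero_less_one order_refl sub \<gamma>(2) dom1] by metis
  show ?thesis
  proof (rule that[of "\<lambda>t. lcoord (A x) (\<gamma> t)" q' S])
    show "pw_curve {0..1} (\<lambda>t. lcoord (A x) (\<gamma> t)) q' S" by (rule q)
    show "lcoord (A x) (\<gamma> 0) = v1" using \<gamma>(2) A_lcoord_inv[OF dom1] by simp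
    show "lcoord (A x) (\<gamma> t) \<in> ball v1 r" if t: "t \<in> {0..1}" for t
    proof -
      obtain v where v: "v \<in> ball v1 r" "\<gamma> t = chart_inv (A x) (v, w)" using conf[OF t] by blast
      then show ?thesis using A_lcoord_inv[OF dom[OF v(1)]] by simp
    qed
    show "z = chart_inv (A x) (lcoord (A x) (\<gamma> 1), w)" using inv[of 1] \<gamma>(3) by simp
    have "clen (\<lambda>v. hm x (v, w)) (\<lambda>t. lcoord (A x) (\<gamma> t)) q' = path_len A g \<gamma>"
      unfolding clen_def path_len_def
    proof (rule nn_integral_cong_AE, rule AE_mp[OF AE_finite_lborel[of "S \<union> {0, 1}"]])
      show "finite (S \<union> {0, 1})" using q by (simp add: pw_curve_def)
      show "AE s in lborel. s \<notin> S \<union> {0, 1} \<longrightarrow>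
         ennreal (sqrt (q' s \<bullet> (hm x (lcoord (A x) (\<gamma> s), w) *v q' s))) * indicator {0..1} s =
         ennreal (sqrt (g (\<gamma> s) (velocity A \<gamma> s) (velocity A \<gamma> s))) * indicator {0..1} s"
      proof (rule AE_I2, rule impI)
        fix s :: real assume s: "s \<notin> S \<union> {0, 1}"
        show "ennreal (sqrt (q' s \<bullet> (hm x (lcoord (A x) (\<gamma> s), w) *v q' s))) * indicator {0..1} s =
         ennreal (sqrt (g (\<gamma> s) (velocity A \<gamma> s) (velocity A \<gamma> s))) * indicator {0..1} s"
          using sp[of s] s by (cases "s \<in> {0..1}") auto
      qed
    qed
    then show "clen (\<lambda>v. hm x (v, w)) (\<lambda>t. lcoord (A x) (\<gamma> t)) q' < ennreal L" using \<gamma>(4) by simp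
  qed
qed

end

section \<open>Leafwise balls as star bodies\<close>

text \<open>Strict increase along rays makes each ray cross the level \<delta> exactly once, at a
  radius \<open>\<rho>\<close>; the gauge is \<open>norm u / \<rho>\<close>. The lower bound with
  \<open>\<delta> < l * r\<close> guarantees that the level is reached within the domain.\<close>

lemma gauge_of_star_function:
  fixes dd :: "real^'n \<Rightarrow> 'c::metric_space \<Rightarrow> real" and W :: "'c set"
  assumes W: "compact W" and r: "r > 0" and l: "l > 0" and Lm: "Lm > 0"
    and cont: "continuous_on (cball 0 r \<times> W) (\<lambda>q. dd (fst q) (snd q))"
    and lower: "\<And>u w. norm u \<le> r \<Longrightarrow> w \<in> W \<Longrightarrow> l * norm u \<le> dd u w"
    and upper: "\<And>u w. norm u \<le> r \<Longrightarrow> w \<in> W \<Longrightarrow> dd u w \<le> Lm * norm u"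
    and star: "\<And>u w s. norm u \<le> r \<Longrightarrow> w \<in> W \<Longrightarrow> 0 \<le> s \<Longrightarrow> s < 1 \<Longrightarrow> dd u w > 0 \<Longrightarrow> dd (s *\<^sub>R u) w < dd u w"
    and \<delta>: "0 < \<delta>" "\<delta> < l * r"
  obtains p :: "real^'n \<Rightarrow> 'c \<Rightarrow> real" where
    "continuous_on (UNIV \<times> W) (\<lambda>q. p (fst q) (snd q))"
    "\<And>u w s. w \<in> W \<Longrightarrow> s \<ge> 0 \<Longrightarrow> p (s *\<^sub>R u) w = s * p u w"
    "\<And>u w. w \<in> W \<Longrightarrow> u \<noteq> 0 \<Longrightarrow> p u w > 0"
    "\<And>u w. w \<in> W \<Longrightarrow> p u w \<le> 1 \<longleftrightarrow> norm u \<le> r \<and> dd u w \<le> \<delta>"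
    "\<And>u w. w \<in> W \<Longrightarrow> p u w \<le> 1 \<Longrightarrow> norm u \<le> \<delta> / l"
proof -
  have nz: "dd u w > 0" if "norm u \<le> r" "w \<in> W" "u \<noteq> 0" for u w
    using lower[OF that(1,2)] l that(3) by (meson less_le_trans mult_pos_pos zero_less_norm_iff)
  have dd0: "dd 0 w = 0" if "w \<in> W" for w using lower[of 0 w] upper[of 0 w] that r by simp
  have cray: "continuous_on {0..r} (\<lambda>s. dd (s *\<^sub>R \<theta>) w)" if "norm \<theta> = 1" "w \<in> W" for \<theta> w
  proof -
    have "continuous_on {0..r} (\<lambda>s. (\<lambda>q. dd (fst q) (snd q)) (s *\<^sub>R \<theta>, w))"
      by (rule continuous_on_compose2[OF cont]) (use that in \<open>auto intro!: continuous_intros\<close>)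
    then show ?thesis by simp
  qed
  have inj: "s = s'" if "norm \<theta> = 1" "w \<in> W" "0 \<le> s" "s \<le> r" "0 \<le> s'" "s' \<le> r" "dd (s *\<^sub>R \<theta>) w = \<delta>" "dd (s' *\<^sub>R \<theta>) w = \<delta>" for \<theta> w s s'
  proof -
    have *: "dd (a *\<^sub>R \<theta>) w < dd (b *\<^sub>R \<theta>) w" if "0 \<le> a" "a < b" "b \<le> r" for a b
    proof -
      have "dd ((a / b) *\<^sub>R (b *\<^sub>R \<theta>)) w < dd (b *\<^sub>R \<theta>) w"
        using that \<open>norm \<theta> = 1\<close> \<open>w \<in> W\<close> by (intro star nz) auto
      then show ?thesis using that by simp
    qed
    show ?thesis using *[of s s'] *[of s' s] that by (cases s s' rule: linorder_cases) auto
  qed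
  have ex: "\<exists>s. 0 \<le> s \<and> s \<le> r \<and> dd (s *\<^sub>R \<theta>) w = \<delta>" if "norm \<theta> = 1" "w \<in> W" for \<theta> w
  proof -
    have "\<delta> \<le> dd (r *\<^sub>R \<theta>) w" using lower[of "r *\<^sub>R \<theta>" w] that \<delta> r by simp
    then show ?thesis
      using IVT'[of "\<lambda>s. dd (s *\<^sub>R \<theta>) w" 0 \<delta> r] dd0[OF that(2)] cray[OF that] \<delta> r by auto
  qed
  define \<rho> where "\<rho> q = (SOME s. 0 \<le> s \<and> s \<le> r \<and> dd (s *\<^sub>R fst q) (snd q) = \<delta>)" for q
  have \<rho>: "0 \<le> \<rho> (\<theta>, w)" "\<rho> (\<theta>, w) \<le> r" "dd (\<rho> (\<theta>, w) *\<^sub>R \<theta>) w = \<delta>" if "norm \<theta> = 1" "w \<in> W" for \<theta> w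
    using someI_ex[OF ex[OF that]] unfolding \<rho>_def by auto
  have \<rho>le: "\<rho> (\<theta>, w) \<le> \<delta> / l" if "norm \<theta> = 1" "w \<in> W" for \<theta> w
    using lower[of "\<rho> (\<theta>, w) *\<^sub>R \<theta>" w] \<rho>[OF that] that l by (simp add: field_simps)
  have \<rho>ge: "\<delta> / Lm \<le> \<rho> (\<theta>, w)" if "norm \<theta> = 1" "w \<in> W" for \<theta> w
    using upper[of "\<rho> (\<theta>, w) *\<^sub>R \<theta>" w] \<rho>[OF that] that Lm by (simp add: field_simps)
  have \<rho>pos: "\<rho> (\<theta>, w) > 0" if "norm \<theta> = 1" "w \<in> W" for \<theta> w
    using \<rho>ge[OF that] \<delta> Lm by (meson divide_pos_pos less_le_trans)
  have c\<rho>: "continuous_on (sphere 0 1 \<times> W) \<rho>"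
  proof -
    \<comment> \<open>\<open>G\<close> is the graph of \<open>\<rho>\<close>. It is compact and
      projects bijectively to the sphere times \<open>W\<close>, so the inverse of the projection is
      continuous, and with it \<open>\<rho>\<close>.\<close>
    define G where "G = {x \<in> (sphere (0::real^'n) 1 \<times> W) \<times> {0..r}. dd (snd x *\<^sub>R fst (fst x)) (snd (fst x)) = \<delta>}"
    have cK: "compact ((sphere (0::real^'n) 1 \<times> W) \<times> {0..r})" by (intro compact_Times compact_sphere W compact_Icc)
    have cdd: "continuous_on ((sphere (0::real^'n) 1 \<times> W) \<times> {0..r}) (\<lambda>x. dd (snd x *\<^sub>R fst (fst x)) (snd (fst x)))"
    proof -
      have "continuous_on ((sphere (0::real^'n) 1 \<times> W) \<times> {0..r}) (\<lambda>x. (\<lambda>q. dd (fst q) (snd q)) (snd x *\<^sub>R fst (fst x), snd (fst x)))"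
        by (rule continuous_on_compose2[OF cont])
          (auto intro!: continuous_on_Pair continuous_on_scaleR continuous_on_fst continuous_on_snd continuous_on_id)
      then show ?thesis by simp
    qed
    have "closed G" unfolding G_def
    proof -
      have "closed ((sphere (0::real^'n) 1 \<times> W) \<times> {0..r} \<inter> (\<lambda>x. dd (snd x *\<^sub>R fst (fst x)) (snd (fst x))) -` {\<delta>})"
        by (rule continuous_closed_preimage[OF cdd compact_imp_closed[OF cK] closed_singleton])
      moreover have "(sphere (0::real^'n) 1 \<times> W) \<times> {0..r} \<inter> (\<lambda>x. dd (snd x *\<^sub>R fst (fst x)) (snd (fst x))) -` {\<delta>}
         = {x \<in> (sphere (0::real^'n) 1 \<times> W) \<times> {0..r}. dd (snd x *\<^sub>R fst (fst x)) (snd (fst x)) = \<delta>}" by blast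
      ultimately show "closed {x \<in> (sphere (0::real^'n) 1 \<times> W) \<times> {0..r}. dd (snd x *\<^sub>R fst (fst x)) (snd (fst x)) = \<delta>}" by simp
    qed
    then have cG: "compact G" using compact_Int_closed[OF cK, of G] unfolding G_def by (simp add: Int_absorb1 Collect_restrict)
    have cf: "continuous_on G fst" by (intro continuous_on_fst continuous_on_id)
    have "continuous_on (fst ` G) (\<lambda>q. (q, \<rho> q))"
    proof (rule continuous_on_inv[OF cf cG], rule ballI)
      fix x assume "x \<in> G"
      then show "(fst x, \<rho> (fst x)) = x"
        using inj[of "fst (fst x)" "snd (fst x)" "\<rho> (fst x)" "snd x"] \<rho>[of "fst (fst x)" "snd (fst x)"]
        by (auto simp: G_def prod_eq_iff)
    qed
    moreover have "sphere 0 1 \<times> W \<subseteq> fst ` G"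
    proof
      fix q :: "(real^'n) \<times> 'c" assume q: "q \<in> sphere 0 1 \<times> W"
      then have "(q, \<rho> q) \<in> G" using \<rho>[of "fst q" "snd q"] by (auto simp: G_def mem_Times_iff)
      then show "q \<in> fst ` G" by force
    qed
    ultimately have "continuous_on (sphere 0 1 \<times> W) (\<lambda>q. (q, \<rho> q))" using continuous_on_subset by blast
    from continuous_on_snd[OF this] show ?thesis by simp
  qed
  define p where "p u w = (if u = 0 then 0 else norm u / \<rho> (inverse (norm u) *\<^sub>R u, w))" for u w
  have sgn: "norm (inverse (norm u) *\<^sub>R u) = 1" if "u \<noteq> 0" for u :: "real^'n" using that by simp
  show ?thesis
  proof (rule that[of p])
    show "p (s *\<^sub>R u) w = s * p u w" if "w \<in> W" "s \<ge> 0" for u w s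
    proof (cases "s = 0 \<or> u = 0")
      case False
      then have e: "inverse (norm (s *\<^sub>R u)) *\<^sub>R (s *\<^sub>R u) = inverse (norm u) *\<^sub>R u" using that by simp
      have "p (s *\<^sub>R u) w = norm (s *\<^sub>R u) / \<rho> (inverse (norm (s *\<^sub>R u)) *\<^sub>R (s *\<^sub>R u), w)"
        using False by (auto simp only: p_def scaleR_eq_0_iff split: if_splits)
      also have "\<dots> = norm (s *\<^sub>R u) / \<rho> (inverse (norm u) *\<^sub>R u, w)" unfolding e ..
      finally show ?thesis using False that by (simp add: p_def)
    qed (auto simp: p_def)
    show "p u w > 0" if "w \<in> W" "u \<noteq> 0" for u w
      using \<rho>pos[OF sgn[OF that(2)] that(1)] that(2) by (simp add: p_def)
    have char: "p u w \<le> 1 \<longleftrightarrow> norm u \<le> \<rho> (inverse (norm u) *\<^sub>R u, w)" if "w \<in> W" "u \<noteq> 0" for u w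
      using \<rho>pos[OF sgn[OF that(2)] that(1)] that(2) by (simp add: p_def)
    show "norm u \<le> \<delta> / l" if "w \<in> W" "p u w \<le> 1" for u w
    proof (cases "u = 0")
      case False
      then show ?thesis using char[OF that(1) False] that(2) \<rho>le[OF sgn[OF False] that(1)] by linarith
    qed (use \<delta> l in simp)
    show "p u w \<le> 1 \<longleftrightarrow> norm u \<le> r \<and> dd u w \<le> \<delta>" if w: "w \<in> W" for u w
    proof (cases "u = 0")
      case True
      then show ?thesis using dd0[OF w] r \<delta> by (simp add: p_def)
    next
      case False
      define \<theta> where "\<theta> = inverse (norm u) *\<^sub>R u"
      have n: "norm \<theta> = 1" and u: "u = norm u *\<^sub>R \<theta>" using False by (auto simp: \<theta>_def)
      have P: "0 < \<rho> (\<theta>, w)" "\<rho> (\<theta>, w) \<le> r" "dd (\<rho> (\<theta>, w) *\<^sub>R \<theta>) w = \<delta>" using \<rho>[OF n w] \<rho>pos[OF n w] by auto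
      show ?thesis unfolding char[OF w False] \<theta>_def[symmetric]
      proof
        assume le: "norm u \<le> \<rho> (\<theta>, w)"
        have "dd u w \<le> \<delta>"
        proof (cases "norm u = \<rho> (\<theta>, w)")
          case True
          then show ?thesis using P(3) u by simp
        next
          case False
          then have lt: "norm u / \<rho> (\<theta>, w) < 1" using le P(1) by simp
          have "dd ((norm u / \<rho> (\<theta>, w)) *\<^sub>R (\<rho> (\<theta>, w) *\<^sub>R \<theta>)) w < dd (\<rho> (\<theta>, w) *\<^sub>R \<theta>) w"
            using P n lt w \<delta> by (intro star) auto
          moreover have "(norm u / \<rho> (\<theta>, w)) *\<^sub>R (\<rho> (\<theta>, w) *\<^sub>R \<theta>) = u" using P(1) u by simp
          ultimately show ?thesis using P(3) by simp
        qed
        then show "norm u \<le> r \<and> dd u w \<le> \<delta>" using le P(2) by simp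
      next
        assume a: "norm u \<le> r \<and> dd u w \<le> \<delta>"
        show "norm u \<le> \<rho> (\<theta>, w)"
        proof (rule ccontr)
          assume "\<not> ?thesis"
          then have lt: "\<rho> (\<theta>, w) / norm u < 1" using False by simp
          have "dd ((\<rho> (\<theta>, w) / norm u) *\<^sub>R u) w < dd u w"
            using P(1) lt a w nz[OF _ w False] by (intro star) auto
          moreover have "(\<rho> (\<theta>, w) / norm u) *\<^sub>R u = \<rho> (\<theta>, w) *\<^sub>R \<theta>" using False by (simp add: \<theta>_def divide_inverse)
          ultimately show False using P(3) a by simp
        qed
      qed
    qed
    show "continuous_on (UNIV \<times> W) (\<lambda>q. p (fst q) (snd q))"
      unfolding continuous_on_eq_continuous_within
    proof
      fix q :: "(real^'n) \<times> 'c" assume q: "q \<in> UNIV \<times> W"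
      show "continuous (at q within UNIV \<times> W) (\<lambda>q. p (fst q) (snd q))"
      proof (cases "fst q = 0")
        case True
        \<comment> \<open>At the origin the direction is undefined, but the radii are at least
          \<open>\<delta> / Lm\<close>, so the gauge is dominated by a multiple of the norm.\<close>
        have "((\<lambda>q. p (fst q) (snd q)) \<longlongrightarrow> 0) (at q within UNIV \<times> W)"
        proof (rule Lim_null_comparison)
          show "\<forall>\<^sub>F q in at q within UNIV \<times> W. norm (p (fst q) (snd q)) \<le> norm (fst q) * (Lm / \<delta>)"
          proof (rule eventually_at_topological[THEN iffD2], intro exI[of _ UNIV] conjI ballI impI)
            fix q' :: "(real^'n) \<times> 'c" assume q': "q' \<in> UNIV \<times> W"
            show "norm (p (fst q') (snd q')) \<le> norm (fst q') * (Lm / \<delta>)"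
            proof (cases "fst q' = 0")
              case False
              define a where "a = \<rho> (inverse (norm (fst q')) *\<^sub>R fst q', snd q')"
              have a: "a > 0" "\<delta> / Lm \<le> a" using \<rho>pos[OF sgn[OF False]] \<rho>ge[OF sgn[OF False]] q' by (auto simp: a_def mem_Times_iff)
              have "1 / a \<le> Lm / \<delta>" using a \<delta> Lm by (simp add: field_simps)
              then have "norm (fst q') * (1 / a) \<le> norm (fst q') * (Lm / \<delta>)" by (rule mult_left_mono) simp
              then show ?thesis using False a by (simp add: p_def a_def)
            qed (simp add: p_def)
          qed auto
          have "((\<lambda>q. norm (fst q) * (Lm / \<delta>)) \<longlongrightarrow> norm (fst q) * (Lm / \<delta>)) (at q within UNIV \<times> W)"
            by (intro tendsto_mult tendsto_norm tendsto_fst tendsto_const tendsto_ident_at)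
          then show "((\<lambda>q. norm (fst q) * (Lm / \<delta>)) \<longlongrightarrow> 0) (at q within UNIV \<times> W)" using True by simp
        qed
        then show ?thesis using True by (simp add: continuous_within p_def)
      next
        case False
        let ?E = "{q :: (real^'n) \<times> 'c. fst q \<noteq> 0}"
        have oE: "open ?E" by (intro open_Collect_neq continuous_on_fst continuous_on_id continuous_on_const)
        have "continuous_on (UNIV \<times> W \<inter> ?E) (\<lambda>q. norm (fst q) / \<rho> (inverse (norm (fst q)) *\<^sub>R fst q, snd q))"
        proof (intro continuous_on_divide continuous_on_norm continuous_on_fst continuous_on_id ballI)
          show "continuous_on (UNIV \<times> W \<inter> ?E) (\<lambda>q. \<rho> (inverse (norm (fst q)) *\<^sub>R fst q, snd q))"
            by (rule continuous_on_compose2[OF c\<rho>])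
              (auto intro!: continuous_on_Pair continuous_on_scaleR continuous_on_inverse continuous_on_norm continuous_on_fst continuous_on_snd continuous_on_id)
          show "\<rho> (inverse (norm (fst q)) *\<^sub>R fst q, snd q) \<noteq> 0" if "q \<in> UNIV \<times> W \<inter> ?E" for q
            using \<rho>pos[OF sgn, of "fst q" "snd q"] that by auto
        qed
        then have "continuous_on (UNIV \<times> W \<inter> ?E) (\<lambda>q. p (fst q) (snd q))"
          by (rule continuous_on_eq) (simp add: p_def)
        then have "continuous (at q within UNIV \<times> W \<inter> ?E) (\<lambda>q. p (fst q) (snd q))"
          using q False by (auto simp: continuous_on_eq_continuous_within)
        moreover have "at q within UNIV \<times> W \<inter> ?E = at q within UNIV \<times> W"
          by (rule at_within_nhd[OF _ oE]) (use False in auto)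
        ultimately show ?thesis by simp
      qed
    qed
  qed
qed

section \<open>Uniform bounds on a compact coordinate patch\<close>

lemma norm_matrix_vector_le: "norm (M *v b) \<le> norm M * norm (b :: real^'n)" for M :: "real^'n^'m"
proof -
  have "norm (M *v b) = L2_set (\<lambda>i. norm ((M *v b) $ i)) UNIV" by (simp add: norm_vec_def)
  also have "\<dots> \<le> L2_set (\<lambda>i. norm (M $ i) * norm b) UNIV"
  proof (rule L2_set_mono)
    fix i
    have "(M *v b) $ i = M $ i \<bullet> b" by (simp add: matrix_vector_mult_def inner_vec_def)
    then show "norm ((M *v b) $ i) \<le> norm (M $ i) * norm b" using Cauchy_Schwarz_ineq2[of "M $ i" b] by simp
  qed simp
  also have "\<dots> = norm M * norm b" by (simp add: norm_vec_def L2_set_left_distrib)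
  finally show ?thesis .
qed

lemma inner_matrix_le: "\<bar>a \<bullet> (M *v b)\<bar> \<le> norm M * norm a * norm (b :: real^'n)" for M :: "real^'n^'m"
proof -
  have "\<bar>a \<bullet> (M *v b)\<bar> \<le> norm a * norm (M *v b)" by (rule Cauchy_Schwarz_ineq2)
  also have "\<dots> \<le> norm a * (norm M * norm b)" by (intro mult_left_mono norm_matrix_vector_le) simp
  finally show ?thesis by (simp add: mult_ac)
qed

lemma ck_linear_expand:
  assumes "ck (Suc 0) D F" "q \<in> D"
  shows "dirder u F q = (\<Sum>b\<in>Basis. (u \<bullet> b) *\<^sub>R dirder b F q)"
proof -
  have lin: "linear (\<lambda>u. dirder u F q)" using has_derivative_linear[OF ck_has_derivative[OF assms]] .
  have "dirder u F q = dirder (\<Sum>b\<in>Basis. (u \<bullet> b) *\<^sub>R b) F q" by (simp add: euclidean_representation)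
  then show ?thesis by (simp only: linear_sum[OF lin] linear_scale[OF lin])
qed

lemma compact_bounded_norm:
  assumes "compact Q" "continuous_on Q f"
  shows "\<exists>C\<ge>0. \<forall>q\<in>Q. norm (f q) \<le> C"
proof -
  have "bounded (f ` Q)" using compact_continuous_image[OF assms(2,1)] compact_imp_bounded by blast
  then obtain C where "\<forall>q\<in>Q. norm (f q) \<le> C" unfolding bounded_iff by auto
  then show ?thesis by (intro exI[of _ "max C 0"]) (auto simp: le_max_iff_disj)
qed

lemma ck_first_derivative_bound:
  assumes D: "Q \<subseteq> D" "compact Q" and F: "ck (Suc 0) D F"
  shows "\<exists>C\<ge>0. \<forall>q\<in>Q. \<forall>u. norm (dirder u F q) \<le> C * norm u"
proof -
  have "\<forall>b. \<exists>C\<ge>0. \<forall>q\<in>Q. norm (dirder b F q) \<le> C"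
  proof
    fix b show "\<exists>C\<ge>0. \<forall>q\<in>Q. norm (dirder b F q) \<le> C"
    using compact_bounded_norm[OF D(2) continuous_on_subset[OF ck_imp_continuous[OF ck_dirder[OF F]] D(1)]] by blast
  qed
  then obtain C where C: "\<And>b. C b \<ge> 0" "\<And>b q. q \<in> Q \<Longrightarrow> norm (dirder b F q) \<le> C b" by metis
  show ?thesis
  proof (intro exI[of _ "sum C Basis"] conjI ballI allI)
    fix q u assume q: "q \<in> Q"
    have "norm (dirder u F q) \<le> (\<Sum>b\<in>Basis. norm ((u \<bullet> b) *\<^sub>R dirder b F q))"
      by (subst ck_linear_expand[OF F subsetD[OF D(1) q], of u]) (rule norm_sum)
    also have "\<dots> \<le> (\<Sum>b\<in>Basis. norm u * C b)"
      using C(1) C(2)[OF q] by (intro sum_mono) (auto intro!: mult_mono Basis_le_norm)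
    finally show "norm (dirder u F q) \<le> sum C Basis * norm u" by (simp add: sum_distrib_left mult.commute)
  qed (simp add: C(1) sum_nonneg)
qed

lemma ck_second_derivative_bound:
  assumes D: "open D" "Q \<subseteq> D" "compact Q" and F: "ck (Suc (Suc 0)) D F"
  shows "\<exists>C\<ge>0. \<forall>q\<in>Q. \<forall>u u'. norm (dirder u' (dirder u F) q) \<le> C * norm u * norm u'"
proof -
  have "\<forall>b. \<exists>C\<ge>0. \<forall>q\<in>Q. \<forall>u. norm (dirder u (dirder b F) q) \<le> C * norm u"
  proof
    fix b show "\<exists>C\<ge>0. \<forall>q\<in>Q. \<forall>u. norm (dirder u (dirder b F) q) \<le> C * norm u"
    using ck_first_derivative_bound[OF D(2,3) ck_dirder[OF F]] by blast
  qed
  then obtain C where C: "\<And>b. C b \<ge> 0" "\<And>b q u. q \<in> Q \<Longrightarrow> norm (dirder u (dirder b F) q) \<le> C b * norm u" by metis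
  have F1: "ck (Suc 0) D F" using ck_Suc_imp[OF F] .
  show ?thesis
  proof (intro exI[of _ "sum C Basis"] conjI ballI allI)
    fix q u u' assume q: "q \<in> Q"
    have qD: "q \<in> D" using q D by blast
    have "((\<lambda>v. \<Sum>b\<in>Basis. (u \<bullet> b) *\<^sub>R dirder b F (v, snd q)) has_derivative
       (\<lambda>u'. \<Sum>b\<in>Basis. (u \<bullet> b) *\<^sub>R dirder u' (dirder b F) q)) (at (fst q))"
      by (intro has_derivative_sum has_derivative_scaleR_right ck_has_derivative[OF ck_dirder[OF F] qD])
    then have "((\<lambda>v. dirder u F (v, snd q)) has_derivative
       (\<lambda>u'. \<Sum>b\<in>Basis. (u \<bullet> b) *\<^sub>R dirder u' (dirder b F) q)) (at (fst q))"
    proof (rule has_derivative_transform_within_open[OF _ open_slice[OF D(1), of "snd q"]])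
      show "fst q \<in> {v. (v, snd q) \<in> D}" using qD by simp
      show "(\<Sum>b\<in>Basis. (u \<bullet> b) *\<^sub>R dirder b F (v, snd q)) = dirder u F (v, snd q)" if "v \<in> {v. (v, snd q) \<in> D}" for v
        using ck_linear_expand[OF F1, of "(v, snd q)" u] that by simp
    qed
    then have e: "dirder u' (dirder u F) q = (\<Sum>b\<in>Basis. (u \<bullet> b) *\<^sub>R dirder u' (dirder b F) q)"
      by (rule dirder_eqI)
    have "norm (dirder u' (dirder u F) q) \<le> (\<Sum>b\<in>Basis. norm ((u \<bullet> b) *\<^sub>R dirder u' (dirder b F) q))"
      unfolding e by (rule norm_sum)
    also have "\<dots> \<le> (\<Sum>b\<in>Basis. norm u * (C b * norm u'))"
      using C(1) C(2)[OF q] by (intro sum_mono) (auto intro!: mult_mono Basis_le_norm mult_nonneg_nonneg)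
    also have "\<dots> = sum C Basis * norm u * norm u'" by (simp add: sum_distrib_left sum_distrib_right mult_ac)
    finally show "norm (dirder u' (dirder u F) q) \<le> sum C Basis * norm u * norm u'" .
  qed (simp add: C(1) sum_nonneg)
qed

text \<open>Over a compact set of plaques the metric is comparable with the Euclidean norm and
  bounded together with its first two leafwise derivatives. All later smallness conditions are
  expressed in \<open>R\<close>, \<open>l\<close>, \<open>Lm\<close> and \<open>C\<close>, which
  makes them uniform in the plaque.\<close>

locale metric_patch = riemannian_matchbox A g
  for A :: "'m::metric_space \<Rightarrow> ('m, 'n::finite, 'x::metric_space) fchart"
    and g :: "'m \<Rightarrow> real^'n \<Rightarrow> real^'n \<Rightarrow> real" +
  fixes x0 :: 'm and W :: "'x set" and R l Lm C :: real
  assumes W: "compact W" "W \<subseteq> interior (transv (A x0))"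
    and R: "R > 0" "cball 0 R \<subseteq> box (- 1) (1::real^'n)"
    and l: "l > 0" and Lm: "Lm > 0" and C: "C > 0"
    and lower: "\<And>v w a. v \<in> cball 0 R \<Longrightarrow> w \<in> W \<Longrightarrow> l * norm a \<le> sqrt (a \<bullet> (hm x0 (v, w) *v a))"
    and upper: "\<And>v w a. v \<in> cball 0 R \<Longrightarrow> w \<in> W \<Longrightarrow> sqrt (a \<bullet> (hm x0 (v, w) *v a)) \<le> Lm * norm a"
    and C0: "\<And>v w. v \<in> cball 0 R \<Longrightarrow> w \<in> W \<Longrightarrow> norm (hm x0 (v, w)) \<le> C"
    and C1: "\<And>v w u. v \<in> cball 0 R \<Longrightarrow> w \<in> W \<Longrightarrow> norm (dirder u (hm x0) (v, w)) \<le> C * norm u"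
    and C2: "\<And>v w u u'. v \<in> cball 0 R \<Longrightarrow> w \<in> W \<Longrightarrow> norm (dirder u' (dirder u (hm x0)) (v, w)) \<le> C * norm u * norm u'"

lemma (in riemannian_matchbox) metric_patch_exists:
  "\<exists>W R l Lm C. metric_patch A g x0 W R l Lm C \<and> tproj (A x0) x0 \<in> interior W"
proof -
  let ?w = "tproj (A x0) x0"
  obtain \<rho> where \<rho>: "\<rho> > 0" "cball ?w \<rho> \<subseteq> interior (transv (A x0))"
    using A_center(3) open_contains_cball open_interior by blast
  have "0 \<in> box (- 1) (1::real^'n)" by (simp add: mem_box_cart)
  then obtain R where R: "R > 0" "cball 0 R \<subseteq> box (- 1) (1::real^'n)"
    using open_contains_cball open_box by blast
  define W where "W = cball ?w \<rho>"
  have cW: "compact W" unfolding W_def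
    using compact_Int_closed[OF compact_X closed_cball, of ?w \<rho>] by simp
  define Q where "Q = cball (0::real^'n) R \<times> W"
  have cQ: "compact Q" unfolding Q_def by (intro compact_Times compact_cball cW)
  have QD: "Q \<subseteq> dom_box x0" using R \<rho> by (auto simp: Q_def W_def)
  obtain k0 where k0: "k0 \<ge> 0" "\<forall>q\<in>Q. norm (hm x0 q) \<le> k0"
    using compact_bounded_norm[OF cQ continuous_on_subset[OF ck_imp_continuous[OF hm_ck[of 0]] QD]] by blast
  obtain k1 where k1: "k1 \<ge> 0" "\<forall>q\<in>Q. \<forall>u. norm (dirder u (hm x0) q) \<le> k1 * norm u"
    using ck_first_derivative_bound[OF QD cQ hm_ck] by blast
  obtain k2 where k2: "k2 \<ge> 0" "\<forall>q\<in>Q. \<forall>u u'. norm (dirder u' (dirder u (hm x0)) q) \<le> k2 * norm u * norm u'"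
    using ck_second_derivative_bound[OF chart_box_open[OF A_chart] QD cQ hm_ck] by blast
  \<comment> \<open>One constant serves for the metric and both orders of derivatives; the summand 1
    makes it positive, and its root bounds the metric norm from above.\<close>
  define C where "C = 1 + k0 + k1 + k2"
  have C: "C \<ge> 1" "k0 \<le> C" "k1 \<le> C" "k2 \<le> C" using k0 k1 k2 by (auto simp: C_def)
  have "\<exists>m>0. \<forall>q\<in>Q. \<forall>a. norm a = 1 \<longrightarrow> m \<le> a \<bullet> (hm x0 q *v a)"
  proof -
    let ?K = "Q \<times> sphere (0::real^'n) 1"
    have cK: "compact ?K" by (intro compact_Times cQ compact_sphere)
    have "((0, ?w), axis undefined 1) \<in> ?K" using R \<rho> by (simp add: Q_def W_def norm_axis_1)
    then have neK: "?K \<noteq> {}" by blast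
    have "continuous_on ?K (\<lambda>y. \<Sum>i\<in>UNIV. \<Sum>j\<in>UNIV. snd y $ i * (hm x0 (fst y) $ i $ j * snd y $ j))"
    proof (intro continuous_on_sum continuous_on_mult continuous_on_component continuous_on_snd continuous_on_id)
      show "continuous_on ?K (\<lambda>y. hm x0 (fst y))"
        by (rule continuous_on_compose2[OF ck_imp_continuous[OF hm_ck[of 0]] continuous_on_fst[OF continuous_on_id]])
          (use QD in auto)
    qed
    then have cf: "continuous_on ?K (\<lambda>y. snd y \<bullet> (hm x0 (fst y) *v snd y))"
      by (simp add: inner_vec_def matrix_vector_mult_def sum_distrib_left)
    obtain y where y: "y \<in> ?K" "\<And>z. z \<in> ?K \<Longrightarrow> snd y \<bullet> (hm x0 (fst y) *v snd y) \<le> snd z \<bullet> (hm x0 (fst z) *v snd z)"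
      using continuous_attains_inf[OF cK neK cf] by blast
    have "fst y \<in> dom_box x0" "snd y \<noteq> 0" using y(1) QD by (auto simp: mem_Times_iff)
    then have "snd y \<bullet> (hm x0 (fst y) *v snd y) > 0" by (rule hm_pos)
    moreover have "snd y \<bullet> (hm x0 (fst y) *v snd y) \<le> a \<bullet> (hm x0 q *v a)" if "q \<in> Q" "norm a = 1" for q a
      using y(2)[of "(q, a)"] that by simp
    ultimately show ?thesis by blast
  qed
  then obtain m where m: "m > 0" "\<And>q a. q \<in> Q \<Longrightarrow> norm a = 1 \<Longrightarrow> m \<le> a \<bullet> (hm x0 q *v a)" by blast
  have low: "sqrt m * norm a \<le> sqrt (a \<bullet> (hm x0 q *v a))" if q: "q \<in> Q" for q a
  proof (cases "a = 0")
    case False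
    define e where "e = inverse (norm a) *\<^sub>R a"
    have e: "norm e = 1" "a = norm a *\<^sub>R e" using False by (auto simp: e_def)
    have "a \<bullet> (hm x0 q *v a) = (norm a)\<^sup>2 * (e \<bullet> (hm x0 q *v e))"
      by (subst (1 2) e(2)) (simp add: matrix_vector_mult_scaleR power2_eq_square)
    moreover have "(norm a)\<^sup>2 * m \<le> (norm a)\<^sup>2 * (e \<bullet> (hm x0 q *v e))"
      by (rule mult_left_mono[OF m(2)[OF q e(1)]]) simp
    ultimately have "m * (norm a)\<^sup>2 \<le> a \<bullet> (hm x0 q *v a)" by (simp add: mult.commute)
    then have "sqrt (m * (norm a)\<^sup>2) \<le> sqrt (a \<bullet> (hm x0 q *v a))" by (rule real_sqrt_le_mono)
    then show ?thesis by (simp add: real_sqrt_mult)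
  qed simp
  have up: "sqrt (a \<bullet> (hm x0 q *v a)) \<le> sqrt C * norm a" if q: "q \<in> Q" for q a
  proof -
    have "a \<bullet> (hm x0 q *v a) \<le> norm (hm x0 q) * norm a * norm a" using inner_matrix_le[of a "hm x0 q" a] by linarith
    also have "\<dots> \<le> C * norm a * norm a" using k0(2) q C(2) by (intro mult_right_mono) (auto intro: order_trans)
    finally have "sqrt (a \<bullet> (hm x0 q *v a)) \<le> sqrt (C * (norm a)\<^sup>2)"
      by (intro real_sqrt_le_mono) (simp add: power2_eq_square mult.assoc)
    then show ?thesis by (simp add: real_sqrt_mult)
  qed
  have "metric_patch A g x0 W R (sqrt m) (sqrt C) C"
  proof (unfold_locales)
    show "W \<subseteq> interior (transv (A x0))" using \<rho> by (simp add: W_def)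
    fix v :: "real^'n" and w assume "v \<in> cball 0 R" "w \<in> W"
    then have q: "(v, w) \<in> Q" by (simp add: Q_def)
    show "sqrt m * norm a \<le> sqrt (a \<bullet> (hm x0 (v, w) *v a))" for a using low[OF q] .
    show "sqrt (a \<bullet> (hm x0 (v, w) *v a)) \<le> sqrt C * norm a" for a using up[OF q] .
    show "norm (hm x0 (v, w)) \<le> C" using k0(2) q C(2) by (auto intro: order_trans)
    show "norm (dirder u (hm x0) (v, w)) \<le> C * norm u" for u
    proof -
      have "norm (dirder u (hm x0) (v, w)) \<le> k1 * norm u" using k1(2) q by blast
      also have "\<dots> \<le> C * norm u" using C(3) by (rule mult_right_mono) simp
      finally show ?thesis .
    qed
    show "norm (dirder u' (dirder u (hm x0)) (v, w)) \<le> C * norm u * norm u'" for u u'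
    proof -
      have "norm (dirder u' (dirder u (hm x0)) (v, w)) \<le> k2 * norm u * norm u'" using k2(2) q by blast
      also have "\<dots> \<le> C * norm u * norm u'" using C(4) by (intro mult_right_mono) auto
      finally show ?thesis .
    qed
  qed (use cW R m C in auto)
  moreover have "?w \<in> interior W" unfolding W_def using \<rho>(1) centre_in_ball ball_subset_cball interior_maximal open_ball by (metis subsetD)
  ultimately show ?thesis by blast
qed

text \<open>Leafwise distances are infima that need not be attained. An estimate proved for all
  lengths slightly above the distance passes to the distance itself by continuity.\<close>

lemma le_mult_approx:
  fixes a c D L :: real
  assumes "c \<ge> 0" "D < L" "\<And>L'. D < L' \<Longrightarrow> L' < L \<Longrightarrow> a \<le> c * L' + b"
  shows "a \<le> c * D + b"
proof -
  have "((\<lambda>L'. c * L' + b) \<longlongrightarrow> c * D + b) (at_right D)" by (intro tendsto_intros)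
  moreover have "\<forall>\<^sub>F L' in at_right D. a \<le> c * L' + b"
    using eventually_at_right_less[of D] eventually_at_right_field[of _ D] assms(2,3)
    by (auto simp: eventually_at_right_field intro!: exI[of _ L])
  ultimately show ?thesis by (rule tendsto_lowerbound) simp
qed

section \<open>Leafwise distance between points of one plaque\<close>

context metric_patch
begin

lemma dom_patch: "v \<in> cball 0 R \<Longrightarrow> w \<in> W \<Longrightarrow> (v, w) \<in> dom_box x0"
  using R W by blast

lemma W_int: "w \<in> W \<Longrightarrow> w \<in> interior (transv (A x0))"
  using W by blast

lemma patch_inj:
  assumes "v \<in> cball 0 R" "v' \<in> cball 0 R" "w \<in> W" "chart_inv (A x0) (v, w) = chart_inv (A x0) (v', w)"
  shows "v = v'"
proof -
  have "v = lcoord (A x0) (chart_inv (A x0) (v, w))" using A_lcoord_inv[OF dom_patch[OF assms(1,3)]] by (rule sym)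
  also have "\<dots> = lcoord (A x0) (chart_inv (A x0) (v', w))" by (simp only: assms(4))
  also have "\<dots> = v'" by (rule A_lcoord_inv[OF dom_patch[OF assms(2,3)]])
  finally show ?thesis .
qed

lemma hm_lip:
  assumes "v \<in> cball 0 R" "v' \<in> cball 0 R" "w \<in> W"
  shows "norm (hm x0 (v, w) - hm x0 (v', w)) \<le> C * norm (v - v')"
proof (rule differentiable_bound[of "cball 0 R" "\<lambda>v. hm x0 (v, w)" "\<lambda>v u. dirder u (hm x0) (v, w)"])
  fix v :: "real^'n" assume v: "v \<in> cball 0 R"
  show "((\<lambda>v. hm x0 (v, w)) has_derivative (\<lambda>u. dirder u (hm x0) (v, w))) (at v within cball 0 R)"
    using ck_has_derivative[OF hm_ck[of "Suc 0"] dom_patch[OF v assms(3)]] by (auto intro: has_derivative_at_withinI)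
  show "onorm (\<lambda>u. dirder u (hm x0) (v, w)) \<le> C" by (rule onorm_le) (rule C1[OF v assms(3)])
qed (use assms in auto)

lemma quad_le:
  assumes "norm (hm x0 q - hm x0 q') \<le> \<omega>"
  shows "a \<bullet> (hm x0 q *v a) \<le> a \<bullet> (hm x0 q' *v a) + \<omega> * (norm a)\<^sup>2"
proof -
  have "a \<bullet> (hm x0 q *v a) - a \<bullet> (hm x0 q' *v a) = a \<bullet> ((hm x0 q - hm x0 q') *v a)"
    by (simp add: matrix_vector_mult_diff_rdistrib inner_diff_right)
  also have "\<dots> \<le> norm (hm x0 q - hm x0 q') * norm a * norm a" using inner_matrix_le[of a "hm x0 q - hm x0 q'" a] by linarith
  also have "\<dots> \<le> \<omega> * norm a * norm a" using assms by (intro mult_right_mono) auto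
  finally show ?thesis by (simp add: power2_eq_square mult.assoc)
qed

lemma lower2:
  assumes "v \<in> cball 0 R" "w \<in> W"
  shows "l\<^sup>2 * (norm a)\<^sup>2 \<le> a \<bullet> (hm x0 (v, w) *v a)"
proof -
  have "(l * norm a)\<^sup>2 \<le> (sqrt (a \<bullet> (hm x0 (v, w) *v a)))\<^sup>2"
    using lower[OF assms, of a] l by (intro power_mono) auto
  moreover have "a \<bullet> (hm x0 (v, w) *v a) \<ge> 0"
    using lower[OF assms, of a] l by (metis mult_nonneg_nonneg norm_ge_zero order_trans less_imp_le real_sqrt_ge_0_iff)
  ultimately show ?thesis by (simp add: power_mult_distrib)
qed

lemma quad_nonneg: "v \<in> cball 0 R \<Longrightarrow> w \<in> W \<Longrightarrow> a \<bullet> (hm x0 (v, w) *v a) \<ge> 0"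
  using lower2[of v w a] by (meson order_trans zero_le_mult_iff zero_le_power2)

text \<open>The lower bound for the metric turns an additive error
  \<open>\<omega> * (norm a)^2\<close> in the quadratic form into a factor, which is what a
  comparison of lengths requires.\<close>

lemma sqrt_quad_transfer:
  assumes v: "v \<in> cball 0 R" "w \<in> W" and w: "\<omega> \<ge> 0" and le: "X \<le> a \<bullet> (hm x0 (v, w) *v a) + \<omega> * (norm a)\<^sup>2"
  shows "sqrt X \<le> sqrt (1 + \<omega> / l\<^sup>2) * sqrt (a \<bullet> (hm x0 (v, w) *v a))"
proof -
  have "\<omega> * (norm a)\<^sup>2 = (\<omega> / l\<^sup>2) * (l\<^sup>2 * (norm a)\<^sup>2)" using l by simp
  also have "\<dots> \<le> (\<omega> / l\<^sup>2) * (a \<bullet> (hm x0 (v, w) *v a))" using w by (intro mult_left_mono lower2 v) auto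
  finally have "X \<le> (1 + \<omega> / l\<^sup>2) * (a \<bullet> (hm x0 (v, w) *v a))" using le by (simp add: distrib_right)
  then have "sqrt X \<le> sqrt ((1 + \<omega> / l\<^sup>2) * (a \<bullet> (hm x0 (v, w) *v a)))" by (rule real_sqrt_le_mono)
  then show ?thesis by (simp add: real_sqrt_mult)
qed

text \<open>Passing to real values loses nothing inside the patch, since the straight coordinate
  segment already has finite length.\<close>

definition dd :: "real^'n \<Rightarrow> real^'n \<Rightarrow> 'x \<Rightarrow> real" where
  "dd v v' w = enn2real (leaf_dist A g (chart_inv (A x0) (v, w)) (chart_inv (A x0) (v', w)))"

lemma leaf_dist_segment:
  assumes "v \<in> cball 0 R" "v' \<in> cball 0 R" "w \<in> W"
  shows "leaf_dist A g (chart_inv (A x0) (v, w)) (chart_inv (A x0) (v', w)) \<le> ennreal (Lm * norm (v' - v))"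
proof -
  define q where "q t = v + t *\<^sub>R (v' - v)" for t
  have qc: "q t \<in> cball 0 R" if "t \<in> {0..1}" for t
  proof -
    have "q t = (1 - t) *\<^sub>R v + t *\<^sub>R v'" by (simp add: q_def algebra_simps)
    then show ?thesis using convexD[OF convex_cball assms(1,2), of "1 - t" t] that by simp
  qed
  have pw: "pw_curve {0..1} q (\<lambda>t. v' - v) {}" unfolding pw_curve_def q_def
    by (auto intro!: continuous_intros derivative_eq_intros)
  have "leaf_dist A g (chart_inv (A x0) (q 0, w)) (chart_inv (A x0) (q 1, w)) \<le> clen (\<lambda>v. hm x0 (v, w)) q (\<lambda>t. v' - v)"
    by (rule leaf_dist_le_clen[OF pw W_int[OF assms(3)]]) (use qc R in blast)
  also have "\<dots> \<le> (\<integral>\<^sup>+ t. ennreal (Lm * norm (v' - v)) * indicator {0..1::real} t \<partial>lborel)"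
    unfolding clen_def
  proof (rule nn_integral_mono)
    fix t :: real
    show "ennreal (sqrt ((v' - v) \<bullet> (hm x0 (q t, w) *v (v' - v)))) * indicator {0..1} t \<le> ennreal (Lm * norm (v' - v)) * indicator {0..1} t"
      using upper[OF qc[of t] assms(3), of "v' - v"] by (cases "t \<in> {0..1}") (auto intro!: ennreal_leI)
  qed
  also have "\<dots> = ennreal (Lm * norm (v' - v))" by (simp add: nn_integral_cmult)
  finally show ?thesis by (simp add: q_def)
qed

lemma leaf_dist_dd:
  assumes "v \<in> cball 0 R" "v' \<in> cball 0 R" "w \<in> W"
  shows "leaf_dist A g (chart_inv (A x0) (v, w)) (chart_inv (A x0) (v', w)) = ennreal (dd v v' w)"
    "0 \<le> dd v v' w" "dd v v' w \<le> Lm * norm (v' - v)"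
proof -
  have "leaf_dist A g (chart_inv (A x0) (v, w)) (chart_inv (A x0) (v', w)) < \<infinity>"
    using leaf_dist_segment[OF assms] by (simp add: le_less_trans)
  then show e: "leaf_dist A g (chart_inv (A x0) (v, w)) (chart_inv (A x0) (v', w)) = ennreal (dd v v' w)"
    unfolding dd_def by (simp add: less_top)
  show "0 \<le> dd v v' w" by (simp add: dd_def)
  show "dd v v' w \<le> Lm * norm (v' - v)"
    using leaf_dist_segment[OF assms] Lm unfolding e by (simp add: ennreal_le_iff)
qed

lemma leaf_dist_path:
  assumes w: "w \<in> W" and L: "L > 0" "norm v1 + L / l \<le> R"
    and d: "leaf_dist A g (chart_inv (A x0) (v1, w)) z < ennreal L"
  obtains q q' S where "pw_curve {0..1} q q' S" "q 0 = v1" "\<And>t. t \<in> {0..1} \<Longrightarrow> q t \<in> ball v1 (L / l)"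
    "z = chart_inv (A x0) (q 1, w)" "clen (\<lambda>v. hm x0 (v, w)) q q' < ennreal L"
proof -
  have c: "cball v1 (L / l) \<subseteq> cball 0 R" using L(2) by (auto simp: dist_norm) (smt (verit) norm_triangle_ineq2 norm_minus_commute)
  show ?thesis
  proof (rule leaf_dist_coords[OF W_int[OF w] _ _ l _ d, of "L / l"])
    show "0 < L / l" "L \<le> l * (L / l)" using L l by auto
    show "cball v1 (L / l) \<subseteq> box (- 1) 1" using c R by blast
    show "l * norm a \<le> sqrt (a \<bullet> (hm x0 (v, w) *v a))" if "v \<in> cball v1 (L / l)" for v a
      using lower[OF subsetD[OF c that] w] .
  qed (rule that)
qed

text \<open>A curve of length less than \<open>L\<close> has coordinate displacement less than
  \<open>L / l\<close>; the condition on \<open>norm v1\<close> keeps all such curves within the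
  patch, where the chart is injective and the end point is recovered as \<open>v\<close>.\<close>

lemma dd_path:
  assumes w: "w \<in> W" and L: "L > 0" "norm v1 + L / l \<le> R" and v: "v \<in> cball 0 R" and d: "dd v1 v w < L"
  obtains q q' S where "pw_curve {0..1} q q' S" "q 0 = v1" "q 1 = v" "\<And>t. t \<in> {0..1} \<Longrightarrow> q t \<in> ball v1 (L / l)"
    "\<And>t. t \<in> {0..1} \<Longrightarrow> q t \<in> cball 0 R" "clen (\<lambda>v. hm x0 (v, w)) q q' < ennreal L"
proof -
  have v1: "v1 \<in> cball 0 R" using L l by (simp add: pos_divide_le_eq) (smt (verit) divide_pos_pos l)
  have ld: "leaf_dist A g (chart_inv (A x0) (v1, w)) (chart_inv (A x0) (v, w)) < ennreal L"
    unfolding leaf_dist_dd(1)[OF v1 v w] using d L(1) by (simp add: ennreal_lessI)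
  obtain q q' S where q: "pw_curve {0..1} q q' S" "q 0 = v1"
    "\<And>t. t \<in> {0..1} \<Longrightarrow> q t \<in> ball v1 (L / l)"
    "chart_inv (A x0) (v, w) = chart_inv (A x0) (q 1, w)" "clen (\<lambda>v. hm x0 (v, w)) q q' < ennreal L"
    by (rule leaf_dist_path[OF w L ld]) (rule that)
  have qc: "q t \<in> cball 0 R" if "t \<in> {0..1}" for t
    using q(3)[OF that] L(2) norm_triangle_sub[of "q t" v1] by (simp add: dist_norm norm_minus_commute)
  have "q 1 = v" using patch_inj[OF v qc[of 1] w q(4)] by simp
  then show ?thesis using that q qc by blast
qed

lemma dd_le_clen:
  assumes w: "w \<in> W" and q: "pw_curve {0..1} q q' S" "\<And>t. t \<in> {0..1} \<Longrightarrow> q t \<in> cball 0 R"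
    and K: "clen (\<lambda>v. hm x0 (v, w)) q q' \<le> ennreal K" "K \<ge> 0"
  shows "dd (q 0) (q 1) w \<le> K"
proof -
  have "leaf_dist A g (chart_inv (A x0) (q 0, w)) (chart_inv (A x0) (q 1, w)) \<le> clen (\<lambda>v. hm x0 (v, w)) q q'"
    by (rule leaf_dist_le_clen[OF q(1) W_int[OF w]]) (use q(2) R in blast)
  then have "ennreal (dd (q 0) (q 1) w) \<le> ennreal K" using leaf_dist_dd(1)[OF q(2) q(2) w, of 0 1] K(1) by simp
  then show ?thesis using K(2) by (simp add: ennreal_le_iff)
qed

text \<open>Were the distance smaller, a path realising it would be confined to an open coordinate
  ball about \<open>v1\<close> whose boundary contains its own end point.\<close>

lemma dd_lower:
  assumes w: "w \<in> W" and v: "norm v1 + norm (v - v1) \<le> R"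
  shows "l * norm (v - v1) \<le> dd v1 v w"
proof (rule ccontr)
  assume "\<not> ?thesis"
  then have d: "dd v1 v w < l * norm (v - v1)" by simp
  have vR: "v \<in> cball 0 R" using v norm_triangle_sub[of v v1] by simp
  have "dd v1 v w \<ge> 0" by (simp add: dd_def)
  then have L: "l * norm (v - v1) > 0" using d by linarith
  have LR: "norm v1 + l * norm (v - v1) / l \<le> R" using v l by simp
  obtain q :: "real \<Rightarrow> real^'n" where q: "q 1 = v" "\<And>t. t \<in> {0..1} \<Longrightarrow> q t \<in> ball v1 (l * norm (v - v1) / l)"
    by (rule dd_path[OF w L LR vR d]) blast
  then show False using q(2)[of 1] l by (simp add: dist_norm norm_minus_commute)
qed

lemma continuous_hm_slice: "w \<in> W \<Longrightarrow> continuous_on (cball 0 R) (\<lambda>v. hm x0 (v, w))"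
  by (rule continuous_on_compose2[OF ck_imp_continuous[OF hm_ck[of 0]]])
    (use dom_patch in \<open>auto intro!: continuous_on_Pair continuous_on_id continuous_on_const\<close>)

lemma clen_scale:
  assumes w: "w \<in> W" "w' \<in> W" and q: "pw_curve {0..1} q q' S" "\<And>t. t \<in> {0..1} \<Longrightarrow> q t \<in> cball 0 R"
    and \<alpha>: "\<alpha> \<ge> 0" "\<beta> \<ge> 0" and L: "clen (\<lambda>v. hm x0 (v, w)) q q' \<le> ennreal L" "L \<ge> 0"
    and le: "\<And>t. t \<in> {0..1} - S \<Longrightarrow> sqrt (p' t \<bullet> (hm x0 (p t, w') *v p' t)) \<le> \<alpha> * sqrt (q' t \<bullet> (hm x0 (q t, w) *v q' t)) + \<beta>"
  shows "clen (\<lambda>v. hm x0 (v, w')) p p' \<le> ennreal (\<alpha> * L + \<beta>)"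
proof -
  have "clen (\<lambda>v. hm x0 (v, w')) p p' \<le> ennreal \<alpha> * clen (\<lambda>v. hm x0 (v, w)) q q' + ennreal \<beta>"
    by (rule clen_transfer[OF q(1) continuous_hm_slice[OF w(1)] q(2) \<alpha>]) (use le in auto)
  also have "\<dots> \<le> ennreal \<alpha> * ennreal L + ennreal \<beta>" by (intro add_right_mono mult_left_mono L) simp
  also have "\<dots> = ennreal (\<alpha> * L + \<beta>)" using \<alpha> L by (simp add: ennreal_plus ennreal_mult)
  finally show ?thesis .
qed

text \<open>A nearly minimal curve is contracted linearly towards \<open>v1\<close>. Velocities
  shrink by \<open>s\<close>, while the metric changes by at most
  \<open>C * (1 - s) * L / l\<close>, which \<open>C * L \<le> l^3\<close> bounds by
  \<open>(1 - s) * l^2\<close>. The length is thus multiplied by at most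
  \<open>s * sqrt (2 - s)\<close>, and the factor stays below 1 for \<open>s < 1\<close>.\<close>

lemma dd_star:
  assumes w: "w \<in> W" and L: "L > 0" "norm v1 + L / l \<le> R" "C * L \<le> l ^ 3" and v: "v \<in> cball 0 R" and d: "dd v1 v w < L"
    and s: "0 \<le> s" "s \<le> 1"
  shows "dd v1 (v1 + s *\<^sub>R (v - v1)) w \<le> s * (3 - s) / 2 * dd v1 v w"
proof -
  have "dd v1 (v1 + s *\<^sub>R (v - v1)) w \<le> s * (3 - s) / 2 * L' + 0" if L': "dd v1 v w < L'" "L' < L" for L'
  proof -
    have "dd v1 v w \<ge> 0" by (simp add: dd_def)
    then have L'0: "L' > 0" using L' by linarith
    have "L' / l \<le> L / l" using L' l by (simp add: divide_right_mono)
    then have L'R: "norm v1 + L' / l \<le> R" using L by linarith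
    obtain q q' S where q: "pw_curve {0..1} q q' S" "q 0 = v1" "q 1 = v" "\<And>t. t \<in> {0..1} \<Longrightarrow> q t \<in> ball v1 (L' / l)"
      "\<And>t. t \<in> {0..1} \<Longrightarrow> q t \<in> cball 0 R" "clen (\<lambda>v. hm x0 (v, w)) q q' < ennreal L'"
      by (rule dd_path[OF w L'0 L'R v L'(1)]) (rule that)
    define p where "p t = v1 + s *\<^sub>R (q t - v1)" for t
    have pc: "p t \<in> cball 0 R" if "t \<in> {0..1}" for t
    proof -
      have "p t = (1 - s) *\<^sub>R v1 + s *\<^sub>R q t" by (simp add: p_def algebra_simps)
      moreover have "v1 \<in> cball 0 R" using q(2) q(5)[of 0] by simp
      ultimately show ?thesis using convexD[OF convex_cball _ q(5)[OF that], of v1 "1 - s" s] s by simp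
    qed
    have pw: "pw_curve {0..1} p (\<lambda>t. s *\<^sub>R q' t) S"
      using q(1) unfolding pw_curve_def p_def
      by (auto intro!: continuous_intros derivative_eq_intros)
    \<comment> \<open>The two sides of the squared inequality differ by
      \<open>(1 - s)^2 / 4\<close>.\<close>
    have sq: "sqrt (1 + (1 - s)) \<le> (3 - s) / 2"
    proof (rule real_le_lsqrt)
      show "1 + (1 - s) \<le> ((3 - s) / 2)\<^sup>2" using zero_le_power2[of "1 - s"] by (simp add: power2_eq_square field_simps)
    qed (use s in auto)
    have "clen (\<lambda>v. hm x0 (v, w)) p (\<lambda>t. s *\<^sub>R q' t) \<le> ennreal (s * (3 - s) / 2 * L' + 0)"
    proof (rule clen_scale[OF w w q(1,5)])
      fix t assume t: "t \<in> {0..1} - S"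
      have tt: "t \<in> {0..1}" using t by blast
      define a where "a = q' t"
      \<comment> \<open>The bound for the change of the metric is chosen so that
        \<open>1 + \<omega> / l^2\<close> is exactly \<open>2 - s\<close>.\<close>
      define \<omega> where "\<omega> = (1 - s) * l\<^sup>2"
      have dq: "norm (q t - v1) \<le> L' / l" using q(4)[OF tt] by (simp add: dist_norm norm_minus_commute)
      have "norm (hm x0 (p t, w) - hm x0 (q t, w)) \<le> C * norm (p t - q t)" by (rule hm_lip[OF pc[OF tt] q(5)[OF tt] w])
      also have "p t - q t = - ((1 - s) *\<^sub>R (q t - v1))" by (simp add: p_def algebra_simps)
      also have "C * norm (- ((1 - s) *\<^sub>R (q t - v1))) = (1 - s) * (C * norm (q t - v1))" using s by simp
      also have "\<dots> \<le> (1 - s) * (C * (L' / l))" using dq C s by (intro mult_left_mono) auto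
      also have "\<dots> \<le> (1 - s) * l\<^sup>2"
      proof -
        have "C * L' \<le> C * L" using C L' by (intro mult_left_mono) auto
        then have "C * L' \<le> l ^ 3" using L(3) by linarith
        then have "C * (L' / l) \<le> l\<^sup>2" using l by (simp add: field_simps power3_eq_cube power2_eq_square)
        then show ?thesis using s by (intro mult_left_mono) auto
      qed
      finally have om: "norm (hm x0 (p t, w) - hm x0 (q t, w)) \<le> \<omega>" by (simp add: \<omega>_def)
      have "sqrt (a \<bullet> (hm x0 (p t, w) *v a)) \<le> sqrt (1 + \<omega> / l\<^sup>2) * sqrt (a \<bullet> (hm x0 (q t, w) *v a))"
        using s by (intro sqrt_quad_transfer q(5)[OF tt] w quad_le[OF om]) (simp add: \<omega>_def)
      also have "\<dots> \<le> (3 - s) / 2 * sqrt (a \<bullet> (hm x0 (q t, w) *v a))"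
        using sq l quad_nonneg[OF q(5)[OF tt] w] by (intro mult_right_mono) (auto simp: \<omega>_def)
      finally have "s * sqrt (a \<bullet> (hm x0 (p t, w) *v a)) \<le> s * ((3 - s) / 2 * sqrt (a \<bullet> (hm x0 (q t, w) *v a)))"
        using s by (intro mult_left_mono) auto
      moreover have "sqrt ((s *\<^sub>R a) \<bullet> (hm x0 (p t, w) *v (s *\<^sub>R a))) = s * sqrt (a \<bullet> (hm x0 (p t, w) *v a))"
        using s by (simp add: matrix_vector_mult_scaleR real_sqrt_mult mult.assoc[symmetric])
      ultimately show "sqrt ((s *\<^sub>R q' t) \<bullet> (hm x0 (p t, w) *v (s *\<^sub>R q' t)))
         \<le> s * (3 - s) / 2 * sqrt (q' t \<bullet> (hm x0 (q t, w) *v q' t)) + 0" by (simp add: a_def mult_ac)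
    qed (use q(6) L'0 s in auto)
    then have "dd (p 0) (p 1) w \<le> s * (3 - s) / 2 * L' + 0"
      using L'0 s by (intro dd_le_clen[OF w pw pc]) auto
    then show ?thesis by (simp add: p_def q(2,3))
  qed
  from le_mult_approx[OF _ d this] show ?thesis using s by simp
qed

text \<open>A nearly minimal curve to \<open>v\<close> on the plaque over \<open>w\<close> is
  carried to the plaque over \<open>w'\<close> and corrected by the linear drift
  \<open>t *\<^sub>R (v' - v)\<close> to end at \<open>v'\<close>. The change of the metric costs a
  factor, the drift an additive term; together they give continuity in both arguments.\<close>

lemma dd_perturb:
  assumes w: "w \<in> W" "w' \<in> W" and L: "L > 0" "norm v1 + L / l + norm (v' - v) \<le> R"
    and v: "v \<in> cball 0 R" and d: "dd v1 v w < L" and om: "\<omega> \<ge> 0"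
    and close: "\<And>u u'. u \<in> cball 0 R \<Longrightarrow> u' \<in> cball 0 R \<Longrightarrow> norm (u' - u) \<le> norm (v' - v) \<Longrightarrow>
        norm (hm x0 (u', w') - hm x0 (u, w)) \<le> \<omega>"
  shows "dd v1 v' w' \<le> dd v1 v w + \<omega> / l\<^sup>2 * L + (C / l + C + 1) * norm (v' - v)"
proof -
  \<comment> \<open>With \<open>K * l \<ge> C\<close> and \<open>K^2 \<ge> C\<close> the cross terms
    and the square of the drift are absorbed in \<open>(Y + K * norm e)^2\<close>, so that the root
    can be taken.\<close>
  define K where "K = C / l + C + 1"
  have K: "K \<ge> 0" "K * l \<ge> C" "K\<^sup>2 \<ge> C"
  proof -
    show "K \<ge> 0" using C l by (simp add: K_def)
    have "K * l = C + (C + 1) * l" using l by (simp add: K_def field_simps)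
    then show "K * l \<ge> C" using C l by simp
    have "C + 1 \<le> K" using C l by (simp add: K_def)
    then have "C * 1 \<le> K * K" using C by (intro mult_mono) auto
    then show "K\<^sup>2 \<ge> C" by (simp add: power2_eq_square)
  qed
  have "dd v1 v' w' \<le> (1 + \<omega> / l\<^sup>2) * L' + K * norm (v' - v)" if L': "dd v1 v w < L'" "L' < L" for L'
  proof -
    have "dd v1 v w \<ge> 0" by (simp add: dd_def)
    then have L'0: "L' > 0" using L' by linarith
    have LL: "L' / l \<le> L / l" using L' l by (simp add: divide_right_mono)
    then have L'R: "norm v1 + L' / l \<le> R" using L by (smt (verit) norm_ge_zero)
    obtain q q' S where q: "pw_curve {0..1} q q' S" "q 0 = v1" "q 1 = v" "\<And>t. t \<in> {0..1} \<Longrightarrow> q t \<in> ball v1 (L' / l)"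
      "\<And>t. t \<in> {0..1} \<Longrightarrow> q t \<in> cball 0 R" "clen (\<lambda>v. hm x0 (v, w)) q q' < ennreal L'"
      by (rule dd_path[OF w(1) L'0 L'R v L'(1)]) (rule that)
    define e where "e = v' - v"
    define p where "p t = q t + t *\<^sub>R e" for t
    have te: "norm (t *\<^sub>R e) \<le> norm e" if "t \<in> {0..1}" for t using that by (simp add: mult_left_le_one_le)
    have pc: "p t \<in> cball 0 R" if "t \<in> {0..1}" for t
    proof -
      have "norm (p t) \<le> norm v1 + norm (q t - v1) + norm (t *\<^sub>R e)"
        unfolding p_def by (smt (verit) norm_triangle_ineq norm_triangle_sub)
      moreover have "norm (q t - v1) \<le> L' / l" using q(4)[OF that] by (simp add: dist_norm norm_minus_commute)
      ultimately show ?thesis using te[OF that] LL L(2) by (simp add: e_def)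
    qed
    have pw: "pw_curve {0..1} p (\<lambda>t. q' t + e) S"
      using q(1) unfolding pw_curve_def p_def
      by (auto intro!: continuous_intros derivative_eq_intros)
    have "clen (\<lambda>v. hm x0 (v, w')) p (\<lambda>t. q' t + e) \<le> ennreal ((1 + \<omega> / l\<^sup>2) * L' + K * norm e)"
    proof (rule clen_scale[OF w q(1,5)])
      fix t assume t: "t \<in> {0..1} - S"
      have tt: "t \<in> {0..1}" using t by blast
      define a where "a = q' t"
      define H where "H = hm x0 (p t, w')"
      define Y where "Y = sqrt (a \<bullet> (H *v a))"
      have om': "norm (H - hm x0 (q t, w)) \<le> \<omega>"
        unfolding H_def using te[OF tt] by (intro close q(5)[OF tt] pc[OF tt]) (simp add: p_def e_def)
      have "Y \<le> sqrt (1 + \<omega> / l\<^sup>2) * sqrt (a \<bullet> (hm x0 (q t, w) *v a))"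
        unfolding Y_def H_def by (intro sqrt_quad_transfer q(5)[OF tt] w om quad_le om'[unfolded H_def])
      also have "\<dots> \<le> (1 + \<omega> / l\<^sup>2) * sqrt (a \<bullet> (hm x0 (q t, w) *v a))"
      proof (rule mult_right_mono)
        have "0 \<le> \<omega> / l\<^sup>2" using om by simp
        moreover have "1 + z \<le> (1 + z)\<^sup>2" if "0 \<le> z" for z :: real
          using that zero_le_power2[of z] unfolding power2_eq_square by (simp add: algebra_simps)
        ultimately have "1 + \<omega> / l\<^sup>2 \<le> (1 + \<omega> / l\<^sup>2)\<^sup>2" by blast
        then show "sqrt (1 + \<omega> / l\<^sup>2) \<le> 1 + \<omega> / l\<^sup>2" using \<open>0 \<le> \<omega> / l\<^sup>2\<close> by (intro real_le_lsqrt) auto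
      qed (use quad_nonneg[OF q(5)[OF tt] w(1)] in simp)
      finally have Y: "Y \<le> (1 + \<omega> / l\<^sup>2) * sqrt (a \<bullet> (hm x0 (q t, w) *v a))" .
      have Yl: "l * norm a \<le> Y" unfolding Y_def H_def by (rule lower[OF pc[OF tt] w(2)])
      have Ynn: "Y \<ge> 0" unfolding Y_def H_def using quad_nonneg[OF pc[OF tt] w(2)] by simp
      have Ysq: "a \<bullet> (H *v a) = Y\<^sup>2" unfolding Y_def H_def using quad_nonneg[OF pc[OF tt] w(2)] by simp
      have nH: "norm H \<le> C" unfolding H_def by (rule C0[OF pc[OF tt] w(2)])
      have "(a + e) \<bullet> (H *v (a + e)) = Y\<^sup>2 + a \<bullet> (H *v e) + e \<bullet> (H *v a) + e \<bullet> (H *v e)"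
        by (simp add: matrix_vector_right_distrib inner_add_left inner_add_right Ysq)
      also have "\<dots> \<le> Y\<^sup>2 + C * norm a * norm e + C * norm e * norm a + C * norm e * norm e"
      proof -
        have *: "x \<bullet> (H *v y) \<le> C * norm x * norm y" for x y
        proof -
          have "x \<bullet> (H *v y) \<le> norm H * norm x * norm y" using inner_matrix_le[of x H y] by linarith
          also have "\<dots> \<le> C * norm x * norm y" using nH by (intro mult_right_mono) auto
          finally show ?thesis .
        qed
        show ?thesis using *[of a e] *[of e a] *[of e e] by linarith
      qed
      also have "\<dots> \<le> (Y + K * norm e)\<^sup>2"
      proof -
        have "C * norm a \<le> (K * l) * norm a" using K(2) by (intro mult_right_mono) auto
        also have "\<dots> \<le> K * Y" using Yl K(1) by (simp add: mult.assoc mult_left_mono)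
        finally have 1: "(C * norm a) * norm e \<le> (K * Y) * norm e" by (rule mult_right_mono) simp
        have 2: "C * (norm e * norm e) \<le> K\<^sup>2 * (norm e * norm e)" using K(3) by (intro mult_right_mono) auto
        have "(Y + K * norm e)\<^sup>2 = Y\<^sup>2 + 2 * ((K * Y) * norm e) + K\<^sup>2 * (norm e * norm e)"
          by (simp add: power2_eq_square algebra_simps)
        then show ?thesis using 1 2 by (simp add: mult_ac)
      qed
      finally have "sqrt ((a + e) \<bullet> (H *v (a + e))) \<le> sqrt ((Y + K * norm e)\<^sup>2)" by (rule real_sqrt_le_mono)
      also have "\<dots> = Y + K * norm e" using Ynn K(1) by simp
      finally show "sqrt ((q' t + e) \<bullet> (hm x0 (p t, w') *v (q' t + e)))
         \<le> (1 + \<omega> / l\<^sup>2) * sqrt (q' t \<bullet> (hm x0 (q t, w) *v q' t)) + K * norm e"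
        using Y by (simp add: a_def H_def)
    qed (use q(6) L'0 om K(1) l in \<open>auto intro!: add_nonneg_nonneg\<close>)
    then have "dd (p 0) (p 1) w' \<le> (1 + \<omega> / l\<^sup>2) * L' + K * norm e"
      using L'0 om K(1) by (intro dd_le_clen[OF w(2) pw pc]) auto
    then show ?thesis by (simp add: p_def q(2,3) e_def)
  qed
  from le_mult_approx[OF _ d this] have "dd v1 v' w' \<le> (1 + \<omega> / l\<^sup>2) * dd v1 v w + K * norm (v' - v)" using om by simp
  moreover have "\<omega> / l\<^sup>2 * dd v1 v w \<le> \<omega> / l\<^sup>2 * L" using d om by (intro mult_left_mono) auto
  ultimately show ?thesis by (simp add: K_def distrib_right)
qed

text \<open>A length scale: by the first term, curves this short from a point with
  \<open>norm v1 \<le> R / 2\<close> stay in the patch; the second is the condition under which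
  \<open>dd_star\<close> contracts.\<close>

definition Lc :: real where "Lc = min (l * R / 4) (l ^ 3 / C)"
text \<open>The matching coordinate radius: within it distances stay below \<open>Lc\<close>, and
  the room needed by \<open>dd_perturb\<close> adds up to
  \<open>R / 2 + R / 4 + 2 * (R / 8) = R\<close>.\<close>

definition rc :: real where "rc = min (R / 8) (Lc / (2 * Lm))"

lemma Lc: "Lc > 0" "Lc / l \<le> R / 4" "C * Lc \<le> l ^ 3"
proof -
  show "Lc > 0" using l R C by (simp add: Lc_def)
  have "Lc \<le> l * R / 4" unfolding Lc_def by (rule min.cobounded1)
  then show "Lc / l \<le> R / 4" using l by (simp add: field_simps)
  have "Lc \<le> l ^ 3 / C" unfolding Lc_def by (rule min.cobounded2)
  then show "C * Lc \<le> l ^ 3" using C by (simp add: field_simps)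
qed

lemma rc: "rc > 0" "rc \<le> R / 8" "Lm * rc < Lc"
proof -
  show "rc > 0" using Lc R Lm by (simp add: rc_def)
  show "rc \<le> R / 8" unfolding rc_def by (rule min.cobounded1)
  have "rc \<le> Lc / (2 * Lm)" unfolding rc_def by (rule min.cobounded2)
  then have "Lm * rc \<le> Lc / 2" using Lm by (simp add: field_simps)
  then show "Lm * rc < Lc" using Lc(1) by linarith
qed

lemma hm_uniform:
  assumes "e > 0"
  shows "\<exists>d>0. \<forall>u\<in>cball 0 R. \<forall>u'\<in>cball 0 R. \<forall>w\<in>W. \<forall>w'\<in>W. norm (u' - u) < d \<longrightarrow> dist w w' < d \<longrightarrow>
    norm (hm x0 (u', w') - hm x0 (u, w)) \<le> e"
proof -
  have "compact (cball (0::real^'n) R \<times> W)" by (intro compact_Times compact_cball W)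
  moreover have "continuous_on (cball 0 R \<times> W) (hm x0)"
    by (rule continuous_on_subset[OF ck_imp_continuous[OF hm_ck[of 0]]]) (use dom_patch in auto)
  ultimately have "uniformly_continuous_on (cball 0 R \<times> W) (hm x0)" by (rule compact_uniformly_continuous[rotated])
  then obtain d where d: "d > 0" "\<And>a b. a \<in> cball 0 R \<times> W \<Longrightarrow> b \<in> cball 0 R \<times> W \<Longrightarrow> dist b a < d \<Longrightarrow> dist (hm x0 b) (hm x0 a) < e"
    unfolding uniformly_continuous_on_def using assms by metis
  show ?thesis
  proof (intro exI[of _ "d/2"] conjI ballI impI)
    fix u u' :: "real^'n" and w w' assume a: "u \<in> cball 0 R" "u' \<in> cball 0 R" "w \<in> W" "w' \<in> W" "norm (u' - u) < d/2" "dist w w' < d/2"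
    have "dist (u', w') (u, w) \<le> dist u' u + dist w' w"
      unfolding dist_prod_def by (simp add: sqrt_sum_squares_le_sum)
    then have "dist (u', w') (u, w) < d" using a by (simp add: dist_norm dist_commute)
    then show "norm (hm x0 (u', w') - hm x0 (u, w)) \<le> e" using d(2)[of "(u, w)" "(u', w')"] a by (simp add: dist_norm)
  qed (use d in auto)
qed

lemma dd_continuous:
  assumes v1: "norm v1 \<le> R / 2"
  shows "continuous_on (cball 0 rc \<times> W) (\<lambda>q. dd v1 (v1 + fst q) (snd q))"
proof -
  define K where "K = C / l + C + 1"
  have K: "K > 0" using C l by (simp add: K_def add_nonneg_pos)
  have vR: "v1 + u \<in> cball 0 R" if "u \<in> cball 0 rc" for u
    using that v1 rc(2) R norm_triangle_ineq[of v1 u] by simp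
  have v1R: "v1 \<in> cball 0 R" using v1 R by simp
  have small: "dd v1 (v1 + u) w < Lc" if "u \<in> cball 0 rc" "w \<in> W" for u w
  proof -
    have "dd v1 (v1 + u) w \<le> Lm * norm u" using leaf_dist_dd(3)[OF v1R vR[OF that(1)] that(2)] by simp
    also have "\<dots> \<le> Lm * rc" using that Lm by (intro mult_left_mono) auto
    finally show ?thesis using rc(3) by linarith
  qed
  show ?thesis
    unfolding continuous_on_iff
  proof (intro ballI allI impI)
    fix q :: "(real^'n) \<times> 'x" and e :: real assume q: "q \<in> cball 0 rc \<times> W" and e: "e > 0"
    \<comment> \<open>The error splits into \<open>e/4\<close> from the change of the metric over
      curves of length \<open>Lc\<close> and \<open>e/4\<close> from the drift.\<close>
    define \<omega> where "\<omega> = e * l\<^sup>2 / (4 * Lc)"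
    have om: "\<omega> > 0" "\<omega> / l\<^sup>2 * Lc = e / 4" using e l Lc(1) by (auto simp: \<omega>_def)
    obtain d where d: "d > 0" "\<And>u u' w w'. u \<in> cball 0 R \<Longrightarrow> u' \<in> cball 0 R \<Longrightarrow> w \<in> W \<Longrightarrow> w' \<in> W \<Longrightarrow>
       norm (u' - u) < d \<Longrightarrow> dist w w' < d \<Longrightarrow> norm (hm x0 (u', w') - hm x0 (u, w)) \<le> \<omega>"
      using hm_uniform[OF om(1)] by metis
    define d' where "d' = min d (e / (4 * K))"
    have d': "d' > 0" "d' \<le> d" "K * d' \<le> e / 4" using d e K by (auto simp: d'_def min_def field_simps)
    have half: "dd v1 (v1 + u') w' \<le> dd v1 (v1 + u) w + e / 2"
      if "u \<in> cball 0 rc" "u' \<in> cball 0 rc" "w \<in> W" "w' \<in> W" "norm (u' - u) < d'" "dist w w' < d'" for u u' w w'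
    proof -
      have "norm (u' - u) \<le> 2 * rc" using that(1,2) norm_triangle_ineq4[of u' u] by simp
      then have LR: "norm v1 + Lc / l + norm ((v1 + u') - (v1 + u)) \<le> R"
        using v1 Lc(2) rc(2) unfolding add_diff_cancel_left by linarith
      have "dd v1 (v1 + u') w' \<le> dd v1 (v1 + u) w + \<omega> / l\<^sup>2 * Lc + (C / l + C + 1) * norm ((v1 + u') - (v1 + u))"
        using om(1) that d'(2)
        by (intro dd_perturb[OF that(3,4) Lc(1) LR vR[OF that(1)] small[OF that(1,3)]] d(2)) auto
      moreover have "K * norm (u' - u) \<le> K * d'" using that K by (intro mult_left_mono) auto
      ultimately show ?thesis using d'(3) unfolding om(2) add_diff_cancel_left K_def[symmetric] by linarith
    qed
    show "\<exists>d>0. \<forall>x'\<in>cball 0 rc \<times> W. dist x' q < d \<longrightarrow> dist (dd v1 (v1 + fst x') (snd x')) (dd v1 (v1 + fst q) (snd q)) < e"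
    proof (intro exI[of _ d'] conjI ballI impI)
      fix x' assume x': "x' \<in> cball 0 rc \<times> W" "dist x' q < d'"
      have a: "norm (fst x' - fst q) < d'" "dist (snd x') (snd q) < d'"
        using x'(2) dist_fst_le[of x' q] dist_snd_le[of x' q] by (auto simp: dist_norm)
      have m: "fst x' \<in> cball 0 rc" "snd x' \<in> W" "fst q \<in> cball 0 rc" "snd q \<in> W" using x' q by (auto simp: mem_Times_iff)
      have "dd v1 (v1 + fst x') (snd x') \<le> dd v1 (v1 + fst q) (snd q) + e / 2"
        using half[OF m(3,1,4,2)] a by (simp add: dist_commute)
      moreover have "dd v1 (v1 + fst q) (snd q) \<le> dd v1 (v1 + fst x') (snd x') + e / 2"
        using half[OF m(1,3,2,4)] a by (simp add: norm_minus_commute)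
      ultimately show "dist (dd v1 (v1 + fst x') (snd x')) (dd v1 (v1 + fst q) (snd q)) < e"
        using e by (simp add: dist_real_def abs_less_iff)
    qed (rule d')
  qed
qed

text \<open>The bound \<open>\<delta> < l * rc\<close> prevents paths of length about \<delta> from
  leaving the coordinate ball, so the leafwise ball, a subset of the leaf, is the whole sublevel set
  of the coordinate distance in a single plaque.\<close>

lemma leaf_cball_gauge:
  assumes v1: "norm v1 \<le> R / 2" and \<delta>: "0 < \<delta>" "\<delta> < l * rc"
  obtains p :: "real^'n \<Rightarrow> 'x \<Rightarrow> real" where
    "continuous_on (UNIV \<times> W) (\<lambda>q. p (fst q) (snd q))"
    "\<And>u w s. w \<in> W \<Longrightarrow> s \<ge> 0 \<Longrightarrow> p (s *\<^sub>R u) w = s * p u w"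
    "\<And>u w. w \<in> W \<Longrightarrow> u \<noteq> 0 \<Longrightarrow> p u w > 0"
    "\<And>u w. w \<in> W \<Longrightarrow> p u w \<le> 1 \<Longrightarrow> norm u \<le> \<delta> / l"
    "\<And>w. w \<in> W \<Longrightarrow> leaf_cball A g (chart_inv (A x0) (v1, w)) \<delta> = (\<lambda>u. chart_inv (A x0) (v1 + u, w)) ` {u. p u w \<le> 1}"
proof -
  have vR: "v1 + u \<in> cball 0 R" if "norm u \<le> rc" for u
    using that v1 rc(2) R norm_triangle_ineq[of v1 u] by simp
  have v1R: "v1 \<in> cball 0 R" using v1 R by simp
  have up: "dd v1 (v1 + u) w \<le> Lm * norm u" if "norm u \<le> rc" "w \<in> W" for u w
    using leaf_dist_dd(3)[OF v1R vR[OF that(1)] that(2)] by simp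
  have small: "dd v1 (v1 + u) w < Lc" if "norm u \<le> rc" "w \<in> W" for u w
  proof -
    have "Lm * norm u \<le> Lm * rc" using that Lm by (intro mult_left_mono) auto
    then show ?thesis using rc(3) up[OF that] by linarith
  qed
  have star: "dd v1 (v1 + s *\<^sub>R u) w < dd v1 (v1 + u) w"
    if "norm u \<le> rc" "w \<in> W" "0 \<le> s" "s < 1" "dd v1 (v1 + u) w > 0" for u w s
  proof -
    have "norm v1 + Lc / l \<le> R" using v1 Lc(2) R by linarith
    then have "dd v1 (v1 + s *\<^sub>R ((v1 + u) - v1)) w \<le> s * (3 - s) / 2 * dd v1 (v1 + u) w"
      using that by (intro dd_star[OF that(2) Lc(1) _ Lc(3) vR[OF that(1)] small[OF that(1,2)]]) auto
    moreover have "s * (3 - s) / 2 < 1"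
    proof -
      have "0 < (1 - s) * (2 - s)" using that by (intro mult_pos_pos) auto
      then show ?thesis by (simp add: algebra_simps)
    qed
    then have "s * (3 - s) / 2 * dd v1 (v1 + u) w < 1 * dd v1 (v1 + u) w" using that(5) by (intro mult_strict_right_mono)
    ultimately show ?thesis by simp
  qed
  obtain p :: "real^'n \<Rightarrow> 'x \<Rightarrow> real" where p: "continuous_on (UNIV \<times> W) (\<lambda>q. p (fst q) (snd q))"
    "\<And>u w s. w \<in> W \<Longrightarrow> s \<ge> 0 \<Longrightarrow> p (s *\<^sub>R u) w = s * p u w"
    "\<And>u w. w \<in> W \<Longrightarrow> u \<noteq> 0 \<Longrightarrow> p u w > 0"
    and ple: "\<And>u w. w \<in> W \<Longrightarrow> p u w \<le> 1 \<longleftrightarrow> norm u \<le> rc \<and> dd v1 (v1 + u) w \<le> \<delta>"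
    and pn: "\<And>u w. w \<in> W \<Longrightarrow> p u w \<le> 1 \<Longrightarrow> norm u \<le> \<delta> / l"
  proof (rule gauge_of_star_function[of W rc l Lm "\<lambda>u w. dd v1 (v1 + u) w" \<delta>])
    show "l * norm u \<le> dd v1 (v1 + u) w" if "norm u \<le> rc" "w \<in> W" for u w
      using dd_lower[OF that(2), of v1 "v1 + u"] that v1 rc(2) R by simp
  qed (use W rc l Lm dd_continuous[OF v1] up star \<delta> in \<open>auto\<close>)
  show ?thesis
  proof (rule that[of p])
    fix w assume w: "w \<in> W"
    show "leaf_cball A g (chart_inv (A x0) (v1, w)) \<delta> = (\<lambda>u. chart_inv (A x0) (v1 + u, w)) ` {u. p u w \<le> 1}"
    proof (intro equalityI subsetI)
      fix z assume "z \<in> leaf_cball A g (chart_inv (A x0) (v1, w)) \<delta>"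
      then have le: "leaf_dist A g (chart_inv (A x0) (v1, w)) z \<le> ennreal \<delta>" by (simp add: leaf_cball_def)
      also have "\<dots> < ennreal (l * rc)" using \<delta> by (simp add: ennreal_lessI)
      finally have lt: "leaf_dist A g (chart_inv (A x0) (v1, w)) z < ennreal (l * rc)" .
      have L: "l * rc > 0" "norm v1 + l * rc / l \<le> R" using l rc v1 R by auto
      obtain q :: "real \<Rightarrow> real^'n" where q: "\<And>t. t \<in> {0..1} \<Longrightarrow> q t \<in> ball v1 (l * rc / l)" "z = chart_inv (A x0) (q 1, w)"
        by (rule leaf_dist_path[OF w L lt]) blast
      define u where "u = q 1 - v1"
      have u: "norm u \<le> rc" "z = chart_inv (A x0) (v1 + u, w)"
        using q(1)[of 1] q(2) l by (auto simp: u_def dist_norm norm_minus_commute)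
      have "ennreal (dd v1 (v1 + u) w) \<le> ennreal \<delta>" using le leaf_dist_dd(1)[OF v1R vR[OF u(1)] w] u(2) by simp
      then have "p u w \<le> 1" using ple[OF w] u(1) \<delta> by (simp add: ennreal_le_iff)
      then show "z \<in> (\<lambda>u. chart_inv (A x0) (v1 + u, w)) ` {u. p u w \<le> 1}" using u(2) by blast
    next
      fix z assume "z \<in> (\<lambda>u. chart_inv (A x0) (v1 + u, w)) ` {u. p u w \<le> 1}"
      then obtain u where u: "p u w \<le> 1" "z = chart_inv (A x0) (v1 + u, w)" by blast
      then have "norm u \<le> rc" "dd v1 (v1 + u) w \<le> \<delta>" using ple[OF w] by auto
      then show "z \<in> leaf_cball A g (chart_inv (A x0) (v1, w)) \<delta>"
        using leaf_dist_dd(1)[OF v1R vR w, of u] u(2) by (simp add: leaf_cball_def ennreal_leI)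
    qed
  qed (use p pn in auto)
qed

end

section \<open>Strong convexity of small leafwise balls\<close>

text \<open>Subtracting the chord and adding the parabola \<open>m * t * (1 - t) / 2\<close> leaves
  a function with second derivative at least 0 that vanishes at both ends. A positive value in
  between would force its derivative to be positive first and negative later.\<close>

lemma second_derivative_chord:
  fixes f f' f'' :: "real \<Rightarrow> real"
  assumes cont: "continuous_on {0..1} f"
    and d1: "\<And>t. t \<in> {0<..<1} \<Longrightarrow> (f has_real_derivative f' t) (at t)"
    and d2: "\<And>t. t \<in> {0<..<1} \<Longrightarrow> (f' has_real_derivative f'' t) (at t)"
    and m: "\<And>t. t \<in> {0<..<1} \<Longrightarrow> m \<le> f'' t" and t: "t \<in> {0..1}"
  shows "f t \<le> (1 - t) * f 0 + t * f 1 - m * (t * (1 - t)) / 2"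
proof (rule ccontr)
  assume neg: "\<not> ?thesis"
  define F where "F s = f s - (1 - s) * f 0 - s * f 1 + m * (s * (1 - s)) / 2" for s
  define F' where "F' s = f' s + f 0 - f 1 + m * (1 - 2 * s) / 2" for s
  have Ft: "F t > 0" using neg by (simp add: F_def)
  have F01: "F 0 = 0" "F 1 = 0" by (simp_all add: F_def)
  have t01: "0 < t" "t < 1" using Ft F01 t by (auto simp: less_le)
  have cF: "continuous_on {0..1} F" unfolding F_def by (intro continuous_intros cont) simp_all
  have dF: "(F has_real_derivative F' s) (at s)" if "s \<in> {0<..<1}" for s
    unfolding F_def F'_def by (auto intro!: derivative_eq_intros d1[OF that] simp: field_simps)
  have dF': "(F' has_real_derivative (f'' s - m)) (at s)" if "s \<in> {0<..<1}" for s
    unfolding F'_def by (auto intro!: derivative_eq_intros d2[OF that] simp: field_simps)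
  have hd: "(F has_derivative (*) (F' s)) (at s)" if "0 < s" "s < 1" for s
    using dF[of s] that by (simp add: has_field_derivative_def)
  obtain x where x: "0 < x" "x < t" "F t - F 0 = F' x * (t - 0)"
  proof (rule mvt[OF t01(1), of F "\<lambda>s. (*) (F' s)"])
    show "continuous_on {0..t} F" using t01 by (intro continuous_on_subset[OF cF]) auto
    show "(F has_derivative (*) (F' s)) (at s)" if "0 < s" "s < t" for s using that t01 by (intro hd) auto
  qed (rule that)
  obtain y where y: "t < y" "y < 1" "F 1 - F t = F' y * (1 - t)"
  proof (rule mvt[OF t01(2), of F "\<lambda>s. (*) (F' s)"])
    show "continuous_on {t..1} F" using t01 by (intro continuous_on_subset[OF cF]) auto
    show "(F has_derivative (*) (F' s)) (at s)" if "t < s" "s < 1" for s using that t01 by (intro hd) auto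
  qed (rule that)
  have "F' x * t > 0" using x(3) Ft F01 by simp
  then have "F' x > 0" using t01 by (simp add: zero_less_mult_iff)
  have "F' y * (1 - t) < 0" using y(3) Ft F01 by simp
  then have "F' y < 0" using t01 by (simp add: mult_less_0_iff)
  have "F' x \<le> F' y"
  proof (rule DERIV_nonneg_imp_nondecreasing[of x y F'])
    show "\<exists>d. (F' has_real_derivative d) (at s) \<and> d \<ge> 0" if "x \<le> s" "s \<le> y" for s
      using dF'[of s] m[of s] that x y t01 by (intro exI[of _ "f'' s - m"]) auto
  qed (use x y in simp)
  then show False using \<open>F' x > 0\<close> \<open>F' y < 0\<close> by simp
qed

context riemannian_matchbox
begin

lemma geodesic_imp_leafwise_path:
  assumes "geodesic A g \<gamma>" shows "leafwise_path A \<gamma>"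
  unfolding leafwise_path_def
proof (intro conjI allI impI)
  show "continuous_map (top_of_set {0..1}) (fine_topology A) \<gamma>" using assms by (simp add: geodesic_def)
  fix x a b assume ab: "0 \<le> a \<and> a < b \<and> b \<le> 1 \<and> \<gamma> ` {a..b} \<subseteq> udom (A x)"
  from assms[unfolded geodesic_def, THEN conjunct2, rule_format, OF ab]
  obtain q' where "\<forall>t\<in>{a..b}. ((\<lambda>s. lcoord (A x) (\<gamma> s)) has_vector_derivative q' t) (at t within {a..b}) \<and>
     (\<exists>d. (q' has_vector_derivative d) (at t within {a..b}))" by blast
  then have q': "\<And>t. t \<in> {a..b} \<Longrightarrow> ((\<lambda>s. lcoord (A x) (\<gamma> s)) has_vector_derivative q' t) (at t within {a..b})"
    and q'': "\<And>t. t \<in> {a..b} \<Longrightarrow> \<exists>d. (q' has_vector_derivative d) (at t within {a..b})" by blast+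
  show "(\<lambda>t. lcoord (A x) (\<gamma> t)) piecewise_C1_differentiable_on {a..b}"
    unfolding piecewise_C1_differentiable_on_def
  proof (intro conjI exI[of _ "{a, b}"])
    show "continuous_on {a..b} (\<lambda>t. lcoord (A x) (\<gamma> t))"
      unfolding continuous_on_eq_continuous_within using has_vector_derivative_continuous[OF q'] by blast
    show "(\<lambda>t. lcoord (A x) (\<gamma> t)) C1_differentiable_on {a..b} - {a, b}"
      unfolding C1_differentiable_on_def
    proof (intro exI[of _ q'] conjI ballI)
      fix t assume t: "t \<in> {a..b} - {a, b}"
      then have "at t within {a..b} = at t" by (intro at_within_Icc_at) auto
      then show "((\<lambda>t. lcoord (A x) (\<gamma> t)) has_vector_derivative q' t) (at t)" using q'[of t] t by auto
    next
      have "continuous_on {a..b} q'"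
        using q'' has_vector_derivative_continuous by (metis continuous_on_eq_continuous_within)
      then show "continuous_on ({a..b} - {a, b}) q'" by (rule continuous_on_subset) auto
    qed
  qed simp
qed

text \<open>The Christoffel symbols enter only through the identity
  \<open>\<langle>c, \<Gamma>(a, a)\<rangle> = (D\<^sub>a h)(a, c) - (D\<^sub>c h)(a, a) / 2\<close>.\<close>

lemma christoffel_quadratic:
  fixes a c :: "real^'n"
  assumes q: "(v, w) \<in> dom_box x"
  defines "\<Gamma> \<equiv> (\<chi> k. \<Sum>i\<in>UNIV. \<Sum>j\<in>UNIV. christoffel (\<lambda>u. hm x (u, w)) k i j v * a $ i * a $ j)"
  shows "c \<bullet> (hm x (v, w) *v \<Gamma>) =
    a \<bullet> (dirder a (hm x) (v, w) *v c) - a \<bullet> (dirder c (hm x) (v, w) *v a) / 2"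
proof -
  let ?h = "hm x (v, w)"
  define H where "H i = dirder (axis i 1) (hm x) (v, w)" for i :: 'n
  have der: "((\<lambda>u. hm x (u, w)) has_derivative (\<lambda>u. dirder u (hm x) (v, w))) (at v)"
    using ck_has_derivative[OF hm_ck[of "Suc 0"] q] by simp
  have pd: "pdiff i (\<lambda>u. hm x (u, w) $ j $ k) v = H i $ j $ k" for i j k
  proof -
    have "((\<lambda>u. hm x (u, w) $ j $ k) has_derivative (\<lambda>u. dirder u (hm x) (v, w) $ j $ k)) (at v)"
      by (intro bounded_linear.has_derivative[OF bounded_linear_vec_nth] der)
    from frechet_derivative_at[OF this] show ?thesis unfolding pdiff_def H_def by (metis)
  qed
  have lin: "linear (\<lambda>u. dirder u (hm x) (v, w))" using has_derivative_linear[OF der] .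
  have dH: "dirder u (hm x) (v, w) = (\<Sum>i\<in>UNIV. u $ i *\<^sub>R H i)" for u
  proof -
    have "u = (\<Sum>i\<in>UNIV. u $ i *\<^sub>R axis i 1)" by (simp add: vec_eq_iff axis_def if_distrib cong: if_cong)
    then have "dirder u (hm x) (v, w) = dirder (\<Sum>i\<in>UNIV. u $ i *\<^sub>R axis i 1) (hm x) (v, w)" by simp
    then show ?thesis by (simp only: linear_sum[OF lin] linear_scale[OF lin] H_def)
  qed
  \<comment> \<open>\<open>b\<close> is \<open>\<Gamma>\<close> with its index lowered;
    multiplication by the metric cancels the inverse matrix contained in the Christoffel
    symbols.\<close>
  define b where "b k = (\<Sum>i\<in>UNIV. \<Sum>j\<in>UNIV. (H i $ j $ k + H j $ i $ k - H k $ i $ j) / 2 * a $ i * a $ j)" for k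
  have G: "\<Gamma> = matrix_inv ?h *v (\<chi> k. b k)"
  proof -
    have "(\<Sum>i\<in>UNIV. \<Sum>j\<in>UNIV. christoffel (\<lambda>u. hm x (u, w)) k i j v * a $ i * a $ j)
       = (\<Sum>i\<in>UNIV. \<Sum>j\<in>UNIV. \<Sum>m\<in>UNIV. matrix_inv ?h $ k $ m * ((H i $ j $ m + H j $ i $ m - H m $ i $ j) / 2 * a $ i * a $ j))" for k
    proof (intro sum.cong refl)
      fix i j
      show "christoffel (\<lambda>u. hm x (u, w)) k i j v * a $ i * a $ j =
        (\<Sum>m\<in>UNIV. matrix_inv ?h $ k $ m * ((H i $ j $ m + H j $ i $ m - H m $ i $ j) / 2 * a $ i * a $ j))"
        unfolding christoffel_def pd sum_divide_distrib sum_distrib_right by (intro sum.cong refl) (simp add: mult_ac)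
    qed
    also have "\<dots> k = (\<Sum>m\<in>UNIV. \<Sum>i\<in>UNIV. \<Sum>j\<in>UNIV. matrix_inv ?h $ k $ m * ((H i $ j $ m + H j $ i $ m - H m $ i $ j) / 2 * a $ i * a $ j))" for k
    proof -
      have sw: "(\<Sum>i\<in>UNIV. \<Sum>j\<in>UNIV. \<Sum>m\<in>UNIV. T i j m) = (\<Sum>m\<in>UNIV. \<Sum>i\<in>UNIV. \<Sum>j\<in>UNIV. T i j m)" for T :: "'n \<Rightarrow> 'n \<Rightarrow> 'n \<Rightarrow> real"
      proof -
        have "(\<Sum>i\<in>UNIV. \<Sum>j\<in>UNIV. \<Sum>m\<in>UNIV. T i j m) = (\<Sum>i\<in>UNIV. \<Sum>m\<in>UNIV. \<Sum>j\<in>UNIV. T i j m)"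
          by (intro sum.cong refl sum.swap)
        also have "\<dots> = (\<Sum>m\<in>UNIV. \<Sum>i\<in>UNIV. \<Sum>j\<in>UNIV. T i j m)" by (rule sum.swap)
        finally show ?thesis .
      qed
      show ?thesis by (rule sw)
    qed
    finally show ?thesis unfolding \<Gamma>_def b_def
      by (simp add: vec_eq_iff matrix_vector_mult_def sum_distrib_left)
  qed
  have "inj ((*v) ?h)"
  proof -
    have "u = 0" if "?h *v u = 0" for u using hm_pos[OF q, of u] that by (cases "u = 0") auto
    then show ?thesis using linear_injective_0[OF matrix_vector_mul_linear[of ?h]] by blast
  qed
  then have "invertible ?h" using matrix_left_invertible_injective[of ?h] by (simp add: invertible_left_inverse)
  then have hG: "?h *v \<Gamma> = (\<chi> k. b k)"
    unfolding G using matrix_inv_inverse(1)[of ?h] by (simp add: matrix_vector_mul_assoc)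
  have "c \<bullet> (?h *v \<Gamma>) = (\<Sum>k\<in>UNIV. c $ k * b k)" unfolding hG by (simp add: inner_vec_def)
  also have "\<dots> = (\<Sum>k\<in>UNIV. c $ k * (\<Sum>i\<in>UNIV. \<Sum>j\<in>UNIV. H i $ j $ k * a $ i * a $ j))
     - (\<Sum>k\<in>UNIV. c $ k * (\<Sum>i\<in>UNIV. \<Sum>j\<in>UNIV. H k $ i $ j * a $ i * a $ j)) / 2"
  proof -
    have "b k = (\<Sum>i\<in>UNIV. \<Sum>j\<in>UNIV. H i $ j $ k * a $ i * a $ j) - (\<Sum>i\<in>UNIV. \<Sum>j\<in>UNIV. H k $ i $ j * a $ i * a $ j) / 2" for k
    proof -
      \<comment> \<open>Contraction with the same vector in both lower slots makes the first two
        terms of the symbol equal.\<close>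
      have sw: "(\<Sum>i\<in>UNIV. \<Sum>j\<in>UNIV. H j $ i $ k * a $ i * a $ j) = (\<Sum>i\<in>UNIV. \<Sum>j\<in>UNIV. H i $ j $ k * a $ i * a $ j)"
        by (subst sum.swap) (simp add: mult_ac)
      have "b k = (\<Sum>i\<in>UNIV. \<Sum>j\<in>UNIV. H i $ j $ k * a $ i * a $ j) / 2 + (\<Sum>i\<in>UNIV. \<Sum>j\<in>UNIV. H j $ i $ k * a $ i * a $ j) / 2
         - (\<Sum>i\<in>UNIV. \<Sum>j\<in>UNIV. H k $ i $ j * a $ i * a $ j) / 2"
        unfolding b_def sum_divide_distrib sum.distrib[symmetric] sum_subtractf[symmetric]
        by (intro sum.cong refl) (simp add: field_simps)
      then show ?thesis unfolding sw by simp
    qed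
    then show ?thesis by (simp add: right_diff_distrib sum_subtractf sum_divide_distrib[symmetric])
  qed
  also have "(\<Sum>k\<in>UNIV. c $ k * (\<Sum>i\<in>UNIV. \<Sum>j\<in>UNIV. H i $ j $ k * a $ i * a $ j)) = a \<bullet> (dirder a (hm x) (v, w) *v c)"
  proof -
    have "a \<bullet> (dirder a (hm x) (v, w) *v c) = (\<Sum>j\<in>UNIV. \<Sum>k\<in>UNIV. \<Sum>i\<in>UNIV. c $ k * (H i $ j $ k * a $ i * a $ j))"
      unfolding dH by (simp add: inner_vec_def matrix_vector_mult_def sum_distrib_left sum_distrib_right mult_ac)
    also have "\<dots> = (\<Sum>k\<in>UNIV. \<Sum>j\<in>UNIV. \<Sum>i\<in>UNIV. c $ k * (H i $ j $ k * a $ i * a $ j))" by (rule sum.swap)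
    also have "\<dots> = (\<Sum>k\<in>UNIV. \<Sum>i\<in>UNIV. \<Sum>j\<in>UNIV. c $ k * (H i $ j $ k * a $ i * a $ j))"
      by (intro sum.cong refl sum.swap)
    finally show ?thesis by (simp add: sum_distrib_left)
  qed
  also have "(\<Sum>k\<in>UNIV. c $ k * (\<Sum>i\<in>UNIV. \<Sum>j\<in>UNIV. H k $ i $ j * a $ i * a $ j)) = a \<bullet> (dirder c (hm x) (v, w) *v a)"
  proof -
    have "a \<bullet> (dirder c (hm x) (v, w) *v a) = (\<Sum>i\<in>UNIV. \<Sum>j\<in>UNIV. \<Sum>k\<in>UNIV. c $ k * (H k $ i $ j * a $ i * a $ j))"
      unfolding dH by (simp add: inner_vec_def matrix_vector_mult_def sum_distrib_left sum_distrib_right mult_ac)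
    also have "\<dots> = (\<Sum>i\<in>UNIV. \<Sum>k\<in>UNIV. \<Sum>j\<in>UNIV. c $ k * (H k $ i $ j * a $ i * a $ j))" by (intro sum.cong refl sum.swap)
    also have "\<dots> = (\<Sum>k\<in>UNIV. \<Sum>i\<in>UNIV. \<Sum>j\<in>UNIV. c $ k * (H k $ i $ j * a $ i * a $ j))" by (rule sum.swap)
    finally show ?thesis by (simp add: sum_distrib_left)
  qed
  finally show ?thesis .
qed

end

lemma bounded_bilinear_matrix_vector: "bounded_bilinear ((*v) :: real^'n^'m \<Rightarrow> real^'n \<Rightarrow> real^'m)"
proof (rule bounded_bilinear.intro)
  show "\<exists>K. \<forall>M b. norm (M *v b) \<le> norm (M :: real^'n^'m) * norm b * K"
    by (intro exI[of _ 1] allI) (simp add: norm_matrix_vector_le)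
qed (simp_all add: matrix_vector_mult_add_rdistrib matrix_vector_right_distrib scaleR_matrix_vector_assoc matrix_vector_mult_scaleR)

lemmas has_vector_derivative_mv = bounded_bilinear.has_vector_derivative[OF bounded_bilinear_matrix_vector]
lemmas has_vector_derivative_inner = bounded_bilinear.has_vector_derivative[OF bounded_bilinear_inner]

text \<open>A Poincare inequality on the unit interval. Testing with the fixed vector
  \<open>z = \<xi> s\<close> and using \<open>z \<bullet> \<eta> \<le> (norm z)^2 / 2 + (norm
  \<eta>)^2 / 2\<close> replaces the Cauchy-Schwarz inequality for integrals; half of
  \<open>(norm z)^2\<close> is absorbed on the left.\<close>

lemma integral_square_bound:
  fixes \<xi> \<eta> :: "real \<Rightarrow> 'a::euclidean_space"
  assumes d: "\<And>s. s \<in> {0..1} \<Longrightarrow> (\<xi> has_vector_derivative \<eta> s) (at s within {0..1})"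
    and c: "continuous_on {0..1} \<eta>" and 0: "\<xi> 0 = 0" and s: "s \<in> {0..1}"
  shows "(norm (\<xi> s))\<^sup>2 \<le> integral {0..1} (\<lambda>\<tau>. (norm (\<eta> \<tau>))\<^sup>2)"
proof -
  define z where "z = \<xi> s"
  have sub: "{0..s} \<subseteq> {0..1}" using s by auto
  have i1: "(\<lambda>\<tau>. (norm (\<eta> \<tau>))\<^sup>2) integrable_on {0..1}"
    by (intro integrable_continuous_interval continuous_on_power continuous_on_norm c)
  have i2: "(\<lambda>\<tau>. (norm (\<eta> \<tau>))\<^sup>2) integrable_on {0..s}"
    by (intro integrable_continuous_interval continuous_on_power continuous_on_norm continuous_on_subset[OF c sub])
  have "((\<lambda>\<tau>. z \<bullet> \<eta> \<tau>) has_integral (z \<bullet> \<xi> s - z \<bullet> \<xi> 0)) {0..s}"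
  proof (rule fundamental_theorem_of_calculus)
    fix \<tau> assume \<tau>: "\<tau> \<in> {0..s}"
    have "(\<xi> has_vector_derivative \<eta> \<tau>) (at \<tau> within {0..s})"
      by (rule has_vector_derivative_within_subset[OF d sub]) (use \<tau> s in auto)
    then show "((\<lambda>\<tau>. z \<bullet> \<xi> \<tau>) has_vector_derivative z \<bullet> \<eta> \<tau>) (at \<tau> within {0..s})"
      by (rule bounded_linear.has_vector_derivative[OF bounded_linear_inner_right])
  qed (use s in auto)
  moreover have "((\<lambda>\<tau>. (norm z)\<^sup>2 / 2 + (norm (\<eta> \<tau>))\<^sup>2 / 2) has_integral
     ((norm z)\<^sup>2 / 2 * (s - 0) + integral {0..s} (\<lambda>\<tau>. (norm (\<eta> \<tau>))\<^sup>2) / 2)) {0..s}"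
    using has_integral_add[OF has_integral_const_real[of "(norm z)\<^sup>2 / 2" 0 s] has_integral_divide[OF integrable_integral[OF i2], of 2]] s
    by (simp add: mult.commute)
  moreover have "z \<bullet> \<eta> \<tau> \<le> (norm z)\<^sup>2 / 2 + (norm (\<eta> \<tau>))\<^sup>2 / 2" for \<tau>
  proof -
    have "0 \<le> (norm (z - \<eta> \<tau>))\<^sup>2" by simp
    also have "\<dots> = (norm z)\<^sup>2 - 2 * (z \<bullet> \<eta> \<tau>) + (norm (\<eta> \<tau>))\<^sup>2"
      by (simp add: power2_norm_eq_inner inner_diff_left inner_diff_right inner_commute)
    finally show ?thesis by simp
  qed
  ultimately have "z \<bullet> \<xi> s - z \<bullet> \<xi> 0 \<le> (norm z)\<^sup>2 / 2 * (s - 0) + integral {0..s} (\<lambda>\<tau>. (norm (\<eta> \<tau>))\<^sup>2) / 2"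
    by (rule has_integral_le)
  moreover have "integral {0..s} (\<lambda>\<tau>. (norm (\<eta> \<tau>))\<^sup>2) \<le> integral {0..1} (\<lambda>\<tau>. (norm (\<eta> \<tau>))\<^sup>2)"
    by (rule integral_subset_le[OF sub i2 i1]) simp
  moreover have "(norm z)\<^sup>2 / 2 * (s - 0) \<le> (norm z)\<^sup>2 / 2 * 1" using s by (intro mult_left_mono) auto
  moreover have "z \<bullet> \<xi> s - z \<bullet> \<xi> 0 = (norm z)\<^sup>2" using 0 by (simp add: z_def power2_norm_eq_inner)
  ultimately show ?thesis by (simp add: z_def)
qed

section \<open>Energy of interpolated curves and geodesics in coordinates\<close>

context metric_patch
begin

lemma hm_line:
  assumes "v0 + t *\<^sub>R \<xi> \<in> cball 0 R" "w \<in> W"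
  shows "((\<lambda>t. hm x0 (v0 + t *\<^sub>R \<xi>, w)) has_vector_derivative dirder \<xi> (hm x0) (v0 + t *\<^sub>R \<xi>, w)) (at t)"
    "((\<lambda>t. dirder \<xi> (hm x0) (v0 + t *\<^sub>R \<xi>, w)) has_vector_derivative dirder \<xi> (dirder \<xi> (hm x0)) (v0 + t *\<^sub>R \<xi>, w)) (at t)"
proof -
  have line: "((\<lambda>t. v0 + t *\<^sub>R \<xi>) has_derivative (\<lambda>t. t *\<^sub>R \<xi>)) (at t)" by (auto intro!: derivative_eq_intros)
  have *: "((\<lambda>t. F (v0 + t *\<^sub>R \<xi>, w)) has_vector_derivative dirder \<xi> F (v0 + t *\<^sub>R \<xi>, w)) (at t)"
    if F: "ck (Suc 0) (dom_box x0) F" for F :: "(real^'n) \<times> 'x \<Rightarrow> real^'n^'n"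
  proof -
    have d: "((\<lambda>v. F (v, w)) has_derivative (\<lambda>u. dirder u F (v0 + t *\<^sub>R \<xi>, w))) (at (v0 + t *\<^sub>R \<xi>))"
      using ck_has_derivative[OF F dom_patch[OF assms]] by simp
    have "((\<lambda>t. F (v0 + t *\<^sub>R \<xi>, w)) has_derivative (\<lambda>s. dirder (s *\<^sub>R \<xi>) F (v0 + t *\<^sub>R \<xi>, w))) (at t)"
      by (rule has_derivative_compose[OF line d])
    then show ?thesis unfolding has_vector_derivative_def using linear_scale[OF has_derivative_linear[OF d]] by simp
  qed
  show "((\<lambda>t. hm x0 (v0 + t *\<^sub>R \<xi>, w)) has_vector_derivative dirder \<xi> (hm x0) (v0 + t *\<^sub>R \<xi>, w)) (at t)"
    by (rule *[OF hm_ck])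
  show "((\<lambda>t. dirder \<xi> (hm x0) (v0 + t *\<^sub>R \<xi>, w)) has_vector_derivative dirder \<xi> (dirder \<xi> (hm x0)) (v0 + t *\<^sub>R \<xi>, w)) (at t)"
    by (rule *[OF ck_dirder[OF hm_ck]])
qed

lemma inner_dirder_le:
  assumes "v \<in> cball 0 R" "w \<in> W"
  shows "\<bar>a \<bullet> (dirder u (hm x0) (v, w) *v b)\<bar> \<le> C * norm u * norm a * norm b"
proof -
  have "\<bar>a \<bullet> (dirder u (hm x0) (v, w) *v b)\<bar> \<le> norm (dirder u (hm x0) (v, w)) * norm a * norm b" by (rule inner_matrix_le)
  also have "\<dots> \<le> C * norm u * norm a * norm b" using C1[OF assms] by (intro mult_right_mono) auto
  finally show ?thesis .
qed

text \<open>Position and velocity are interpolated together. In the second derivative of the energy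
  density the term \<open>2 * (\<eta> \<bullet> (H *v \<eta>))\<close> gives the convexity; the
  derivatives of the metric contribute errors that carry a factor \<open>norm \<xi>\<close> each and
  are small when the velocities are.\<close>

lemma energy_chord:
  assumes u: "u0 \<in> cball 0 R" "u1 \<in> cball 0 R" and w: "w \<in> W" and a: "norm a0 \<le> B" "norm a1 \<le> B" and t: "t \<in> {0..1}"
  defines "\<xi> \<equiv> u1 - u0" and "\<eta> \<equiv> a1 - a0"
  shows "(a0 + t *\<^sub>R \<eta>) \<bullet> (hm x0 (u0 + t *\<^sub>R \<xi>, w) *v (a0 + t *\<^sub>R \<eta>)) \<le>
     (1 - t) * (a0 \<bullet> (hm x0 (u0, w) *v a0)) + t * (a1 \<bullet> (hm x0 (u1, w) *v a1))
     - (2 * l\<^sup>2 * (norm \<eta>)\<^sup>2 - C * B\<^sup>2 * (norm \<xi>)\<^sup>2 - 4 * C * B * norm \<xi> * norm \<eta>) * (t * (1 - t)) / 2"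
proof -
  have B: "B \<ge> 0" using a(1) norm_ge_zero order_trans by blast
  have uR: "u0 + \<tau> *\<^sub>R \<xi> \<in> cball 0 R" if "\<tau> \<in> {0..1}" for \<tau>
  proof -
    have "u0 + \<tau> *\<^sub>R \<xi> = (1 - \<tau>) *\<^sub>R u0 + \<tau> *\<^sub>R u1" by (simp add: \<xi>_def algebra_simps)
    then show ?thesis using convexD[OF convex_cball u, of "1 - \<tau>" \<tau>] that by simp
  qed
  have aB: "norm (a0 + \<tau> *\<^sub>R \<eta>) \<le> B" if "\<tau> \<in> {0..1}" for \<tau>
  proof -
    have "a0 + \<tau> *\<^sub>R \<eta> = (1 - \<tau>) *\<^sub>R a0 + \<tau> *\<^sub>R a1" by (simp add: \<eta>_def algebra_simps)
    then show ?thesis using convexD[OF convex_cball, of a0 0 B a1 "1 - \<tau>" \<tau>] that a by simp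
  qed
  define H where "H \<tau> = hm x0 (u0 + \<tau> *\<^sub>R \<xi>, w)" for \<tau>
  define H1 where "H1 \<tau> = dirder \<xi> (hm x0) (u0 + \<tau> *\<^sub>R \<xi>, w)" for \<tau>
  define H2 where "H2 \<tau> = dirder \<xi> (dirder \<xi> (hm x0)) (u0 + \<tau> *\<^sub>R \<xi>, w)" for \<tau>
  define a where "a \<tau> = a0 + \<tau> *\<^sub>R \<eta>" for \<tau>
  have dH: "(H has_vector_derivative H1 \<tau>) (at \<tau>)" "(H1 has_vector_derivative H2 \<tau>) (at \<tau>)" if "\<tau> \<in> {0..1}" for \<tau>
    using hm_line[OF uR[OF that] w] unfolding H_def H1_def H2_def by simp_all
  have da: "(a has_vector_derivative \<eta>) (at \<tau>)" for \<tau> unfolding a_def by (auto intro!: derivative_eq_intros)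
  have d\<eta>: "((\<lambda>_. \<eta>) has_vector_derivative 0) (at \<tau>)" for \<tau> :: real by (auto intro!: derivative_eq_intros)
  define f where "f \<tau> = a \<tau> \<bullet> (H \<tau> *v a \<tau>)" for \<tau>
  define f' where "f' \<tau> = a \<tau> \<bullet> (H \<tau> *v \<eta> + H1 \<tau> *v a \<tau>) + \<eta> \<bullet> (H \<tau> *v a \<tau>)" for \<tau>
  define f'' where "f'' \<tau> = 2 * (\<eta> \<bullet> (H \<tau> *v \<eta>)) + 2 * (a \<tau> \<bullet> (H1 \<tau> *v \<eta>)) + 2 * (\<eta> \<bullet> (H1 \<tau> *v a \<tau>)) + a \<tau> \<bullet> (H2 \<tau> *v a \<tau>)" for \<tau>
  have df: "(f has_real_derivative f' \<tau>) (at \<tau>)" if "\<tau> \<in> {0..1}" for \<tau>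
    unfolding has_real_derivative_iff_has_vector_derivative f_def f'_def
    by (rule has_vector_derivative_inner[OF da has_vector_derivative_mv[OF dH(1)[OF that] da]])
  have df': "(f' has_real_derivative f'' \<tau>) (at \<tau>)" if "\<tau> \<in> {0..1}" for \<tau>
  proof -
    have 1: "((\<lambda>\<tau>. H \<tau> *v \<eta>) has_vector_derivative (H \<tau> *v 0 + H1 \<tau> *v \<eta>)) (at \<tau>)"
      by (rule has_vector_derivative_mv[OF dH(1)[OF that] d\<eta>])
    have 2: "((\<lambda>\<tau>. H1 \<tau> *v a \<tau>) has_vector_derivative (H1 \<tau> *v \<eta> + H2 \<tau> *v a \<tau>)) (at \<tau>)"
      by (rule has_vector_derivative_mv[OF dH(2)[OF that] da])
    have 3: "((\<lambda>\<tau>. H \<tau> *v a \<tau>) has_vector_derivative (H \<tau> *v \<eta> + H1 \<tau> *v a \<tau>)) (at \<tau>)"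
      by (rule has_vector_derivative_mv[OF dH(1)[OF that] da])
    have "(f' has_vector_derivative
       ((a \<tau> \<bullet> ((H \<tau> *v 0 + H1 \<tau> *v \<eta>) + (H1 \<tau> *v \<eta> + H2 \<tau> *v a \<tau>)) + \<eta> \<bullet> (H \<tau> *v \<eta> + H1 \<tau> *v a \<tau>)) +
        (\<eta> \<bullet> (H \<tau> *v \<eta> + H1 \<tau> *v a \<tau>) + 0 \<bullet> (H \<tau> *v a \<tau>)))) (at \<tau>)"
      unfolding f'_def
      by (rule has_vector_derivative_add[OF has_vector_derivative_inner[OF da has_vector_derivative_add[OF 1 2]]
            has_vector_derivative_inner[OF d\<eta> 3]])
    moreover have "a \<tau> \<bullet> (H \<tau> *v 0 + H1 \<tau> *v \<eta> + (H1 \<tau> *v \<eta> + H2 \<tau> *v a \<tau>)) +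
        \<eta> \<bullet> (H \<tau> *v \<eta> + H1 \<tau> *v a \<tau>) + (\<eta> \<bullet> (H \<tau> *v \<eta> + H1 \<tau> *v a \<tau>) + 0 \<bullet> (H \<tau> *v a \<tau>)) = f'' \<tau>"
      unfolding f''_def inner_add_right by simp
    ultimately show ?thesis unfolding has_real_derivative_iff_has_vector_derivative by (simp only:)
  qed
  let ?m = "2 * l\<^sup>2 * (norm \<eta>)\<^sup>2 - C * B\<^sup>2 * (norm \<xi>)\<^sup>2 - 4 * C * B * norm \<xi> * norm \<eta>"
  have m: "?m \<le> f'' \<tau>" if "\<tau> \<in> {0..1}" for \<tau>
  proof -
    have 1: "l\<^sup>2 * (norm \<eta>)\<^sup>2 \<le> \<eta> \<bullet> (H \<tau> *v \<eta>)" unfolding H_def by (rule lower2[OF uR[OF that] w])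
    have an: "norm (a \<tau>) \<le> B" unfolding a_def by (rule aB[OF that])
    have 2: "\<bar>a \<tau> \<bullet> (H1 \<tau> *v \<eta>)\<bar> \<le> C * norm \<xi> * B * norm \<eta>"
    proof -
      have "\<bar>a \<tau> \<bullet> (H1 \<tau> *v \<eta>)\<bar> \<le> C * norm \<xi> * norm (a \<tau>) * norm \<eta>" unfolding H1_def by (rule inner_dirder_le[OF uR[OF that] w])
      also have "\<dots> \<le> C * norm \<xi> * B * norm \<eta>" using an C by (intro mult_right_mono mult_left_mono) auto
      finally show ?thesis .
    qed
    have 3: "\<bar>\<eta> \<bullet> (H1 \<tau> *v a \<tau>)\<bar> \<le> C * norm \<xi> * norm \<eta> * B"
    proof -
      have "\<bar>\<eta> \<bullet> (H1 \<tau> *v a \<tau>)\<bar> \<le> C * norm \<xi> * norm \<eta> * norm (a \<tau>)" unfolding H1_def by (rule inner_dirder_le[OF uR[OF that] w])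
      also have "\<dots> \<le> C * norm \<xi> * norm \<eta> * B" using an C by (intro mult_left_mono) auto
      finally show ?thesis .
    qed
    have 4: "\<bar>a \<tau> \<bullet> (H2 \<tau> *v a \<tau>)\<bar> \<le> C * norm \<xi> * norm \<xi> * B * B"
    proof -
      have "\<bar>a \<tau> \<bullet> (H2 \<tau> *v a \<tau>)\<bar> \<le> norm (H2 \<tau>) * norm (a \<tau>) * norm (a \<tau>)" by (rule inner_matrix_le)
      also have "\<dots> \<le> (C * norm \<xi> * norm \<xi>) * B * B"
        using an C C2[OF uR[OF that] w, of \<xi> \<xi>] B unfolding H2_def by (intro mult_mono) auto
      finally show ?thesis .
    qed
    have "f'' \<tau> \<ge> 2 * (l\<^sup>2 * (norm \<eta>)\<^sup>2) - 2 * (C * norm \<xi> * B * norm \<eta>) - 2 * (C * norm \<xi> * norm \<eta> * B) - C * norm \<xi> * norm \<xi> * B * B"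
      using 1 2 3 4 unfolding f''_def by linarith
    then show ?thesis by (simp add: power2_eq_square mult_ac)
  qed
  have cf: "continuous_on {0..1} f"
    using DERIV_isCont[OF df] by (auto intro: continuous_at_imp_continuous_on)
  have "f t \<le> (1 - t) * f 0 + t * f 1 - ?m * (t * (1 - t)) / 2"
    by (rule second_derivative_chord[OF cf df df' m t]) auto
  then show ?thesis by (simp add: f_def a_def H_def \<xi>_def \<eta>_def)
qed

text \<open>A short minimal geodesic is confined to the patch like any short path, so it obeys one
  differential equation on the whole of \<open>{0..1}\<close>. Since its speed is constant and its
  parameter interval has length 1, the speed is the distance between its end points.\<close>

lemma geodesic_coords:
  assumes w: "w \<in> W" and L: "L > 0" "norm va + L / l \<le> R"
    and sg: "shortest_geodesic A g \<gamma> (chart_inv (A x0) (va, w)) z"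
    and d: "leaf_dist A g (chart_inv (A x0) (va, w)) z < ennreal L"
  obtains q q' q'' and el :: real where "q 0 = va" "z = chart_inv (A x0) (q 1, w)"
    "\<And>t. t \<in> {0..1} \<Longrightarrow> \<gamma> t = chart_inv (A x0) (q t, w)"
    "\<And>t. t \<in> {0..1} \<Longrightarrow> q t \<in> ball va (L / l)"
    "\<And>t. t \<in> {0..1} \<Longrightarrow> (q has_vector_derivative q' t) (at t within {0..1})"
    "\<And>t. t \<in> {0..1} \<Longrightarrow> (q' has_vector_derivative q'' t) (at t within {0..1})"
    "\<And>t. t \<in> {0..1} \<Longrightarrow> norm (q'' t) \<le> 3 * C / (2 * l\<^sup>2) * (norm (q' t))\<^sup>2"
    "\<And>t. t \<in> {0..1} \<Longrightarrow> q' t \<bullet> (hm x0 (q t, w) *v q' t) = el\<^sup>2"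
    "el \<ge> 0" "leaf_dist A g (chart_inv (A x0) (va, w)) z = ennreal el"
proof -
  have geo: "geodesic A g \<gamma>" and g0: "\<gamma> 0 = chart_inv (A x0) (va, w)" and g1: "\<gamma> 1 = z"
    and pl: "path_len A g \<gamma> = leaf_dist A g (chart_inv (A x0) (va, w)) z"
    using sg by (auto simp: shortest_geodesic_def)
  have c: "cball va (L / l) \<subseteq> cball 0 R"
  proof
    fix v assume "v \<in> cball va (L / l)"
    then show "v \<in> cball 0 R" using L(2) norm_triangle_sub[of v va] by (simp add: dist_norm norm_minus_commute)
  qed
  have Ll: "l * (L / l) = L" "L / l > 0" using l L by auto
  have conf: "\<gamma> t \<in> (\<lambda>v. chart_inv (A x0) (v, w)) ` ball va (L / l)" if "t \<in> {0..1}" for t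
  proof (rule leafwise_path_confined[OF geodesic_imp_leafwise_path[OF geo] g0 W_int[OF w] Ll(2) _ l _ _ that])
    show "cball va (L / l) \<subseteq> box (- 1) 1" using c R by blast
    show "l * norm a \<le> sqrt (a \<bullet> (hm x0 (v, w) *v a))" if "v \<in> cball va (L / l)" for v a
      using lower[OF subsetD[OF c that] w] .
    show "path_len A g \<gamma> < ennreal (l * (L / l))" unfolding Ll pl by (rule d)
  qed
  have bc: "ball va (L / l) \<subseteq> cball 0 R" using c ball_subset_cball by blast
  define q where "q t = lcoord (A x0) (\<gamma> t)" for t
  have q: "q t \<in> ball va (L / l)" "\<gamma> t = chart_inv (A x0) (q t, w)" "tproj (A x0) (\<gamma> t) = w" "q t \<in> cball 0 R"
    if "t \<in> {0..1}" for t
  proof -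
    obtain v where v: "v \<in> ball va (L / l)" "\<gamma> t = chart_inv (A x0) (v, w)" using conf[OF \<open>t \<in> {0..1}\<close>] by blast
    have dm: "(v, w) \<in> dom_box x0" using dom_patch[OF subsetD[OF bc v(1)] w] .
    have "q t = v" using A_lcoord_inv[OF dm] v(2) by (simp add: q_def)
    then show "q t \<in> ball va (L / l)" "\<gamma> t = chart_inv (A x0) (q t, w)" "q t \<in> cball 0 R" using v bc by auto
    show "tproj (A x0) (\<gamma> t) = w" using A_tproj_inv[OF dm] v(2) by simp
  qed
  have sub: "\<gamma> ` {0..1} \<subseteq> udom (A x0)" using q(2) A_inv_udom[OF dom_patch[OF q(4) w]] by auto
  have ab: "0 \<le> (0::real) \<and> 0 < (1::real) \<and> 1 \<le> (1::real) \<and> \<gamma> ` {0..1} \<subseteq> udom (A x0)" using sub by simp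
  from geo[unfolded geodesic_def, THEN conjunct2, rule_format, OF ab]
  obtain q' where Q: "\<forall>t\<in>{0..1}. ((\<lambda>s. lcoord (A x0) (\<gamma> s)) has_vector_derivative q' t) (at t within {0..1}) \<and>
           (q' has_vector_derivative
              (\<chi> k. - (\<Sum>i\<in>UNIV. \<Sum>j\<in>UNIV.
                 christoffel (local_metric A g (A x0) (tproj (A x0) (\<gamma> t))) k i j (lcoord (A x0) (\<gamma> t))
                 * q' t $ i * q' t $ j))) (at t within {0..1})" by blast
  define G where "G t = (\<chi> k. \<Sum>i\<in>UNIV. \<Sum>j\<in>UNIV. christoffel (\<lambda>u. hm x0 (u, w)) k i j (q t) * q' t $ i * q' t $ j)" for t
  have lm: "local_metric A g (A x0) w = (\<lambda>u. hm x0 (u, w))" by (simp add: hm_def fun_eq_iff)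
  have dq: "(q has_vector_derivative q' t) (at t within {0..1})" if "t \<in> {0..1}" for t
    using Q that unfolding q_def[abs_def] by blast
  have dq': "(q' has_vector_derivative - G t) (at t within {0..1})" if "t \<in> {0..1}" for t
  proof -
    have "- G t = (\<chi> k. - (\<Sum>i\<in>UNIV. \<Sum>j\<in>UNIV.
                 christoffel (local_metric A g (A x0) (tproj (A x0) (\<gamma> t))) k i j (lcoord (A x0) (\<gamma> t))
                 * q' t $ i * q' t $ j))" unfolding q(3)[OF that] lm G_def q_def by (simp add: vec_eq_iff)
    then show ?thesis by (simp only: bspec[OF Q that, THEN conjunct2])
  qed
  have GI: "y \<bullet> (hm x0 (q t, w) *v G t) =
    q' t \<bullet> (dirder (q' t) (hm x0) (q t, w) *v y) - q' t \<bullet> (dirder y (hm x0) (q t, w) *v q' t) / 2" if "t \<in> {0..1}" for t y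
    unfolding G_def by (rule christoffel_quadratic[OF dom_patch[OF q(4)[OF that] w]])
  \<comment> \<open>Testing the quadratic identity with \<open>G t\<close> itself gives a right-hand
    side linear in \<open>norm (G t)\<close>: a term with constant \<open>C\<close> and one with
    \<open>C / 2\<close>, hence the factor 3/2.\<close>
  have bound: "norm (- G t) \<le> 3 * C / (2 * l\<^sup>2) * (norm (q' t))\<^sup>2" if t: "t \<in> {0..1}" for t
  proof (cases "G t = 0")
    case False
    have "l\<^sup>2 * (norm (G t))\<^sup>2 \<le> G t \<bullet> (hm x0 (q t, w) *v G t)" by (rule lower2[OF q(4)[OF t] w])
    also have "\<dots> \<le> C * norm (q' t) * norm (q' t) * norm (G t) + C * norm (G t) * norm (q' t) * norm (q' t) / 2"
      unfolding GI[OF t]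
      using inner_dirder_le[OF q(4)[OF t] w, of "q' t" "q' t" "G t"] inner_dirder_le[OF q(4)[OF t] w, of "q' t" "G t" "q' t"] by linarith
    also have "\<dots> = (3 * C / 2 * (norm (q' t))\<^sup>2) * norm (G t)" by (simp add: power2_eq_square)
    finally have "(l\<^sup>2 * norm (G t)) * norm (G t) \<le> (3 * C / 2 * (norm (q' t))\<^sup>2) * norm (G t)" by (simp add: power2_eq_square mult.assoc)
    then have "l\<^sup>2 * norm (G t) \<le> 3 * C / 2 * (norm (q' t))\<^sup>2" using False by simp
    then show ?thesis using l by (simp add: field_simps)
  qed (use C l in simp)
  define \<psi> where "\<psi> t = q' t \<bullet> (hm x0 (q t, w) *v q' t)" for t
  \<comment> \<open>Conservation of energy: tested with the velocity, the Christoffel terms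
    contribute minus the derivative of the metric along the curve.\<close>
  have "(\<psi> has_vector_derivative 0) (at t within {0..1})" if t: "t \<in> {0..1}" for t
  proof -
    have d: "((\<lambda>v. hm x0 (v, w)) has_derivative (\<lambda>u. dirder u (hm x0) (q t, w))) (at (q t))"
      using ck_has_derivative[OF hm_ck[of "Suc 0"] dom_patch[OF q(4)[OF t] w]] by simp
    have "((\<lambda>t. hm x0 (q t, w)) has_derivative (\<lambda>s. dirder (s *\<^sub>R q' t) (hm x0) (q t, w))) (at t within {0..1})"
      by (rule has_derivative_compose[OF dq[OF t, unfolded has_vector_derivative_def] d])
    then have dh: "((\<lambda>t. hm x0 (q t, w)) has_vector_derivative dirder (q' t) (hm x0) (q t, w)) (at t within {0..1})"
      unfolding has_vector_derivative_def using linear_scale[OF has_derivative_linear[OF d]] by simp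
    have "(\<psi> has_vector_derivative (q' t \<bullet> (hm x0 (q t, w) *v (- G t) + dirder (q' t) (hm x0) (q t, w) *v q' t)
        + (- G t) \<bullet> (hm x0 (q t, w) *v q' t))) (at t within {0..1})"
      unfolding \<psi>_def by (rule has_vector_derivative_inner[OF dq'[OF t] has_vector_derivative_mv[OF dh dq'[OF t]]])
    moreover have "q' t \<bullet> (hm x0 (q t, w) *v (- G t) + dirder (q' t) (hm x0) (q t, w) *v q' t)
        + (- G t) \<bullet> (hm x0 (q t, w) *v q' t) = 0"
    proof -
      have mneg: "hm x0 (q t, w) *v (- G t) = - (hm x0 (q t, w) *v G t)"
        using matrix_vector_mult_scaleR[of "hm x0 (q t, w)" "-1" "G t"] by simp
      show ?thesis
        using GI[OF t, of "q' t"] hm_symmetric[OF dom_patch[OF q(4)[OF t] w], of "G t" "q' t"]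
        by (simp add: mneg inner_diff_right)
    qed
    ultimately show ?thesis by simp
  qed
  then obtain k where k: "\<And>t. t \<in> {0..1} \<Longrightarrow> \<psi> t = k"
    using has_vector_derivative_zero_constant[of "{0..1}" \<psi>] by auto
  have "k \<ge> 0" using k[of 0] quad_nonneg[OF q(4)[of 0] w, of "q' 0"] by (simp add: \<psi>_def)
  define el where "el = sqrt k"
  have el: "el \<ge> 0" "el\<^sup>2 = k" using \<open>k \<ge> 0\<close> by (auto simp: el_def)
  have "path_len A g \<gamma> = (\<integral>\<^sup>+ t. ennreal el * indicator {0..1::real} t \<partial>lborel)"
    unfolding path_len_def
  proof (rule nn_integral_cong)
    fix t :: real
    show "ennreal (sqrt (g (\<gamma> t) (velocity A \<gamma> t) (velocity A \<gamma> t))) * indicator {0..1} t = ennreal el * indicator {0..1} t"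
    proof (cases "t \<in> {0..1}")
      case True
      have qb: "q t \<in> box (- 1) 1" using q(4)[OF True] R by blast
      have "g (\<gamma> t) (velocity A \<gamma> t) (velocity A \<gamma> t) = \<psi> t"
        unfolding \<psi>_def by (rule speed_eq[OF True W_int[OF w] qb dq[OF True] zero_less_one]) (rule q(2))
      then show ?thesis using k[OF True] by (simp add: el_def)
    qed simp
  qed
  then have "path_len A g \<gamma> = ennreal el" by (simp add: nn_integral_cmult)
  then have ld: "leaf_dist A g (chart_inv (A x0) (va, w)) z = ennreal el" using pl by simp
  have q0: "q 0 = va"
  proof -
    have "va \<in> cball 0 R" using L Ll(2) by simp
    then show ?thesis using A_lcoord_inv[OF dom_patch[OF _ w]] g0 by (simp add: q_def)
  qed
  show ?thesis
  proof (rule that[of q q' "\<lambda>t. - G t" el])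
    show "z = chart_inv (A x0) (q 1, w)" using q(2)[of 1] g1 by simp
    show "q' t \<bullet> (hm x0 (q t, w) *v q' t) = el\<^sup>2" if "t \<in> {0..1}" for t using k[OF that] el(2) by (simp add: \<psi>_def)
  qed (use q0 q dq dq' bound el ld in auto)
qed

end

context metric_patch
begin

text \<open>The acceleration bound of \<open>geodesic_coords\<close> for a minimal geodesic between
  \<open>P\<close> and \<open>Q\<close>, whose coordinate speed is at most
  \<open>(Lm / l) * norm (Q - P)\<close>: the coordinate acceleration is at most
  \<open>Kc * (norm (Q - P))^2\<close>.\<close>

definition Kc :: real where "Kc = 3 * C / (2 * l\<^sup>2) * (Lm / l)\<^sup>2"

lemma Kc: "Kc \<ge> 0" using C by (simp add: Kc_def)

text \<open>Interpolating linearly between two minimal geodesics issuing from the centre makes the energy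
  strictly convex; this gain dominates the cost of moving the end point from the chord to the
  geodesic joining the two end points.\<close>

lemma geodesic_stays:
  assumes w: "w \<in> W" and \<delta>: "\<delta> > 0"
  defines "B \<equiv> \<delta> / l"
  assumes c1: "B \<le> 1" and c2: "norm v1 + 3 * B + 5 * Lm * B / l \<le> R" and c3: "2 * Kc * B \<le> 1"
    and c4: "B * (5 * C + 4 * C * Kc) \<le> 2 * l\<^sup>2"
  defines "y \<equiv> chart_inv (A x0) (v1, w)"
  assumes p: "p \<in> leaf_cball A g y \<delta>" and q: "q \<in> leaf_cball A g y \<delta>"
    and sp: "shortest_geodesic A g \<sigma>0 y p" and sq: "shortest_geodesic A g \<sigma>1 y q"
    and sg: "shortest_geodesic A g \<gamma> p q" and t: "t \<in> {0..1}"
  shows "\<gamma> t \<in> leaf_cball A g y \<delta>"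
proof -
  have B: "B > 0" "l * B = \<delta>" using \<delta> l by (auto simp: B_def)
  have LB: "5 * Lm * B / l \<ge> 0" using Lm l B by simp
  have e2: "2 * \<delta> / l = 2 * B" by (simp add: B_def)
  have L: "2 * \<delta> > 0" "norm v1 + 2 * \<delta> / l \<le> R" using \<delta> c2 B(1) LB unfolding e2 by linarith+
  have lt: "ennreal \<delta> < ennreal (2 * \<delta>)" using \<delta> by (intro ennreal_lessI) auto
  have dp: "leaf_dist A g y p \<le> ennreal \<delta>" and dq: "leaf_dist A g y q \<le> ennreal \<delta>"
    using p q by (simp_all add: leaf_cball_def)
  obtain s0 a0 s0'' l0 where "s0 0 = v1" "p = chart_inv (A x0) (s0 1, w)"
    "\<And>t. t \<in> {0..1} \<Longrightarrow> \<sigma>0 t = chart_inv (A x0) (s0 t, w)"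
    "\<And>t. t \<in> {0..1} \<Longrightarrow> s0 t \<in> ball v1 (2 * \<delta> / l)"
    "\<And>t. t \<in> {0..1} \<Longrightarrow> (s0 has_vector_derivative a0 t) (at t within {0..1})"
    "\<And>t. t \<in> {0..1} \<Longrightarrow> (a0 has_vector_derivative s0'' t) (at t within {0..1})"
    "\<And>t. t \<in> {0..1} \<Longrightarrow> norm (s0'' t) \<le> 3 * C / (2 * l\<^sup>2) * (norm (a0 t))\<^sup>2"
    "\<And>t. t \<in> {0..1} \<Longrightarrow> a0 t \<bullet> (hm x0 (s0 t, w) *v a0 t) = l0\<^sup>2" "l0 \<ge> 0" "leaf_dist A g y p = ennreal l0"
    by (rule geodesic_coords[OF w L sp[unfolded y_def] le_less_trans[OF dp[unfolded y_def] lt], folded y_def]) (rule that[rotated 2], assumption+)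
  note s0 = this(1,2,4-6,8-10)
  obtain s1 a1 s1'' l1 where "s1 0 = v1" "q = chart_inv (A x0) (s1 1, w)"
    "\<And>t. t \<in> {0..1} \<Longrightarrow> \<sigma>1 t = chart_inv (A x0) (s1 t, w)"
    "\<And>t. t \<in> {0..1} \<Longrightarrow> s1 t \<in> ball v1 (2 * \<delta> / l)"
    "\<And>t. t \<in> {0..1} \<Longrightarrow> (s1 has_vector_derivative a1 t) (at t within {0..1})"
    "\<And>t. t \<in> {0..1} \<Longrightarrow> (a1 has_vector_derivative s1'' t) (at t within {0..1})"
    "\<And>t. t \<in> {0..1} \<Longrightarrow> norm (s1'' t) \<le> 3 * C / (2 * l\<^sup>2) * (norm (a1 t))\<^sup>2"
    "\<And>t. t \<in> {0..1} \<Longrightarrow> a1 t \<bullet> (hm x0 (s1 t, w) *v a1 t) = l1\<^sup>2" "l1 \<ge> 0" "leaf_dist A g y q = ennreal l1"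
    by (rule geodesic_coords[OF w L sq[unfolded y_def] le_less_trans[OF dq[unfolded y_def] lt], folded y_def]) (rule that[rotated 2], assumption+)
  note s1 = this(1,2,4-6,8-10)
  have l0: "l0 \<le> \<delta>" using dp s0(8) \<delta> by (simp add: ennreal_le_iff)
  have l1: "l1 \<le> \<delta>" using dq s1(8) \<delta> by (simp add: ennreal_le_iff)
  \<comment> \<open>The budget \<open>3 * B\<close> consists of \<open>2 * B\<close> for points
    interpolated between the two geodesics from the centre and \<open>B\<close> for the correction
    \<open>e\<close>.\<close>
  have sR: "v \<in> cball 0 R" if "norm (v - v1) \<le> 3 * B" for v
    using that norm_triangle_sub[of v v1] c2 LB by simp
  have n0: "norm (s0 t - v1) \<le> 2 * B" and n1: "norm (s1 t - v1) \<le> 2 * B" if "t \<in> {0..1}" for t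
    using s0(3)[OF that] s1(3)[OF that] unfolding e2 by (simp_all add: dist_norm norm_minus_commute)
  have R0: "s0 t \<in> cball 0 R" and R1: "s1 t \<in> cball 0 R" if "t \<in> {0..1}" for t
    using n0[OF that] n1[OF that] B(1) by (intro sR; linarith)+
  have speed: "norm a \<le> B" if "v \<in> cball 0 R" "a \<bullet> (hm x0 (v, w) *v a) = k\<^sup>2" "0 \<le> k" "k \<le> \<delta>" for v a k
  proof -
    have "l * norm a \<le> \<delta>" using lower[OF that(1) w, of a] that(2-4) by simp
    then show ?thesis using l by (simp add: B_def field_simps)
  qed
  have A0: "norm (a0 t) \<le> B" and A1: "norm (a1 t) \<le> B" if "t \<in> {0..1}" for t
    using speed[OF R0[OF that] s0(6)[OF that] s0(7) l0] speed[OF R1[OF that] s1(6)[OF that] s1(7) l1] by auto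
  define P where "P = s0 1"
  define Q where "Q = s1 1"
  have PR: "P \<in> cball 0 R" "Q \<in> cball 0 R" using R0[of 1] R1[of 1] by (simp_all add: P_def Q_def)
  have PQ: "norm (Q - P) \<le> 4 * B" using n0[of 1] n1[of 1] norm_triangle_ineq4[of "Q - v1" "P - v1"] by (simp add: P_def Q_def)
  \<comment> \<open>The end points are at most \<open>4 * B\<close> apart; the factor 5 leaves room
    for the strict inequality required for confinement.\<close>
  have L2: "5 * Lm * B > 0" "norm P + 5 * Lm * B / l \<le> R"
    using Lm B n0[of 1] norm_triangle_sub[of P v1] c2 by (auto simp: P_def)
  have dPQ: "leaf_dist A g (chart_inv (A x0) (P, w)) q \<le> ennreal (Lm * norm (Q - P))"
    using leaf_dist_segment[OF PR w] s1(2) by (simp add: Q_def)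
  have "Lm * norm (Q - P) \<le> Lm * (4 * B)" using PQ Lm by (intro mult_left_mono) auto
  also have "\<dots> < 5 * Lm * B" using Lm B by simp
  finally have "ennreal (Lm * norm (Q - P)) < ennreal (5 * Lm * B)" using Lm by (intro ennreal_lessI L2(1))
  with dPQ have dlt: "leaf_dist A g (chart_inv (A x0) (P, w)) q < ennreal (5 * Lm * B)" by (rule le_less_trans)
  have sg': "shortest_geodesic A g \<gamma> (chart_inv (A x0) (P, w)) q" using sg s0(2) by (simp add: P_def)
  obtain c c' c'' el where c: "c 0 = P" "q = chart_inv (A x0) (c 1, w)"
    "\<And>t. t \<in> {0..1} \<Longrightarrow> \<gamma> t = chart_inv (A x0) (c t, w)"
    "\<And>t. t \<in> {0..1} \<Longrightarrow> c t \<in> ball P (5 * Lm * B / l)"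
    "\<And>t. t \<in> {0..1} \<Longrightarrow> (c has_vector_derivative c' t) (at t within {0..1})"
    "\<And>t. t \<in> {0..1} \<Longrightarrow> (c' has_vector_derivative c'' t) (at t within {0..1})"
    "\<And>t. t \<in> {0..1} \<Longrightarrow> norm (c'' t) \<le> 3 * C / (2 * l\<^sup>2) * (norm (c' t))\<^sup>2"
    "\<And>t. t \<in> {0..1} \<Longrightarrow> c' t \<bullet> (hm x0 (c t, w) *v c' t) = el\<^sup>2"
    "el \<ge> 0" "leaf_dist A g (chart_inv (A x0) (P, w)) q = ennreal el"
    by (rule geodesic_coords[OF w L2 sg' dlt]) (rule that)
  have cR: "c t \<in> cball 0 R" if "t \<in> {0..1}" for t
    using c(4)[OF that] L2(2) norm_triangle_sub[of "c t" P] by (simp add: dist_norm norm_minus_commute)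
  have cQ: "c 1 = Q" using patch_inj[OF cR[of 1] PR(2) w] c(2) s1(2) by (simp add: Q_def)
  have ell: "el \<le> Lm * norm (Q - P)" using dPQ c(10) Lm by (simp add: ennreal_le_iff)
  define M where "M = Kc * (norm (Q - P))\<^sup>2"
  have M0: "M \<ge> 0" using Kc by (simp add: M_def)
  have acc: "norm (c'' s) \<le> M" if s: "s \<in> {0..1}" for s
  proof -
    have "l * norm (c' s) \<le> el" using lower[OF cR[OF s] w, of "c' s"] c(8)[OF s] c(9) by simp
    then have "l * norm (c' s) \<le> Lm * norm (Q - P)" using ell by linarith
    then have "norm (c' s) \<le> (Lm / l) * norm (Q - P)" using l by (simp add: field_simps)
    then have "(norm (c' s))\<^sup>2 \<le> ((Lm / l) * norm (Q - P))\<^sup>2" by (rule power_mono) simp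
    then have "3 * C / (2 * l\<^sup>2) * (norm (c' s))\<^sup>2 \<le> 3 * C / (2 * l\<^sup>2) * ((Lm / l) * norm (Q - P))\<^sup>2"
      using C by (intro mult_left_mono) auto
    then show ?thesis using c(7)[OF s] by (simp add: M_def Kc_def power_mult_distrib power_divide mult.assoc)
  qed
  \<comment> \<open>\<open>e\<close> is the deviation of the geodesic from the coordinate chord of
    its end points. Testing with \<open>e\<close> itself and using the acceleration bound gives the
    factor \<open>t * (1 - t) / 2\<close>, the same as in the convexity gain, so the two can be
    compared for every \<open>t\<close>.\<close>
  define e where "e = c t - ((1 - t) *\<^sub>R P + t *\<^sub>R Q)"
  have en: "norm e \<le> M * (t * (1 - t)) / 2"
  proof (cases "e = 0")
    case True
    then show ?thesis using M0 t by simp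
  next
    case False
    have inn: "at s within {0..1} = at s" if "s \<in> {0<..<1}" for s :: real using that by (intro at_within_Icc_at) auto
    have "e \<bullet> c t \<le> (1 - t) * (e \<bullet> c 0) + t * (e \<bullet> c 1) - (- (norm e * M)) * (t * (1 - t)) / 2"
    proof (rule second_derivative_chord[of "\<lambda>s. e \<bullet> c s" "\<lambda>s. e \<bullet> c' s" "\<lambda>s. e \<bullet> c'' s"])
      have "continuous_on {0..1} c"
        unfolding continuous_on_eq_continuous_within using has_vector_derivative_continuous[OF c(5)] by blast
      then show "continuous_on {0..1} (\<lambda>s. e \<bullet> c s)" by (intro continuous_on_inner continuous_on_const)
      fix s :: real assume s: "s \<in> {0<..<1}"
      then have s': "s \<in> {0..1}" by auto
      show "((\<lambda>s. e \<bullet> c s) has_real_derivative e \<bullet> c' s) (at s)"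
        unfolding has_real_derivative_iff_has_vector_derivative
        using bounded_linear.has_vector_derivative[OF bounded_linear_inner_right c(5)[OF s', unfolded inn[OF s]]] .
      show "((\<lambda>s. e \<bullet> c' s) has_real_derivative e \<bullet> c'' s) (at s)"
        unfolding has_real_derivative_iff_has_vector_derivative
        using bounded_linear.has_vector_derivative[OF bounded_linear_inner_right c(6)[OF s', unfolded inn[OF s]]] .
      have "\<bar>e \<bullet> c'' s\<bar> \<le> norm e * norm (c'' s)" by (rule Cauchy_Schwarz_ineq2)
      also have "\<dots> \<le> norm e * M" using acc[OF s'] by (intro mult_left_mono) auto
      finally show "- (norm e * M) \<le> e \<bullet> c'' s" by linarith
    qed (rule t)
    moreover have "e \<bullet> e = e \<bullet> c t - ((1 - t) * (e \<bullet> P) + t * (e \<bullet> Q))"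
      by (subst (2) e_def) (simp add: inner_diff_right inner_add_right)
    ultimately have "e \<bullet> e \<le> norm e * (M * (t * (1 - t)) / 2)" using c(1) cQ by simp
    then have "norm e * norm e \<le> norm e * (M * (t * (1 - t)) / 2)" by (simp add: power2_norm_eq_inner[symmetric] power2_eq_square)
    then show ?thesis using False by simp
  qed
  have tt: "0 \<le> t * (1 - t)" "t * (1 - t) \<le> 1/4"
  proof -
    show "0 \<le> t * (1 - t)" using t by simp
    have "0 \<le> (2 * t - 1)\<^sup>2" by simp
    then show "t * (1 - t) \<le> 1/4" by (simp add: power2_eq_square algebra_simps)
  qed
  \<comment> \<open>From \<open>norm (Q - P) \<le> 4 * B\<close> and
    \<open>t * (1 - t) \<le> 1/4\<close> one gets \<open>norm e \<le> 2 * Kc * B * B\<close>, and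
    \<open>c3\<close> removes the first factor.\<close>
  have eB: "norm e \<le> B"
  proof -
    have "(norm (Q - P))\<^sup>2 \<le> (4 * B)\<^sup>2" using PQ by (intro power_mono) auto
    then have M16: "M \<le> Kc * (16 * B\<^sup>2)" unfolding M_def using Kc by (intro mult_left_mono) (auto simp: power_mult_distrib)
    have "M * (t * (1 - t)) \<le> Kc * (16 * B\<^sup>2) * (1/4)" using M16 M0 tt Kc by (intro mult_mono) auto
    also have "\<dots> = (2 * Kc * B) * (2 * B)" by (simp add: power2_eq_square)
    also have "\<dots> \<le> 1 * (2 * B)" using c3 B by (intro mult_right_mono) auto
    finally show ?thesis using en by linarith
  qed
  define \<xi> where "\<xi> s = s1 s - s0 s" for s
  define \<eta> where "\<eta> s = a1 s - a0 s" for s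
  have d\<xi>: "(\<xi> has_vector_derivative \<eta> s) (at s within {0..1})" if "s \<in> {0..1}" for s
    unfolding \<xi>_def \<eta>_def by (intro has_vector_derivative_diff s0(4) s1(4) that)
  have ca: "continuous_on {0..1} a0" "continuous_on {0..1} a1"
    unfolding continuous_on_eq_continuous_within
    using has_vector_derivative_continuous[OF s0(5)] has_vector_derivative_continuous[OF s1(5)] by blast+
  have cs: "continuous_on {0..1} s0" "continuous_on {0..1} s1"
    unfolding continuous_on_eq_continuous_within
    using has_vector_derivative_continuous[OF s0(4)] has_vector_derivative_continuous[OF s1(4)] by blast+
  have c\<eta>: "continuous_on {0..1} \<eta>" unfolding \<eta>_def by (intro continuous_on_diff ca)
  \<comment> \<open>This integral controls everything that measures how far the two geodesics
    spread: \<open>\<xi>\<close> at all times and, at time 1, the distance of the end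
    points.\<close>
  define Y where "Y = integral {0..1} (\<lambda>s. (norm (\<eta> s))\<^sup>2)"
  have \<xi>Y: "(norm (\<xi> s))\<^sup>2 \<le> Y" if "s \<in> {0..1}" for s
    unfolding Y_def using s0(1) s1(1) by (intro integral_square_bound[OF d\<xi> c\<eta> _ that]) (auto simp: \<xi>_def)
  have QPY: "(norm (Q - P))\<^sup>2 \<le> Y" using \<xi>Y[of 1] by (simp add: \<xi>_def P_def Q_def)
  \<comment> \<open>The comparison curve starts at the centre, follows the interpolation with fixed
    weight \<open>t\<close>, and drifts linearly by \<open>e\<close> so as to end at the point
    \<open>c t\<close> of the geodesic.\<close>
  define r where "r s = s0 s + t *\<^sub>R \<xi> s + s *\<^sub>R e" for s
  define r' where "r' s = a0 s + t *\<^sub>R \<eta> s + e" for s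
  have lin: "norm (s0 s + t *\<^sub>R \<xi> s - v1) \<le> 2 * B" if s: "s \<in> {0..1}" for s
  proof -
    have "s0 s + t *\<^sub>R \<xi> s - v1 = (1 - t) *\<^sub>R (s0 s - v1) + t *\<^sub>R (s1 s - v1)" by (simp add: \<xi>_def algebra_simps)
    then show ?thesis using convexD[OF convex_cball, of "s0 s - v1" 0 "2 * B" "s1 s - v1" "1 - t" t] n0[OF s] n1[OF s] t by simp
  qed
  have linA: "norm (a0 s + t *\<^sub>R \<eta> s) \<le> B" if s: "s \<in> {0..1}" for s
  proof -
    have "a0 s + t *\<^sub>R \<eta> s = (1 - t) *\<^sub>R a0 s + t *\<^sub>R a1 s" by (simp add: \<eta>_def algebra_simps)
    then show ?thesis using convexD[OF convex_cball, of "a0 s" 0 B "a1 s" "1 - t" t] A0[OF s] A1[OF s] t by simp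
  qed
  have se: "norm (s *\<^sub>R e) \<le> norm e" if "s \<in> {0..1}" for s using that by (simp add: mult_left_le_one_le)
  have linR: "s0 s + t *\<^sub>R \<xi> s \<in> cball 0 R" if s: "s \<in> {0..1}" for s using lin[OF s] B by (intro sR) auto
  have rR: "r s \<in> cball 0 R" if s: "s \<in> {0..1}" for s
  proof (rule sR)
    have "norm (r s - v1) \<le> norm (s0 s + t *\<^sub>R \<xi> s - v1) + norm (s *\<^sub>R e)"
      using norm_triangle_ineq[of "s0 s + t *\<^sub>R \<xi> s - v1" "s *\<^sub>R e"] by (simp add: r_def algebra_simps)
    then show "norm (r s - v1) \<le> 3 * B" using lin[OF s] se[OF s] eB by linarith
  qed
  \<comment> \<open>Three parts: the energy of the given geodesics, at most
    \<open>\<delta>^2\<close>; the gain from convexity, after the mixed term has been split by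
    \<open>2 * norm \<xi> * norm \<eta> \<le> Y + (norm \<eta>)^2\<close>; and the cost of the
    drift.\<close>
  define G where "G s = \<delta>\<^sup>2 - ((2 * l\<^sup>2 - 2 * C * B) * (norm (\<eta> s))\<^sup>2 - 3 * C * B * Y) * (t * (1 - t)) / 2
     + 4 * C * B * (Kc * (norm (Q - P))\<^sup>2 * (t * (1 - t)) / 2)" for s
  have pw: "r' s \<bullet> (hm x0 (r s, w) *v r' s) \<le> G s" if s: "s \<in> {0..1}" for s
  proof -
    define a where "a = a0 s + t *\<^sub>R \<eta> s"
    define u where "u = s0 s + t *\<^sub>R \<xi> s"
    define H where "H = hm x0 (r s, w)"
    have aB: "norm a \<le> B" unfolding a_def by (rule linA[OF s])
    have Y0: "Y \<ge> 0" using \<xi>Y[OF s] by (meson order_trans zero_le_power2)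
    have 1: "a \<bullet> (hm x0 (u, w) *v a) \<le> \<delta>\<^sup>2 - ((2 * l\<^sup>2 - 2 * C * B) * (norm (\<eta> s))\<^sup>2 - 3 * C * B * Y) * (t * (1 - t)) / 2"
    proof -
      have "a \<bullet> (hm x0 (u, w) *v a) \<le> (1 - t) * (a0 s \<bullet> (hm x0 (s0 s, w) *v a0 s)) + t * (a1 s \<bullet> (hm x0 (s1 s, w) *v a1 s))
         - (2 * l\<^sup>2 * (norm (\<eta> s))\<^sup>2 - C * B\<^sup>2 * (norm (\<xi> s))\<^sup>2 - 4 * C * B * norm (\<xi> s) * norm (\<eta> s)) * (t * (1 - t)) / 2"
        unfolding a_def u_def \<eta>_def \<xi>_def by (rule energy_chord[OF R0[OF s] R1[OF s] w A0[OF s] A1[OF s] t])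
      moreover have "(1 - t) * (a0 s \<bullet> (hm x0 (s0 s, w) *v a0 s)) + t * (a1 s \<bullet> (hm x0 (s1 s, w) *v a1 s)) \<le> \<delta>\<^sup>2"
      proof -
        have "l0\<^sup>2 \<le> \<delta>\<^sup>2" "l1\<^sup>2 \<le> \<delta>\<^sup>2" using l0 l1 s0(7) s1(7) by (auto intro: power_mono)
        then have "(1 - t) * l0\<^sup>2 + t * l1\<^sup>2 \<le> (1 - t) * \<delta>\<^sup>2 + t * \<delta>\<^sup>2" using t by (intro add_mono mult_left_mono) auto
        then show ?thesis using s0(6)[OF s] s1(6)[OF s] by (simp add: algebra_simps)
      qed
      moreover have "((2 * l\<^sup>2 - 2 * C * B) * (norm (\<eta> s))\<^sup>2 - 3 * C * B * Y) * (t * (1 - t))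
         \<le> (2 * l\<^sup>2 * (norm (\<eta> s))\<^sup>2 - C * B\<^sup>2 * (norm (\<xi> s))\<^sup>2 - 4 * C * B * norm (\<xi> s) * norm (\<eta> s)) * (t * (1 - t))"
      proof (rule mult_right_mono[OF _ tt(1)])
        have i: "B\<^sup>2 * (norm (\<xi> s))\<^sup>2 \<le> B * Y"
        proof -
          have "B\<^sup>2 \<le> B" using c1 B by (simp add: power2_eq_square mult_left_le)
          then show ?thesis using \<xi>Y[OF s] B by (intro mult_mono) auto
        qed
        have ii: "2 * (norm (\<xi> s) * norm (\<eta> s)) \<le> Y + (norm (\<eta> s))\<^sup>2"
          using sum_squares_bound[of "norm (\<xi> s)" "norm (\<eta> s)"] \<xi>Y[OF s] by simp
        have "C * (B\<^sup>2 * (norm (\<xi> s))\<^sup>2) \<le> C * (B * Y)" using i C by (intro mult_left_mono) auto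
        moreover have "(2 * C * B) * (2 * (norm (\<xi> s) * norm (\<eta> s))) \<le> (2 * C * B) * (Y + (norm (\<eta> s))\<^sup>2)"
          using ii C B by (intro mult_left_mono) auto
        ultimately show "(2 * l\<^sup>2 - 2 * C * B) * (norm (\<eta> s))\<^sup>2 - 3 * C * B * Y \<le>
          2 * l\<^sup>2 * (norm (\<eta> s))\<^sup>2 - C * B\<^sup>2 * (norm (\<xi> s))\<^sup>2 - 4 * C * B * norm (\<xi> s) * norm (\<eta> s)"
          by (simp add: algebra_simps)
      qed
      ultimately show ?thesis by linarith
    qed
    \<comment> \<open>Four contributions of size \<open>C * B * norm e\<close>: the change of the
      metric, two mixed terms, and the square of the drift velocity.\<close>
    have 2: "(a + e) \<bullet> (H *v (a + e)) \<le> a \<bullet> (hm x0 (u, w) *v a) + 4 * C * B * norm e"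
    proof -
      have nH: "norm H \<le> C" unfolding H_def by (rule C0[OF rR[OF s] w])
      have *: "x \<bullet> (H *v y) \<le> C * norm x * norm y" for x y
      proof -
        have "x \<bullet> (H *v y) \<le> norm H * norm x * norm y" using inner_matrix_le[of x H y] by linarith
        also have "\<dots> \<le> C * norm x * norm y" using nH by (intro mult_right_mono) auto
        finally show ?thesis .
      qed
      have "norm (hm x0 (r s, w) - hm x0 (u, w)) \<le> C * norm (r s - u)" by (rule hm_lip[OF rR[OF s] _ w]) (use linR[OF s] in \<open>simp add: u_def\<close>)
      also have "\<dots> \<le> C * norm e" using se[OF s] C by (intro mult_left_mono) (auto simp: r_def u_def)
      finally have "a \<bullet> (H *v a) \<le> a \<bullet> (hm x0 (u, w) *v a) + C * norm e * (norm a)\<^sup>2" unfolding H_def by (rule quad_le)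
      moreover have "C * norm e * (norm a)\<^sup>2 \<le> C * norm e * B"
      proof -
        have "(norm a)\<^sup>2 \<le> B * 1" unfolding power2_eq_square using aB c1 B(1) by (intro mult_mono) auto
        then show ?thesis using C by (intro mult_left_mono) auto
      qed
      moreover have "C * norm a * norm e \<le> C * B * norm e" using aB C by (intro mult_right_mono mult_left_mono) auto
      moreover have "C * norm e * norm e \<le> C * B * norm e" using eB C by (intro mult_right_mono mult_left_mono) auto
      moreover have "(a + e) \<bullet> (H *v (a + e)) = a \<bullet> (H *v a) + a \<bullet> (H *v e) + e \<bullet> (H *v a) + e \<bullet> (H *v e)"
        by (simp add: matrix_vector_right_distrib inner_add_left inner_add_right)
      ultimately show ?thesis using *[of a e] *[of e a] *[of e e] by (simp add: mult_ac)
    qed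
    have 3: "4 * C * B * norm e \<le> 4 * C * B * (Kc * (norm (Q - P))\<^sup>2 * (t * (1 - t)) / 2)"
      using en C B unfolding M_def by (intro mult_left_mono) auto
    have r'e: "r' s = a + e" by (simp add: r'_def a_def)
    show ?thesis using 1 2 3 unfolding G_def H_def r'e by linarith
  qed
  have cG: "continuous_on {0..1} G" unfolding G_def
    by (intro continuous_intros continuous_on_power continuous_on_norm c\<eta>) auto
  \<comment> \<open>Integration over the curve turns \<open>(norm (\<eta> s))^2\<close> into
    \<open>Y\<close>, so the gain becomes \<open>(2 * l^2 - 5 * C * B) * Y\<close>; by
    \<open>c4\<close> it outweighs the cost \<open>4 * C * B * Kc * Y\<close>.\<close>
  have intG: "integral {0..1} G \<le> \<delta>\<^sup>2"
  proof -
    define k1 where "k1 = (2 * l\<^sup>2 - 2 * C * B) * (t * (1 - t)) / 2"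
    define k0 where "k0 = \<delta>\<^sup>2 + 3 * C * B * Y * (t * (1 - t)) / 2 + 4 * C * B * (Kc * (norm (Q - P))\<^sup>2 * (t * (1 - t)) / 2)"
    have Gk: "G = (\<lambda>s. k0 - k1 * (norm (\<eta> s))\<^sup>2)" unfolding G_def k0_def k1_def by (simp add: fun_eq_iff field_simps)
    have i: "(\<lambda>s. (norm (\<eta> s))\<^sup>2) integrable_on {0..1}"
      by (intro integrable_continuous_interval continuous_on_power continuous_on_norm c\<eta>)
    have "integral {0..1} G = k0 - k1 * Y"
    proof -
      have "((\<lambda>s. k0 - k1 * (norm (\<eta> s))\<^sup>2) has_integral (k0 * (1 - 0) - k1 * Y)) {0..1}"
        using has_integral_diff[OF has_integral_const_real[of k0 0 1] has_integral_mult_right[OF integrable_integral[OF i], of k1]]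
        by (simp add: Y_def)
      then show ?thesis unfolding Gk by (simp add: integral_unique)
    qed
    also have "\<dots> = \<delta>\<^sup>2 - (t * (1 - t)) / 2 * ((2 * l\<^sup>2 - 5 * C * B) * Y - 4 * C * B * Kc * (norm (Q - P))\<^sup>2)"
      by (simp add: k0_def k1_def field_simps)
    also have "\<dots> \<le> \<delta>\<^sup>2"
    proof -
      have "(4 * C * B * Kc) * (norm (Q - P))\<^sup>2 \<le> (4 * C * B * Kc) * Y" using QPY C B Kc by (intro mult_left_mono) auto
      moreover have "(4 * C * B * Kc) * Y \<le> (2 * l\<^sup>2 - 5 * C * B) * Y"
      proof (rule mult_right_mono)
        show "4 * C * B * Kc \<le> 2 * l\<^sup>2 - 5 * C * B" using c4 by (simp add: algebra_simps)
        show "Y \<ge> 0" using QPY by (meson order_trans zero_le_power2)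
      qed
      ultimately have "0 \<le> (2 * l\<^sup>2 - 5 * C * B) * Y - 4 * C * B * Kc * (norm (Q - P))\<^sup>2" by linarith
      then have "0 \<le> (t * (1 - t)) / 2 * ((2 * l\<^sup>2 - 5 * C * B) * Y - 4 * C * B * Kc * (norm (Q - P))\<^sup>2)"
        using tt(1) by (intro mult_nonneg_nonneg) auto
      then show ?thesis by linarith
    qed
    finally show ?thesis .
  qed
  have pwc: "pw_curve {0..1} r r' {0, 1}"
    unfolding pw_curve_def
  proof (intro conjI ballI)
    show "continuous_on {0..1} r" unfolding r_def \<xi>_def by (intro continuous_intros cs)
    show "continuous_on ({0..1} - {0, 1}) r'" unfolding r'_def
      by (intro continuous_intros continuous_on_subset[OF ca(1)] continuous_on_subset[OF c\<eta>]) auto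
    fix s :: real assume s: "s \<in> {0..1} - {0, 1}"
    then have s': "s \<in> {0..1}" and "at s within {0..1} = at s" by (auto intro!: at_within_Icc_at)
    then have "(s0 has_vector_derivative a0 s) (at s)" "(\<xi> has_vector_derivative \<eta> s) (at s)"
      using s0(4)[OF s'] d\<xi>[OF s'] by simp_all
    then show "(r has_vector_derivative r' s) (at s)" unfolding r_def r'_def
      by (auto intro!: derivative_eq_intros)
  qed simp
  have "clen (\<lambda>v. hm x0 (v, w)) r r' \<le> ennreal \<delta>"
  proof -
    \<comment> \<open>From energy to length by
      \<open>sqrt X \<le> X / (2 * \<delta>) + \<delta> / 2\<close>, with equality at
      \<open>X = \<delta>^2\<close>: an energy of at most \<open>\<delta>^2\<close> yields a length
      of at most \<delta>.\<close>
    define F where "F s = G s / (2 * \<delta>) + \<delta> / 2" for s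
    have F: "sqrt (r' s \<bullet> (hm x0 (r s, w) *v r' s)) \<le> F s" if s: "s \<in> {0..1}" for s
    proof -
      define X where "X = r' s \<bullet> (hm x0 (r s, w) *v r' s)"
      have X: "X \<ge> 0" unfolding X_def by (rule quad_nonneg[OF rR[OF s] w])
      have "sqrt X * (2 * \<delta>) \<le> X + \<delta>\<^sup>2" using sum_squares_bound[of "sqrt X" \<delta>] X by (simp add: mult_ac)
      then have "sqrt X \<le> (X + \<delta>\<^sup>2) / (2 * \<delta>)" using \<delta> by (simp add: pos_le_divide_eq)
      also have "\<dots> \<le> (G s + \<delta>\<^sup>2) / (2 * \<delta>)" using pw[OF s] \<delta> by (intro divide_right_mono) (auto simp: X_def)
      also have "\<dots> = F s" using \<delta> by (simp add: F_def add_divide_distrib power2_eq_square)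
      finally show ?thesis by (simp add: X_def)
    qed
    have Fnn: "F s \<ge> 0" if "s \<in> {0..1}" for s
      using F[OF that] quad_nonneg[OF rR[OF that] w, of "r' s"] by (meson order_trans real_sqrt_ge_zero)
    have cF: "continuous_on {0..1} F" unfolding F_def using \<delta> by (intro continuous_intros cG) auto
    have iF: "(F has_integral integral {0..1} F) {0..1}" by (rule integrable_integral[OF integrable_continuous_interval[OF cF]])
    have "clen (\<lambda>v. hm x0 (v, w)) r r' \<le> (\<integral>\<^sup>+ s. ennreal (indicator {0..1} s * F s) \<partial>lborel)"
      unfolding clen_def
    proof (rule nn_integral_mono)
      fix s :: real
      show "ennreal (sqrt (r' s \<bullet> (hm x0 (r s, w) *v r' s))) * indicator {0..1} s \<le> ennreal (indicator {0..1} s * F s)"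
        using F[of s] by (cases "s \<in> {0..1}") (auto intro!: ennreal_leI)
    qed
    also have "\<dots> = ennreal (integral {0..1} F)"
      by (rule nn_integral_has_integral_lebesgue[OF Fnn iF])
    also have "integral {0..1} F \<le> \<delta>"
    proof -
      have iG: "(G has_integral integral {0..1} G) {0..1}" by (rule integrable_integral[OF integrable_continuous_interval[OF cG]])
      have "(F has_integral (integral {0..1} G / (2 * \<delta>) + \<delta> / 2 * (1 - 0))) {0..1}"
        unfolding F_def using has_integral_add[OF has_integral_divide[OF iG, of "2 * \<delta>"] has_integral_const_real[of "\<delta> / 2" 0 1]] by simp
      then have "integral {0..1} F = integral {0..1} G / (2 * \<delta>) + \<delta> / 2" by (simp add: integral_unique)
      also have "\<dots> \<le> \<delta>\<^sup>2 / (2 * \<delta>) + \<delta> / 2" using intG \<delta> by (intro add_right_mono divide_right_mono) auto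
      also have "\<dots> = \<delta>" using \<delta> by (simp add: power2_eq_square)
      finally show ?thesis .
    qed
    then have "ennreal (integral {0..1} F) \<le> ennreal \<delta>" by (rule ennreal_leI)
    finally show ?thesis .
  qed
  then have "dd (r 0) (r 1) w \<le> \<delta>" using \<delta> by (intro dd_le_clen[OF w pwc rR]) auto
  moreover have "r 0 = v1" using s0(1) s1(1) by (simp add: r_def \<xi>_def)
  moreover have r1: "r 1 = c t" by (simp add: r_def \<xi>_def e_def P_def Q_def algebra_simps)
  ultimately have "leaf_dist A g y (\<gamma> t) \<le> ennreal \<delta>"
    using leaf_dist_dd(1)[OF rR[of 0] rR[of 1] w] c(3)[OF t] by (simp add: y_def ennreal_leI)
  then show ?thesis by (simp add: leaf_cball_def)
qed

text \<open>A ball inside a strongly convex one need not be convex; only containment of the minimal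
  geodesics has to be added. The threshold depends on \<open>lam\<close> and the patch constants
  alone, hence it serves all centres of the patch.\<close>

lemma strongly_convex_small_ball:
  assumes cr: "convexity_radius A g lam"
  shows "\<exists>\<delta>0>0. \<forall>\<delta> (v1 :: real^'n) w. 0 < \<delta> \<longrightarrow> \<delta> \<le> \<delta>0 \<longrightarrow> norm v1 \<le> R / 2 \<longrightarrow> w \<in> W \<longrightarrow>
    strongly_convex A g (leaf_cball A g (chart_inv (A x0) (v1, w)) \<delta>)"
proof -
  \<comment> \<open>The four terms bound \<open>\<delta> / l\<close> so as to meet the smallness
    conditions \<open>c1\<close> to \<open>c4\<close> of \<open>geodesic_stays\<close> in this
    order; the summand 1 next to \<open>2 * Kc\<close> keeps the denominator positive.\<close>
  define \<beta> where "\<beta> = min 1 (min (R / 2 / (3 + 5 * Lm / l)) (min (1 / (2 * Kc + 1)) (2 * l\<^sup>2 / (5 * C + 4 * C * Kc))))"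
  have pos: "3 + 5 * Lm / l > 0" "2 * Kc + 1 > 0" "5 * C + 4 * C * Kc > 0"
    using Lm l Kc C by (auto intro!: add_pos_nonneg)
  have \<beta>: "\<beta> > 0" using R l pos by (simp add: \<beta>_def)
  have \<beta>le: "\<beta> \<le> 1" "\<beta> \<le> R / 2 / (3 + 5 * Lm / l)" "\<beta> \<le> 1 / (2 * Kc + 1)" "\<beta> \<le> 2 * l\<^sup>2 / (5 * C + 4 * C * Kc)"
    unfolding \<beta>_def by (simp_all only: min.cobounded1 min.coboundedI2 min.cobounded2)
  have lam: "lam > 0" "\<And>x. strongly_convex A g (leaf_cball A g x lam)" using cr by (auto simp: convexity_radius_def)
  show ?thesis
  proof (intro exI[of _ "min lam (l * \<beta>)"] conjI allI impI)
    show "min lam (l * \<beta>) > 0" using lam l \<beta> by simp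
    fix \<delta> w and v1 :: "real^'n" assume \<delta>: "0 < \<delta>" "\<delta> \<le> min lam (l * \<beta>)" and v1: "norm v1 \<le> R / 2" and w: "w \<in> W"
    define B where "B = \<delta> / l"
    have B: "0 < B" "B \<le> \<beta>" using \<delta> l by (auto simp: B_def pos_divide_le_eq mult.commute)
    have c1: "\<delta> / l \<le> 1" using B \<beta>le by (simp add: B_def)
    have c2: "norm v1 + 3 * (\<delta> / l) + 5 * Lm * (\<delta> / l) / l \<le> R"
    proof -
      have "B * (3 + 5 * Lm / l) \<le> R / 2" using B(2) \<beta>le(2) pos(1) by (meson order_trans pos_le_divide_eq)
      moreover have "B * (3 + 5 * Lm / l) = 3 * B + 5 * Lm * B / l" by (simp add: algebra_simps)
      ultimately show ?thesis using v1 unfolding B_def[symmetric] by linarith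
    qed
    have c3: "2 * Kc * (\<delta> / l) \<le> 1"
    proof -
      have "B * (2 * Kc + 1) \<le> 1" using B(2) \<beta>le(3) pos(2) by (meson order_trans pos_le_divide_eq)
      then show ?thesis using B(1) by (simp add: algebra_simps B_def[symmetric])
    qed
    have c4: "\<delta> / l * (5 * C + 4 * C * Kc) \<le> 2 * l\<^sup>2"
      using B(2) \<beta>le(4) pos(3) unfolding B_def[symmetric] by (meson order_trans pos_le_divide_eq)
    let ?y = "chart_inv (A x0) (v1, w)"
    have sub: "leaf_cball A g ?y \<delta> \<subseteq> leaf_cball A g ?y lam"
      using \<delta> by (auto simp: leaf_cball_def intro: order_trans ennreal_leI)
    have "v1 \<in> cball 0 R" using v1 R by simp
    then have "leaf_dist A g ?y ?y \<le> ennreal (Lm * norm (v1 - v1))" using leaf_dist_segment w by blast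
    then have yy: "?y \<in> leaf_cball A g ?y lam" by (simp add: leaf_cball_def)
    note sc = lam(2)[of ?y, unfolded strongly_convex_def]
    have ex: "\<exists>\<gamma>. shortest_geodesic A g \<gamma> a b \<and>
        (\<forall>\<gamma>'. shortest_geodesic A g \<gamma>' a b \<longrightarrow> (\<forall>t\<in>{0..1}. \<gamma>' t = \<gamma> t))"
      if "a \<in> leaf_cball A g ?y lam" "b \<in> leaf_cball A g ?y lam" for a b
      using bspec[OF bspec[OF conjunct2[OF sc] that(1)] that(2)] by (elim exE conjE) (rule exI, rule conjI)
    obtain L where L: "L \<in> leaves A" "leaf_cball A g ?y lam \<subseteq> L" using conjunct1[OF sc] by (rule bexE)
    show "strongly_convex A g (leaf_cball A g ?y \<delta>)"
      unfolding strongly_convex_def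
    proof (intro conjI ballI)
      show "\<exists>L\<in>leaves A. leaf_cball A g ?y \<delta> \<subseteq> L" by (rule bexI[OF _ L(1)], rule order_trans[OF sub L(2)])
      fix p q assume p: "p \<in> leaf_cball A g ?y \<delta>" and q: "q \<in> leaf_cball A g ?y \<delta>"
      note p' = subsetD[OF sub p] and q' = subsetD[OF sub q]
      obtain \<gamma> where \<gamma>: "shortest_geodesic A g \<gamma> p q"
          "\<forall>\<gamma>'. shortest_geodesic A g \<gamma>' p q \<longrightarrow> (\<forall>t\<in>{0..1}. \<gamma>' t = \<gamma> t)"
        using ex[OF p' q'] by (elim exE conjE)
      obtain \<sigma>0 where \<sigma>0: "shortest_geodesic A g \<sigma>0 ?y p" using ex[OF yy p'] by (elim exE conjE)
      obtain \<sigma>1 where \<sigma>1: "shortest_geodesic A g \<sigma>1 ?y q" using ex[OF yy q'] by (elim exE conjE)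
      have sg: "\<gamma> ` {0..1} \<subseteq> leaf_cball A g ?y \<delta>"
        by (rule image_subsetI, rule geodesic_stays[OF w \<delta>(1) c1 c2 c3 c4 p q \<sigma>0 \<sigma>1 \<gamma>(1)])
      show "\<exists>\<gamma>. shortest_geodesic A g \<gamma> p q \<and> \<gamma> ` {0..1} \<subseteq> leaf_cball A g ?y \<delta> \<and>
          (\<forall>\<gamma>'. shortest_geodesic A g \<gamma>' p q \<longrightarrow> (\<forall>t\<in>{0..1}. \<gamma>' t = \<gamma> t))"
        by (rule exI, rule conjI[OF \<gamma>(1) conjI[OF sg \<gamma>(2)]])
    qed
  qed
qed

end

section \<open>Construction of regular coverings\<close>

text \<open>The excluded radii are extremal values of the distance on members of a countable base.\<close>

lemma generic_radius:
  fixes w :: "'x::metric_space"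
  assumes cpt: "compact (UNIV :: 'x set)" and r: "r > 0"
  obtains rad where "0 < rad" "rad < r" "interior (cball w rad) = ball w rad" "closure (ball w rad) = cball w rad"
proof -
  have "\<forall>n::nat. \<exists>F. finite F \<and> (UNIV :: 'x set) \<subseteq> (\<Union>y\<in>F. ball y (1 / real (Suc n)))"
  proof
    fix n
    have "\<forall>e>0. \<exists>k. finite k \<and> k \<subseteq> (UNIV :: 'x set) \<and> UNIV \<subseteq> (\<Union>y\<in>k. ball y e)"
      using cpt unfolding compact_eq_totally_bounded by blast
    from this[rule_format, of "1 / real (Suc n)"]
    show "\<exists>F. finite F \<and> (UNIV :: 'x set) \<subseteq> (\<Union>y\<in>F. ball y (1 / real (Suc n)))" by auto
  qed
  from choice[OF this] obtain F where F: "\<And>n. finite (F n)" "\<And>n. (UNIV :: 'x set) \<subseteq> (\<Union>y\<in>F n. ball y (1 / real (Suc n)))"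
    by blast
  define \<B> where "\<B> = (\<Union>n. (\<lambda>y. ball y (1 / real (Suc n))) ` F n)"
  have cB: "countable \<B>" unfolding \<B>_def by (rule countable_UN) (simp_all add: countable_finite F(1))
  have base: "\<exists>U\<in>\<B>. x \<in> U \<and> U \<subseteq> N" if N: "open N" "x \<in> N" for x N
  proof -
    obtain e where e: "e > 0" "ball x e \<subseteq> N" using N openE by blast
    obtain n where n: "1 / real (Suc n) < e / 2" using e(1) reals_Archimedean[of "e / 2"] by (auto simp: inverse_eq_divide)
    obtain y where y: "y \<in> F n" "x \<in> ball y (1 / real (Suc n))" using F(2)[of n] by blast
    have "ball y (1 / real (Suc n)) \<subseteq> ball x e"
    proof
      fix z assume "z \<in> ball y (1 / real (Suc n))"
      then have "dist x z < 1 / real (Suc n) + 1 / real (Suc n)"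
        using y(2) dist_triangle[of x z y] by (simp add: dist_commute)
      then show "z \<in> ball x e" using n by simp
    qed
    then show ?thesis using y e(2) unfolding \<B>_def by blast
  qed
  \<comment> \<open>A point at distance \<open>rad\<close> that is interior to the closed ball makes
    \<open>rad\<close> the largest distance from \<open>w\<close> on a small member of the base; one
    outside the closure of the open ball makes it the smallest.\<close>
  define bad where "bad = (\<lambda>U. Sup (dist w ` U)) ` \<B> \<union> (\<lambda>U. Inf (dist w ` U)) ` \<B>"
  have "countable bad" unfolding bad_def using cB by (intro countable_Un countable_image)
  then have "\<not> {0<..<r} \<subseteq> bad" using uncountable_open_interval[of 0 r] r countable_subset by blast
  then obtain rad where rad: "0 < rad" "rad < r" "rad \<notin> bad" by (metis greaterThanLessThan_iff subsetI)
  have "x \<in> ball w rad" if x: "x \<in> interior (cball w rad)" for x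
  proof (rule ccontr)
    assume "x \<notin> ball w rad"
    then have d: "dist w x = rad" using x interior_subset by fastforce
    obtain U where U: "U \<in> \<B>" "x \<in> U" "U \<subseteq> interior (cball w rad)" using base[OF open_interior x] by blast
    have "dist w y \<le> rad" if "y \<in> U" for y using U(3) that interior_subset by fastforce
    then have "Sup (dist w ` U) = rad" using U(2) d by (intro cSup_eq_maximum) auto
    then show False using rad(3) U(1) by (auto simp: bad_def)
  qed
  then have i: "interior (cball w rad) = ball w rad"
    by (intro subset_antisym subsetI interior_maximal) auto
  have "x \<in> closure (ball w rad)" if x: "x \<in> cball w rad" for x
  proof (rule ccontr)
    assume n: "x \<notin> closure (ball w rad)"
    then have "x \<notin> ball w rad" using closure_subset by blast
    then have d: "dist w x = rad" using x by simp
    obtain U where U: "U \<in> \<B>" "x \<in> U" "U \<subseteq> - closure (ball w rad)"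
      using base[of "- closure (ball w rad)" x] n by (auto simp: open_Compl)
    have "rad \<le> dist w y" if "y \<in> U" for y
    proof -
      have "y \<notin> ball w rad" using U(3) that closure_subset[of "ball w rad"] by blast
      then show ?thesis by simp
    qed
    then have "Inf (dist w ` U) = rad" using U(2) d by (intro cInf_eq_minimum) auto
    then show False using rad(3) U(1) by (auto simp: bad_def)
  qed
  moreover have "closure (ball w rad) \<subseteq> cball w rad" by (intro closure_minimal) auto
  ultimately have "closure (ball w rad) = cball w rad" by blast
  with rad(1,2) i show ?thesis by (rule that)
qed

text \<open>Charts are constructed through their inverses: an injective continuous map on the
  compact box is a homeomorphism onto its image. That this image is the closure of the chart domain
  rests on \<open>T\<close> being the closure of its interior.\<close>

lemma chart_of_parametrization:
  fixes \<Psi> :: "(real^'n) \<times> 'x::metric_space \<Rightarrow> 'm::metric_space"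
  assumes T: "compact T" "closure (interior T) = T"
    and cont: "continuous_on (cbox (- 1) 1 \<times> T) \<Psi>"
    and inv: "\<And>q. q \<in> cbox (- 1) 1 \<times> T \<Longrightarrow> \<Phi> (\<Psi> q) = q"
    and op: "open (\<Psi> ` (box (- 1) 1 \<times> interior T))"
  defines "c \<equiv> \<lparr>udom = \<Psi> ` (box (- 1) 1 \<times> interior T), transv = T, coord = \<Phi>\<rparr>"
  shows "is_chart c" and "closure (udom c) = \<Psi> ` (cbox (- 1) 1 \<times> T)"
    and "\<And>q. q \<in> cbox (- 1) 1 \<times> T \<Longrightarrow> chart_inv c q = \<Psi> q"
proof -
  let ?Q = "cbox (- 1) (1::real^'n) \<times> T"
  have cQ: "compact ?Q" by (intro compact_Times compact_cbox T)
  have "0 \<in> box (- 1) (1::real^'n)" by (simp add: mem_box_cart)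
  then have "box (- 1) (1::real^'n) \<noteq> {}" by blast
  then have cl: "closure (box (- 1) 1 \<times> interior T) = ?Q" using T(2) by (simp add: closure_Times closure_box)
  have sub: "box (- 1) 1 \<times> interior T \<subseteq> ?Q" using box_subset_cbox[of "- 1" "1::real^'n"] interior_subset[of T] by blast
  show clU: "closure (udom c) = \<Psi> ` ?Q"
  proof
    show "closure (udom c) \<subseteq> \<Psi> ` ?Q"
      unfolding c_def fchart.simps
      by (intro closure_minimal image_mono sub compact_imp_closed compact_continuous_image cont cQ)
    show "\<Psi> ` ?Q \<subseteq> closure (udom c)"
      using image_closure_subset[of "box (- 1) 1 \<times> interior T" \<Psi> "closure (udom c)"] cont
      unfolding cl by (simp add: c_def closure_subset)
  qed
  have inv': "\<Psi> (\<Phi> z) = z" "\<Phi> z \<in> ?Q" if "z \<in> \<Psi> ` ?Q" for z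
  proof -
    obtain q where q: "q \<in> ?Q" "z = \<Psi> q" using \<open>z \<in> \<Psi> ` ?Q\<close> by (rule imageE)
    show "\<Psi> (\<Phi> z) = z" "\<Phi> z \<in> ?Q" unfolding q(2) inv[OF q(1)] by (rule refl, rule q(1))
  qed
  have inj: "inj_on \<Phi> (\<Psi> ` ?Q)" by (rule inj_on_inverseI[of _ \<Psi>]) (rule inv'(1))
  show ci: "chart_inv c q = \<Psi> q" if "q \<in> ?Q" for q
    unfolding chart_inv_def clU using inv_into_f_f[OF inj imageI[OF that]] inv[OF that] by (simp add: c_def)
  have cc: "coord c = \<Phi>" by (simp add: c_def)
  have h: "homeomorphism (closure (udom c)) ?Q (coord c) (chart_inv c)"
    unfolding clU cc
  proof (rule homeomorphismI)
    show "continuous_on (\<Psi> ` ?Q) \<Phi>" by (rule continuous_on_inv[OF cont cQ]) (intro ballI inv)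
    show "continuous_on ?Q (chart_inv c)" by (rule continuous_on_eq[OF cont]) (rule ci[symmetric])
    show "\<Phi> ` \<Psi> ` ?Q \<subseteq> ?Q" by (rule image_subsetI) (rule inv'(2))
    show "chart_inv c ` ?Q \<subseteq> \<Psi> ` ?Q" by (rule image_subsetI) (simp only: ci imageI)
    show "chart_inv c (\<Phi> z) = z" if "z \<in> \<Psi> ` ?Q" for z unfolding ci[OF inv'(2)[OF that]] by (rule inv'(1)[OF that])
    show "\<Phi> (chart_inv c q) = q" if "q \<in> ?Q" for q unfolding ci[OF that] using that by (rule inv)
  qed
  have "udom c = {z \<in> closure (udom c). coord c z \<in> box (- 1) 1 \<times> interior (transv c)}"
  proof (intro set_eqI iffI)
    fix z assume "z \<in> udom c"
    then obtain q where q: "q \<in> box (- 1) 1 \<times> interior T" "z = \<Psi> q" by (auto simp: c_def)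
    then show "z \<in> {z \<in> closure (udom c). coord c z \<in> box (- 1) 1 \<times> interior (transv c)}"
      using inv[OF subsetD[OF sub q(1)]] subsetD[OF sub q(1)] unfolding clU by (simp add: c_def)
  next
    fix z assume z: "z \<in> {z \<in> closure (udom c). coord c z \<in> box (- 1) 1 \<times> interior (transv c)}"
    then obtain q where q: "q \<in> ?Q" "z = \<Psi> q" unfolding clU by blast
    then have "q \<in> box (- 1) 1 \<times> interior T" using z inv[OF q(1)] by (simp add: c_def)
    then show "z \<in> udom c" using q(2) by (simp add: c_def)
  qed
  then show "is_chart c" unfolding is_chart_def using h op T(1) by (simp add: c_def)
qed

lemma chart_box_nbhd:
  fixes c :: "('m::metric_space, 'n::finite, 'x::metric_space) fchart"
  assumes c: "is_chart c" and U: "open U" "U \<subseteq> udom c" "z \<in> U"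
  obtains r where "r > 0" "ball (lcoord c z) r \<times> ball (tproj c z) r \<subseteq> coord c ` U"
proof -
  have "open (coord c ` U)" by (rule chart_coord_image_open[OF c U(1,2)])
  moreover have "(lcoord c z, tproj c z) \<in> coord c ` U" using U(3) chart_coord_eq[OF c, of z] by (metis imageI)
  ultimately obtain A B where AB: "open A" "open B" "lcoord c z \<in> A" "tproj c z \<in> B" "A \<times> B \<subseteq> coord c ` U"
    by (auto elim: open_prod_elim)
  obtain r1 where r1: "r1 > 0" "ball (lcoord c z) r1 \<subseteq> A" using AB(1,3) openE by blast
  obtain r2 where r2: "r2 > 0" "ball (tproj c z) r2 \<subseteq> B" using AB(2,4) openE by blast
  have a: "ball (lcoord c z) (min r1 r2) \<subseteq> A" by (rule order_trans[OF subset_ball r1(2)]) simp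
  have b: "ball (tproj c z) (min r1 r2) \<subseteq> B" by (rule order_trans[OF subset_ball r2(2)]) simp
  have "ball (lcoord c z) (min r1 r2) \<times> ball (tproj c z) (min r1 r2) \<subseteq> coord c ` U"
    by (rule order_trans[OF Sigma_mono[OF a b] AB(5)])
  then show ?thesis using r1(1) r2(1) by (intro that[of "min r1 r2"]) auto
qed

lemma chart_slice_connected:
  fixes c :: "('m::metric_space, 'n::finite, 'x::metric_space) fchart"
  assumes c: "is_chart c" and B: "ball v r \<times> {w} \<subseteq> box (- 1) 1 \<times> interior (transv c)"
  shows "connected ((\<lambda>u. chart_inv c (u, w)) ` ball v r)"
proof (rule connected_continuous_image[OF _ connected_ball])
  show "continuous_on (ball v r) (\<lambda>u. chart_inv c (u, w))"
    by (rule continuous_on_compose2[OF chart_cont_inv[OF c]])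
      (use B chart_box_sub[OF c] in \<open>auto intro!: continuous_on_Pair continuous_on_id continuous_on_const\<close>)
qed

text \<open>Over totally disconnected transversals the plaques of any two charts match locally, because
  the connected slices of a small product box of one chart have constant transverse coordinate in
  the other.\<close>

lemma slices_locally_constant:
  fixes c c' :: "('m::metric_space, 'n::finite, 'x::metric_space) fchart"
  assumes c: "is_chart c" and c': "is_chart c'" and td: "tot_disconnected (transv c')"
    and U: "open U" "z \<in> U" "U \<subseteq> udom c \<inter> udom c'"
  obtains N where "open N" "z \<in> N" "N \<subseteq> U" "\<And>w. connected {y \<in> N. tproj c y = w}"
    "\<And>y y'. y \<in> N \<Longrightarrow> y' \<in> N \<Longrightarrow> tproj c y = tproj c y' \<Longrightarrow> tproj c' y = tproj c' y'"
proof -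
  have Uc: "U \<subseteq> udom c" using U by blast
  obtain r where r: "r > 0" "ball (lcoord c z) r \<times> ball (tproj c z) r \<subseteq> coord c ` U"
    by (rule chart_box_nbhd[OF c U(1) Uc U(2)]) (rule that)
  let ?B = "ball (lcoord c z) r \<times> ball (tproj c z) r"
  have "coord c ` U \<subseteq> box (- 1) 1 \<times> interior (transv c)"
    by (rule image_subsetI) (rule chart_coord_udom[OF c subsetD[OF Uc]])
  then have Bd: "?B \<subseteq> box (- 1) 1 \<times> interior (transv c)" by (rule order_trans[OF r(2)])
  note Bc = order_trans[OF Bd chart_box_sub[OF c]]
  define N where "N = chart_inv c ` ?B"
  have N: "open N" unfolding N_def by (rule chart_inv_image_open[OF c _ Bd]) (intro open_Times open_ball)
  have NU: "N \<subseteq> U"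
  proof
    fix y assume "y \<in> N"
    then obtain q where q: "q \<in> ?B" "y = chart_inv c q" by (auto simp: N_def)
    obtain u where u: "u \<in> U" "q = coord c u" using r(2) q(1) by blast
    then show "y \<in> U" using q(2) chart_inv_coord[OF c chart_udom_closure[OF c subsetD[OF Uc u(1)]]] by simp
  qed
  have zN: "z \<in> N"
  proof -
    have "coord c z \<in> ?B" using r(1) by (simp add: chart_coord_eq[OF c])
    then show ?thesis unfolding N_def using chart_inv_coord[OF c chart_udom_closure[OF c subsetD[OF Uc U(2)]]] by force
  qed
  have tB: "tproj c (chart_inv c (u, w)) = w" if "u \<in> ball (lcoord c z) r" "w \<in> ball (tproj c z) r" for u w
    by (rule chart_tproj_inv[OF c subsetD[OF Bc SigmaI[OF that]]])
  have Nim: "\<exists>u\<in>ball (lcoord c z) r. tproj c y \<in> ball (tproj c z) r \<and> y = chart_inv c (u, tproj c y)" if yN: "y \<in> N" for y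
  proof -
    obtain q where q: "y = chart_inv c q" "q \<in> ?B" using yN unfolding N_def by (rule imageE)
    have q': "fst q \<in> ball (lcoord c z) r" "snd q \<in> ball (tproj c z) r"
      using q(2) by (simp_all only: mem_Times_iff)
    have t: "tproj c y = snd q" using tB[OF q'] q(1) by simp
    show ?thesis unfolding t using q' q(1) by (intro bexI[of _ "fst q"]) simp_all
  qed
  have conn: "connected {y \<in> N. tproj c y = w}" for w
  proof (cases "w \<in> ball (tproj c z) r")
    case True
    have "{y \<in> N. tproj c y = w} = (\<lambda>u. chart_inv c (u, w)) ` ball (lcoord c z) r"
    proof (intro set_eqI iffI)
      fix y assume y: "y \<in> {y \<in> N. tproj c y = w}"
      then have yN: "y \<in> N" and yw: "tproj c y = w" by simp_all
      obtain u where "u \<in> ball (lcoord c z) r" "y = chart_inv c (u, w)" using Nim[OF yN] unfolding yw by (elim bexE conjE)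
      then show "y \<in> (\<lambda>u. chart_inv c (u, w)) ` ball (lcoord c z) r" by (rule rev_image_eqI)
    next
      fix y assume "y \<in> (\<lambda>u. chart_inv c (u, w)) ` ball (lcoord c z) r"
      then obtain u where u: "y = chart_inv c (u, w)" "u \<in> ball (lcoord c z) r" by (rule imageE)
      have "y \<in> N" unfolding N_def u(1) by (rule imageI[OF SigmaI[OF u(2) True]])
      then show "y \<in> {y \<in> N. tproj c y = w}" using tB[OF u(2) True] u(1) by simp
    qed
    moreover have "ball (lcoord c z) r \<times> {w} \<subseteq> box (- 1) 1 \<times> interior (transv c)"
      by (rule order_trans[OF Sigma_mono Bd]) (use True in simp_all)
    ultimately show ?thesis using chart_slice_connected[OF c] by simp
  next
    case False
    then have "{y \<in> N. tproj c y = w} = {}" using Nim by blast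
    then show ?thesis by (simp only: connected_empty)
  qed
  show ?thesis
  proof (rule that[OF N zN NU conn])
    fix y y' assume y: "y \<in> N" "y' \<in> N" "tproj c y = tproj c y'"
    have "{a \<in> N. tproj c a = tproj c y} \<subseteq> closure (udom c')" using order_trans[OF NU U(3)] closure_subset[of "udom c'"] by blast
    then show "tproj c' y = tproj c' y'" by (rule chart_tproj_const[OF c' td conn]) (use y in simp_all)
  qed
qed

text \<open>Compatibility is automatic over totally disconnected transversals: near a common point,
  the slices of one chart lie in plaques of the other. The condition is symmetric, so one half is
  proved for an arbitrary pair of charts and used twice.\<close>

lemma plaque_compatibleI:
  fixes c c' :: "('m::metric_space, 'n::finite, 'x::metric_space) fchart"
  assumes c: "is_chart c" "tot_disconnected (transv c)" and c': "is_chart c'" "tot_disconnected (transv c')"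
  shows "plaque_compatible c c'"
proof -
  have half: "openin (top_of_set (plaque d (tproj d z))) (plaque_int d (tproj d z) \<inter> plaque_int d' (tproj d' z))"
    if d: "is_chart d" and d': "is_chart d'" "tot_disconnected (transv d')" and z: "z \<in> udom d \<inter> udom d'"
    for d d' :: "('m, 'n, 'x) fchart" and z
  proof -
    have pint: "plaque_int b (tproj b z) = {y \<in> udom b. tproj b y = tproj b z}" if b: "is_chart b" "z \<in> udom b" for b :: "('m, 'n, 'x) fchart"
    proof (rule set_eqI)
      fix x
      show "x \<in> plaque_int b (tproj b z) \<longleftrightarrow> x \<in> {y \<in> udom b. tproj b y = tproj b z}"
        unfolding plaque_int_def mem_Collect_eq chart_udom_iff[OF b(1), of x] chart_coord_eq[OF b(1), of x] mem_Times_iff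
        using chart_tproj_mem[OF b] by (cases "tproj b x = tproj b z") simp_all
    qed
    let ?I = "plaque_int d (tproj d z) \<inter> plaque_int d' (tproj d' z)"
    have I: "?I = {y \<in> udom d \<inter> udom d'. tproj d y = tproj d z \<and> tproj d' y = tproj d' z}"
      unfolding pint[OF d IntD1[OF z]] pint[OF d'(1) IntD2[OF z]] by blast
    show ?thesis
      unfolding openin_subopen[of _ ?I]
    proof
      fix y assume y: "y \<in> ?I"
      have ud: "open (udom d \<inter> udom d')" using chart_open[OF d] chart_open[OF d'(1)] by blast
      have yu: "y \<in> udom d \<inter> udom d'" using y I by blast
      obtain N where N: "open N" "y \<in> N" "N \<subseteq> udom d \<inter> udom d'"
        "\<And>a b. a \<in> N \<Longrightarrow> b \<in> N \<Longrightarrow> tproj d a = tproj d b \<Longrightarrow> tproj d' a = tproj d' b"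
        by (rule slices_locally_constant[OF d d' ud yu subset_refl]) (rule that)
      have "openin (top_of_set (plaque d (tproj d z))) (plaque d (tproj d z) \<inter> N)" by (rule openin_open_Int[OF N(1)])
      moreover have "y \<in> plaque d (tproj d z) \<inter> N" using y N(2) by (simp add: plaque_int_def plaque_def chart_coord_eq[OF d])
      moreover have "plaque d (tproj d z) \<inter> N \<subseteq> ?I"
      proof
        fix a assume "a \<in> plaque d (tproj d z) \<inter> N"
        then have a: "a \<in> N" "tproj d a = tproj d z" by (simp_all add: plaque_def)
        have yz: "tproj d y = tproj d z" "tproj d' y = tproj d' z" using y unfolding I by simp_all
        have "tproj d' a = tproj d' y" by (rule N(4)[OF a(1) N(2)]) (simp only: a(2) yz(1))
        then show "a \<in> ?I" unfolding I using subsetD[OF N(3) a(1)] a(2) yz(2) by simp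
      qed
      ultimately show "\<exists>V. openin (top_of_set (plaque d (tproj d z))) V \<and> y \<in> V \<and> V \<subseteq> ?I" by blast
    qed
  qed
  show ?thesis unfolding plaque_compatible_def Let_def
  proof (intro ballI conjI)
    fix z assume z: "z \<in> udom c \<inter> udom c'"
    show "openin (top_of_set (plaque c (tproj c z))) (plaque_int c (tproj c z) \<inter> plaque_int c' (tproj c' z))"
      by (rule half[OF c(1) c' z])
    show "openin (top_of_set (plaque c' (tproj c' z))) (plaque_int c (tproj c z) \<inter> plaque_int c' (tproj c' z))"
      using half[OF c'(1) c] z by (simp add: Int_commute)
  qed
qed

text \<open>The neighbourhood is refined twice, once for each order of the charts. In the outer one
  equal plaques of \<open>c'\<close> imply equal plaques of \<open>c\<close>; the inner one has the
  converse property and connected slices for \<open>c\<close>. There the two plaques through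
  \<open>z\<close> coincide, so connectedness holds for both.\<close>

lemma smoothly_relatedI:
  fixes c c' :: "('m::metric_space, 'n::finite, 'x::metric_space) fchart"
  assumes c: "is_chart c" "tot_disconnected (transv c)" and c': "is_chart c'" "tot_disconnected (transv c')"
    and ck: "\<And>k. ck k (coord c ` (udom c \<inter> udom c')) (\<lambda>q. lcoord c' (chart_inv c q))"
  shows "smoothly_related c c'"
  unfolding smoothly_related_def Let_def
proof
  fix z assume z: "z \<in> udom c \<inter> udom c'"
  have ud: "open (udom c \<inter> udom c')" "udom c \<inter> udom c' \<subseteq> udom c' \<inter> udom c" using chart_open[OF c(1)] chart_open[OF c'(1)] by blast+
  obtain N' where N': "open N'" "z \<in> N'" "N' \<subseteq> udom c \<inter> udom c'"
    "\<And>y y'. y \<in> N' \<Longrightarrow> y' \<in> N' \<Longrightarrow> tproj c' y = tproj c' y' \<Longrightarrow> tproj c y = tproj c y'"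
    by (rule slices_locally_constant[OF c'(1) c ud(1) z ud(2)]) (rule that)
  obtain N where N: "open N" "z \<in> N" "N \<subseteq> N'" "\<And>w. connected {y \<in> N. tproj c y = w}"
    "\<And>y y'. y \<in> N \<Longrightarrow> y' \<in> N \<Longrightarrow> tproj c y = tproj c y' \<Longrightarrow> tproj c' y = tproj c' y'"
    by (rule slices_locally_constant[OF c(1) c' N'(1-3)]) (rule that)
  have sub: "N \<subseteq> udom c \<inter> udom c'" using N(3) N'(3) by blast
  have P: "plaque c (tproj c z) \<inter> N = {y \<in> N. tproj c y = tproj c z}"
    using sub chart_udom_closure[OF c(1)] by (auto simp: plaque_def)
  have P': "plaque c' (tproj c' z) \<inter> N = {y \<in> N. tproj c y = tproj c z}"
  proof (intro set_eqI iffI)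
    fix y assume "y \<in> plaque c' (tproj c' z) \<inter> N"
    then have y: "y \<in> N" "tproj c' y = tproj c' z" by (simp_all add: plaque_def)
    have "tproj c y = tproj c z" by (rule N'(4)[OF subsetD[OF N(3) y(1)] N'(2) y(2)])
    then show "y \<in> {y \<in> N. tproj c y = tproj c z}" using y by simp
  next
    fix y assume "y \<in> {y \<in> N. tproj c y = tproj c z}"
    then have y: "y \<in> N" "tproj c y = tproj c z" by simp_all
    have "y \<in> udom c'" using subsetD[OF sub y(1)] by simp
    then show "y \<in> plaque c' (tproj c' z) \<inter> N"
      using N(5)[OF y(1) N(2) y(2)] y(1) chart_udom_closure[OF c'(1)] by (simp add: plaque_def)
  qed
  have Nc: "N \<subseteq> udom c" using sub by blast
  have "smooth_family (coord c ` N) (\<lambda>w v. lcoord c' (chart_inv c (v, w)))"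
  proof (rule ck_imp_smooth_family[OF chart_coord_image_open[OF c(1) N(1) Nc]])
    show "ck k (coord c ` N) (\<lambda>q. lcoord c' (chart_inv c (fst q, snd q)))" for k
      using ck_subset[OF ck image_mono[OF sub]] by simp
  qed
  then show "\<exists>V. open V \<and> z \<in> V \<and> V \<subseteq> udom c \<inter> udom c' \<and>
        openin (top_of_set (plaque c (tproj c z))) (plaque c (tproj c z) \<inter> V) \<and> connected (plaque c (tproj c z) \<inter> V) \<and>
        openin (top_of_set (plaque c' (tproj c' z))) (plaque c' (tproj c' z) \<inter> V) \<and> connected (plaque c' (tproj c' z) \<inter> V) \<and>
        plaque c (tproj c z) \<inter> V \<subseteq> plaque c' (tproj c' z) \<and>
        smooth_family (coord c ` V) (\<lambda>w v. lcoord c' (chart_inv c (v, w)))"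
  proof (intro exI[of _ N] conjI)
    show "connected (plaque c (tproj c z) \<inter> N)" "connected (plaque c' (tproj c' z) \<inter> N)"
      unfolding P P' by (rule N(4))+
    have "plaque c (tproj c z) \<inter> N = plaque c' (tproj c' z) \<inter> N" by (simp only: P P')
    then show "plaque c (tproj c z) \<inter> N \<subseteq> plaque c' (tproj c' z)" by simp
  qed (rule N(1) N(2) sub openin_open_Int[OF N(1)] | assumption)+
qed

text \<open>\<open>p\<close> is the gauge of the leafwise balls of radius \<delta> centred on the
  transversal section \<open>{v1} \<times> T\<close>, and \<open>X\<close>, \<open>Y\<close> are the
  mutually inverse cube coordinates of these star bodies. The bound on \<delta> keeps the balls
  inside the patch.\<close>

locale star_chart = metric_patch A g x0 W R l Lm C
  for A :: "'m::metric_space \<Rightarrow> ('m, 'n::finite, 'x::metric_space) fchart"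
    and g :: "'m \<Rightarrow> real^'n \<Rightarrow> real^'n \<Rightarrow> real" and x0 W R l Lm C +
  fixes v1 :: "real^'n" and T :: "'x set" and \<delta> :: real and p :: "real^'n \<Rightarrow> 'x \<Rightarrow> real"
    and X Y :: "(real^'n) \<times> 'x \<Rightarrow> real^'n"
  assumes v1: "norm v1 \<le> R / 2" and \<delta>: "0 < \<delta>" "\<delta> \<le> l * (R / 4)"
    and T: "compact T" "T \<subseteq> W" "closure (interior T) = T"
    and pc: "continuous_on (UNIV \<times> T) (\<lambda>q. p (fst q) (snd q))"
    and ph: "\<And>u w s. w \<in> T \<Longrightarrow> s \<ge> 0 \<Longrightarrow> p (s *\<^sub>R u) w = s * p u w"
    and pb: "\<And>u w. w \<in> T \<Longrightarrow> p u w \<le> 1 \<Longrightarrow> norm u \<le> \<delta> / l"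
    and pl: "\<And>w. w \<in> T \<Longrightarrow> leaf_cball A g (chart_inv (A x0) (v1, w)) \<delta> = (\<lambda>u. chart_inv (A x0) (v1 + u, w)) ` {u. p u w \<le> 1}"
    and Yc: "continuous_on (cbox (- 1) 1 \<times> T) Y"
    and YX: "\<And>u w. w \<in> T \<Longrightarrow> p u w \<le> 1 \<Longrightarrow> X (u, w) \<in> cbox (- 1) 1 \<and> Y (X (u, w), w) = u"
    and Xb: "\<And>u w. w \<in> T \<Longrightarrow> p u w \<le> 1 \<Longrightarrow> X (u, w) \<in> box (- 1) 1 \<longleftrightarrow> p u w < 1"
    and XY: "\<And>y w. w \<in> T \<Longrightarrow> y \<in> cbox (- 1) 1 \<Longrightarrow> p (Y (y, w)) w \<le> 1 \<and> X (Y (y, w), w) = y"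
    and X0: "\<And>w. w \<in> T \<Longrightarrow> X (0, w) = 0"
    and Xck: "\<And>k. ck k {q. snd q \<in> interior T \<and> p (fst q) (snd q) < 1} X"
    and Yck: "\<And>k. ck k (box (- 1) 1 \<times> interior T) Y"
begin

definition par :: "(real^'n) \<times> 'x \<Rightarrow> 'm" where "par q = chart_inv (A x0) (v1 + Y q, snd q)"

definition cpar :: "'m \<Rightarrow> (real^'n) \<times> 'x" where
  "cpar z = (X (lcoord (A x0) z - v1, tproj (A x0) z), tproj (A x0) z)"

definition chrt :: "('m, 'n, 'x) fchart" where
  "chrt = \<lparr>udom = par ` (box (- 1) 1 \<times> interior T), transv = T, coord = cpar\<rparr>"

lemma p_zero: "w \<in> T \<Longrightarrow> p 0 w = 0" using ph[of w 0 0] by simp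

lemma p_patch:
  assumes "w \<in> T" "p u w \<le> 1"
  shows "v1 + u \<in> cball 0 R" "(v1 + u, w) \<in> dom_box x0"
proof -
  have "norm u \<le> \<delta> / l" by (rule pb[OF assms])
  also have "\<delta> / l \<le> R / 4" using \<delta>(2) l by (simp add: pos_divide_le_eq mult.commute)
  finally show "v1 + u \<in> cball 0 R" using norm_triangle_ineq[of v1 u] v1 R(1) by simp
  then show "(v1 + u, w) \<in> dom_box x0" by (rule dom_patch[OF _ subsetD[OF T(2) assms(1)]])
qed

lemma Y_dom:
  assumes "q \<in> cbox (- 1) 1 \<times> T"
  shows "p (Y q) (snd q) \<le> 1" "X (Y q, snd q) = fst q" "(v1 + Y q, snd q) \<in> dom_box x0"
proof -
  have q: "snd q \<in> T" "fst q \<in> cbox (- 1) 1" using assms by (simp_all only: mem_Times_iff)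
  show 1: "p (Y q) (snd q) \<le> 1" and "X (Y q, snd q) = fst q" using XY[OF q] by simp_all
  show "(v1 + Y q, snd q) \<in> dom_box x0" by (rule p_patch(2)[OF q(1) 1])
qed

lemma cpar_inv: "w \<in> T \<Longrightarrow> p u w \<le> 1 \<Longrightarrow> cpar (chart_inv (A x0) (v1 + u, w)) = (X (u, w), w)"
  using A_lcoord_inv[OF p_patch(2)] A_tproj_inv[OF p_patch(2)] by (simp add: cpar_def)

lemma cpar_par: "q \<in> cbox (- 1) 1 \<times> T \<Longrightarrow> cpar (par q) = q"
  unfolding par_def using cpar_inv[OF _ Y_dom(1)] Y_dom(2) by (simp add: mem_Times_iff)

lemma par_cont: "continuous_on (cbox (- 1) 1 \<times> T) par"
  unfolding par_def[abs_def]
proof (rule continuous_on_compose2[OF A_cont_inv[of x0]])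
  show "continuous_on (cbox (- 1) 1 \<times> T) (\<lambda>q. (v1 + Y q, snd q))"
    by (intro continuous_on_Pair continuous_on_add continuous_on_const Yc continuous_on_snd continuous_on_id)
  show "(\<lambda>q. (v1 + Y q, snd q)) ` (cbox (- 1) 1 \<times> T) \<subseteq> dom_box x0" by (rule image_subsetI) (rule Y_dom(3))
qed

lemma par_slice:
  assumes w: "w \<in> T"
  shows "(\<lambda>y. par (y, w)) ` cbox (- 1) 1 = (\<lambda>u. chart_inv (A x0) (v1 + u, w)) ` {u. p u w \<le> 1}"
    "(\<lambda>y. par (y, w)) ` box (- 1) 1 = (\<lambda>u. chart_inv (A x0) (v1 + u, w)) ` {u. p u w < 1}"
proof -
  have "(\<lambda>y. Y (y, w)) ` cbox (- 1) 1 = {u. p u w \<le> 1}"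
  proof (intro set_eqI iffI)
    fix u assume "u \<in> {u. p u w \<le> 1}"
    then show "u \<in> (\<lambda>y. Y (y, w)) ` cbox (- 1) 1" using YX[OF w, of u] by (intro rev_image_eqI[of "X (u, w)"]) simp_all
  qed (use XY[OF w] in \<open>auto simp del: mem_box\<close>)
  then show "(\<lambda>y. par (y, w)) ` cbox (- 1) 1 = (\<lambda>u. chart_inv (A x0) (v1 + u, w)) ` {u. p u w \<le> 1}"
    by (simp add: par_def image_image[symmetric, of "\<lambda>u. chart_inv (A x0) (v1 + u, w)" "\<lambda>y. Y (y, w)"])
  have "(\<lambda>y. Y (y, w)) ` box (- 1) 1 = {u. p u w < 1}"
  proof (intro set_eqI iffI)
    fix u assume "u \<in> {u. p u w < 1}"
    then show "u \<in> (\<lambda>y. Y (y, w)) ` box (- 1) 1" using YX[OF w, of u] Xb[OF w, of u]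
      by (intro rev_image_eqI[of "X (u, w)"]) simp_all
  next
    fix u assume "u \<in> (\<lambda>y. Y (y, w)) ` box (- 1) 1"
    then obtain y where y: "u = Y (y, w)" "y \<in> box (- 1) 1" by (rule imageE)
    have "y \<in> cbox (- 1) 1" using subsetD[OF box_subset_cbox y(2)] .
    from XY[OF w this] Xb[OF w, of u] y show "u \<in> {u. p u w < 1}" by simp
  qed
  then show "(\<lambda>y. par (y, w)) ` box (- 1) 1 = (\<lambda>u. chart_inv (A x0) (v1 + u, w)) ` {u. p u w < 1}"
    by (simp add: par_def image_image[symmetric, of "\<lambda>u. chart_inv (A x0) (v1 + u, w)" "\<lambda>y. Y (y, w)"])
qed

text \<open>In the coordinates of \<open>A x0\<close> the new chart domain is a strict sublevel set
  of a continuous function over an open transversal. Its openness follows without any property of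
  the parametrisation.\<close>

lemma udom_alt: "par ` (box (- 1) 1 \<times> interior T) =
    chart_inv (A x0) ` {q. snd q \<in> interior T \<and> p (fst q - v1) (snd q) < 1}"
proof -
  have "par ` (box (- 1) 1 \<times> interior T) = (\<Union>w\<in>interior T. (\<lambda>y. par (y, w)) ` box (- 1) 1)" by force
  also have "\<dots> = (\<Union>w\<in>interior T. (\<lambda>u. chart_inv (A x0) (v1 + u, w)) ` {u. p u w < 1})"
    by (rule SUP_cong[OF refl par_slice(2)]) (rule subsetD[OF interior_subset])
  also have "\<dots> = chart_inv (A x0) ` {q. snd q \<in> interior T \<and> p (fst q - v1) (snd q) < 1}"
  proof (intro set_eqI iffI)
    fix z assume "z \<in> (\<Union>w\<in>interior T. (\<lambda>u. chart_inv (A x0) (v1 + u, w)) ` {u. p u w < 1})"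
    then obtain w u where "w \<in> interior T" "p u w < 1" "z = chart_inv (A x0) (v1 + u, w)" by blast
    then show "z \<in> chart_inv (A x0) ` {q. snd q \<in> interior T \<and> p (fst q - v1) (snd q) < 1}"
      by (intro rev_image_eqI[of "(v1 + u, w)"]) simp_all
  next
    fix z assume "z \<in> chart_inv (A x0) ` {q. snd q \<in> interior T \<and> p (fst q - v1) (snd q) < 1}"
    then obtain q where q: "z = chart_inv (A x0) q" "q \<in> {q. snd q \<in> interior T \<and> p (fst q - v1) (snd q) < 1}" by (rule imageE)
    have "z = chart_inv (A x0) (v1 + (fst q - v1), snd q)" using q(1) by simp
    then have "z \<in> (\<lambda>u. chart_inv (A x0) (v1 + u, snd q)) ` {u. p u (snd q) < 1}"
      using q(2) by (intro rev_image_eqI[of "fst q - v1"]) simp_all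
    then show "z \<in> (\<Union>w\<in>interior T. (\<lambda>u. chart_inv (A x0) (v1 + u, w)) ` {u. p u w < 1})"
      using q(2) by (intro UN_I[of "snd q"]) simp_all
  qed
  finally show ?thesis .
qed

lemma open_sublevel: "open {q. snd q \<in> interior T \<and> p (fst q - a) (snd q) < 1}"
proof -
  have o: "open ((UNIV :: (real^'n) set) \<times> interior T)" by (intro open_Times open_UNIV open_interior)
  have "continuous_on (UNIV \<times> interior T) (\<lambda>q. p (fst (fst q - a, snd q)) (snd (fst q - a, snd q)))"
  proof (rule continuous_on_compose2[OF pc])
    show "continuous_on (UNIV \<times> interior T) (\<lambda>q. (fst q - a, snd q))"
      by (intro continuous_on_Pair continuous_on_diff continuous_on_fst continuous_on_snd continuous_on_id continuous_on_const)
  qed (use interior_subset[of T] in \<open>auto simp: mem_Times_iff\<close>)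
  then have "open ((UNIV \<times> interior T) \<inter> (\<lambda>q. p (fst q - a) (snd q)) -` {..<1})"
    using continuous_on_open_vimage[OF o, of "\<lambda>q. p (fst q - a) (snd q)"] open_lessThan by (simp add: Int_commute)
  moreover have "(UNIV \<times> interior T) \<inter> (\<lambda>q. p (fst q - a) (snd q)) -` {..<1} = {q. snd q \<in> interior T \<and> p (fst q - a) (snd q) < 1}"
    by (auto simp: mem_Times_iff)
  ultimately show ?thesis by simp
qed

lemma sublevel_dom: "q \<in> {q. snd q \<in> interior T \<and> p (fst q - v1) (snd q) < 1} \<Longrightarrow> q \<in> dom_box x0"
  using p_patch(2)[of "snd q" "fst q - v1"] interior_subset[of T] by (simp add: subset_iff)

lemma open_udom: "open (par ` (box (- 1) 1 \<times> interior T))"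
  unfolding udom_alt by (rule chart_inv_image_open[OF A_chart open_sublevel]) (rule subsetI, rule sublevel_dom)

lemmas chrt_param = chart_of_parametrization[OF T(1,3) par_cont cpar_par open_udom, folded chrt_def]

lemma chrt_chart: "is_chart chrt"
  and chrt_closure: "closure (udom chrt) = par ` (cbox (- 1) 1 \<times> T)"
  and chrt_inv: "q \<in> cbox (- 1) 1 \<times> T \<Longrightarrow> chart_inv chrt q = par q"
  by (rule chrt_param, simp)+

lemma chrt_simps: "transv chrt = T" "coord chrt = cpar" "udom chrt = par ` (box (- 1) 1 \<times> interior T)"
  "tproj chrt z = tproj (A x0) z" "lcoord chrt z = X (lcoord (A x0) z - v1, tproj (A x0) z)"
  by (simp_all add: chrt_def tproj_def lcoord_def cpar_def)

lemma closure_udomE: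
  assumes "z \<in> closure (udom chrt)"
  obtains u w where "w \<in> T" "p u w \<le> 1" "z = chart_inv (A x0) (v1 + u, w)"
proof -
  obtain q where q: "z = par q" "q \<in> cbox (- 1) 1 \<times> T" using assms unfolding chrt_closure by (rule imageE)
  show ?thesis
    by (rule that[OF _ Y_dom(1)[OF q(2)]]) (use q in \<open>simp_all add: par_def mem_Times_iff\<close>)
qed

lemma chrt_plaque:
  assumes w: "w \<in> T"
  shows "plaque chrt w = leaf_cball A g (chart_inv (A x0) (v1, w)) \<delta>"
proof -
  have "plaque chrt w = (\<lambda>y. par (y, w)) ` cbox (- 1) 1"
  proof (intro set_eqI iffI)
    fix z assume "z \<in> plaque chrt w"
    then obtain q where q: "z = par q" "q \<in> cbox (- 1) 1 \<times> T" and t: "tproj chrt z = w"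
      unfolding plaque_def chrt_closure by blast
    have "snd q = w" using t cpar_par[OF q(2)] q(1) by (simp add: tproj_def chrt_simps(2))
    then have "q = (fst q, w)" by (simp add: prod_eq_iff)
    then show "z \<in> (\<lambda>y. par (y, w)) ` cbox (- 1) 1" using q by (intro rev_image_eqI[of "fst q"]) (simp_all add: mem_Times_iff)
  next
    fix z assume "z \<in> (\<lambda>y. par (y, w)) ` cbox (- 1) 1"
    then obtain y where y: "z = par (y, w)" "y \<in> cbox (- 1) 1" by (rule imageE)
    have q: "(y, w) \<in> cbox (- 1) 1 \<times> T" using y(2) w by (rule SigmaI)
    have "tproj chrt z = w" using cpar_par[OF q] y(1) by (simp add: tproj_def chrt_simps(2))
    then show "z \<in> plaque chrt w" unfolding plaque_def chrt_closure using imageI[OF q, of par] y(1) by simp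
  qed
  then show ?thesis by (simp only: par_slice(1)[OF w] pl[OF w])
qed

lemma zero_cbox: "(0::real^'n) \<in> cbox (- 1) 1" "(0::real^'n) \<in> box (- 1) 1" by (simp_all add: mem_box_cart)

lemma Y_zero: "w \<in> T \<Longrightarrow> Y (0, w) = 0" using YX[of w 0] X0[of w] p_zero[of w] by simp

text \<open>Since \<open>X\<close> fixes the origin, the zero section of the new chart is the
  section \<open>v = v1\<close> of the old one, and its points are the centres of the balls that
  form the plaques.\<close>

lemma centre_plaque:
  assumes y: "y \<in> closure (udom chrt)" "lcoord chrt y = 0"
  shows "tproj chrt y \<in> T" "y = chart_inv (A x0) (v1, tproj chrt y)"
proof -
  obtain q where q: "y = par q" "q \<in> cbox (- 1) 1 \<times> T" using y(1) unfolding chrt_closure by (rule imageE)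
  have c: "coord chrt y = q" using cpar_par[OF q(2)] q(1) by (simp add: chrt_simps(2))
  have w: "tproj chrt y = snd q" "fst q = 0" using y(2) c by (simp_all add: tproj_def lcoord_def)
  show "tproj chrt y \<in> T" using q(2) unfolding w(1) by (simp only: mem_Times_iff)
  then have "Y q = 0" using Y_zero w by (cases q) simp
  then show "y = chart_inv (A x0) (v1, tproj chrt y)" using q(1) w(1) by (simp add: par_def)
qed

lemma chrt_centered:
  assumes w: "w \<in> interior T"
  shows "centered_at chrt (chart_inv (A x0) (v1, w))" "tproj chrt (chart_inv (A x0) (v1, w)) = w"
proof -
  have wT: "w \<in> T" using subsetD[OF interior_subset w] .
  have e: "chart_inv (A x0) (v1, w) = par (0, w)" using Y_zero[OF wT] by (simp add: par_def)
  have c: "coord chrt (par (0, w)) = (0, w)" using cpar_par[OF SigmaI[OF zero_cbox(1) wT]] by (simp add: chrt_simps(2))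
  show "tproj chrt (chart_inv (A x0) (v1, w)) = w" using c e by (simp add: tproj_def)
  show "centered_at chrt (chart_inv (A x0) (v1, w))"
    unfolding centered_at_def using c w imageI[OF SigmaI[OF zero_cbox(2) w], of par]
    by (simp add: e tproj_def lcoord_def chrt_simps(1,3))
qed

lemma chrt_td: "tot_disconnected (transv chrt)"
  unfolding tot_disconnected_def chrt_simps
proof
  fix w assume w: "w \<in> T"
  have TA: "T \<subseteq> transv (A x0)" using T(2) W(2) interior_subset[of "transv (A x0)"] by (simp add: subset_iff)
  have "connected_component_set T w \<subseteq> connected_component_set (transv (A x0)) w"
    by (rule connected_component_mono[OF TA])
  moreover have "connected_component_set (transv (A x0)) w = {w}"
    using A_td[of x0, unfolded tot_disconnected_def] subsetD[OF TA w] by (rule bspec)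
  moreover have "w \<in> connected_component_set T w" using w by simp
  ultimately show "connected_component_set T w = {w}" by (intro subset_antisym) simp_all
qed

lemma chrt_udom_sub: "udom chrt \<subseteq> udom (A x0)"
proof
  fix z assume "z \<in> udom chrt"
  from closure_udomE[OF subsetD[OF closure_subset this]]
  obtain u w where "w \<in> T" "p u w \<le> 1" "z = chart_inv (A x0) (v1 + u, w)" .
  then show "z \<in> udom (A x0)" using A_inv_udom[OF p_patch(2)] by simp
qed

text \<open>Two kinds of boundary points have to be excluded. A coordinate box around an interior
  point of the closure shows at once that its transverse coordinate is interior to \<open>T\<close>;
  a point with gauge 1 could be pushed outwards along its ray within the box, which would give a
  gauge above 1.\<close>

lemma chrt_interior: "interior (closure (udom chrt)) = udom chrt"
proof
  show "udom chrt \<subseteq> interior (closure (udom chrt))"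
    by (rule interior_maximal[OF closure_subset chart_open[OF chrt_chart]])
  show "interior (closure (udom chrt)) \<subseteq> udom chrt"
  proof
    fix z assume z: "z \<in> interior (closure (udom chrt))"
    from closure_udomE[OF subsetD[OF interior_subset z]]
    obtain u w where u: "w \<in> T" "p u w \<le> 1" "z = chart_inv (A x0) (v1 + u, w)" .
    have dm: "(v1 + u, w) \<in> dom_box x0" by (rule p_patch(2)[OF u(1,2)])
    have zA: "z \<in> udom (A x0)" using A_inv_udom[OF dm] u(3) by simp
    let ?U = "interior (closure (udom chrt)) \<inter> udom (A x0)"
    have lz: "lcoord (A x0) z = v1 + u" "tproj (A x0) z = w" using A_lcoord_inv[OF dm] A_tproj_inv[OF dm] u(3) by simp_all
    have U: "open ?U" "?U \<subseteq> udom (A x0)" "z \<in> ?U" using chart_open[OF A_chart[of x0]] z zA by (simp_all add: open_Int)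
    obtain r where r: "r > 0" "ball (lcoord (A x0) z) r \<times> ball (tproj (A x0) z) r \<subseteq> coord (A x0) ` ?U"
      by (rule chart_box_nbhd[OF A_chart U])
    have near: "w' \<in> T \<and> p u' w' \<le> 1" if u': "v1 + u' \<in> ball (v1 + u) r" and w': "w' \<in> ball w r" for u' w'
    proof -
      have "(v1 + u', w') \<in> coord (A x0) ` ?U" using subsetD[OF r(2)] u' w' unfolding lz by simp
      then obtain a where a: "coord (A x0) a = (v1 + u', w')" "a \<in> ?U" by (metis imageE)
      have "a \<in> closure (udom chrt)" using a(2) interior_subset by blast
      from closure_udomE[OF this] obtain u2 w2 where u2: "w2 \<in> T" "p u2 w2 \<le> 1" "a = chart_inv (A x0) (v1 + u2, w2)" .
      have "coord (A x0) a = (v1 + u2, w2)" unfolding u2(3)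
        by (rule A_coord_inv[OF subsetD[OF chart_box_sub[OF A_chart] p_patch(2)[OF u2(1,2)]]])
      then show ?thesis using a(1) u2(1,2) by simp
    qed
    have "ball w r \<subseteq> T"
    proof
      fix w' assume "w' \<in> ball w r"
      then show "w' \<in> T" using near[of u w'] r(1) by simp
    qed
    then have wi: "w \<in> interior T" using r(1) by (intro interiorI[of "ball w r"]) simp_all
    have "p u w < 1"
    proof (rule ccontr)
      assume "\<not> p u w < 1"
      then have p1: "p u w = 1" using u(2) by simp
      \<comment> \<open>The factor exceeds 1 and moves \<open>u\<close> by at most
        \<open>r / 2\<close>; adding 1 to the norm avoids a separate argument for
        \<open>u = 0\<close>.\<close>
      define s where "s = 1 + r / 2 * inverse (norm u + 1)"
      have n1: "norm u + 1 > 0" by (simp add: add_nonneg_pos)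
      have s: "s > 1" using r(1) n1 by (simp add: s_def)
      have "s *\<^sub>R u - u = (r / 2 * inverse (norm u + 1)) *\<^sub>R u" by (simp add: s_def scaleR_add_left)
      then have "norm (s *\<^sub>R u - u) = r / 2 * (inverse (norm u + 1) * norm u)" using r(1) n1 by (simp add: mult.assoc)
      also have "\<dots> \<le> r / 2 * (inverse (norm u + 1) * (norm u + 1))"
        using r(1) n1 by (intro mult_left_mono) simp_all
      also have "\<dots> = r / 2" using n1 by simp
      also have "\<dots> < r" using r(1) by simp
      finally have "v1 + s *\<^sub>R u \<in> ball (v1 + u) r" by (simp add: dist_norm norm_minus_commute)
      then have "p (s *\<^sub>R u) w \<le> 1" using near[of "s *\<^sub>R u" w] r(1) by simp
      then show False using ph[OF u(1), of s u] s p1 by simp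
    qed
    then have "z \<in> chart_inv (A x0) ` {q. snd q \<in> interior T \<and> p (fst q - v1) (snd q) < 1}"
      using wi u(3) by (intro rev_image_eqI[of "(v1 + u, w)"]) simp_all
    then show "z \<in> udom chrt" by (simp only: chrt_simps(3) udom_alt)
  qed
qed

lemma chrt_to_A: "ck k (coord chrt ` (udom chrt \<inter> udom (A y))) (\<lambda>q. lcoord (A y) (chart_inv chrt q))"
proof -
  let ?U = "udom chrt \<inter> udom (A y)" let ?D = "coord chrt ` ?U"
  have oU: "open ?U" using chart_open[OF chrt_chart] chart_open[OF A_chart] by (rule open_Int)
  have oD: "open ?D" by (rule chart_coord_image_open[OF chrt_chart oU]) (rule Int_lower1)
  have Dq: "q \<in> box (- 1) 1 \<times> interior T" "chart_inv chrt q \<in> ?U" "chart_inv chrt q = par q" if qD: "q \<in> ?D" for q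
  proof -
    obtain z where z: "q = coord chrt z" "z \<in> ?U" using qD by (rule imageE)
    show "q \<in> box (- 1) 1 \<times> interior T" using chart_coord_udom[OF chrt_chart IntD1[OF z(2)]] unfolding z(1) chrt_simps(1) .
    then have q': "q \<in> cbox (- 1) 1 \<times> T" using chart_box_sub[OF chrt_chart] unfolding chrt_simps(1) by (rule rev_subsetD)
    show "chart_inv chrt q \<in> ?U"
      unfolding z(1) chart_inv_coord[OF chrt_chart chart_udom_closure[OF chrt_chart IntD1[OF z(2)]]] by (rule z(2))
    show "chart_inv chrt q = par q" by (rule chrt_inv[OF q'])
  qed
  have "ck k ?D (\<lambda>q. tr x0 y (v1 + Y q, snd q))"
  proof (rule ck_compose[where \<kappa> = "\<lambda>w. w" and F = "tr x0 y" and E = "tr_dom x0 y" and G = "\<lambda>q. v1 + Y q", OF oD tr_dom_open _ tr_ck])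
    show "ck k ?D (\<lambda>q. v1 + Y q)"
      by (intro ck_add[OF oD ck_const[OF oD] ck_subset[OF Yck]] subsetI) (rule Dq(1))
    show "continuous_on ?D (\<lambda>q. snd q)" by (rule continuous_on_snd[OF continuous_on_id])
    show "(v1 + Y q, snd q) \<in> tr_dom x0 y" if "q \<in> ?D" for q
    proof -
      have "q \<in> cbox (- 1) 1 \<times> T" using chart_box_sub[OF chrt_chart] Dq(1)[OF that] unfolding chrt_simps(1) by (rule subsetD)
      then show ?thesis unfolding tr_dom_iff using Y_dom(3) Dq(2,3)[OF that] by (simp add: par_def)
    qed
  qed
  then show ?thesis
    by (rule ck_cong[OF oD, rotated]) (simp add: Dq(3) par_def tr_def)
qed

text \<open>The new coordinates are \<open>X\<close> applied to a transition map, but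
  \<open>X\<close> also depends on the transverse coordinate of \<open>A x0\<close>. On a small
  product box this coordinate is a function of the transverse coordinate of \<open>A y\<close>
  alone, so differentiation along plaques does not see it.\<close>

lemma A_to_chrt: "ck k (coord (A y) ` (udom (A y) \<inter> udom chrt)) (\<lambda>q. lcoord chrt (chart_inv (A y) q))"
proof (rule ck_local)
  let ?U = "udom (A y) \<inter> udom chrt" let ?D = "coord (A y) ` ?U"
  have oU: "open ?U" using chart_open[OF A_chart] chart_open[OF chrt_chart] by (rule open_Int)
  fix q assume "q \<in> ?D"
  then obtain z where z: "q = coord (A y) z" "z \<in> ?U" by (rule imageE)
  have sub: "?U \<subseteq> udom (A y)" by (rule Int_lower1)
  obtain r where r: "r > 0" "ball (lcoord (A y) z) r \<times> ball (tproj (A y) z) r \<subseteq> ?D"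
    by (rule chart_box_nbhd[OF A_chart oU sub z(2)])
  define V where "V = ball (lcoord (A y) z) r"
  define E where "E = V \<times> ball (tproj (A y) z) r"
  have oE: "open E" unfolding E_def V_def by (intro open_Times open_ball)
  have qE: "q \<in> E" using r(1) by (simp add: E_def V_def z(1) chart_coord_eq[OF A_chart])
  have Ed: "e \<in> dom_box y" "chart_inv (A y) e \<in> ?U" if eE: "e \<in> E" for e
  proof -
    have "e \<in> ?D" using eE r(2) unfolding E_def V_def by (rule rev_subsetD)
    then obtain a where a: "e = coord (A y) a" "a \<in> ?U" by (rule imageE)
    show "e \<in> dom_box y" unfolding a(1) by (rule chart_coord_udom[OF A_chart IntD1[OF a(2)]])
    show "chart_inv (A y) e \<in> ?U"
      unfolding a(1) chart_inv_coord[OF A_chart chart_udom_closure[OF A_chart IntD1[OF a(2)]]] by (rule a(2))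
  qed
  \<comment> \<open>The transverse holonomy from \<open>A y\<close> to \<open>A x0\<close>, read off
    at the centre of each slice; slices are connected, so any other point of the slice gives the
    same value.\<close>
  define \<kappa> where "\<kappa> w = tproj (A x0) (chart_inv (A y) (lcoord (A y) z, w))" for w
  have \<kappa>: "tproj (A x0) (chart_inv (A y) e) = \<kappa> (snd e)" if eE: "e \<in> E" for e
  proof -
    have e: "fst e \<in> V" "snd e \<in> ball (tproj (A y) z) r" using eE by (simp_all only: E_def mem_Times_iff)
    have VE: "(u, snd e) \<in> E" if "u \<in> V" for u unfolding E_def using that e(2) by (rule SigmaI)
    let ?S = "(\<lambda>u. chart_inv (A y) (u, snd e)) ` V"
    have c: "connected ?S" unfolding V_def
      by (rule connected_plaque_ball) (rule Ed(1), rule VE, simp only: V_def)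
    have s: "?S \<subseteq> closure (udom (A x0))"
    proof (rule image_subsetI)
      fix u assume "u \<in> V"
      then show "chart_inv (A y) (u, snd e) \<in> closure (udom (A x0))"
        using Ed(2)[OF VE] chrt_udom_sub closure_subset[of "udom (A x0)"] by blast
    qed
    have m: "chart_inv (A y) e \<in> ?S" using e(1) by (intro rev_image_eqI[of "fst e"]) simp_all
    have m': "chart_inv (A y) (lcoord (A y) z, snd e) \<in> ?S" using r(1) by (intro imageI) (simp add: V_def)
    show ?thesis unfolding \<kappa>_def by (rule chart_tproj_const[OF A_chart A_td c s m m'])
  qed
  have EA: "chart_inv (A y) e \<in> udom (A x0)" if "e \<in> E" for e using subsetD[OF chrt_udom_sub IntD2[OF Ed(2)[OF that]]] .
  have cin: "continuous_on E (chart_inv (A y))" by (rule continuous_on_subset[OF A_cont_inv subsetI]) (rule Ed(1))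
  have "continuous_on E (\<lambda>e. tproj (A x0) (chart_inv (A y) e))"
    by (rule continuous_on_compose2[OF chart_cont_tproj[OF A_chart] cin])
      (rule image_subsetI, rule chart_udom_closure[OF A_chart EA])
  then have c\<kappa>: "continuous_on E (\<lambda>e. \<kappa> (snd e))" by (rule continuous_on_eq) (rule \<kappa>)
  let ?S = "{q. snd q \<in> interior T \<and> p (fst q) (snd q) < 1}"
  have oS: "open ?S" using open_sublevel[of 0] by simp
  have Et: "E \<subseteq> tr_dom y x0" using Ed(1) EA by (simp add: subset_iff tr_dom_iff)
  have "ck k E (\<lambda>e. X (tr y x0 e - v1, \<kappa> (snd e)))"
  proof (rule ck_compose[where F = X and E = ?S and G = "\<lambda>e. tr y x0 e - v1", OF oE oS _ Xck c\<kappa>])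
    show "ck k E (\<lambda>e. tr y x0 e - v1)" by (intro ck_diff[OF oE ck_subset[OF tr_ck Et] ck_const[OF oE]])
    show "(tr y x0 e - v1, \<kappa> (snd e)) \<in> ?S" if eE: "e \<in> E" for e
    proof -
      have "chart_inv (A y) e \<in> udom chrt" using Ed(2)[OF eE] by simp
      then obtain q where q: "chart_inv (A y) e = chart_inv (A x0) q" "q \<in> {q. snd q \<in> interior T \<and> p (fst q - v1) (snd q) < 1}"
        unfolding chrt_simps(3) udom_alt by (rule imageE)
      have d: "(fst q, snd q) \<in> dom_box x0" using sublevel_dom[OF q(2)] by simp
      have "tr y x0 e = fst q" "\<kappa> (snd e) = snd q"
        using A_lcoord_inv[OF d] A_tproj_inv[OF d] \<kappa>[OF eE] q(1) by (simp_all add: tr_def)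
      then show ?thesis using q(2) by simp
    qed
  qed
  then have "ck k E (\<lambda>q. lcoord chrt (chart_inv (A y) q))"
    by (rule ck_cong[OF oE, rotated]) (simp add: chrt_simps(5) tr_def \<kappa>)
  then show "\<exists>E. open E \<and> q \<in> E \<and> ck k E (\<lambda>q. lcoord chrt (chart_inv (A y) q))"
    using oE qE by (intro exI[of _ E]) simp
qed

lemma chrt_foliation_chart: "foliation_chart A chrt"
  unfolding foliation_chart_def
proof (intro conjI allI)
  fix y
  show "plaque_compatible chrt (A y)" by (rule plaque_compatibleI[OF chrt_chart chrt_td A_chart A_td])
  show "smoothly_related chrt (A y)" by (rule smoothly_relatedI[OF chrt_chart chrt_td A_chart A_td chrt_to_A])
  show "smoothly_related (A y) chrt" by (rule smoothly_relatedI[OF A_chart A_td chrt_chart chrt_td A_to_chrt])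
qed (rule chrt_chart)

lemma chrt_fibre_connected: "connected {z \<in> udom chrt. tproj (A x0) z = w}"
proof (cases "w \<in> interior T")
  case True
  have wT: "w \<in> T" using subsetD[OF interior_subset True] .
  have sub: "box (- 1) 1 \<times> {w} \<subseteq> cbox (- 1) (1::real^'n) \<times> T"
    by (intro Sigma_mono box_subset_cbox) (use wT in simp)
  have "{z \<in> udom chrt. tproj (A x0) z = w} = (\<lambda>y. par (y, w)) ` box (- 1) 1"
  proof (intro set_eqI iffI)
    fix z assume "z \<in> {z \<in> udom chrt. tproj (A x0) z = w}"
    then have z: "z \<in> udom chrt" "tproj chrt z = w" by (simp_all only: mem_Collect_eq chrt_simps(4))
    then obtain q where q: "z = par q" "q \<in> box (- 1) 1 \<times> interior T" unfolding chrt_simps(3) by (rule_tac imageE)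
    have "q \<in> cbox (- 1) 1 \<times> T" using chart_box_sub[OF chrt_chart] q(2) unfolding chrt_simps(1) by (rule subsetD)
    then have "snd q = w" using z(2) cpar_par q(1) by (simp add: tproj_def chrt_simps(2))
    then have "q = (fst q, w)" by (simp add: prod_eq_iff)
    then show "z \<in> (\<lambda>y. par (y, w)) ` box (- 1) 1" using q by (intro rev_image_eqI[of "fst q"]) (simp_all add: mem_Times_iff)
  next
    fix z assume "z \<in> (\<lambda>y. par (y, w)) ` box (- 1) 1"
    then obtain y where y: "z = par (y, w)" "y \<in> box (- 1) 1" by (rule imageE)
    have "(y, w) \<in> cbox (- 1) 1 \<times> T" using sub y(2) by blast
    then have "tproj chrt z = w" using cpar_par y(1) by (simp add: tproj_def chrt_simps(2))
    moreover have "z \<in> udom chrt" unfolding chrt_simps(3) y(1) by (rule imageI[OF SigmaI[OF y(2) True]])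
    ultimately show "z \<in> {z \<in> udom chrt. tproj (A x0) z = w}" by (simp add: chrt_simps(4))
  qed
  moreover have "connected ((\<lambda>y. par (y, w)) ` box (- 1) 1)"
  proof (rule connected_continuous_image[OF continuous_on_compose2[OF par_cont]])
    show "continuous_on (box (- 1) 1) (\<lambda>y::real^'n. (y, w))" by (intro continuous_on_Pair continuous_on_id continuous_on_const)
    show "(\<lambda>y::real^'n. (y, w)) ` box (- 1) 1 \<subseteq> cbox (- 1) 1 \<times> T" using sub by blast
  qed (rule convex_connected[OF convex_box(2)])
  ultimately show ?thesis by simp
next
  case False
  have "{z \<in> udom chrt. tproj (A x0) z = w} = {}"
    using chart_tproj_mem[OF chrt_chart] False by (auto simp: chrt_simps(1,4))
  then show ?thesis by (simp only: connected_empty)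
qed

end

text \<open>Everything that a regular covering and \<open>holonomy_cover\<close> ask of one chart.
  \<open>M\<close> is the intermediate domain: it contains the closed chart, has connected fibres
  inside the large chart \<open>A x0\<close>, and its size is governed by \<open>\<mu>\<close>
  independently of the plaque radius \<delta>.\<close>

definition good_chart ::
  "('m::metric_space \<Rightarrow> ('m, 'n::finite, 'x::metric_space) fchart) \<Rightarrow> ('m \<Rightarrow> real^'n \<Rightarrow> real^'n \<Rightarrow> real)
    \<Rightarrow> 'm \<Rightarrow> real \<Rightarrow> real \<Rightarrow> 'm \<Rightarrow> ('m, 'n, 'x) fchart \<Rightarrow> 'm set \<Rightarrow> real \<Rightarrow> bool" where
  "good_chart A g x0 \<mu> \<delta> x c M rad \<longleftrightarrow>
     foliation_chart A c \<and> centered_at c x \<and> rad > 0 \<and>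
     transv c = cball (tproj c x) rad \<and> interior (transv c) = ball (tproj c x) rad \<and>
     interior (closure (udom c)) = udom c \<and>
     (\<forall>y \<in> closure (udom c). lcoord c y = 0 \<longrightarrow>
        plaque c (tproj c y) = leaf_cball A g y \<delta> \<and> strongly_convex A g (leaf_cball A g y \<delta>)) \<and>
     closure (udom c) \<subseteq> M \<and> open M \<and> M \<subseteq> ball x \<mu> \<and> M \<subseteq> udom (A x0) \<and>
     (\<forall>w. connected {z \<in> M. tproj (A x0) z = w}) \<and>
     (\<forall>w. connected {z \<in> udom c. tproj (A x0) z = w}) \<and>
     (\<forall>z. tproj c z = tproj (A x0) z)"

text \<open>The plaque radius is universally quantified below a threshold because charts from
  different patches have to share it. The margin \<open>\<rho>\<close> bounds the centres away from
  the edge of \<open>W\<close>, which makes the threshold independent of the centre.\<close>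

lemma (in metric_patch) good_chart_exists:
  assumes cr: "convexity_radius A g lam" and \<rho>: "\<rho> > 0" and \<mu>: "\<mu> > 0"
  shows "\<exists>\<delta>0>0. \<forall>\<delta> (v1 :: real^'n) w1. 0 < \<delta> \<longrightarrow> \<delta> \<le> \<delta>0 \<longrightarrow> norm v1 \<le> R / 2 \<longrightarrow> cball w1 \<rho> \<subseteq> W \<longrightarrow>
    (\<exists>c M rad. good_chart A g x0 \<mu> \<delta> (chart_inv (A x0) (v1, w1)) c M rad)"
proof -
  let ?K = "cball (0::real^'n) R \<times> W"
  have Kd: "?K \<subseteq> dom_box x0" by (rule Sigma_mono[OF R(2) W(2)])
  have "uniformly_continuous_on ?K (chart_inv (A x0))"
    by (rule compact_uniformly_continuous[OF continuous_on_subset[OF A_cont_inv Kd] compact_Times[OF compact_cball W(1)]])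
  then obtain \<eta> where \<eta>: "\<eta> > 0" "\<And>q q'. q \<in> ?K \<Longrightarrow> q' \<in> ?K \<Longrightarrow> dist q' q < \<eta> \<Longrightarrow> dist (chart_inv (A x0) q') (chart_inv (A x0) q) < \<mu>"
    unfolding uniformly_continuous_on_def using \<mu> by metis
  obtain \<delta>1 where \<delta>1: "\<delta>1 > 0" "\<And>\<delta> (v1 :: real^'n) w. 0 < \<delta> \<Longrightarrow> \<delta> \<le> \<delta>1 \<Longrightarrow> norm v1 \<le> R / 2 \<Longrightarrow> w \<in> W \<Longrightarrow>
      strongly_convex A g (leaf_cball A g (chart_inv (A x0) (v1, w)) \<delta>)"
    using strongly_convex_small_ball[OF cr] by metis
  \<comment> \<open>Half of \<open>\<eta>\<close> is spent in each factor, so the product box about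
    the centre has image within \<open>\<mu>\<close> of the image of the centre.\<close>
  define r1 where "r1 = min (R / 2) (\<eta> / 2)"
  define \<rho>1 where "\<rho>1 = min \<rho> (\<eta> / 2)"
  have pos: "r1 > 0" "\<rho>1 > 0" using R(1) \<eta>(1) \<rho> by (simp_all add: r1_def \<rho>1_def)
  \<comment> \<open>The three bounds provide strong convexity, the gauge with
    \<open>\<delta> < l * rc\<close>, and plaques of coordinate radius less than \<open>r1\<close>,
    which fit into the intermediate domain.\<close>
  define \<delta>0 where "\<delta>0 = min \<delta>1 (min (l * rc / 2) (l * r1 / 2))"
  have \<delta>0: "\<delta>0 > 0" "\<delta>0 \<le> \<delta>1" "\<delta>0 \<le> l * rc / 2" "\<delta>0 \<le> l * r1 / 2" using \<delta>1(1) l rc(1) pos by (simp_all add: \<delta>0_def)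
  show ?thesis
  proof (intro exI[of _ \<delta>0] conjI allI impI)
    fix \<delta> w1 and v1 :: "real^'n"
    assume \<delta>: "0 < \<delta>" "\<delta> \<le> \<delta>0" and v1: "norm v1 \<le> R / 2" and w1: "cball w1 \<rho> \<subseteq> W"
    obtain rad where rad: "0 < rad" "rad < \<rho>1" "interior (cball w1 rad) = ball w1 rad" "closure (ball w1 rad) = cball w1 rad"
      by (rule generic_radius[OF compact_X pos(2), of w1]) (rule that)
    let ?T = "cball w1 rad"
    have TW: "?T \<subseteq> W" by (rule order_trans[OF subset_cball w1]) (use rad(2) in \<open>simp add: \<rho>1_def\<close>)
    have cT: "compact ?T" using compact_Int_closed[OF compact_X closed_cball, of w1 rad] by simp
    have lr: "\<delta> < l * rc" using \<delta> \<delta>0(3) l rc(1) by (intro le_less_trans[of \<delta> "l * rc / 2"]) simp_all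
    have l8: "\<delta> \<le> l * (R / 4)"
    proof -
      have "l * rc \<le> l * (R / 4)" using l rc(2) R(1) by (intro mult_left_mono) simp_all
      then show ?thesis using lr by simp
    qed
    have dl: "\<delta> / l < r1"
    proof -
      have "\<delta> \<le> l * r1 / 2" using \<delta>(2) \<delta>0(4) by simp
      also have "\<dots> < r1 * l" using l pos(1) by simp
      finally show ?thesis using l by (simp add: pos_divide_less_eq)
    qed
    obtain p :: "real^'n \<Rightarrow> 'x \<Rightarrow> real" where p: "continuous_on (UNIV \<times> W) (\<lambda>q. p (fst q) (snd q))"
      "\<And>u w s. w \<in> W \<Longrightarrow> s \<ge> 0 \<Longrightarrow> p (s *\<^sub>R u) w = s * p u w"
      "\<And>u w. w \<in> W \<Longrightarrow> u \<noteq> 0 \<Longrightarrow> p u w > 0"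
      "\<And>u w. w \<in> W \<Longrightarrow> p u w \<le> 1 \<Longrightarrow> norm u \<le> \<delta> / l"
      "\<And>w. w \<in> W \<Longrightarrow> leaf_cball A g (chart_inv (A x0) (v1, w)) \<delta> = (\<lambda>u. chart_inv (A x0) (v1 + u, w)) ` {u. p u w \<le> 1}"
      by (rule leaf_cball_gauge[OF v1 \<delta>(1) lr]) (rule that)
    have pc: "continuous_on (UNIV \<times> ?T) (\<lambda>q. p (fst q) (snd q))"
      by (rule continuous_on_subset[OF p(1) Sigma_mono[OF order_refl TW]])
    have Tne: "?T \<noteq> {}" using rad(1) by simp
    note TWD = subsetD[OF TW]
    obtain X Y :: "(real^'n) \<times> 'x \<Rightarrow> real^'n" where XY:
      "continuous_on {q. snd q \<in> ?T \<and> p (fst q) (snd q) \<le> 1} X"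
      "continuous_on (cbox (- 1) 1 \<times> ?T) Y"
      "\<And>v w. w \<in> ?T \<Longrightarrow> p v w \<le> 1 \<Longrightarrow> X (v, w) \<in> cbox (- 1) 1 \<and> Y (X (v, w), w) = v"
      "\<And>v w. w \<in> ?T \<Longrightarrow> p v w \<le> 1 \<Longrightarrow> X (v, w) \<in> box (- 1) 1 \<longleftrightarrow> p v w < 1"
      "\<And>y w. w \<in> ?T \<Longrightarrow> y \<in> cbox (- 1) 1 \<Longrightarrow> p (Y (y, w)) w \<le> 1 \<and> X (Y (y, w), w) = y"
      "\<And>w. w \<in> ?T \<Longrightarrow> X (0, w) = 0"
      "\<And>k. ck k {q. snd q \<in> interior ?T \<and> p (fst q) (snd q) < 1} X"
      "\<And>k. ck k (box (- 1) 1 \<times> interior ?T) Y"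
      by (rule star_body_cube[OF cT Tne pc p(2)[OF TWD] p(3)[OF TWD]]) (assumption | rule that)+
    interpret S: star_chart A g x0 W R l Lm C v1 ?T \<delta> p X Y
    proof
      show "closure (interior ?T) = ?T" by (simp only: rad(3,4))
    qed (rule v1 \<delta>(1) l8 cT TW pc XY p(2)[OF TWD] p(4)[OF TWD] p(5)[OF TWD] | assumption)+
    let ?x = "chart_inv (A x0) (v1, w1)"
    have wi: "w1 \<in> interior ?T" using rad(1) unfolding rad(3) by simp
    note cen = S.chrt_centered[OF wi]
    define Q where "Q = ball v1 r1 \<times> ball w1 \<rho>1"
    have QK: "q \<in> ?K" if q: "q \<in> Q" for q
    proof -
      have "dist v1 (fst q) < r1" "snd q \<in> ball w1 \<rho>1" using q by (simp_all add: Q_def mem_Times_iff)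
      moreover have "ball w1 \<rho>1 \<subseteq> W" by (rule order_trans[OF ball_subset_cball order_trans[OF subset_cball w1]]) (simp add: \<rho>1_def)
      moreover have "norm (fst q) \<le> norm v1 + dist v1 (fst q)" using norm_triangle_sub[of "fst q" v1] by (simp add: dist_norm norm_minus_commute)
      ultimately show ?thesis using v1 by (simp only: mem_Times_iff) (auto simp: r1_def)
    qed
    have Qd: "Q \<subseteq> dom_box x0" using QK Kd by blast
    define M where "M = chart_inv (A x0) ` Q"
    have cq: "(v1, w1) \<in> Q" using pos by (simp add: Q_def)
    have "good_chart A g x0 \<mu> \<delta> ?x S.chrt M rad"
      unfolding good_chart_def cen(2)
    proof (intro conjI ballI impI allI)
      show "foliation_chart A S.chrt" by (rule S.chrt_foliation_chart)
      show "centered_at S.chrt ?x" by (rule cen(1))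
      show "rad > 0" by (rule rad(1))
      show "transv S.chrt = cball w1 rad" by (rule S.chrt_simps(1))
      show "interior (transv S.chrt) = ball w1 rad" unfolding S.chrt_simps(1) by (rule rad(3))
      show "interior (closure (udom S.chrt)) = udom S.chrt" by (rule S.chrt_interior)
      show "plaque S.chrt (tproj S.chrt y) = leaf_cball A g y \<delta>" "strongly_convex A g (leaf_cball A g y \<delta>)"
        if y: "y \<in> closure (udom S.chrt)" "lcoord S.chrt y = 0" for y
      proof -
        note e = S.centre_plaque[OF y]
        show "plaque S.chrt (tproj S.chrt y) = leaf_cball A g y \<delta>" using S.chrt_plaque[OF e(1)] e(2) by simp
        have "strongly_convex A g (leaf_cball A g (chart_inv (A x0) (v1, tproj S.chrt y)) \<delta>)"
          by (rule \<delta>1(2)[OF \<delta>(1) order_trans[OF \<delta>(2) \<delta>0(2)] v1 TWD[OF e(1)]])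
        then show "strongly_convex A g (leaf_cball A g y \<delta>)" using e(2) by simp
      qed
      show "closure (udom S.chrt) \<subseteq> M"
      proof
        fix z assume "z \<in> closure (udom S.chrt)"
        then obtain u w where u: "w \<in> ?T" "p u w \<le> 1" "z = chart_inv (A x0) (v1 + u, w)" by (rule S.closure_udomE)
        have "norm u < r1" using p(4)[OF TWD[OF u(1)] u(2)] dl by simp
        then have "(v1 + u, w) \<in> Q" using u(1) rad(2) by (simp add: Q_def dist_norm)
        then show "z \<in> M" unfolding M_def u(3) by (rule imageI)
      qed
      show "open M" unfolding M_def by (rule chart_inv_image_open[OF A_chart _ Qd]) (simp add: Q_def open_Times)
      show "M \<subseteq> ball ?x \<mu>"
      proof
        fix z assume "z \<in> M"
        then obtain q where q: "z = chart_inv (A x0) q" "q \<in> Q" unfolding M_def by (rule imageE)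
        have "dist (v1, w1) q \<le> dist v1 (fst q) + dist w1 (snd q)"
          using sqrt_sum_squares_le_sum[OF zero_le_dist zero_le_dist, of v1 "fst q" w1 "snd q"] by (simp add: dist_prod_def)
        also have "\<dots> < \<eta>" using q(2) by (simp add: Q_def r1_def \<rho>1_def mem_Times_iff)
        finally show "z \<in> ball ?x \<mu>" using \<eta>(2)[OF QK[OF q(2)] QK[OF cq]] q(1) by simp
      qed
      show "M \<subseteq> udom (A x0)" unfolding M_def by (rule image_subsetI) (rule A_inv_udom[OF subsetD[OF Qd]])
      show "connected {z \<in> M. tproj (A x0) z = w}" for w
      proof (cases "w \<in> ball w1 \<rho>1")
        case True
        have tq: "tproj (A x0) (chart_inv (A x0) (u, w')) = w'" if "(u, w') \<in> Q" for u w'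
          by (rule A_tproj_inv[OF subsetD[OF Qd that]])
        have uQ: "(u, w) \<in> Q" if "u \<in> ball v1 r1" for u unfolding Q_def by (rule SigmaI[OF that True])
        have "{z \<in> M. tproj (A x0) z = w} = (\<lambda>u. chart_inv (A x0) (u, w)) ` ball v1 r1"
        proof (intro set_eqI iffI)
          fix z assume z: "z \<in> {z \<in> M. tproj (A x0) z = w}"
          then have "z \<in> M" by simp
          then obtain q where q: "z = chart_inv (A x0) q" "q \<in> Q" unfolding M_def by (rule imageE)
          have "snd q = w" using z tq[of "fst q" "snd q"] q by simp
          then have "q = (fst q, w)" by (simp add: prod_eq_iff)
          moreover have "fst q \<in> ball v1 r1" using q(2) by (simp add: Q_def mem_Times_iff)
          ultimately show "z \<in> (\<lambda>u. chart_inv (A x0) (u, w)) ` ball v1 r1" using q(1) by (intro rev_image_eqI[of "fst q"]) simp_all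
        next
          fix z assume "z \<in> (\<lambda>u. chart_inv (A x0) (u, w)) ` ball v1 r1"
          then obtain u where u: "z = chart_inv (A x0) (u, w)" "u \<in> ball v1 r1" by (rule imageE)
          show "z \<in> {z \<in> M. tproj (A x0) z = w}"
            unfolding mem_Collect_eq u(1) M_def using tq[OF uQ[OF u(2)]] imageI[OF uQ[OF u(2)], of "chart_inv (A x0)"] by simp
        qed
        moreover have "connected ((\<lambda>u. chart_inv (A x0) (u, w)) ` ball v1 r1)"
          by (rule connected_plaque_ball) (rule subsetD[OF Qd uQ])
        ultimately show ?thesis by simp
      next
        case False
        have "{z \<in> M. tproj (A x0) z = w} = {}"
        proof (rule ccontr)
          assume "{z \<in> M. tproj (A x0) z = w} \<noteq> {}"
          then obtain z where z: "z \<in> M" "tproj (A x0) z = w" by blast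
          obtain q where q: "z = chart_inv (A x0) q" "q \<in> Q" using z(1) unfolding M_def by (rule imageE)
          have "(fst q, snd q) \<in> dom_box x0" using subsetD[OF Qd q(2)] by simp
          from A_tproj_inv[OF this] have "snd q = w" using z(2) q(1) by simp
          then show False using q(2) False by (simp add: Q_def mem_Times_iff)
        qed
        then show ?thesis by (simp only: connected_empty)
      qed
      show "connected {z \<in> udom S.chrt. tproj (A x0) z = w}" for w by (rule S.chrt_fibre_connected)
      show "tproj S.chrt z = tproj (A x0) z" for z by (rule S.chrt_simps(4))
    qed
    then show "\<exists>c M rad. good_chart A g x0 \<mu> \<delta> ?x c M rad" by (intro exI)
  qed (rule \<delta>0(1))
qed

section \<open>Assembling a regular covering\<close>

context riemannian_matchbox
begin

text \<open>The neighbourhood is chosen before \<open>\<mu>\<close>: later \<open>\<mu>\<close> is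
  taken from a Lebesgue number of a cover by these neighbourhoods, and only then is the plaque
  radius fixed.\<close>

lemma good_chart_local:
  assumes cr: "convexity_radius A g lam"
  shows "\<exists>N. open N \<and> x0 \<in> N \<and> N \<subseteq> udom (A x0) \<and>
    (\<forall>\<mu>>0. \<exists>\<delta>0>0. \<forall>\<delta>. 0 < \<delta> \<longrightarrow> \<delta> \<le> \<delta>0 \<longrightarrow> (\<forall>x\<in>N. \<exists>c M rad. good_chart A g x0 \<mu> \<delta> x c M rad))"
proof -
  obtain W R l Lm C where mp: "metric_patch A g x0 W R l Lm C" and w0: "tproj (A x0) x0 \<in> interior W"
    using metric_patch_exists[of x0] by (elim exE conjE)
  interpret P: metric_patch A g x0 W R l Lm C by (rule mp)
  let ?w0 = "tproj (A x0) x0"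
  obtain \<rho> where \<rho>: "\<rho> > 0" "cball ?w0 \<rho> \<subseteq> interior W" using w0 open_contains_cball[of "interior W"] open_interior by metis
  define Q where "Q = ball (0::real^'n) (R / 2) \<times> ball ?w0 (\<rho> / 2)"
  have wW: "cball w (\<rho> / 2) \<subseteq> W" if "w \<in> ball ?w0 (\<rho> / 2)" for w
  proof
    fix w' assume "w' \<in> cball w (\<rho> / 2)"
    then have "dist ?w0 w' \<le> \<rho>" using dist_triangle[of ?w0 w' w] that by simp
    then have "w' \<in> cball ?w0 \<rho>" by simp
    then show "w' \<in> W" using \<rho>(2) interior_subset[of W] by blast
  qed
  have Qd: "Q \<subseteq> dom_box x0"
  proof
    fix q assume "q \<in> Q"
    then have q: "norm (fst q) < R / 2" "snd q \<in> ball ?w0 (\<rho> / 2)" by (simp_all add: Q_def mem_Times_iff)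
    have "snd q \<in> W" using subsetD[OF wW[OF q(2)], of "snd q"] \<rho>(1) by simp
    moreover have "fst q \<in> cball 0 R" using q(1) P.R(1) by simp
    ultimately have "(fst q, snd q) \<in> dom_box x0" by (rule P.dom_patch[rotated])
    then show "q \<in> dom_box x0" by simp
  qed
  show ?thesis
  proof (intro exI[of _ "chart_inv (A x0) ` Q"] conjI allI impI)
    show "open (chart_inv (A x0) ` Q)" by (rule chart_inv_image_open[OF A_chart _ Qd]) (simp add: Q_def open_Times)
    have "x0 = chart_inv (A x0) (0, ?w0)"
      using chart_inv_lcoord_tproj[OF A_chart chart_udom_closure[OF A_chart A_center(1)[of x0]]] A_center(2)[of x0] by simp
    moreover have "(0, ?w0) \<in> Q" using P.R(1) \<rho>(1) by (simp add: Q_def)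
    ultimately show "x0 \<in> chart_inv (A x0) ` Q" by (rule rev_image_eqI[rotated])
    show "chart_inv (A x0) ` Q \<subseteq> udom (A x0)" by (rule image_subsetI) (rule A_inv_udom[OF subsetD[OF Qd]])
    fix \<mu> :: real assume \<mu>: "\<mu> > 0"
    have "\<rho> / 2 > 0" using \<rho>(1) by simp
    from P.good_chart_exists[OF cr this \<mu>]
    obtain \<delta>0 where \<delta>0: "\<delta>0 > 0" "\<And>\<delta> (v1 :: real^'n) w1. 0 < \<delta> \<Longrightarrow> \<delta> \<le> \<delta>0 \<Longrightarrow> norm v1 \<le> R / 2 \<Longrightarrow> cball w1 (\<rho> / 2) \<subseteq> W \<Longrightarrow>
       \<exists>c M rad. good_chart A g x0 \<mu> \<delta> (chart_inv (A x0) (v1, w1)) c M rad" by metis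
    show "\<exists>\<delta>0>0. \<forall>\<delta>. 0 < \<delta> \<longrightarrow> \<delta> \<le> \<delta>0 \<longrightarrow> (\<forall>x\<in>chart_inv (A x0) ` Q. \<exists>c M rad. good_chart A g x0 \<mu> \<delta> x c M rad)"
    proof (intro exI[of _ \<delta>0] conjI allI impI ballI)
      fix \<delta> x assume \<delta>: "0 < \<delta>" "\<delta> \<le> \<delta>0" and "x \<in> chart_inv (A x0) ` Q"
      then obtain q where q: "x = chart_inv (A x0) q" "q \<in> Q" by (elim imageE)
      have "norm (fst q) \<le> R / 2" "snd q \<in> ball ?w0 (\<rho> / 2)" using q(2) by (simp_all add: Q_def mem_Times_iff)
      then show "\<exists>c M rad. good_chart A g x0 \<mu> \<delta> x c M rad" using \<delta>0(2)[OF \<delta>, of "fst q" "snd q"] wW q(1) by simp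
    qed (rule \<delta>0(1))
  qed
qed

theorem equicontinuous:
  assumes hom: "homogeneous_space TYPE('m)" and cr: "convexity_radius A g lam" and eps: "eps > 0"
  shows "equicontinuous_matchbox A g lam eps"
proof -
  have lam: "lam > 0" using cr by (simp add: convexity_radius_def)
  obtain N where N0: "\<forall>x0. open (N x0) \<and> x0 \<in> N x0 \<and> N x0 \<subseteq> udom (A x0) \<and>
    (\<forall>\<mu>>0. \<exists>\<delta>0>0. \<forall>\<delta>. 0 < \<delta> \<longrightarrow> \<delta> \<le> \<delta>0 \<longrightarrow> (\<forall>x\<in>N x0. \<exists>c M rad. good_chart A g x0 \<mu> \<delta> x c M rad))"
    using choice[OF allI[OF good_chart_local[OF cr]]] by (rule exE)
  note N = N0[THEN spec, THEN conjunct1] N0[THEN spec, THEN conjunct2, THEN conjunct1]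
    N0[THEN spec, THEN conjunct2, THEN conjunct2, THEN conjunct1]
    N0[THEN spec, THEN conjunct2, THEN conjunct2, THEN conjunct2, THEN spec, THEN mp]
  have cov: "(UNIV :: 'm set) \<subseteq> (\<Union>x0\<in>UNIV. N x0)" using N(2) by blast
  obtain F where F: "finite F" "(UNIV :: 'm set) \<subseteq> (\<Union>x0\<in>F. N x0)"
    by (rule compactE_image[OF compact_M N(1) cov]) (rule that)
  have cov': "(UNIV :: 'm set) \<subseteq> \<Union> (N ` F)" using F(2) by simp
  \<comment> \<open>Every ball of radius \<open>e\<close> lies in one of finitely many
    neighbourhoods, hence in the domain of one of the given charts. This chart, selected by
    \<open>b\<close>, extends the small chart at \<open>x\<close>.\<close>
  obtain e where e: "e > 0" "\<And>x. \<exists>G\<in>N ` F. ball x e \<subseteq> G"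
  proof (rule Heine_Borel_lemma[OF compact_M cov'])
    show "open G" if "G \<in> N ` F" for G using that N(1) by (elim imageE) simp
  qed (rule that, simp_all)
  have "\<forall>x. \<exists>x0. x0 \<in> F \<and> ball x e \<subseteq> N x0" using e(2) by blast
  then obtain b where b0: "\<forall>x. b x \<in> F \<and> ball x e \<subseteq> N (b x)" by (rule exE[OF choice])
  note b = b0[THEN spec, THEN conjunct1] b0[THEN spec, THEN conjunct2]
  \<comment> \<open>The bound \<open>eps\<close> is the size allowed for the closed charts. The
    third of \<open>e\<close> pays for a chain of three steps below \<open>\<mu>\<close>, needed
    when two intermediate domains meet.\<close>
  define \<mu> where "\<mu> = min eps (e / 3)"
  have \<mu>: "\<mu> > 0" "\<mu> \<le> eps" "3 * \<mu> \<le> e" using eps e(1) by (simp_all add: \<mu>_def)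
  obtain D where D0: "\<forall>x0. D x0 > 0 \<and> (\<forall>\<delta>. 0 < \<delta> \<longrightarrow> \<delta> \<le> D x0 \<longrightarrow> (\<forall>x\<in>N x0. \<exists>c M rad. good_chart A g x0 \<mu> \<delta> x c M rad))"
    using choice[OF allI[OF N(4)[OF \<mu>(1)]]] by (rule exE)
  note D = D0[THEN spec, THEN conjunct1] D0[THEN spec, THEN conjunct2, rule_format]
  \<comment> \<open>One plaque radius for all charts; a positive minimum exists because only the
    finitely many patches in \<open>F\<close> occur.\<close>
  define \<delta> where "\<delta> = Min (insert (lam / 4) (D ` F))"
  have \<delta>: "\<delta> > 0" "\<delta> \<le> lam / 4" "\<And>x0. x0 \<in> F \<Longrightarrow> \<delta> \<le> D x0"
  proof -
    show "\<delta> > 0" using F(1) D(1) lam by (simp add: \<delta>_def)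
    show "\<delta> \<le> lam / 4" unfolding \<delta>_def using F(1) by (intro Min_le) simp_all
    show "\<delta> \<le> D x0" if "x0 \<in> F" for x0 unfolding \<delta>_def using F(1) that by (intro Min_le) simp_all
  qed
  have "\<forall>x. \<exists>t. good_chart A g (b x) \<mu> \<delta> x (fst t) (fst (snd t)) (snd (snd t))"
  proof
    fix x
    have "x \<in> N (b x)" using subsetD[OF b(2), of x] e(1) by simp
    from D(2)[OF \<delta>(1) \<delta>(3)[OF b(1)] this] obtain c M rad where "good_chart A g (b x) \<mu> \<delta> x c M rad" by (elim exE)
    then show "\<exists>t. good_chart A g (b x) \<mu> \<delta> x (fst t) (fst (snd t)) (snd (snd t))" by (intro exI[of _ "(c, M, rad)"]) simp
  qed
  then obtain t where t: "\<forall>x. good_chart A g (b x) \<mu> \<delta> x (fst (t x)) (fst (snd (t x))) (snd (snd (t x)))"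
    by (rule exE[OF choice])
  define cc where "cc x = fst (t x)" for x
  define MM where "MM x = fst (snd (t x))" for x
  define rr where "rr x = snd (snd (t x))" for x
  note G0 = t[THEN spec, folded cc_def MM_def rr_def, unfolded good_chart_def]
  note G = G0[THEN conjunct1]
    G0[THEN conjunct2, THEN conjunct1]
    G0[THEN conjunct2, THEN conjunct2, THEN conjunct1]
    G0[THEN conjunct2, THEN conjunct2, THEN conjunct2, THEN conjunct1]
    G0[THEN conjunct2, THEN conjunct2, THEN conjunct2, THEN conjunct2, THEN conjunct1]
    G0[THEN conjunct2, THEN conjunct2, THEN conjunct2, THEN conjunct2, THEN conjunct2, THEN conjunct1]
    G0[THEN conjunct2, THEN conjunct2, THEN conjunct2, THEN conjunct2, THEN conjunct2, THEN conjunct2, THEN conjunct1]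
    G0[THEN conjunct2, THEN conjunct2, THEN conjunct2, THEN conjunct2, THEN conjunct2, THEN conjunct2, THEN conjunct2, THEN conjunct1]
    G0[THEN conjunct2, THEN conjunct2, THEN conjunct2, THEN conjunct2, THEN conjunct2, THEN conjunct2, THEN conjunct2, THEN conjunct2, THEN conjunct1]
    G0[THEN conjunct2, THEN conjunct2, THEN conjunct2, THEN conjunct2, THEN conjunct2, THEN conjunct2, THEN conjunct2, THEN conjunct2, THEN conjunct2, THEN conjunct1]
    G0[THEN conjunct2, THEN conjunct2, THEN conjunct2, THEN conjunct2, THEN conjunct2, THEN conjunct2, THEN conjunct2, THEN conjunct2, THEN conjunct2, THEN conjunct2, THEN conjunct1]
    G0[THEN conjunct2, THEN conjunct2, THEN conjunct2, THEN conjunct2, THEN conjunct2, THEN conjunct2, THEN conjunct2, THEN conjunct2, THEN conjunct2, THEN conjunct2, THEN conjunct2, THEN conjunct1]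
    G0[THEN conjunct2, THEN conjunct2, THEN conjunct2, THEN conjunct2, THEN conjunct2, THEN conjunct2, THEN conjunct2, THEN conjunct2, THEN conjunct2, THEN conjunct2, THEN conjunct2, THEN conjunct2, THEN conjunct1]
    G0[THEN conjunct2, THEN conjunct2, THEN conjunct2, THEN conjunct2, THEN conjunct2, THEN conjunct2, THEN conjunct2, THEN conjunct2, THEN conjunct2, THEN conjunct2, THEN conjunct2, THEN conjunct2, THEN conjunct2]
  have ch: "is_chart (cc x)" for x using G(1)[of x] by (simp add: foliation_chart_def)
  have cin: "x \<in> udom (cc x)" for x using G(2)[of x] by (simp add: centered_at_def)
  have cov2: "(UNIV :: 'm set) \<subseteq> (\<Union>x\<in>UNIV. udom (cc x))" using cin by blast
  obtain H where H: "finite H" "(UNIV :: 'm set) \<subseteq> (\<Union>x\<in>H. udom (cc x))"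
    by (rule compactE_image[OF compact_M chart_open[OF ch] cov2]) (rule that)
  obtain h where h: "bij_betw h {1..card H} H" using ex_bij_betw_nat_finite_1[OF H(1)] by (elim exE)
  define c where "c i = cc (h i)" for i
  have hH: "h ` {1..card H} = H" using h by (rule bij_betw_imp_surj_on)
  have rc: "regular_covering A g lam eps (card H) c"
    unfolding regular_covering_def
  proof (intro conjI exI ballI)
    have "(\<Union>i\<in>{1..card H}. udom (c i)) = (\<Union>x\<in>h ` {1..card H}. udom (cc x))" by (simp add: c_def image_image)
    then show "(\<Union>i\<in>{1..card H}. udom (c i)) = UNIV" using H(2) unfolding hH by (simp add: top.extremum_unique)
    show "0 < \<delta>" "\<delta> \<le> lam / 4" by (rule \<delta>)+
    fix i
    show "foliation_chart A (c i)" "centered_at (c i) (h i)" "rr (h i) > 0"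
      "transv (c i) = cball (tproj (c i) (h i)) (rr (h i))" unfolding c_def by (rule G)+
    show "udom (c i) = interior (closure (udom (c i)))" unfolding c_def by (rule G(6)[symmetric])
    show "udom (c i) = {z \<in> closure (udom (c i)). coord (c i) z \<in> box (- 1) 1 \<times> ball (tproj (c i) (h i)) (rr (h i))}"
      unfolding c_def G(5)[symmetric] by (rule set_eqI, unfold mem_Collect_eq, rule chart_udom_iff[OF ch])
    show "closure (udom (c i)) \<subseteq> ball (h i) eps"
      unfolding c_def by (rule order_trans[OF G(8) order_trans[OF G(10) subset_ball[OF \<mu>(2)]]])
    show "lcoord (c i) y = 0 \<longrightarrow> plaque (c i) (tproj (c i) y) = leaf_cball A g y \<delta> \<and> strongly_convex A g (leaf_cball A g y \<delta>)"
      if "y \<in> closure (udom (c i))" for y using G(7) that unfolding c_def by (rule bspec)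
  qed
  \<comment> \<open>The central section of each chart. It is defined on the whole compact
    transversal, closed ball included, which gives its uniform continuity.\<close>
  define sec where "sec i w = chart_inv (c i) (0, w)" for i w
  have z0: "(0::real^'n) \<in> box (- 1) 1" "(0::real^'n) \<in> cbox (- 1) 1" by (simp_all add: mem_box_cart)
  interpret hc: holonomy_cover "card H" c "\<lambda>i. MM (h i)" "\<lambda>i. udom (A (b (h i)))" "\<lambda>i. tproj (A (b (h i)))" sec
  proof
    show "compact (UNIV :: 'm set)" by (rule compact_M)
    fix i
    show "open (udom (c i))" unfolding c_def by (rule chart_open[OF ch])
    show "tproj (c i) z = tproj (A (b (h i))) z" for z unfolding c_def using G(14) by (rule spec)
    show "connected {z \<in> udom (c i). tproj (A (b (h i))) z = w}" for w unfolding c_def using G(13) by (rule spec)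
    show "open (MM (h i))" by (rule G(9))
    show "connected {z \<in> MM (h i). tproj (A (b (h i))) z = w}" for w using G(12) by (rule spec)
    show "closure (udom (c i)) \<subseteq> MM (h i)" unfolding c_def by (rule G(8))
    show "MM (h i) \<subseteq> udom (A (b (h i)))" by (rule G(11))
    \<comment> \<open>Through a common point, every point of the first domain is reached from the
      centre of the second chart in three steps shorter than \<open>\<mu>\<close>, so it lies in the
      ball of radius \<open>e\<close> that the larger chart contains.\<close>
    show "MM (h i) \<subseteq> udom (A (b (h j)))" if ne: "MM (h i) \<inter> MM (h j) \<noteq> {}" for j
    proof
      obtain a where a: "a \<in> MM (h i)" "a \<in> MM (h j)" using ne by blast
      fix z assume z: "z \<in> MM (h i)"
      have d: "dist (h i) a < \<mu>" "dist (h j) a < \<mu>" "dist (h i) z < \<mu>"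
        using subsetD[OF G(10) a(1)] subsetD[OF G(10) a(2)] subsetD[OF G(10) z] by simp_all
      have "dist (h j) z \<le> dist (h j) a + dist (h i) a + dist (h i) z"
        using dist_triangle[of "h j" z a] dist_triangle[of a z "h i"] by (simp add: dist_commute)
      then have "z \<in> ball (h j) e" using d \<mu>(3) by simp
      from subsetD[OF N(3) subsetD[OF b(2) this]] show "z \<in> udom (A (b (h j)))" .
    qed
    show "continuous_on (udom (A (b (h i)))) (tproj (A (b (h i))))"
      by (rule continuous_on_subset[OF chart_cont_tproj[OF A_chart] closure_subset])
    show "tproj (A (b (h i))) x = tproj (A (b (h i))) y"
      if "connected C" "C \<subseteq> udom (A (b (h i)))" "x \<in> C" "y \<in> C" for C x y
      by (rule chart_tproj_const[OF A_chart A_td that(1) order_trans[OF that(2) closure_subset] that(3,4)])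
    show "open (tproj (A (b (h i))) ` V)" if V: "open V" "V \<subseteq> udom (c i)" for V
    proof -
      have "V \<subseteq> udom (A (b (h i)))"
        by (rule order_trans[OF V(2)]) (unfold c_def, rule order_trans[OF closure_subset order_trans[OF G(8) G(11)]])
      then have "open (coord (A (b (h i))) ` V)" by (rule chart_coord_image_open[OF A_chart V(1)])
      from open_image_snd[OF this] show ?thesis by (simp add: image_image tproj_def)
    qed
    have tw: "w \<in> interior (transv (c i))" if wm: "w \<in> tproj (A (b (h i))) ` udom (c i)" for w
    proof -
      obtain z where z: "w = tproj (A (b (h i))) z" "z \<in> udom (c i)" using wm by (rule imageE)
      have "w = tproj (c i) z" unfolding z(1) c_def using G(14) by (simp only:)
      then show ?thesis using chart_tproj_mem[OF ch, of z "h i"] z(2) by (simp add: c_def)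
    qed
    show "sec i w \<in> udom (c i) \<and> tproj (A (b (h i))) (sec i w) = w" if w: "w \<in> tproj (A (b (h i))) ` udom (c i)" for w
    proof
      note wi = tw[OF w, unfolded c_def]
      show "sec i w \<in> udom (c i)" unfolding sec_def c_def by (rule chart_inv_udom[OF ch SigmaI[OF z0(1) wi]])
      have "tproj (cc (h i)) (chart_inv (cc (h i)) (0, w)) = w"
        by (rule chart_tproj_inv[OF ch SigmaI[OF z0(2) subsetD[OF interior_subset wi]]])
      then show "tproj (A (b (h i))) (sec i w) = w" using G(14)[of "h i"] by (simp add: sec_def c_def)
    qed
    have "continuous_on (transv (cc (h i))) (\<lambda>w. chart_inv (cc (h i)) (0, w))"
      by (rule continuous_on_compose2[OF chart_cont_inv[OF ch]])
        (use z0(2) in \<open>auto intro!: continuous_on_Pair continuous_on_id continuous_on_const simp del: mem_box\<close>)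
    moreover have "compact (transv (cc (h i)))" using ch[of "h i"] by (simp add: is_chart_def)
    ultimately have uc: "uniformly_continuous_on (transv (c i)) (sec i)"
      unfolding sec_def[abs_def] c_def by (rule compact_uniformly_continuous)
    have "tproj (A (b (h i))) ` udom (c i) \<subseteq> transv (c i)" by (rule subsetI) (rule subsetD[OF interior_subset tw])
    with uc show "uniformly_continuous_on (tproj (A (b (h i))) ` udom (c i)) (sec i)"
      unfolding uniformly_continuous_on_def by (meson subsetD)
  qed
  show ?thesis unfolding equicontinuous_matchbox_def
    by (rule exI[of _ "card H"], rule exI[of _ c])
      (intro conjI rc hc.hol_well_defined hc.equicontinuous_holonomy[OF hom])
qed

end

theorem theorem5p2:
  fixes A :: "'m::metric_space \<Rightarrow> ('m, 'n::finite, 'x::metric_space) fchart"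
    and g :: "'m \<Rightarrow> real^'n \<Rightarrow> real^'n \<Rightarrow> real"
    and lam eps :: real
  assumes "matchbox_manifold A"
    and "homogeneous_space TYPE('m)"
    and "leafwise_riemannian A g"
    and "\<And>L. L \<in> leaves A \<Longrightarrow> complete_leaf A g L \<and> bounded_geometry_leaf A g L"
    and "convexity_radius A g lam"
    and "convex_covering_constant A g eps"
  shows "equicontinuous_matchbox A g lam eps"
proof -
  interpret riemannian_matchbox A g by unfold_locales (rule assms)+
  show ?thesis by (rule equicontinuous[OF assms(2,5)]) (use assms(6) in \<open>simp add: convex_covering_constant_def\<close>)
qed

end
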